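(* Let $\mathscr{T}$ and $\mathscr{S}$ be rigidly-compactly generated tt-categories and let $f^*:\mathscr{T}\to\mathscr{S}$ be a fully faithful geometric functor. Then the induced map $\varphi=\mathrm{Spc}(f^* ):\mathrm{Spc}(\mathscr{S}^c)\to\mathrm{Spc}(\mathscr{T}^c)$ is a spectral quotient map whose fibers are connected.
   Context: A tt-category is a triangulated category with a compatible (closed) symmetric monoidal structure $(\otimes,\mathbb{1})$. It is rigidly-compactly generated if it has all small coproducts, is compactly generated as a triangulated category, and its compact objects coincide with its dualizable objects (so $\mathbb{1}$ is compact). $\mathscr{T}^c$ denotes the essentially small rigid tt-subcategory of compact objects. A geometric functor $f^*:\mathscr{T}\to\mathscr{S}$ is a coproduct-preserving tensor-triangulated (symmetric monoidal exact) functor between rigidly-compactly generated tt-categories; it restricts to a tt-functor $\mathscr{T}^c\to\mathscr{S}^c$. For an essentially small tt-category $\mathscr{K}$, the Balmer spectrum $\mathrm{Spc}(\mathscr{K})$ is the set of prime thick tensor-ideals $\mathscr{P}\subsetneq\mathscr{K}$ (i.e. $a\otimes b\in\mathscr{P}$ implies $a\in\mathscr{P}$ or $b\in\mathscr{P}$), with the topology having the sets $\mathrm{supp}(a)=\{\mathscr{P}: a\notin\mathscr{P}\}$, $a\in\mathscr{K}$, as a basis of closed sets. It is a spectral space, and a tt-functor $F:\mathscr{K}\to\mathscr{L}$ induces a spectral map $\mathrm{Spc}(F):\mathrm{Spc}(\mathscr{L})\to\mathrm{Spc}(\mathscr{K})$, $\mathscr{Q}\mapsto F^{-1}(\mathscr{Q})$.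 A spectral map of spectral spaces is a continuous map such that preimages of quasi-compact opens are quasi-compact. A surjective spectral map $\varphi:X\to Y$ of spectral spaces is a spectral quotient map if a subset $C\subseteq Y$ is quasi-compact open whenever $\varphi^{-1}(C)$ is quasi-compact open. *)

theory Defs
  imports "HOL-Analysis.Analysis" "HOL-Algebra.Product_Groups" "HOL-Algebra.Free_Abelian_Groups"
begin

unbundle cardinal_syntax

section \<open>Smallness\<close>

text \<open>Smallness is relative to a Grothendieck universe, represented by a set \<open>U\<close> of uncountable
  strongly inaccessible cardinality: a set is small if its cardinality is less than that of \<open>U\<close>.\<close>

definition universe :: "'u set \<Rightarrow> bool" where
  "universe U \<longleftrightarrow> \<not> countable U \<and> regularCard |U| \<and> (\<forall>A\<subseteq>U. |A| <o |U| \<longrightarrow> |Pow A| <o |U| )"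

definition small :: "'u set \<Rightarrow> 'b set \<Rightarrow> bool" where
  "small U A \<longleftrightarrow> |A| <o |U|"

section \<open>Additive categories\<close>

record ('o, 'a) category_data =
  Obj :: "'o set"
  Arr :: "'a set"
  Dom :: "'a \<Rightarrow> 'o"
  Cod :: "'a \<Rightarrow> 'o"
  idm :: "'o \<Rightarrow> 'a"
  compm :: "'a \<Rightarrow> 'a \<Rightarrow> 'a" (infixl "\<cdot>\<index>" 70)

definition Hom :: "('o, 'a, 'm) category_data_scheme \<Rightarrow> 'o \<Rightarrow> 'o \<Rightarrow> 'a set" where
  "Hom C x y = {f \<in> Arr C. Dom C f = x \<and> Cod C f = y}"

locale category =
  fixes C :: "('o, 'a, 'm) category_data_scheme" (structure)
  assumes dom_cod: "f \<in> Arr C \<Longrightarrow> Dom C f \<in> Obj C \<and> Cod C f \<in> Obj C"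
    and idm_hom: "x \<in> Obj C \<Longrightarrow> idm C x \<in> Hom C x x"
    and comp_hom: "\<lbrakk>f \<in> Hom C x y; g \<in> Hom C y z\<rbrakk> \<Longrightarrow> g \<cdot> f \<in> Hom C x z"
    and comp_assoc: "\<lbrakk>f \<in> Hom C w x; g \<in> Hom C x y; h \<in> Hom C y z\<rbrakk> \<Longrightarrow> h \<cdot> g \<cdot> f = h \<cdot> (g \<cdot> f)"
    and comp_idm: "f \<in> Hom C x y \<Longrightarrow> f \<cdot> idm C x = f"
    and idm_comp: "f \<in> Hom C x y \<Longrightarrow> idm C y \<cdot> f = f"

definition is_iso :: "('o, 'a, 'm) category_data_scheme \<Rightarrow> 'o \<Rightarrow> 'o \<Rightarrow> 'a \<Rightarrow> bool" where
  "is_iso C x y f \<longleftrightarrow> f \<in> Hom C x y \<and>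
     (\<exists>g \<in> Hom C y x. g \<cdot>\<^bsub>C\<^esub> f = idm C x \<and> f \<cdot>\<^bsub>C\<^esub> g = idm C y)"

definition inverse_arrow :: "('o, 'a, 'm) category_data_scheme \<Rightarrow> 'o \<Rightarrow> 'o \<Rightarrow> 'a \<Rightarrow> 'a" where
  "inverse_arrow C x y f =
     (THE g. g \<in> Hom C y x \<and> g \<cdot>\<^bsub>C\<^esub> f = idm C x \<and> f \<cdot>\<^bsub>C\<^esub> g = idm C y)"

definition is_coproduct ::
    "('o, 'a, 'm) category_data_scheme \<Rightarrow> 'i set \<Rightarrow> ('i \<Rightarrow> 'o) \<Rightarrow> 'o \<Rightarrow> ('i \<Rightarrow> 'a) \<Rightarrow> bool" where
  "is_coproduct C I y c \<iota> \<longleftrightarrow>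
     c \<in> Obj C \<and> (\<forall>i\<in>I. \<iota> i \<in> Hom C (y i) c) \<and>
     (\<forall>z\<in>Obj C. \<forall>f. (\<forall>i\<in>I. f i \<in> Hom C (y i) z) \<longrightarrow>
        (\<exists>!g. g \<in> Hom C c z \<and> (\<forall>i\<in>I. g \<cdot>\<^bsub>C\<^esub> \<iota> i = f i)))"

text \<open>Indexing by small subsets of \<open>U\<close> is no restriction, as every small set is in bijection with one.\<close>

definition has_small_coproducts :: "'u set \<Rightarrow> ('o, 'a, 'm) category_data_scheme \<Rightarrow> bool" where
  "has_small_coproducts U C \<longleftrightarrow>
     (\<forall>I\<subseteq>U. \<forall>y \<in> I \<rightarrow> Obj C. small U I \<longrightarrow> (\<exists>c \<iota>. is_coproduct C I y c \<iota>))"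

definition locally_small :: "'u set \<Rightarrow> ('o, 'a, 'm) category_data_scheme \<Rightarrow> bool" where
  "locally_small U C \<longleftrightarrow> (\<forall>x\<in>Obj C. \<forall>y\<in>Obj C. small U (Hom C x y))"

record ('o, 'a) preadditive_data = "('o, 'a) category_data" +
  zerom :: "'o \<Rightarrow> 'o \<Rightarrow> 'a"
  addm :: "'a \<Rightarrow> 'a \<Rightarrow> 'a" (infixl "\<boxplus>\<index>" 65)

definition hom_group :: "('o, 'a, 'm) preadditive_data_scheme \<Rightarrow> 'o \<Rightarrow> 'o \<Rightarrow> 'a monoid" where
  "hom_group C x y = \<lparr>carrier = Hom C x y, monoid.mult = addm C, one = zerom C x y\<rparr>"

definition neg :: "('o, 'a, 'm) preadditive_data_scheme \<Rightarrow> 'a \<Rightarrow> 'a" where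
  "neg C f = inv\<^bsub>hom_group C (Dom C f) (Cod C f)\<^esub> f"

definition zero_object :: "('o, 'a, 'm) preadditive_data_scheme \<Rightarrow> 'o \<Rightarrow> bool" where
  "zero_object C x \<longleftrightarrow> x \<in> Obj C \<and> idm C x = zerom C x x"

definition is_biproduct ::
    "('o, 'a, 'm) preadditive_data_scheme \<Rightarrow> 'o \<Rightarrow> 'o \<Rightarrow> 'o \<Rightarrow> bool" where
  "is_biproduct C x y s \<longleftrightarrow>
     (\<exists>i \<in> Hom C x s. \<exists>j \<in> Hom C y s. \<exists>p \<in> Hom C s x. \<exists>q \<in> Hom C s y.
        p \<cdot>\<^bsub>C\<^esub> i = idm C x \<and> q \<cdot>\<^bsub>C\<^esub> j = idm C y \<and> p \<cdot>\<^bsub>C\<^esub> j = zerom C y x \<and> q \<cdot>\<^bsub>C\<^esub> i = zerom C x y \<and>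
        i \<cdot>\<^bsub>C\<^esub> p \<boxplus>\<^bsub>C\<^esub> j \<cdot>\<^bsub>C\<^esub> q = idm C s)"

locale additive_category = category C
  for C :: "('o, 'a, 'm) preadditive_data_scheme" (structure) +
  assumes hom_comm_group: "\<lbrakk>x \<in> Obj C; y \<in> Obj C\<rbrakk> \<Longrightarrow> comm_group (hom_group C x y)"
    and comp_addm: "\<lbrakk>f \<in> Hom C x y; g \<in> Hom C y z; g' \<in> Hom C y z\<rbrakk>
           \<Longrightarrow> (g \<boxplus> g') \<cdot> f = g \<cdot> f \<boxplus> g' \<cdot> f"
    and addm_comp: "\<lbrakk>f \<in> Hom C x y; f' \<in> Hom C x y; g \<in> Hom C y z\<rbrakk>
           \<Longrightarrow> g \<cdot> (f \<boxplus> f') = g \<cdot> f \<boxplus> g \<cdot> f'"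
    and ex_zero_object: "\<exists>z. zero_object C z"
    and ex_biproduct: "\<lbrakk>x \<in> Obj C; y \<in> Obj C\<rbrakk> \<Longrightarrow> \<exists>s. is_biproduct C x y s"

section \<open>Functors\<close>

definition cat_functor ::
    "('o, 'a, 'm) category_data_scheme \<Rightarrow> ('p, 'b, 'n) category_data_scheme
      \<Rightarrow> ('o \<Rightarrow> 'p) \<Rightarrow> ('a \<Rightarrow> 'b) \<Rightarrow> bool" where
  "cat_functor C D Fo Fa \<longleftrightarrow>
     (\<forall>x\<in>Obj C. Fo x \<in> Obj D \<and> Fa (idm C x) = idm D (Fo x)) \<and>
     (\<forall>x y f. f \<in> Hom C x y \<longrightarrow> Fa f \<in> Hom D (Fo x) (Fo y)) \<and>
     (\<forall>x y z f g. f \<in> Hom C x y \<and> g \<in> Hom C y z \<longrightarrow> Fa (g \<cdot>\<^bsub>C\<^esub> f) = Fa g \<cdot>\<^bsub>D\<^esub> Fa f)"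

definition additive_functor ::
    "('o, 'a, 'm) preadditive_data_scheme \<Rightarrow> ('p, 'b, 'n) preadditive_data_scheme
      \<Rightarrow> ('o \<Rightarrow> 'p) \<Rightarrow> ('a \<Rightarrow> 'b) \<Rightarrow> bool" where
  "additive_functor C D Fo Fa \<longleftrightarrow> cat_functor C D Fo Fa \<and>
     (\<forall>x y f g. f \<in> Hom C x y \<and> g \<in> Hom C x y \<longrightarrow> Fa (f \<boxplus>\<^bsub>C\<^esub> g) = Fa f \<boxplus>\<^bsub>D\<^esub> Fa g)"

definition fully_faithful ::
    "('o, 'a, 'm) category_data_scheme \<Rightarrow> ('p, 'b, 'n) category_data_scheme
      \<Rightarrow> ('o \<Rightarrow> 'p) \<Rightarrow> ('a \<Rightarrow> 'b) \<Rightarrow> bool" where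
  "fully_faithful C D Fo Fa \<longleftrightarrow>
     (\<forall>x\<in>Obj C. \<forall>y\<in>Obj C. bij_betw Fa (Hom C x y) (Hom D (Fo x) (Fo y)))"

definition essentially_surjective ::
    "('o, 'a, 'm) category_data_scheme \<Rightarrow> ('p, 'b, 'n) category_data_scheme
      \<Rightarrow> ('o \<Rightarrow> 'p) \<Rightarrow> bool" where
  "essentially_surjective C D Fo \<longleftrightarrow> (\<forall>y\<in>Obj D. \<exists>x\<in>Obj C. \<exists>f. is_iso D (Fo x) y f)"

definition preserves_small_coproducts ::
    "'u set \<Rightarrow> ('o, 'a, 'm) category_data_scheme \<Rightarrow> ('p, 'b, 'n) category_data_scheme
      \<Rightarrow> ('o \<Rightarrow> 'p) \<Rightarrow> ('a \<Rightarrow> 'b) \<Rightarrow> bool" where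
  "preserves_small_coproducts U C D Fo Fa \<longleftrightarrow>
     (\<forall>I\<subseteq>U. \<forall>y \<in> I \<rightarrow> Obj C. \<forall>c \<iota>. small U I \<and> is_coproduct C I y c \<iota> \<longrightarrow>
        is_coproduct D I (\<lambda>i. Fo (y i)) (Fo c) (\<lambda>i. Fa (\<iota> i)))"

section \<open>Triangulated categories\<close>

text \<open>A triple \<open>(f, g, h)\<close> in \<open>Tri\<close> stands for the distinguished triangle
  \<open>x \<rightarrow> y \<rightarrow> z \<rightarrow> \<Sigma>x\<close> with maps \<open>f\<close>, \<open>g\<close>, \<open>h\<close>; the objects are recovered as domains and codomains.\<close>

record ('o, 'a) triangulated_data = "('o, 'a) preadditive_data" +
  Sho :: "'o \<Rightarrow> 'o"
  Sha :: "'a \<Rightarrow> 'a"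
  Tri :: "('a \<times> 'a \<times> 'a) set"

locale triangulated_category = additive_category C
  for C :: "('o, 'a, 'm) triangulated_data_scheme" (structure) +
  assumes shift_additive: "additive_functor C C (Sho C) (Sha C)"
    and shift_fully_faithful: "fully_faithful C C (Sho C) (Sha C)"
    and shift_ess_surj: "essentially_surjective C C (Sho C)"
    and tri_typed: "(f, g, h) \<in> Tri C \<Longrightarrow>
          f \<in> Arr C \<and> g \<in> Arr C \<and> h \<in> Arr C \<and>
          Dom C g = Cod C f \<and> Dom C h = Cod C g \<and> Cod C h = Sho C (Dom C f)"
    and tri_id: "\<lbrakk>x \<in> Obj C; zero_object C z\<rbrakk>
          \<Longrightarrow> (idm C x, zerom C x z, zerom C z (Sho C x)) \<in> Tri C"
    and tri_iso: "\<lbrakk>(f, g, h) \<in> Tri C;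
          f' \<in> Hom C x' y'; g' \<in> Hom C y' z'; h' \<in> Hom C z' (Sho C x');
          is_iso C (Dom C f) x' a; is_iso C (Cod C f) y' b; is_iso C (Cod C g) z' c;
          b \<cdot> f = f' \<cdot> a; c \<cdot> g = g' \<cdot> b; Sha C a \<cdot> h = h' \<cdot> c\<rbrakk>
          \<Longrightarrow> (f', g', h') \<in> Tri C"
    and tri_complete: "f \<in> Arr C \<Longrightarrow> \<exists>g h. (f, g, h) \<in> Tri C"
    and tri_rotate: "\<lbrakk>f \<in> Hom C x y; g \<in> Hom C y z; h \<in> Hom C z (Sho C x)\<rbrakk>
          \<Longrightarrow> (f, g, h) \<in> Tri C \<longleftrightarrow> (g, h, neg C (Sha C f)) \<in> Tri C"
    and tri_morphism: "\<lbrakk>(f, g, h) \<in> Tri C; (f', g', h') \<in> Tri C;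
          a \<in> Hom C (Dom C f) (Dom C f'); b \<in> Hom C (Cod C f) (Cod C f'); b \<cdot> f = f' \<cdot> a\<rbrakk>
          \<Longrightarrow> \<exists>c \<in> Hom C (Cod C g) (Cod C g'). c \<cdot> g = g' \<cdot> b \<and> h' \<cdot> c = Sha C a \<cdot> h"
    and octahedral: "\<lbrakk>f \<in> Hom C x y; g \<in> Hom C y z;
          (f, f1, f2) \<in> Tri C; (g, g1, g2) \<in> Tri C; (g \<cdot> f, k1, k2) \<in> Tri C\<rbrakk>
          \<Longrightarrow> \<exists>a \<in> Hom C (Cod C f1) (Cod C k1). \<exists>b \<in> Hom C (Cod C k1) (Cod C g1).
                (a, b, Sha C f1 \<cdot> g2) \<in> Tri C \<and>
                a \<cdot> f1 = k1 \<cdot> g \<and> k2 \<cdot> a = f2 \<and> b \<cdot> k1 = g1 \<and> g2 \<cdot> b = Sha C f \<cdot> k2"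

section \<open>Tensor-triangulated categories\<close>

text \<open>\<open>tsh x y\<close> is the comparison map \<open>\<Sigma>x \<odot> y \<rightarrow> \<Sigma>(x \<odot> y)\<close>.\<close>

record ('o, 'a) tt_data = "('o, 'a) triangulated_data" +
  unit :: "'o"
  tobj :: "'o \<Rightarrow> 'o \<Rightarrow> 'o" (infixl "\<odot>\<index>" 75)
  tarr :: "'a \<Rightarrow> 'a \<Rightarrow> 'a" (infixl "\<star>\<index>" 75)
  assoc :: "'o \<Rightarrow> 'o \<Rightarrow> 'o \<Rightarrow> 'a"
  lunit :: "'o \<Rightarrow> 'a"
  runit :: "'o \<Rightarrow> 'a"
  braid :: "'o \<Rightarrow> 'o \<Rightarrow> 'a"
  tsh :: "'o \<Rightarrow> 'o \<Rightarrow> 'a"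

locale symmetric_monoidal_category = category C
  for C :: "('o, 'a, 'm) tt_data_scheme" (structure) +
  assumes unit_obj: "unit C \<in> Obj C"
    and tobj_obj: "\<lbrakk>x \<in> Obj C; y \<in> Obj C\<rbrakk> \<Longrightarrow> x \<odot> y \<in> Obj C"
    and tarr_hom: "\<lbrakk>f \<in> Hom C x x'; g \<in> Hom C y y'\<rbrakk> \<Longrightarrow> f \<star> g \<in> Hom C (x \<odot> y) (x' \<odot> y')"
    and tarr_idm: "\<lbrakk>x \<in> Obj C; y \<in> Obj C\<rbrakk> \<Longrightarrow> idm C x \<star> idm C y = idm C (x \<odot> y)"
    and tarr_comp: "\<lbrakk>f \<in> Hom C x x'; f' \<in> Hom C x' x''; g \<in> Hom C y y'; g' \<in> Hom C y' y''\<rbrakk>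
          \<Longrightarrow> (f' \<cdot> f) \<star> (g' \<cdot> g) = (f' \<star> g') \<cdot> (f \<star> g)"
    and assoc_iso: "\<lbrakk>x \<in> Obj C; y \<in> Obj C; z \<in> Obj C\<rbrakk>
          \<Longrightarrow> is_iso C ((x \<odot> y) \<odot> z) (x \<odot> (y \<odot> z)) (assoc C x y z)"
    and assoc_natural: "\<lbrakk>f \<in> Hom C x x'; g \<in> Hom C y y'; h \<in> Hom C z z'\<rbrakk>
          \<Longrightarrow> assoc C x' y' z' \<cdot> ((f \<star> g) \<star> h) = (f \<star> (g \<star> h)) \<cdot> assoc C x y z"
    and lunit_iso: "x \<in> Obj C \<Longrightarrow> is_iso C (unit C \<odot> x) x (lunit C x)"
    and lunit_natural: "f \<in> Hom C x y \<Longrightarrow> lunit C y \<cdot> (idm C (unit C) \<star> f) = f \<cdot> lunit C x"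
    and runit_iso: "x \<in> Obj C \<Longrightarrow> is_iso C (x \<odot> unit C) x (runit C x)"
    and runit_natural: "f \<in> Hom C x y \<Longrightarrow> runit C y \<cdot> (f \<star> idm C (unit C)) = f \<cdot> runit C x"
    and braid_iso: "\<lbrakk>x \<in> Obj C; y \<in> Obj C\<rbrakk> \<Longrightarrow> is_iso C (x \<odot> y) (y \<odot> x) (braid C x y)"
    and braid_natural: "\<lbrakk>f \<in> Hom C x x'; g \<in> Hom C y y'\<rbrakk>
          \<Longrightarrow> braid C x' y' \<cdot> (f \<star> g) = (g \<star> f) \<cdot> braid C x y"
    and pentagon: "\<lbrakk>w \<in> Obj C; x \<in> Obj C; y \<in> Obj C; z \<in> Obj C\<rbrakk>
          \<Longrightarrow> assoc C w x (y \<odot> z) \<cdot> assoc C (w \<odot> x) y z =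
              (idm C w \<star> assoc C x y z) \<cdot> assoc C w (x \<odot> y) z \<cdot> (assoc C w x y \<star> idm C z)"
    and triangle: "\<lbrakk>x \<in> Obj C; y \<in> Obj C\<rbrakk>
          \<Longrightarrow> (idm C x \<star> lunit C y) \<cdot> assoc C x (unit C) y = runit C x \<star> idm C y"
    and hexagon: "\<lbrakk>x \<in> Obj C; y \<in> Obj C; z \<in> Obj C\<rbrakk>
          \<Longrightarrow> assoc C y z x \<cdot> braid C x (y \<odot> z) \<cdot> assoc C x y z =
              (idm C y \<star> braid C x z) \<cdot> assoc C y x z \<cdot> (braid C x y \<star> idm C z)"
    and braid_braid: "\<lbrakk>x \<in> Obj C; y \<in> Obj C\<rbrakk> \<Longrightarrow> braid C y x \<cdot> braid C x y = idm C (x \<odot> y)"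

definition is_internal_hom ::
    "('o, 'a, 'm) tt_data_scheme \<Rightarrow> 'o \<Rightarrow> 'o \<Rightarrow> 'o \<Rightarrow> 'a \<Rightarrow> bool" where
  "is_internal_hom C x w h ev \<longleftrightarrow> h \<in> Obj C \<and> ev \<in> Hom C (h \<odot>\<^bsub>C\<^esub> x) w \<and>
     (\<forall>z\<in>Obj C. \<forall>f \<in> Hom C (z \<odot>\<^bsub>C\<^esub> x) w.
        \<exists>!g. g \<in> Hom C z h \<and> ev \<cdot>\<^bsub>C\<^esub> (g \<star>\<^bsub>C\<^esub> idm C x) = f)"

text \<open>The analogue \<open>x \<odot> \<Sigma>y \<rightarrow> \<Sigma>(x \<odot> y)\<close> of \<open>tsh\<close> in the second variable, via the symmetry.\<close>

definition tsh' :: "('o, 'a, 'm) tt_data_scheme \<Rightarrow> 'o \<Rightarrow> 'o \<Rightarrow> 'a" where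
  "tsh' C x y = Sha C (braid C y x) \<cdot>\<^bsub>C\<^esub> tsh C y x \<cdot>\<^bsub>C\<^esub> braid C x (Sho C y)"

text \<open>Closed symmetric monoidal, with tensor exact in each variable (by symmetry it suffices to
  treat the first one). The axiom \<open>tsh_sign\<close> is the graded commutativity of \<open>\<Sigma>\<one> \<odot> \<Sigma>\<one>\<close>: the two ways
  of moving both suspensions out of \<open>\<Sigma>x \<odot> \<Sigma>y\<close> differ by a sign.\<close>

locale tt_category = triangulated_category C + symmetric_monoidal_category C
  for C :: "('o, 'a, 'm) tt_data_scheme" (structure) +
  assumes closed: "\<lbrakk>x \<in> Obj C; w \<in> Obj C\<rbrakk> \<Longrightarrow> \<exists>h ev. is_internal_hom C x w h ev"
    and tarr_addm: "\<lbrakk>f \<in> Hom C x x'; f' \<in> Hom C x x'; g \<in> Hom C y y'\<rbrakk>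
          \<Longrightarrow> (f \<boxplus> f') \<star> g = (f \<star> g) \<boxplus> (f' \<star> g)"
    and tsh_iso: "\<lbrakk>x \<in> Obj C; y \<in> Obj C\<rbrakk>
          \<Longrightarrow> is_iso C (Sho C x \<odot> y) (Sho C (x \<odot> y)) (tsh C x y)"
    and tsh_natural: "\<lbrakk>f \<in> Hom C x x'; g \<in> Hom C y y'\<rbrakk>
          \<Longrightarrow> tsh C x' y' \<cdot> (Sha C f \<star> g) = Sha C (f \<star> g) \<cdot> tsh C x y"
    and tsh_unit: "x \<in> Obj C \<Longrightarrow> Sha C (runit C x) \<cdot> tsh C x (unit C) = runit C (Sho C x)"
    and tsh_assoc: "\<lbrakk>x \<in> Obj C; y \<in> Obj C; z \<in> Obj C\<rbrakk>
          \<Longrightarrow> tsh C x (y \<odot> z) \<cdot> assoc C (Sho C x) y z =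
              Sha C (assoc C x y z) \<cdot> tsh C (x \<odot> y) z \<cdot> (tsh C x y \<star> idm C z)"
    and tsh_sign: "\<lbrakk>x \<in> Obj C; y \<in> Obj C\<rbrakk>
          \<Longrightarrow> Sha C (tsh' C x y) \<cdot> tsh C x (Sho C y) =
              neg C (Sha C (tsh C x y) \<cdot> tsh' C (Sho C x) y)"
    and tensor_exact: "\<lbrakk>(f, g, h) \<in> Tri C; w \<in> Obj C\<rbrakk>
          \<Longrightarrow> (f \<star> idm C w, g \<star> idm C w, tsh C (Dom C f) w \<cdot> (h \<star> idm C w)) \<in> Tri C"

section \<open>Compact and dualizable objects\<close>

text \<open>\<open>x\<close> is compact if for every small coproduct \<open>c\<close> of objects \<open>y\<^sub>i\<close> the canonical map
  \<open>\<Oplus>\<^sub>i Hom(x, y\<^sub>i) \<rightarrow> Hom(x, c)\<close> is an isomorphism. Note that \<open>gfinprod\<close> is written multiplicatively but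
  is a finite sum of morphisms here.\<close>

definition compact_object :: "'u set \<Rightarrow> ('o, 'a, 'm) preadditive_data_scheme \<Rightarrow> 'o \<Rightarrow> bool" where
  "compact_object U C x \<longleftrightarrow> x \<in> Obj C \<and>
     (\<forall>I\<subseteq>U. \<forall>y \<in> I \<rightarrow> Obj C. \<forall>c \<iota>. small U I \<and> is_coproduct C I y c \<iota> \<longrightarrow>
        (\<lambda>\<phi>. gfinprod (hom_group C x c) (\<lambda>i. \<iota> i \<cdot>\<^bsub>C\<^esub> \<phi> i) I)
          \<in> iso (sum_group I (\<lambda>i. hom_group C x (y i))) (hom_group C x c))"

definition compacts :: "'u set \<Rightarrow> ('o, 'a, 'm) preadditive_data_scheme \<Rightarrow> 'o set" where
  "compacts U C = {x. compact_object U C x}"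

definition dualizable :: "('o, 'a, 'm) tt_data_scheme \<Rightarrow> 'o \<Rightarrow> bool" where
  "dualizable C x \<longleftrightarrow> x \<in> Obj C \<and>
     (\<exists>d \<in> Obj C. \<exists>ev \<in> Hom C (d \<odot>\<^bsub>C\<^esub> x) (unit C). \<exists>coev \<in> Hom C (unit C) (x \<odot>\<^bsub>C\<^esub> d).
        runit C x \<cdot>\<^bsub>C\<^esub> (idm C x \<star>\<^bsub>C\<^esub> ev) \<cdot>\<^bsub>C\<^esub> assoc C x d x \<cdot>\<^bsub>C\<^esub> (coev \<star>\<^bsub>C\<^esub> idm C x) = lunit C x \<and>
        lunit C d \<cdot>\<^bsub>C\<^esub> (ev \<star>\<^bsub>C\<^esub> idm C d)
          \<cdot>\<^bsub>C\<^esub> inverse_arrow C ((d \<odot>\<^bsub>C\<^esub> x) \<odot>\<^bsub>C\<^esub> d) (d \<odot>\<^bsub>C\<^esub> (x \<odot>\<^bsub>C\<^esub> d)) (assoc C d x d)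
          \<cdot>\<^bsub>C\<^esub> (idm C d \<star>\<^bsub>C\<^esub> coev) = runit C d)"

text \<open>\<open>\<Sigma>\<close> is only an equivalence, so the vanishing of \<open>Hom(\<Sigma>\<^sup>n g, x)\<close> for \<open>n < 0\<close> is expressed by
  shifting \<open>x\<close> instead.\<close>

definition compactly_generated :: "'u set \<Rightarrow> ('o, 'a, 'm) triangulated_data_scheme \<Rightarrow> bool" where
  "compactly_generated U C \<longleftrightarrow>
     (\<exists>G \<subseteq> compacts U C. small U G \<and>
        (\<forall>x\<in>Obj C.
           (\<forall>g\<in>G. \<forall>n. Hom C ((Sho C ^^ n) g) x = {zerom C ((Sho C ^^ n) g) x} \<and>
                      Hom C g ((Sho C ^^ n) x) = {zerom C g ((Sho C ^^ n) x)}) \<longrightarrow>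
           zero_object C x))"

definition rigidly_compactly_generated :: "'u set \<Rightarrow> ('o, 'a, 'm) tt_data_scheme \<Rightarrow> bool" where
  "rigidly_compactly_generated U C \<longleftrightarrow>
     tt_category C \<and> locally_small U C \<and> has_small_coproducts U C \<and> compactly_generated U C \<and>
     compacts U C = {x. dualizable C x}"

definition full_subcategory ::
    "('o, 'a, 'm) tt_data_scheme \<Rightarrow> 'o set \<Rightarrow> ('o, 'a, 'm) tt_data_scheme" where
  "full_subcategory C K = C\<lparr>
     Obj := K,
     Arr := {f \<in> Arr C. Dom C f \<in> K \<and> Cod C f \<in> K},
     Tri := {(f, g, h) \<in> Tri C. Dom C f \<in> K \<and> Cod C f \<in> K \<and> Cod C g \<in> K}\<rparr>"

definition compact_part :: "'u set \<Rightarrow> ('o, 'a, 'm) tt_data_scheme \<Rightarrow> ('o, 'a, 'm) tt_data_scheme"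
  where "compact_part U C = full_subcategory C (compacts U C)"

section \<open>Geometric functors\<close>

text \<open>Structure maps: \<open>fsh x : F(\<Sigma>x) \<rightarrow> \<Sigma>(F x)\<close>, \<open>fmul x y : F x \<odot> F y \<rightarrow> F(x \<odot> y)\<close>,
  \<open>funit : \<one> \<rightarrow> F \<one>\<close>.\<close>

record ('o, 'a, 'p, 'b) tt_functor_data =
  fobj :: "'o \<Rightarrow> 'p"
  farr :: "'a \<Rightarrow> 'b"
  fsh :: "'o \<Rightarrow> 'b"
  fmul :: "'o \<Rightarrow> 'o \<Rightarrow> 'b"
  funit :: "'b"

locale tt_functor =
  fixes C :: "('o, 'a, 'm) tt_data_scheme"
    and D :: "('p, 'b, 'n) tt_data_scheme"
    and F :: "('o, 'a, 'p, 'b, 'k) tt_functor_data_scheme"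
  assumes additive: "additive_functor C D (fobj F) (farr F)"
    and fsh_iso: "x \<in> Obj C \<Longrightarrow> is_iso D (fobj F (Sho C x)) (Sho D (fobj F x)) (fsh F x)"
    and fsh_natural: "f \<in> Hom C x y \<Longrightarrow>
          fsh F y \<cdot>\<^bsub>D\<^esub> farr F (Sha C f) = Sha D (farr F f) \<cdot>\<^bsub>D\<^esub> fsh F x"
    and exact: "(f, g, h) \<in> Tri C \<Longrightarrow>
          (farr F f, farr F g, fsh F (Dom C f) \<cdot>\<^bsub>D\<^esub> farr F h) \<in> Tri D"
    and funit_iso: "is_iso D (unit D) (fobj F (unit C)) (funit F)"
    and fmul_iso: "\<lbrakk>x \<in> Obj C; y \<in> Obj C\<rbrakk> \<Longrightarrow>
          is_iso D (fobj F x \<odot>\<^bsub>D\<^esub> fobj F y) (fobj F (x \<odot>\<^bsub>C\<^esub> y)) (fmul F x y)"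
    and fmul_natural: "\<lbrakk>f \<in> Hom C x x'; g \<in> Hom C y y'\<rbrakk> \<Longrightarrow>
          fmul F x' y' \<cdot>\<^bsub>D\<^esub> (farr F f \<star>\<^bsub>D\<^esub> farr F g) = farr F (f \<star>\<^bsub>C\<^esub> g) \<cdot>\<^bsub>D\<^esub> fmul F x y"
    and fmul_assoc: "\<lbrakk>x \<in> Obj C; y \<in> Obj C; z \<in> Obj C\<rbrakk> \<Longrightarrow>
          farr F (assoc C x y z) \<cdot>\<^bsub>D\<^esub> fmul F (x \<odot>\<^bsub>C\<^esub> y) z \<cdot>\<^bsub>D\<^esub> (fmul F x y \<star>\<^bsub>D\<^esub> idm D (fobj F z)) =
          fmul F x (y \<odot>\<^bsub>C\<^esub> z) \<cdot>\<^bsub>D\<^esub> (idm D (fobj F x) \<star>\<^bsub>D\<^esub> fmul F y z)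
            \<cdot>\<^bsub>D\<^esub> assoc D (fobj F x) (fobj F y) (fobj F z)"
    and fmul_lunit: "x \<in> Obj C \<Longrightarrow>
          farr F (lunit C x) \<cdot>\<^bsub>D\<^esub> fmul F (unit C) x \<cdot>\<^bsub>D\<^esub> (funit F \<star>\<^bsub>D\<^esub> idm D (fobj F x)) =
          lunit D (fobj F x)"
    and fmul_runit: "x \<in> Obj C \<Longrightarrow>
          farr F (runit C x) \<cdot>\<^bsub>D\<^esub> fmul F x (unit C) \<cdot>\<^bsub>D\<^esub> (idm D (fobj F x) \<star>\<^bsub>D\<^esub> funit F) =
          runit D (fobj F x)"
    and fmul_braid: "\<lbrakk>x \<in> Obj C; y \<in> Obj C\<rbrakk> \<Longrightarrow>
          farr F (braid C x y) \<cdot>\<^bsub>D\<^esub> fmul F x y = fmul F y x \<cdot>\<^bsub>D\<^esub> braid D (fobj F x) (fobj F y)"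

definition geometric_functor ::
    "'u set \<Rightarrow> ('o, 'a, 'm) tt_data_scheme \<Rightarrow> ('p, 'b, 'n) tt_data_scheme
      \<Rightarrow> ('o, 'a, 'p, 'b, 'k) tt_functor_data_scheme \<Rightarrow> bool" where
  "geometric_functor U C D F \<longleftrightarrow>
     rigidly_compactly_generated U C \<and> rigidly_compactly_generated U D \<and>
     tt_functor C D F \<and> preserves_small_coproducts U C D (fobj F) (farr F)"

section \<open>The Balmer spectrum\<close>

definition thick :: "('o, 'a, 'm) triangulated_data_scheme \<Rightarrow> 'o set \<Rightarrow> bool" where
  "thick K P \<longleftrightarrow> P \<subseteq> Obj K \<and>
     (\<forall>x. zero_object K x \<longrightarrow> x \<in> P) \<and>
     (\<forall>x\<in>Obj K. Sho K x \<in> P \<longleftrightarrow> x \<in> P) \<and>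
     (\<forall>(f, g, h) \<in> Tri K. Dom K f \<in> P \<and> Cod K f \<in> P \<longrightarrow> Cod K g \<in> P) \<and>
     (\<forall>x\<in>Obj K. \<forall>y\<in>Obj K. \<forall>s\<in>P. is_biproduct K x y s \<longrightarrow> x \<in> P)"

definition thick_tensor_ideal :: "('o, 'a, 'm) tt_data_scheme \<Rightarrow> 'o set \<Rightarrow> bool" where
  "thick_tensor_ideal K P \<longleftrightarrow> thick K P \<and> (\<forall>x\<in>P. \<forall>y\<in>Obj K. x \<odot>\<^bsub>K\<^esub> y \<in> P)"

definition Spc :: "('o, 'a, 'm) tt_data_scheme \<Rightarrow> 'o set set" where
  "Spc K = {P. thick_tensor_ideal K P \<and> P \<noteq> Obj K \<and>
     (\<forall>x\<in>Obj K. \<forall>y\<in>Obj K. x \<odot>\<^bsub>K\<^esub> y \<in> P \<longrightarrow> x \<in> P \<or> y \<in> P)}"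

definition supp :: "('o, 'a, 'm) tt_data_scheme \<Rightarrow> 'o \<Rightarrow> 'o set set" where
  "supp K x = {P \<in> Spc K. x \<notin> P}"

text \<open>The complements of supports are closed under finite intersections, since
  \<open>supp x \<union> supp y = supp (x \<oplus> y)\<close>; so they are not just a subbasis but a basis of this topology.\<close>

definition Spc_topology :: "('o, 'a, 'm) tt_data_scheme \<Rightarrow> 'o set topology" where
  "Spc_topology K = topology_generated_by ((\<lambda>x. Spc K - supp K x) ` Obj K)"

definition Spc_map ::
    "('o, 'a, 'm) tt_data_scheme \<Rightarrow> ('o, 'a, 'p, 'b, 'k) tt_functor_data_scheme
      \<Rightarrow> 'p set \<Rightarrow> 'o set" where
  "Spc_map K F Q = {x \<in> Obj K. fobj F x \<in> Q}"

section \<open>Spectral spaces and spectral quotient maps\<close>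

definition qc_open :: "'x topology \<Rightarrow> 'x set \<Rightarrow> bool" where
  "qc_open X V \<longleftrightarrow> openin X V \<and> compactin X V"

definition irreducible_closed :: "'x topology \<Rightarrow> 'x set \<Rightarrow> bool" where
  "irreducible_closed X Z \<longleftrightarrow> closedin X Z \<and> Z \<noteq> {} \<and>
     (\<forall>A B. closedin X A \<and> closedin X B \<and> Z = A \<union> B \<longrightarrow> Z = A \<or> Z = B)"

definition spectral_space :: "'x topology \<Rightarrow> bool" where
  "spectral_space X \<longleftrightarrow> compact_space X \<and> t0_space X \<and>
     (\<forall>V W. qc_open X V \<and> qc_open X W \<longrightarrow> qc_open X (V \<inter> W)) \<and>
     (\<forall>V x. openin X V \<and> x \<in> V \<longrightarrow> (\<exists>W. qc_open X W \<and> x \<in> W \<and> W \<subseteq> V)) \<and>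
     (\<forall>Z. irreducible_closed X Z \<longrightarrow> (\<exists>x. Z = X closure_of {x} \<and> x \<in> topspace X))"

definition spectral_map :: "'x topology \<Rightarrow> 'y topology \<Rightarrow> ('x \<Rightarrow> 'y) \<Rightarrow> bool" where
  "spectral_map X Y \<phi> \<longleftrightarrow> spectral_space X \<and> spectral_space Y \<and> continuous_map X Y \<phi> \<and>
     (\<forall>V. qc_open Y V \<longrightarrow> qc_open X {x \<in> topspace X. \<phi> x \<in> V})"

definition spectral_quotient_map :: "'x topology \<Rightarrow> 'y topology \<Rightarrow> ('x \<Rightarrow> 'y) \<Rightarrow> bool" where
  "spectral_quotient_map X Y \<phi> \<longleftrightarrow> spectral_map X Y \<phi> \<and> \<phi> ` topspace X = topspace Y \<and>
     (\<forall>V\<subseteq>topspace Y. qc_open X {x \<in> topspace X. \<phi> x \<in> V} \<longrightarrow> qc_open Y V)"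

end

theory Submission
  imports Defs
begin

text \<open>The spectrum of the compact objects is the prime spectrum of the distributive lattice of principal thick
  tensor ideals, with joins given by sums and meets by tensor products. Nilpotence of the fibres of coevaluation
  maps shows that a faithful functor induces an injective homomorphism \<open>L \<rightarrow> M\<close> of these lattices; this
  gives surjectivity on spectra. If the functor is also full, then \<open>L\<close> is closed under relative complements: when
  \<open>F x\<close> splits into two parts \<open>s\<^sub>1\<close>, \<open>s\<^sub>2\<close> with disjoint supports modulo \<open>F p\<close>, the two projections are endomorphisms
  of \<open>F x\<close> up to denominators which come from the source category, so they lift, and the cones of the lifts realize
  the splitting over the source.

  Such closure forces the preimage of every interval \<open>{P. P' \<subseteq> P \<subseteq> P''}\<close> of primes to be connected. For \<open>P' = P''\<close>
  these are the fibres. If the preimage of \<open>V\<close> is quasi-compact open but \<open>V\<close> is not, then Zorn's lemma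
  yields an interval with two elements, exactly one of which lies in \<open>V\<close>, whose preimage would be disconnected.\<close>

section \<open>Spectra of distributive lattices\<close>

text \<open>Faithfulness concerns arrows while the spectrum concerns objects. The link is the
  connecting arrow \<open>h\<close> of a coevaluation 1 -> b \<odot> d: tensoring with
  \<open>b\<close> kills it, and its cone lies in every ideal containing \<open>b\<close>. Hence an
  object lies in an ideal \<open>J\<close> exactly when its identity is killed by tensoring with
  some arrow whose cone lies in \<open>J\<close> and whose target is a twist of the unit. This
  condition only speaks of vanishing, which a faithful functor reflects. Fullness is harder to
  exploit. The idempotents that split \<open>F x\<close> modulo \<open>F p\<close> live in a Verdier
  quotient of the target, where the functor has no reason to be full. Therefore all fractions are
  kept explicit: the denominators modulo \<open>F p\<close> are images of arrows of the source, and
  the auxiliary arrows attached to the two parts enter the ends of the summands only through their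
  targets, which are built from the unit and so also come from the source. Both summands then run
  between objects in the image, up to isomorphism, although they factor through objects that are
  not.\<close>

text \<open>Lattices are given as preorders on a carrier, since objects are only compared by the ideals they generate.\<close>

locale distributive_preorder =
  fixes L :: "'a set"
    and le :: "'a \<Rightarrow> 'a \<Rightarrow> bool" (infix "\<preceq>" 50)
    and join :: "'a \<Rightarrow> 'a \<Rightarrow> 'a" (infixl "\<curlyvee>" 65)
    and meet :: "'a \<Rightarrow> 'a \<Rightarrow> 'a" (infixl "\<curlywedge>" 70)
    and bot :: 'a and top :: 'a
  assumes le_refl: "a \<in> L \<Longrightarrow> a \<preceq> a"
    and le_trans: "\<lbrakk>a \<preceq> b; b \<preceq> c; a \<in> L; b \<in> L; c \<in> L\<rbrakk> \<Longrightarrow> a \<preceq> c"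
    and join_in: "\<lbrakk>a \<in> L; b \<in> L\<rbrakk> \<Longrightarrow> a \<curlyvee> b \<in> L"
    and meet_in: "\<lbrakk>a \<in> L; b \<in> L\<rbrakk> \<Longrightarrow> a \<curlywedge> b \<in> L"
    and bot_in: "bot \<in> L" and top_in: "top \<in> L"
    and join1: "\<lbrakk>a \<in> L; b \<in> L\<rbrakk> \<Longrightarrow> a \<preceq> a \<curlyvee> b"
    and join2: "\<lbrakk>a \<in> L; b \<in> L\<rbrakk> \<Longrightarrow> b \<preceq> a \<curlyvee> b"
    and join_least: "\<lbrakk>a \<preceq> c; b \<preceq> c; a \<in> L; b \<in> L; c \<in> L\<rbrakk> \<Longrightarrow> a \<curlyvee> b \<preceq> c"
    and meet1: "\<lbrakk>a \<in> L; b \<in> L\<rbrakk> \<Longrightarrow> a \<curlywedge> b \<preceq> a"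
    and meet2: "\<lbrakk>a \<in> L; b \<in> L\<rbrakk> \<Longrightarrow> a \<curlywedge> b \<preceq> b"
    and meet_greatest: "\<lbrakk>c \<preceq> a; c \<preceq> b; a \<in> L; b \<in> L; c \<in> L\<rbrakk> \<Longrightarrow> c \<preceq> a \<curlywedge> b"
    and distrib: "\<lbrakk>a \<in> L; b \<in> L; c \<in> L\<rbrakk> \<Longrightarrow> a \<curlywedge> (b \<curlyvee> c) \<preceq> (a \<curlywedge> b) \<curlyvee> (a \<curlywedge> c)"
    and bot_le: "a \<in> L \<Longrightarrow> bot \<preceq> a"
    and le_top: "a \<in> L \<Longrightarrow> a \<preceq> top"
begin

definition lideal :: "'a set \<Rightarrow> bool" where
  "lideal I \<longleftrightarrow> I \<subseteq> L \<and> bot \<in> I \<and> (\<forall>a\<in>I. \<forall>b\<in>L. b \<preceq> a \<longrightarrow> b \<in> I) \<and> (\<forall>a\<in>I. \<forall>b\<in>I. a \<curlyvee> b \<in> I)"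

definition lprime :: "'a set \<Rightarrow> bool" where
  "lprime P \<longleftrightarrow> lideal P \<and> top \<notin> P \<and> (\<forall>a\<in>L. \<forall>b\<in>L. a \<curlywedge> b \<in> P \<longrightarrow> a \<in> P \<or> b \<in> P)"

text \<open>Only closure under meets is required: an ideal is downward closed, so it meets
  \<open>G\<close> as soon as it meets the upward closure of \<open>G\<close>.\<close>

definition lfilter_base :: "'a set \<Rightarrow> bool" where
  "lfilter_base G \<longleftrightarrow> G \<subseteq> L \<and> top \<in> G \<and> (\<forall>a\<in>G. \<forall>b\<in>G. a \<curlywedge> b \<in> G)"

lemma lidealD:
  assumes "lideal I"
  shows "I \<subseteq> L" "bot \<in> I" "\<And>a b. \<lbrakk>a \<in> I; b \<in> L; b \<preceq> a\<rbrakk> \<Longrightarrow> b \<in> I" "\<And>a b. \<lbrakk>a \<in> I; b \<in> I\<rbrakk> \<Longrightarrow> a \<curlyvee> b \<in> I"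
    "\<And>a. a \<in> I \<Longrightarrow> a \<in> L"
  using assms unfolding lideal_def by auto

lemma lprimeD:
  assumes "lprime P"
  shows "lideal P" "top \<notin> P" "\<And>a b. \<lbrakk>a \<in> L; b \<in> L; a \<curlywedge> b \<in> P\<rbrakk> \<Longrightarrow> a \<in> P \<or> b \<in> P"
  using assms unfolding lprime_def by auto

lemma join_mono:
  assumes "a \<preceq> a'" "b \<preceq> b'" "a \<in> L" "b \<in> L" "a' \<in> L" "b' \<in> L"
  shows "a \<curlyvee> b \<preceq> a' \<curlyvee> b'"
  by (meson assms join1 join2 join_in join_least le_trans)

lemma meet_mono:
  assumes "a \<preceq> a'" "b \<preceq> b'" "a \<in> L" "b \<in> L" "a' \<in> L" "b' \<in> L"
  shows "a \<curlywedge> b \<preceq> a' \<curlywedge> b'"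
  by (meson assms meet1 meet2 meet_in meet_greatest le_trans)

lemma lprime_join_iff:
  assumes "lprime P" "a \<in> L" "b \<in> L" shows "a \<curlyvee> b \<in> P \<longleftrightarrow> a \<in> P \<and> b \<in> P"
  using lidealD[OF lprimeD(1)[OF assms(1)]] join1 join2 join_in assms by meson

lemma lprime_meet_iff:
  assumes "lprime P" "a \<in> L" "b \<in> L" shows "a \<curlywedge> b \<in> P \<longleftrightarrow> a \<in> P \<or> b \<in> P"
  using lidealD[OF lprimeD(1)[OF assms(1)]] lprimeD(3)[OF assms(1)] meet1 meet2 meet_in assms by meson

lemma lprime_mono:
  assumes "lprime P" "a \<in> P" "b \<in> L" "b \<preceq> a" shows "b \<in> P"
  using lidealD[OF lprimeD(1)[OF assms(1)]] assms by blast

lemma lprime_sub: "lprime P \<Longrightarrow> P \<subseteq> L"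
  by (rule lidealD(1)[OF lprimeD(1)])

text \<open>Distributing twice leaves three meets: two lie below \<open>q\<close> or
  \<open>p\<close>, the third is the meet of \<open>a\<close> and \<open>b\<close>. This is the
  inequality that makes a maximal ideal prime in \<open>lprime_exists\<close>.\<close>

lemma meet_join_cover:
  assumes "g \<preceq> p \<curlyvee> a" "h \<preceq> q \<curlyvee> b" "g \<in> L" "h \<in> L" "p \<in> L" "q \<in> L" "a \<in> L" "b \<in> L"
  shows "g \<curlywedge> h \<preceq> (p \<curlyvee> q) \<curlyvee> (a \<curlywedge> b)"
proof -
  let ?r = "(p \<curlyvee> q) \<curlyvee> (a \<curlywedge> b)"
  note c = assms(3-) join_in meet_in
  have r: "?r \<in> L" using c by auto
  have 1: "g \<curlywedge> h \<preceq> g \<curlywedge> (q \<curlyvee> b)"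
    using assms meet_mono le_refl c by auto
  have 2: "g \<curlywedge> (q \<curlyvee> b) \<preceq> (g \<curlywedge> q) \<curlyvee> (g \<curlywedge> b)" using distrib c by auto
  have pq: "p \<preceq> ?r" "q \<preceq> ?r" using join1 join2 c le_trans[of _ "p \<curlyvee> q" ?r] by auto
  have 3: "g \<curlywedge> q \<preceq> ?r" using le_trans[OF meet2 pq(2)] c r by auto
  have "g \<curlywedge> b \<preceq> b \<curlywedge> (p \<curlyvee> a)"
    using assms c meet_greatest meet2 le_trans[OF meet1 assms(1)] by auto
  moreover have "b \<curlywedge> (p \<curlyvee> a) \<preceq> (b \<curlywedge> p) \<curlyvee> (b \<curlywedge> a)" using distrib c by auto
  moreover have "b \<curlywedge> p \<preceq> ?r" using le_trans[OF meet2 pq(1)] c r by auto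
  moreover have "b \<curlywedge> a \<preceq> ?r" 
    using le_trans[of "b \<curlywedge> a" "a \<curlywedge> b" ?r] join2 c meet_greatest meet1 meet2 by auto
  ultimately have 4: "g \<curlywedge> b \<preceq> ?r"
    by (meson c(1-) r join_least le_trans)
  show ?thesis
    by (meson 1 2 3 4 c r join_least le_trans)
qed

lemma lideal_down: "a \<in> L \<Longrightarrow> lideal {y\<in>L. y \<preceq> a}"
  unfolding lideal_def by (auto intro: bot_in bot_le join_in join_least elim: le_trans)

lemma lideal_principal_join:
  assumes I: "lideal I" and a: "a \<in> L" shows "lideal {y\<in>L. \<exists>p\<in>I. y \<preceq> p \<curlyvee> a}"
  unfolding lideal_def
proof (intro conjI ballI impI)
  note PD = lidealD[OF I]
  let ?X = "{y\<in>L. \<exists>p\<in>I. y \<preceq> p \<curlyvee> a}"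
  show "?X \<subseteq> L" by blast
  show "bot \<in> ?X" using PD(2,5) a bot_in bot_le join_in by blast
  fix y z assume "y \<in> ?X" "z \<in> L" "z \<preceq> y" thus "z \<in> ?X"
    using le_trans[of z y] PD(5) a join_in by blast
next
  note PD = lidealD[OF I]
  let ?X = "{y\<in>L. \<exists>p\<in>I. y \<preceq> p \<curlyvee> a}"
  fix y z assume "y \<in> ?X" "z \<in> ?X"
  then obtain p q where pq: "p \<in> I" "q \<in> I" "y \<preceq> p \<curlyvee> a" "z \<preceq> q \<curlyvee> a" "y \<in> L" "z \<in> L" by blast
  have L: "p \<in> L" "q \<in> L" using pq PD(5) by auto
  have "p \<curlyvee> a \<preceq> (p \<curlyvee> q) \<curlyvee> a" "q \<curlyvee> a \<preceq> (p \<curlyvee> q) \<curlyvee> a"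
    using join_mono join1 join2 le_refl L a join_in by auto
  hence "y \<curlyvee> z \<preceq> (p \<curlyvee> q) \<curlyvee> a"
    using join_least le_trans[OF pq(3)] le_trans[OF pq(4)] L a pq join_in by auto
  thus "y \<curlyvee> z \<in> ?X" using PD(4) pq join_in by blast
qed
text \<open>The prime ideal theorem. Take \<open>P\<close> maximal among the ideals that contain
  \<open>I\<close> and miss \<open>G\<close>. Adjoining an element outside \<open>P\<close> forces
  the ideal to meet \<open>G\<close>; two such witnesses have their meet in \<open>G\<close>, and it
  would lie in \<open>P\<close> if the meet of the two elements did.\<close>

theorem lprime_exists:
  assumes I: "lideal I" and G: "lfilter_base G" and dis: "I \<inter> G = {}"
  obtains P where "lprime P" "I \<subseteq> P" "P \<inter> G = {}"
proof -
  let ?S = "{J. lideal J \<and> I \<subseteq> J \<and> J \<inter> G = {}}"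
  have "\<exists>M\<in>?S. \<forall>X\<in>?S. M \<subseteq> X \<longrightarrow> X = M"
  proof (rule subset_Zorn_nonempty)
    show "?S \<noteq> {}" using assms by blast
    fix \<C> assume C: "\<C> \<noteq> {}" "subset.chain ?S \<C>"
    have sub: "\<And>J. J \<in> \<C> \<Longrightarrow> lideal J \<and> I \<subseteq> J \<and> J \<inter> G = {}"
      using C(2) by (auto simp: subset.chain_def)
    have ch: "\<And>J J'. J \<in> \<C> \<Longrightarrow> J' \<in> \<C> \<Longrightarrow> J \<subseteq> J' \<or> J' \<subseteq> J"
      using C(2) unfolding subset.chain_def by blast
    have "lideal (\<Union>\<C>)" unfolding lideal_def
    proof (intro conjI ballI impI)
      show "\<Union>\<C> \<subseteq> L" using sub lidealD(1) by blast
      show "bot \<in> \<Union>\<C>" using sub lidealD(2) C(1) by blast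
    next
      fix a b assume "a \<in> \<Union>\<C>" "b \<in> L" "b \<preceq> a" thus "b \<in> \<Union>\<C>" using sub lidealD(3) by blast
    next
      fix a b assume "a \<in> \<Union>\<C>" "b \<in> \<Union>\<C>"
      then obtain J J' where J: "J \<in> \<C>" "a \<in> J" "J' \<in> \<C>" "b \<in> J'" by blast
      from ch[OF J(1,3)] show "a \<curlyvee> b \<in> \<Union>\<C>"
      proof
        assume "J \<subseteq> J'" thus ?thesis using lidealD(4)[of J' a b] sub[OF J(3)] J by blast
      next
        assume "J' \<subseteq> J" thus ?thesis using lidealD(4)[of J a b] sub[OF J(1)] J by blast
      qed
    qed
    thus "\<Union>\<C> \<in> ?S" using sub C(1) by blast
  qed
  then obtain P where PS: "P \<in> ?S" and mx0: "\<forall>X\<in>?S. P \<subseteq> X \<longrightarrow> X = P" by (rule bexE)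
  have P: "lideal P" "I \<subseteq> P" "P \<inter> G = {}" using PS by auto
  have mx: "X = P" if "lideal X" "P \<subseteq> X" "X \<inter> G = {}" for X
    using mx0 that P(2) by (metis (mono_tags, lifting) mem_Collect_eq order_trans)
  note PD = lidealD[OF P(1)]
  have G': "G \<subseteq> L" "top \<in> G" "\<And>a b. a \<in> G \<Longrightarrow> b \<in> G \<Longrightarrow> a \<curlywedge> b \<in> G"
    using G unfolding lfilter_base_def by auto
  have ext: "\<exists>g\<in>G. \<exists>p\<in>P. g \<preceq> p \<curlyvee> a" if a: "a \<in> L" "a \<notin> P" for a
  proof -
    let ?X = "{y\<in>L. \<exists>p\<in>P. y \<preceq> p \<curlyvee> a}"
    have "lideal ?X" by (rule lideal_principal_join[OF P(1) a(1)])
    moreover have "P \<subseteq> ?X" using PD(5) join1 a by blast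
    moreover have "a \<in> ?X" using a PD(2) bot_in join2 by blast
    ultimately have "?X \<inter> G \<noteq> {}" using mx a by blast
    thus ?thesis by blast
  qed
  have "lprime P" unfolding lprime_def
  proof (intro conjI ballI impI)
    show "lideal P" by (rule P(1))
    show "top \<notin> P" using G' P(3) by blast
    fix a b assume ab: "a \<in> L" "b \<in> L" "a \<curlywedge> b \<in> P"
    show "a \<in> P \<or> b \<in> P"
    proof (rule ccontr)
      assume "\<not> ?thesis"
      then obtain g p h q where gh: "g \<in> G" "p \<in> P" "g \<preceq> p \<curlyvee> a" "h \<in> G" "q \<in> P" "h \<preceq> q \<curlyvee> b"
        using ext ab by metis
      have "g \<curlywedge> h \<preceq> (p \<curlyvee> q) \<curlyvee> (a \<curlywedge> b)"
        by (rule meet_join_cover) (use gh ab PD(5) G'(1) in blast)+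
      moreover have "(p \<curlyvee> q) \<curlyvee> (a \<curlywedge> b) \<in> P"
        by (rule PD(4)[OF PD(4)[OF gh(2) gh(5)] ab(3)])
      moreover have "g \<curlywedge> h \<in> L" using G'(1) gh meet_in by blast
      ultimately have "g \<curlywedge> h \<in> P" using PD(3) by blast
      thus False using G'(3) gh P(3) by blast
    qed
  qed
  thus thesis using that P by blast
qed

section \<open>The spectral space of primes of a distributive lattice\<close>

definition Pr :: "'a set set" where "Pr = {P. lprime P}"

text \<open>Basic open sets consist of the primes that contain an element, as do the complements of
  supports in a Balmer spectrum. So \<open>D\<close> reverses the order: joins give intersections
  and meets give unions.\<close>

definition D :: "'a \<Rightarrow> 'a set set" where "D a = {P. lprime P \<and> a \<in> P}"

definition ptop :: "'a set topology" where "ptop = topology_generated_by (D ` L)"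

lemma D_join: "a \<in> L \<Longrightarrow> b \<in> L \<Longrightarrow> D (a \<curlyvee> b) = D a \<inter> D b"
  unfolding D_def using lprime_join_iff by blast

lemma D_meet: "a \<in> L \<Longrightarrow> b \<in> L \<Longrightarrow> D (a \<curlywedge> b) = D a \<union> D b"
  unfolding D_def using lprime_meet_iff by blast

lemma D_bot: "D bot = Pr" unfolding D_def Pr_def using lprimeD(1) lidealD(2) by blast
lemma D_top: "D top = {}" unfolding D_def using lprimeD(2) by blast

lemma topspace_ptop: "topspace ptop = Pr"
proof -
  have "topspace ptop = \<Union>(D ` L)" unfolding ptop_def by simp
  also have "\<dots> = Pr" using D_bot bot_in unfolding D_def Pr_def by blast
  finally show ?thesis .
qed

lemma openin_D: "a \<in> L \<Longrightarrow> openin ptop (D a)"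
  unfolding ptop_def by (rule topology_generated_by_Basis) auto

text \<open>Joins make the sets \<open>D a\<close> closed under intersection, so the generating
  family is already a basis.\<close>

lemma openin_ptop_iff: "openin ptop V \<longleftrightarrow> V \<subseteq> Pr \<and> (\<forall>P\<in>V. \<exists>a\<in>L. a \<in> P \<and> D a \<subseteq> V)"
proof
  assume V: "openin ptop V"
  have "generate_topology_on (D ` L) V" using V unfolding ptop_def openin_topology_generated_by_iff .
  hence "\<forall>P\<in>V. \<exists>a\<in>L. a \<in> P \<and> D a \<subseteq> V"
  proof induction
    case Empty then show ?case by simp
  next
    case (Int a b)
    show ?case
    proof
      fix P assume P: "P \<in> a \<inter> b"
      then obtain x y where xy: "x \<in> L" "x \<in> P" "D x \<subseteq> a" "y \<in> L" "y \<in> P" "D y \<subseteq> b"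
        using Int.IH by (meson IntD1 IntD2)
      from P have "P \<in> a" by simp
      moreover have "openin ptop a" using Int.hyps(1) unfolding ptop_def openin_topology_generated_by_iff .
      ultimately have "lprime P" using openin_subset[of ptop a] unfolding topspace_ptop Pr_def by blast
      hence "x \<curlyvee> y \<in> P" using lprime_join_iff xy by blast
      moreover have "D (x \<curlyvee> y) \<subseteq> a \<inter> b" using D_join xy by blast
      ultimately show "\<exists>x\<in>L. x \<in> P \<and> D x \<subseteq> a \<inter> b" using xy join_in by blast
    qed
  next
    case (UN K)
    show ?case
    proof
      fix P assume "P \<in> \<Union>K"
      then obtain k where k: "k \<in> K" "P \<in> k" by blast
      then obtain a where "a \<in> L" "a \<in> P" "D a \<subseteq> k" using UN.IH by meson
      thus "\<exists>a\<in>L. a \<in> P \<and> D a \<subseteq> \<Union>K" using k(1) by blast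
    qed
  next
    case (Basis s) then show ?case unfolding D_def by blast
  qed
  thus "V \<subseteq> Pr \<and> (\<forall>P\<in>V. \<exists>a\<in>L. a \<in> P \<and> D a \<subseteq> V)"
    using openin_subset[OF V] topspace_ptop by auto
next
  assume V: "V \<subseteq> Pr \<and> (\<forall>P\<in>V. \<exists>a\<in>L. a \<in> P \<and> D a \<subseteq> V)"
  have "V = \<Union>{D a | a. a \<in> L \<and> D a \<subseteq> V}" using V unfolding D_def Pr_def by blast
  moreover have "openin ptop (\<Union>{D a | a. a \<in> L \<and> D a \<subseteq> V})" using openin_D by blast
  ultimately show "openin ptop V" by simp
qed

lemma D_finite_union:
  assumes "finite B" "B \<subseteq> L" shows "\<exists>b\<in>L. \<Union>(D ` B) = D b"
  using assms
proof (induction B)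
  case empty then show ?case using D_top top_in by force
next
  case (insert x B)
  then obtain b where "b \<in> L" "\<Union>(D ` B) = D b" by auto
  then have "\<Union>(D ` insert x B) = D (x \<curlywedge> b)" "x \<curlywedge> b \<in> L" using insert D_meet meet_in by auto
  then show ?case by blast
qed

lemma D_mono: assumes "a \<in> L" "b \<in> L" "b \<preceq> a" shows "D a \<subseteq> D b"
  unfolding D_def using lprime_mono assms by blast

text \<open>The elements whose basic open set has a finite subcover form a filter base, because
  meets become unions. If it missed the ideal below \<open>a\<close>, a prime containing
  \<open>a\<close> and avoiding it would belong to no set of the cover.\<close>

lemma compactin_D: assumes a: "a \<in> L" shows "compactin ptop (D a)"
  unfolding compactin_def
proof (intro conjI allI impI)
  show "D a \<subseteq> topspace ptop" unfolding topspace_ptop Pr_def D_def by blast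
  fix \<U> assume "Ball \<U> (openin ptop) \<and> D a \<subseteq> \<Union>\<U>"
  hence U: "\<forall>u\<in>\<U>. openin ptop u" "D a \<subseteq> \<Union>\<U>" by auto
  define B where "B = {b\<in>L. \<exists>u\<in>\<U>. D b \<subseteq> u}"
  define G where "G = {b\<in>L. \<exists>F. finite F \<and> F \<subseteq> B \<and> D b \<subseteq> \<Union>(D ` F)}"
  have GI: "b \<in> G" if "b \<in> L" "finite F" "F \<subseteq> B" "D b \<subseteq> \<Union>(D ` F)" for b F
    using that unfolding G_def by blast
  have GE: "\<exists>F. finite F \<and> F \<subseteq> B \<and> D b \<subseteq> \<Union>(D ` F)" "b \<in> L" if "b \<in> G" for b
    using that unfolding G_def by auto
  have B: "D a \<subseteq> \<Union>(D ` B)"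
  proof
    fix P assume P: "P \<in> D a"
    then obtain u where u: "u \<in> \<U>" "P \<in> u" using U(2) by auto
    then obtain b where b: "b \<in> L" "b \<in> P" "D b \<subseteq> u" using U(1) openin_ptop_iff by meson
    have "P \<in> D b" using P b(2) unfolding D_def by blast
    moreover have "b \<in> B" using b u unfolding B_def by blast
    ultimately show "P \<in> \<Union>(D ` B)" by blast
  qed
  have "lfilter_base G" unfolding lfilter_base_def
  proof (intro conjI ballI)
    show "G \<subseteq> L" using GE(2) by blast
    show "top \<in> G" using GI[of top "{}"] D_top top_in by auto
    fix x y assume xy: "x \<in> G" "y \<in> G"
    obtain F where F: "finite F" "F \<subseteq> B" "D x \<subseteq> \<Union>(D ` F)" using GE(1)[OF xy(1)] by blast
    obtain F' where F': "finite F'" "F' \<subseteq> B" "D y \<subseteq> \<Union>(D ` F')" using GE(1)[OF xy(2)] by blast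
    show "x \<curlywedge> y \<in> G"
    proof (rule GI)
      show "D (x \<curlywedge> y) \<subseteq> \<Union>(D ` (F \<union> F'))" using D_meet[of x y] GE(2) xy F F' by auto
    qed (use F F' GE(2) xy meet_in in auto)
  qed
  moreover have "{y\<in>L. y \<preceq> a} \<inter> G \<noteq> {}"
  proof
    assume "{y\<in>L. y \<preceq> a} \<inter> G = {}"
    from lprime_exists[OF lideal_down[OF a] calculation this] obtain P
      where P: "lprime P" "{y\<in>L. y \<preceq> a} \<subseteq> P" "P \<inter> G = {}" .
    have "P \<in> D a" unfolding D_def using P a le_refl by auto
    then obtain b where b: "b \<in> B" "P \<in> D b" using B by auto
    have "b \<in> G" by (rule GI[of b "{b}"]) (use b in \<open>auto simp: B_def\<close>)
    thus False using P(3) b(2) unfolding D_def by auto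
  qed
  then obtain y where yG: "y \<in> G" "y \<preceq> a" by auto
  have y1: "y \<in> L" by (rule GE(2)[OF yG(1)])
  obtain F where F: "finite F" "F \<subseteq> B" "D y \<subseteq> \<Union>(D ` F)" using GE(1)[OF yG(1)] by blast
  have "D a \<subseteq> D y" by (rule D_mono[OF a y1 yG(2)])
  hence cov: "D a \<subseteq> \<Union>(D ` F)" using F(3) by blast
  have "\<forall>b\<in>F. \<exists>u. u \<in> \<U> \<and> D b \<subseteq> u" using F(2) unfolding B_def by blast
  then obtain w where w: "\<forall>b\<in>F. w b \<in> \<U> \<and> D b \<subseteq> w b" by metis
  have "finite (w ` F)" "w ` F \<subseteq> \<U>" "D a \<subseteq> \<Union>(w ` F)" using w F(1) cov by blast+
  thus "\<exists>\<F>. finite \<F> \<and> \<F> \<subseteq> \<U> \<and> D a \<subseteq> \<Union>\<F>" by blast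
qed

text \<open>A finite union of basic sets is again basic, so compactness leaves a single element.
  This turns the quotient property into a question about elements of the two lattices.\<close>

lemma qc_open_ptop_iff: "qc_open ptop V \<longleftrightarrow> (\<exists>a\<in>L. V = D a)"
proof
  assume V: "qc_open ptop V"
  let ?U = "{D a | a. a \<in> L \<and> D a \<subseteq> V}"
  have op: "openin ptop V" and co: "compactin ptop V" using V unfolding qc_open_def by auto
  have "V \<subseteq> \<Union>?U" using op unfolding openin_ptop_iff D_def Pr_def by blast
  moreover have "\<forall>u\<in>?U. openin ptop u" using openin_D by blast
  ultimately obtain \<F> where F: "finite \<F>" "\<F> \<subseteq> ?U" "V \<subseteq> \<Union>\<F>"
    using compactinD[OF co] by meson
  have "\<forall>u\<in>\<F>. \<exists>a. a \<in> L \<and> u = D a" using F(2) by blast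
  then obtain w where w: "\<forall>u\<in>\<F>. w u \<in> L \<and> u = D (w u)" by metis
  hence "\<Union>\<F> = \<Union>(D ` (w ` \<F>))" by force
  moreover obtain b where "b \<in> L" "\<Union>(D ` (w ` \<F>)) = D b"
    using D_finite_union[of "w ` \<F>"] w F(1) by blast
  moreover have "V = \<Union>\<F>" using F by blast
  ultimately show "\<exists>a\<in>L. V = D a" by (intro bexI[of _ b]) simp_all
next
  assume "\<exists>a\<in>L. V = D a" thus "qc_open ptop V" unfolding qc_open_def using openin_D compactin_D by blast
qed

lemma closure_of_singleton:
  assumes "lprime P" shows "ptop closure_of {P} = {Q. lprime Q \<and> Q \<subseteq> P}"
proof -
  have "Q \<in> ptop closure_of {P} \<longleftrightarrow> lprime Q \<and> Q \<subseteq> P" for Q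
  proof
    assume Q: "Q \<in> ptop closure_of {P}"
    hence q: "lprime Q" using closure_of_subset_topspace topspace_ptop unfolding Pr_def by fastforce
    have "Q \<subseteq> P"
    proof
      fix a assume a: "a \<in> Q"
      hence "a \<in> L" "Q \<in> D a" using q lprime_sub unfolding D_def by blast+
      hence "P \<in> D a" using Q openin_D unfolding in_closure_of by blast
      thus "a \<in> P" unfolding D_def by blast
    qed
    thus "lprime Q \<and> Q \<subseteq> P" using q by blast
  next
    assume Q: "lprime Q \<and> Q \<subseteq> P"
    have "P \<in> V" if "openin ptop V" "Q \<in> V" for V
      using that Q assms unfolding openin_ptop_iff D_def by blast
    thus "Q \<in> ptop closure_of {P}" unfolding in_closure_of topspace_ptop Pr_def using Q by blast
  qed
  thus ?thesis by blast
qed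

text \<open>Closures run towards smaller primes, so the generic point must be the union of the
  primes in \<open>Z\<close>. Irreducibility makes this union closed under joins:
  \<open>Z - D a\<close> and \<open>Z - D b\<close> are proper closed subsets and cannot cover
  \<open>Z\<close>.\<close>

lemma generic_point:
  assumes Z: "irreducible_closed ptop Z"
  shows "\<exists>P. Z = ptop closure_of {P} \<and> P \<in> topspace ptop"
proof -
  have cl: "closedin ptop Z" and ne: "Z \<noteq> {}"
    and irr: "\<And>A B. closedin ptop A \<Longrightarrow> closedin ptop B \<Longrightarrow> Z = A \<union> B \<Longrightarrow> Z = A \<or> Z = B"
    using Z unfolding irreducible_closed_def by auto
  have pr: "\<And>Q. Q \<in> Z \<Longrightarrow> lprime Q" using closedin_subset[OF cl] unfolding topspace_ptop Pr_def by blast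
  let ?P = "\<Union>Z"
  have j: "a \<curlyvee> b \<in> ?P" if ab: "a \<in> ?P" "b \<in> ?P" for a b
  proof -
    have L: "a \<in> L" "b \<in> L" using ab pr lprime_sub by blast+
    have "closedin ptop (Z - D a)" "closedin ptop (Z - D b)"
      using cl openin_D L by (auto intro: closedin_diff)
    moreover have "Z \<noteq> Z - D a" "Z \<noteq> Z - D b" using ab pr unfolding D_def by blast+
    ultimately have "Z \<noteq> (Z - D a) \<union> (Z - D b)" using irr by blast
    then obtain Q where "Q \<in> Z" "Q \<in> D a" "Q \<in> D b" by blast
    thus ?thesis using lprime_join_iff L unfolding D_def by blast
  qed
  have P: "lprime ?P" unfolding lprime_def lideal_def
  proof (intro conjI ballI impI)
    show "?P \<subseteq> L" using pr lprime_sub by blast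
    show "bot \<in> ?P" using ne pr lprimeD(1) lidealD(2) by blast
    show "top \<notin> ?P" using pr lprimeD(2) by blast
    show "\<And>a b. a \<in> ?P \<Longrightarrow> b \<in> ?P \<Longrightarrow> a \<curlyvee> b \<in> ?P" by (rule j)
    fix a b assume "a \<in> ?P" "b \<in> L" "b \<preceq> a" thus "b \<in> ?P" using pr lprime_mono by blast
  next
    fix a b assume "a \<in> L" "b \<in> L" "a \<curlywedge> b \<in> ?P" thus "a \<in> ?P \<or> b \<in> ?P" using pr lprimeD(3) by blast
  qed
  have "?P \<in> Z"
  proof (rule ccontr)
    assume n: "?P \<notin> Z"
    have "openin ptop (Pr - Z)" using cl topspace_ptop unfolding closedin_def by auto
    then obtain a where a: "a \<in> L" "a \<in> ?P" "D a \<subseteq> Pr - Z"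
      using n P unfolding openin_ptop_iff Pr_def by blast
    thus False using pr unfolding D_def by blast
  qed
  have "Z = ptop closure_of {?P}"
  proof
    show "Z \<subseteq> ptop closure_of {?P}" unfolding closure_of_singleton[OF P] using pr by blast
    show "ptop closure_of {?P} \<subseteq> Z" using \<open>?P \<in> Z\<close> cl by (simp add: closure_of_minimal)
  qed
  thus ?thesis using P topspace_ptop unfolding Pr_def by blast
qed

theorem spectral_space_ptop: "spectral_space ptop"
  unfolding spectral_space_def
proof (intro conjI allI impI)
  show "compact_space ptop" unfolding compact_space_def topspace_ptop D_bot[symmetric]
    by (rule compactin_D[OF bot_in])
  show "t0_space ptop" unfolding t0_space_def
  proof (intro ballI impI)
    fix P Q assume PQ: "P \<in> topspace ptop" "Q \<in> topspace ptop" "P \<noteq> Q"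
    hence pr: "lprime P" "lprime Q" unfolding topspace_ptop Pr_def by auto
    obtain a where a: "a \<in> P \<and> a \<notin> Q \<or> a \<in> Q \<and> a \<notin> P" using PQ(3) by blast
    hence "a \<in> L" using pr lprime_sub by blast
    thus "\<exists>V. openin ptop V \<and> (P \<notin> V) = (Q \<in> V)"
      using openin_D[of a] a pr by (intro exI[of _ "D a"]) (auto simp: D_def)
  qed
next
  fix V W assume "qc_open ptop V \<and> qc_open ptop W"
  then obtain a b where "a \<in> L" "b \<in> L" "V = D a" "W = D b" unfolding qc_open_ptop_iff by auto
  thus "qc_open ptop (V \<inter> W)" unfolding qc_open_ptop_iff using D_join join_in by blast
next
  fix V P assume "openin ptop V \<and> P \<in> V"
  then obtain a where "a \<in> L" "a \<in> P" "D a \<subseteq> V" "lprime P" unfolding openin_ptop_iff Pr_def by blast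
  thus "\<exists>W. qc_open ptop W \<and> P \<in> W \<and> W \<subseteq> V"
    by (intro exI[of _ "D a"]) (auto simp: qc_open_ptop_iff D_def)
next
  fix Z assume "irreducible_closed ptop Z"
  thus "\<exists>x. Z = ptop closure_of {x} \<and> x \<in> topspace ptop" by (rule generic_point)
qed


end


text \<open>The assumption \<open>splitting\<close> expresses that elements of \<open>M\<close> which are complementary in an interval
  between elements of \<open>L\<close> belong to \<open>L\<close> themselves.\<close>

locale distributive_preorder_hom =
  A: distributive_preorder L le join meet bot top +
  B: distributive_preorder M leM joinM meetM botM topM
  for L :: "'a set"
    and le :: "'a \<Rightarrow> 'a \<Rightarrow> bool" (infix "\<preceq>" 50)
    and join :: "'a \<Rightarrow> 'a \<Rightarrow> 'a" (infixl "\<curlyvee>" 65)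
    and meet :: "'a \<Rightarrow> 'a \<Rightarrow> 'a" (infixl "\<curlywedge>" 70)
    and bot :: 'a and top :: 'a
    and M :: "'b set"
    and leM :: "'b \<Rightarrow> 'b \<Rightarrow> bool" (infix "\<lesssim>" 50)
    and joinM :: "'b \<Rightarrow> 'b \<Rightarrow> 'b" (infixl "\<^bold>\<or>" 65)
    and meetM :: "'b \<Rightarrow> 'b \<Rightarrow> 'b" (infixl "\<^bold>\<and>" 70)
    and botM :: 'b and topM :: 'b +
  fixes f :: "'a \<Rightarrow> 'b"
  assumes f_in: "a \<in> L \<Longrightarrow> f a \<in> M"
    and f_le_iff: "\<lbrakk>a \<in> L; b \<in> L\<rbrakk> \<Longrightarrow> f a \<lesssim> f b \<longleftrightarrow> a \<preceq> b"
    and f_join: "\<lbrakk>a \<in> L; b \<in> L\<rbrakk> \<Longrightarrow> f (a \<curlyvee> b) \<lesssim> f a \<^bold>\<or> f b"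
    and f_meet: "\<lbrakk>a \<in> L; b \<in> L\<rbrakk> \<Longrightarrow> f a \<^bold>\<and> f b \<lesssim> f (a \<curlywedge> b)"
    and f_bot: "f bot \<lesssim> botM" and f_top: "topM \<lesssim> f top"
    and splitting: "\<lbrakk>x \<in> L; p \<in> L; s1 \<in> M; s2 \<in> M; f x \<lesssim> (s1 \<^bold>\<or> s2) \<^bold>\<or> f p;
           f x \<^bold>\<and> (s1 \<^bold>\<and> s2) \<lesssim> f p\<rbrakk> \<Longrightarrow>
         \<exists>x1\<in>L. \<exists>x2\<in>L. x1 \<curlywedge> x2 \<preceq> p \<and> f x \<^bold>\<and> s1 \<lesssim> f x1 \<^bold>\<or> f p \<and> f x \<^bold>\<and> s2 \<lesssim> f x2 \<^bold>\<or> f p"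
begin

section \<open>Primes over given primes along a lattice embedding\<close>

definition pre :: "'b set \<Rightarrow> 'a set" where "pre Q = {x \<in> L. f x \<in> Q}"

lemma lprime_pre: assumes Q: "B.lprime Q" shows "A.lprime (pre Q)"
  unfolding A.lprime_def A.lideal_def
proof (intro conjI ballI impI)
  note mono = B.lprime_mono[OF Q]
  show "pre Q \<subseteq> L" unfolding pre_def by blast
  have "botM \<in> Q" by (rule B.lidealD(2)[OF B.lprimeD(1)[OF Q]])
  thus "bot \<in> pre Q" unfolding pre_def using mono f_bot f_in A.bot_in by blast
  show "top \<notin> pre Q" unfolding pre_def using mono f_top B.lprimeD(2)[OF Q] B.top_in by blast
  fix a b assume a: "a \<in> pre Q"
  { assume "b \<in> L" "b \<preceq> a" thus "b \<in> pre Q" using a mono f_in f_le_iff unfolding pre_def by blast }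
  { assume b: "b \<in> pre Q"
    hence "f a \<^bold>\<or> f b \<in> Q" using a f_in B.lprime_join_iff[OF Q] unfolding pre_def by blast
    thus "a \<curlyvee> b \<in> pre Q" using mono[OF _ _ f_join] a b f_in A.join_in unfolding pre_def by blast }
next
  note mono = B.lprime_mono[OF Q]
  fix a b assume ab: "a \<in> L" "b \<in> L" "a \<curlywedge> b \<in> pre Q"
  hence "f a \<^bold>\<and> f b \<in> Q" using mono[OF _ _ f_meet[of a b]] f_in B.meet_in unfolding pre_def by blast
  thus "a \<in> pre Q \<or> b \<in> pre Q" using B.lprimeD(3)[OF Q] ab f_in unfolding pre_def by blast
qed

lemma lideal_image:
  assumes "A.lideal P" shows "B.lideal {m\<in>M. \<exists>p\<in>P. m \<lesssim> f p}"
  unfolding B.lideal_def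
proof (intro conjI ballI impI)
  note PD = A.lidealD[OF assms]
  let ?I = "{m\<in>M. \<exists>p\<in>P. m \<lesssim> f p}"
  show "?I \<subseteq> M" by blast
  show "botM \<in> ?I" using PD(2) B.bot_in B.bot_le f_in A.bot_in by blast
  fix a b assume "a \<in> ?I"
  then obtain p where p: "p \<in> P" "a \<lesssim> f p" "a \<in> M" by blast
  have pL: "p \<in> L" using p PD(5) by blast
  { assume "b \<in> M" "b \<lesssim> a" thus "b \<in> ?I" using p B.le_trans[of b a "f p"] f_in pL by blast }
  { assume "b \<in> ?I"
    then obtain q where q: "q \<in> P" "b \<lesssim> f q" "b \<in> M" by blast
    have qL: "q \<in> L" using q PD(5) by blast
    have "f p \<lesssim> f (p \<curlyvee> q)" "f q \<lesssim> f (p \<curlyvee> q)"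
      using f_le_iff A.join1 A.join2 A.join_in pL qL by auto
    hence "a \<^bold>\<or> b \<lesssim> f (p \<curlyvee> q)"
      using B.join_least B.le_trans[OF p(2)] B.le_trans[OF q(2)] p q pL qL f_in A.join_in by auto
    thus "a \<^bold>\<or> b \<in> ?I" using PD(4)[OF p(1) q(1)] p q B.join_in by blast }
qed

text \<open>Prime separation for the ideal generated by \<open>t\<close> and the image of
  \<open>P'\<close>, against the filter generated by \<open>s\<close> and the image of the
  complement of \<open>P\<close>. A common element would be exactly an inequality excluded by
  \<open>dis\<close>. Surjectivity, connectedness and the chain arguments all draw their primes from
  here.\<close>

lemma lprime_over:
  assumes P': "A.lprime P'" and P: "A.lprime P"
    and t: "t \<in> M" and s: "B.lfilter_base s"
    and dis: "\<And>x p g. \<lbrakk>x \<in> L; x \<notin> P; p \<in> P'; g \<in> s; f x \<^bold>\<and> g \<lesssim> f p \<^bold>\<or> t\<rbrakk> \<Longrightarrow> False"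
  obtains Q where "B.lprime Q" "P' \<subseteq> pre Q" "pre Q \<subseteq> P" "t \<in> Q" "Q \<inter> s = {}"
proof -
  note P'D = A.lidealD[OF A.lprimeD(1)[OF P']]
  have sM: "s \<subseteq> M" "topM \<in> s" "\<And>a b. a \<in> s \<Longrightarrow> b \<in> s \<Longrightarrow> a \<^bold>\<and> b \<in> s"
    using s unfolding B.lfilter_base_def by auto
  define J where "J = {m\<in>M. \<exists>p\<in>P'. m \<lesssim> f p}"
  define I where "I = {y\<in>M. \<exists>p\<in>J. y \<lesssim> p \<^bold>\<or> t}"
  define G where "G = {m\<in>M. \<exists>x\<in>L - P. \<exists>g\<in>s. f x \<^bold>\<and> g \<lesssim> m}"
  have GI: "m \<in> G" if "m \<in> M" "x \<in> L" "x \<notin> P" "g \<in> s" "f x \<^bold>\<and> g \<lesssim> m" for m x g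
    using that unfolding G_def by blast
  have GE: "\<exists>x g. x \<in> L \<and> x \<notin> P \<and> g \<in> s \<and> f x \<^bold>\<and> g \<lesssim> m \<and> m \<in> M" if "m \<in> G" for m
    using that unfolding G_def by blast
  have topP: "top \<in> L - P" using A.lprimeD(2)[OF P] A.top_in by blast
  have I: "B.lideal I" unfolding I_def J_def by (rule B.lideal_principal_join[OF lideal_image[OF A.lprimeD(1)[OF P']] t])
  have G: "B.lfilter_base G" unfolding B.lfilter_base_def
  proof (intro conjI ballI)
    show "G \<subseteq> M" unfolding G_def by blast
    show "topM \<in> G" by (rule GI[of _ top topM]) (use topP sM(2) B.le_top B.meet_in B.top_in f_in in auto)
    fix a b assume "a \<in> G" "b \<in> G"
    then obtain x g y h where a: "a \<in> M" "x \<in> L" "x \<notin> P" "g \<in> s" "f x \<^bold>\<and> g \<lesssim> a"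
      and b: "b \<in> M" "y \<in> L" "y \<notin> P" "h \<in> s" "f y \<^bold>\<and> h \<lesssim> b"
      using GE by metis
    \<comment> \<open>Primality of \<open>P\<close> closes its complement under meets.\<close>
    have xy: "x \<curlywedge> y \<in> L - P" using A.lprimeD(3)[OF P] A.meet_in a b by blast
    have M: "f x \<in> M" "f y \<in> M" "g \<in> M" "h \<in> M" "f (x \<curlywedge> y) \<in> M" using a b f_in sM(1) A.meet_in by auto
    have "f (x \<curlywedge> y) \<lesssim> f x" "f (x \<curlywedge> y) \<lesssim> f y" using f_le_iff A.meet1 A.meet2 A.meet_in a b by auto
    hence "f (x \<curlywedge> y) \<^bold>\<and> (g \<^bold>\<and> h) \<lesssim> f x \<^bold>\<and> g" "f (x \<curlywedge> y) \<^bold>\<and> (g \<^bold>\<and> h) \<lesssim> f y \<^bold>\<and> h"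
      using B.meet_mono B.meet1 B.meet2 M B.meet_in by auto
    hence "f (x \<curlywedge> y) \<^bold>\<and> (g \<^bold>\<and> h) \<lesssim> a" "f (x \<curlywedge> y) \<^bold>\<and> (g \<^bold>\<and> h) \<lesssim> b"
      using B.le_trans[OF _ a(5)] B.le_trans[OF _ b(5)] M a b B.meet_in by auto
    hence "f (x \<curlywedge> y) \<^bold>\<and> (g \<^bold>\<and> h) \<lesssim> a \<^bold>\<and> b"
      using B.meet_greatest M a b B.meet_in by auto
    thus "a \<^bold>\<and> b \<in> G" using xy sM(3)[OF a(4) b(4)] B.meet_in a(1) b(1) by (intro GI) auto
  qed
  have "I \<inter> G = {}"
  proof (rule ccontr)
    assume "I \<inter> G \<noteq> {}"
    then obtain y where "y \<in> I" "y \<in> G" by blast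
    then obtain m p x g where y: "y \<in> M" "m \<in> M" "p \<in> P'" "m \<lesssim> f p" "y \<lesssim> m \<^bold>\<or> t" "x \<in> L" "x \<notin> P" "g \<in> s"
      "f x \<^bold>\<and> g \<lesssim> y" using GE unfolding I_def J_def by (smt (verit, best) mem_Collect_eq)
    have M: "f x \<in> M" "f p \<in> M" "g \<in> M" using y f_in P'D(5) sM(1) by auto
    have "m \<^bold>\<or> t \<lesssim> f p \<^bold>\<or> t" using B.join_mono y M t B.le_refl by auto
    hence "f x \<^bold>\<and> g \<lesssim> f p \<^bold>\<or> t"
      using B.le_trans[OF B.le_trans[OF y(9) y(5)]] M t y B.meet_in B.join_in by auto
    thus False using dis y by blast
  qed
  then obtain Q where Q: "B.lprime Q" "I \<subseteq> Q" "Q \<inter> G = {}" using B.lprime_exists[OF I G] by blast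
  show thesis
  proof (rule that[OF Q(1)])
    have le: "m \<in> I" if "m \<in> M" "p \<in> P'" "m \<lesssim> f p" for m p
    proof -
      have "m \<in> J" using that unfolding J_def by blast
      moreover have "m \<lesssim> m \<^bold>\<or> t" using that(1) t B.join1 by blast
      ultimately show ?thesis using that(1) unfolding I_def by blast
    qed
    show "P' \<subseteq> pre Q"
    proof
      fix p assume p: "p \<in> P'"
      hence "f p \<in> I" using le[of "f p" p] B.le_refl f_in P'D(5) by blast
      thus "p \<in> pre Q" using Q(2) P'D(5) p unfolding pre_def by blast
    qed
    show "pre Q \<subseteq> P"
    proof
      fix x assume x: "x \<in> pre Q"
      show "x \<in> P"
      proof (rule ccontr)
        assume n: "x \<notin> P"
        have xL: "x \<in> L" "f x \<in> M" using x f_in unfolding pre_def by auto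
        hence "f x \<in> G" using n sM(2) B.meet1 B.top_in by (intro GI[of _ x topM]) auto
        thus False using Q(3) x unfolding pre_def by blast
      qed
    qed
    \<comment> \<open>The element \<open>bot\<close> of \<open>P'\<close> is the witness that puts
      \<open>t\<close> into \<open>I\<close>.\<close>
    have "t \<lesssim> f bot \<^bold>\<or> t" "f bot \<in> M" using B.join2 f_in A.bot_in t by auto
    moreover have "f bot \<in> J" using P'D(2) B.le_refl f_in A.bot_in unfolding J_def by blast
    ultimately have "t \<in> I" using t unfolding I_def by blast
    thus "t \<in> Q" using Q(2) by blast
    have "g \<in> G" if "g \<in> s" for g
      by (rule GI[of _ top g]) (use topP that sM(1) B.meet2 f_in in auto)
    thus "Q \<inter> s = {}" using Q(3) by blast
  qed
qed

end

section \<open>Chains of primes, separation by closed sets, Zorn's lemma\<close>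

context distributive_preorder begin

text \<open>For \<open>m = top\<close> this filter imposes no condition on a prime; in this way
  \<open>lprime_over\<close> is applied when there are no elements to avoid.\<close>

lemma lfilter_up: "m \<in> L \<Longrightarrow> lfilter_base {g\<in>L. m \<preceq> g}"
  unfolding lfilter_base_def using le_top top_in meet_in meet_greatest by auto

text \<open>If \<open>a\<close> and \<open>b\<close> are both outside the intersection, each is
  missing from some member of the chain; the smaller of the two members misses both, contrary to its
  primality.\<close>

lemma lprime_Inter_chain:
  assumes ne: "\<C> \<noteq> {}" and pr: "\<And>R. R \<in> \<C> \<Longrightarrow> lprime R"
    and ch: "\<And>R R'. \<lbrakk>R \<in> \<C>; R' \<in> \<C>\<rbrakk> \<Longrightarrow> R \<subseteq> R' \<or> R' \<subseteq> R"
  shows "lprime (\<Inter>\<C>)"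
  unfolding lprime_def lideal_def
proof (intro conjI ballI impI)
  show "\<Inter>\<C> \<subseteq> L" using ne lprime_sub[OF pr] by blast
  show "bot \<in> \<Inter>\<C>" using lidealD(2)[OF lprimeD(1)[OF pr]] by blast
  show "top \<notin> \<Inter>\<C>" using ne lprimeD(2)[OF pr] by blast
  fix a b assume a: "a \<in> \<Inter>\<C>"
  { assume "b \<in> L" "b \<preceq> a" thus "b \<in> \<Inter>\<C>" using a lprime_mono[OF pr] by blast }
  { assume "b \<in> \<Inter>\<C>" thus "a \<curlyvee> b \<in> \<Inter>\<C>" using a lidealD(4)[OF lprimeD(1)[OF pr]] by blast }
next
  fix a b assume ab: "a \<in> L" "b \<in> L" "a \<curlywedge> b \<in> \<Inter>\<C>"
  show "a \<in> \<Inter>\<C> \<or> b \<in> \<Inter>\<C>"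
  proof (rule ccontr)
    assume "\<not> ?thesis"
    then obtain R R' where R: "R \<in> \<C>" "R' \<in> \<C>" "a \<notin> R" "b \<notin> R'" by blast
    from ch[OF R(1,2)] show False
      using lprimeD(3)[OF pr[OF R(1)] ab(1,2)] lprimeD(3)[OF pr[OF R(2)] ab(1,2)] ab(3) R by blast
  qed
qed

lemma lprime_Union_chain:
  assumes ne: "\<C> \<noteq> {}" and pr: "\<And>R. R \<in> \<C> \<Longrightarrow> lprime R"
    and ch: "\<And>R R'. \<lbrakk>R \<in> \<C>; R' \<in> \<C>\<rbrakk> \<Longrightarrow> R \<subseteq> R' \<or> R' \<subseteq> R"
  shows "lprime (\<Union>\<C>)"
  unfolding lprime_def lideal_def
proof (intro conjI ballI impI)
  show "\<Union>\<C> \<subseteq> L" using lprime_sub[OF pr] by blast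
  show "bot \<in> \<Union>\<C>" using ne lidealD(2)[OF lprimeD(1)[OF pr]] by blast
  show "top \<notin> \<Union>\<C>" using lprimeD(2)[OF pr] by blast
  fix a b assume a: "a \<in> \<Union>\<C>"
  { assume "b \<in> L" "b \<preceq> a" thus "b \<in> \<Union>\<C>" using a lprime_mono[OF pr] by blast }
  { assume b: "b \<in> \<Union>\<C>"
    obtain R R' where R: "R \<in> \<C>" "a \<in> R" "R' \<in> \<C>" "b \<in> R'" using a b by blast
    from ch[OF R(1,3)] show "a \<curlyvee> b \<in> \<Union>\<C>"
      using lidealD(4)[OF lprimeD(1)[OF pr[OF R(1)]]] lidealD(4)[OF lprimeD(1)[OF pr[OF R(3)]]] R by blast }
next
  fix a b assume "a \<in> L" "b \<in> L" "a \<curlywedge> b \<in> \<Union>\<C>"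
  thus "a \<in> \<Union>\<C> \<or> b \<in> \<Union>\<C>" using lprimeD(3)[OF pr] by blast
qed

lemma closedin_separate:
  assumes "closedin ptop C" "lprime Q" "Q \<notin> C"
  obtains s where "s \<in> L" "s \<in> Q" "\<And>R. R \<in> C \<Longrightarrow> s \<notin> R"
proof -
  have "openin ptop (Pr - C)" using assms(1) topspace_ptop unfolding closedin_def by auto
  then obtain a where a: "a \<in> L" "a \<in> Q" "D a \<subseteq> Pr - C"
    using assms unfolding openin_ptop_iff Pr_def by blast
  have "a \<notin> R" if R: "R \<in> C" for R
  proof
    assume "a \<in> R"
    moreover have "lprime R" using closedin_subset[OF assms(1)] R unfolding topspace_ptop Pr_def by blast
    ultimately show False using a(3) R unfolding D_def by blast
  qed
  thus thesis using that a by blast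
qed

lemma closedin_supp: assumes "a \<in> L" shows "closedin ptop {Q. lprime Q \<and> a \<notin> Q}"
proof -
  have "{Q. lprime Q \<and> a \<notin> Q} = topspace ptop - D a" unfolding topspace_ptop Pr_def D_def by blast
  thus ?thesis using openin_D[OF assms] by auto
qed

end

text \<open>Passing to complements turns intersections of chains into unions and minimal members
  into maximal ones.\<close>

lemma Zorn_minimal:
  assumes ne: "\<A> \<noteq> {}"
    and ch: "\<And>\<C>. \<lbrakk>\<C> \<noteq> {}; \<C> \<subseteq> \<A>; \<And>R R'. \<lbrakk>R \<in> \<C>; R' \<in> \<C>\<rbrakk> \<Longrightarrow> R \<subseteq> R' \<or> R' \<subseteq> R\<rbrakk> \<Longrightarrow> \<Inter>\<C> \<in> \<A>"
  obtains M where "M \<in> \<A>" "\<And>X. \<lbrakk>X \<in> \<A>; X \<subseteq> M\<rbrakk> \<Longrightarrow> X = M"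
proof -
  have "\<exists>N\<in>uminus ` \<A>. \<forall>X\<in>uminus ` \<A>. N \<subseteq> X \<longrightarrow> X = N"
  proof (rule subset_Zorn_nonempty)
    show "uminus ` \<A> \<noteq> {}" using ne by blast
    fix \<D> assume D: "\<D> \<noteq> {}" "subset.chain (uminus ` \<A>) \<D>"
    have D': "\<D> \<subseteq> uminus ` \<A>" "\<And>R R'. \<lbrakk>R \<in> \<D>; R' \<in> \<D>\<rbrakk> \<Longrightarrow> R \<subseteq> R' \<or> R' \<subseteq> R"
      using D(2) unfolding subset.chain_def by blast+
    have "\<Inter>(uminus ` \<D>) \<in> \<A>"
    proof (rule ch)
      show "uminus ` \<D> \<noteq> {}" using D(1) by blast
      show "uminus ` \<D> \<subseteq> \<A>" using D'(1) by fastforce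
      fix R R' assume "R \<in> uminus ` \<D>" "R' \<in> uminus ` \<D>"
      thus "R \<subseteq> R' \<or> R' \<subseteq> R" using D'(2) by fastforce
    qed
    moreover have "\<Union>\<D> = - \<Inter>(uminus ` \<D>)" by auto
    ultimately show "\<Union>\<D> \<in> uminus ` \<A>" by blast
  qed
  then obtain N where N: "N \<in> uminus ` \<A>" "\<forall>X\<in>uminus ` \<A>. N \<subseteq> X \<longrightarrow> X = N" by (rule bexE)
  obtain M where M: "M \<in> \<A>" "N = - M" using N(1) by (rule imageE)
  show thesis
  proof (rule that[OF M(1)])
    fix X assume X: "X \<in> \<A>" "X \<subseteq> M"
    hence "- X = N" using N(2) M(2) by auto
    thus "X = M" using M(2) by auto
  qed
qed

lemma Zorn_maximal:
  assumes ne: "\<A> \<noteq> {}"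
    and ch: "\<And>\<C>. \<lbrakk>\<C> \<noteq> {}; \<C> \<subseteq> \<A>; \<And>R R'. \<lbrakk>R \<in> \<C>; R' \<in> \<C>\<rbrakk> \<Longrightarrow> R \<subseteq> R' \<or> R' \<subseteq> R\<rbrakk> \<Longrightarrow> \<Union>\<C> \<in> \<A>"
  obtains M where "M \<in> \<A>" "\<And>X. \<lbrakk>X \<in> \<A>; M \<subseteq> X\<rbrakk> \<Longrightarrow> X = M"
proof -
  have "\<exists>N\<in>\<A>. \<forall>X\<in>\<A>. N \<subseteq> X \<longrightarrow> X = N"
  proof (rule subset_Zorn_nonempty[OF ne])
    fix \<D> assume D: "\<D> \<noteq> {}" "subset.chain \<A> \<D>"
    show "\<Union>\<D> \<in> \<A>" by (rule ch[OF D(1)]) (use D(2) in \<open>unfold subset.chain_def, blast+\<close>)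
  qed
  then obtain N where N: "N \<in> \<A>" "\<forall>X\<in>\<A>. N \<subseteq> X \<longrightarrow> X = N" by (rule bexE)
  show thesis by (rule that[OF N(1)]) (use N(2) in auto)
qed

section \<open>Connected preimages of intervals and the quotient property\<close>

context distributive_preorder_hom begin

text \<open>Both ends of the interval are taken to be \<open>P\<close>. The excluded inequality
  reduces to \<open>f x\<close> below \<open>f p\<close>, hence \<open>x\<close> below
  \<open>p\<close> as \<open>f\<close> reflects the order, and then \<open>x\<close> would lie in
  \<open>P\<close>.\<close>

lemma lprime_over_exists:
  assumes P: "A.lprime P" obtains Q where "B.lprime Q" "pre Q = P"
proof -
  obtain Q where "B.lprime Q" "P \<subseteq> pre Q" "pre Q \<subseteq> P"
  proof (rule lprime_over[OF P P B.bot_in B.lfilter_up[OF B.top_in]])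
    fix x p g assume h: "x \<in> L" "x \<notin> P" "p \<in> P" "g \<in> {g\<in>M. topM \<lesssim> g}" "f x \<^bold>\<and> g \<lesssim> f p \<^bold>\<or> botM"
    have p: "p \<in> L" using h(3) A.lprime_sub[OF P] by blast
    have 1: "f x \<lesssim> f x \<^bold>\<and> g"
      using h B.meet_greatest[OF B.le_refl B.le_trans[OF B.le_top]] f_in B.top_in by auto
    have 2: "f p \<^bold>\<or> botM \<lesssim> f p" using B.join_least[OF B.le_refl B.bot_le] f_in p B.bot_in by auto
    have "f x \<lesssim> f p"
      using B.le_trans[OF 1 B.le_trans[OF h(5) 2]] f_in p h(1,4) B.meet_in B.join_in B.bot_in by auto
    hence "x \<preceq> p" using f_le_iff h(1) p by blast
    thus False using A.lprime_mono[OF P h(3) h(1)] h(2) by blast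
  qed blast
  thus thesis using that by blast
qed

definition over :: "'a set \<Rightarrow> 'a set \<Rightarrow> 'b set set" where
  "over P' P = {Q. B.lprime Q \<and> P' \<subseteq> pre Q \<and> pre Q \<subseteq> P}"

text \<open>Closed sets are intersections of supports, so two compactness arguments replace
  \<open>C1\<close> and \<open>C2\<close> by single elements \<open>s1\<close> and
  \<open>s2\<close>, complementary in \<open>f z\<close> modulo \<open>f r\<close> for some
  \<open>z\<close> outside \<open>P\<close> and \<open>r\<close> in \<open>P'\<close>. Then
  \<open>splitting\<close> brings the two pieces down to \<open>x1\<close> and \<open>x2\<close>,
  and primality of \<open>P'\<close> forces one of them into \<open>P'\<close>.\<close>

theorem over_connected:
  assumes P': "A.lprime P'" and P: "A.lprime P"
    and C: "closedin B.ptop C1" "closedin B.ptop C2"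
    and cov: "over P' P \<subseteq> C1 \<union> C2" and dis: "C1 \<inter> C2 \<inter> over P' P = {}"
  shows "C1 \<inter> over P' P = {} \<or> C2 \<inter> over P' P = {}"
proof -
  have Cpr: "B.lprime Q" if "Q \<in> C1 \<union> C2" for Q
    using that C[THEN closedin_subset] unfolding B.topspace_ptop B.Pr_def by blast
  \<comment> \<open>The supports of the elements of \<open>S C\<close> are the basic closed sets
    that contain \<open>C\<close>.\<close>
  define S where "S C = {s\<in>M. \<forall>Q\<in>C. s \<notin> Q}" for C :: "'b set set"
  have topS: "topM \<in> S C1" "topM \<in> S C2"
    unfolding S_def using B.top_in Cpr B.lprimeD(2) by blast+
  have Smeet: "a \<^bold>\<and> b \<in> S C" if ab: "a \<in> S C" "b \<in> S C" "C \<subseteq> C1 \<union> C2" for a b C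
  proof -
    have M: "a \<in> M" "b \<in> M" using ab unfolding S_def by auto
    have "a \<^bold>\<and> b \<notin> Q" if "Q \<in> C" for Q
      using that ab B.lprime_meet_iff[OF Cpr M, of Q] unfolding S_def by auto
    thus ?thesis using B.meet_in[OF M] unfolding S_def by auto
  qed
  have SM: "S C \<subseteq> M" for C unfolding S_def by blast
  define G where "G = {g\<in>M. \<exists>s1\<in>S C1. \<exists>s2\<in>S C2. s1 \<^bold>\<and> s2 \<lesssim> g}"
  have GI: "g \<in> G" if "g \<in> M" "s1 \<in> S C1" "s2 \<in> S C2" "s1 \<^bold>\<and> s2 \<lesssim> g" for g s1 s2
    using that unfolding G_def by blast
  have G: "B.lfilter_base G" unfolding B.lfilter_base_def
  proof (intro conjI ballI)
    show "G \<subseteq> M" unfolding G_def by blast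
    show "topM \<in> G" by (rule GI[OF B.top_in topS B.le_top]) (use B.top_in B.meet_in in auto)
    fix a b assume "a \<in> G" "b \<in> G"
    then obtain s1 s2 r1 r2 where s: "a \<in> M" "s1 \<in> S C1" "s2 \<in> S C2" "s1 \<^bold>\<and> s2 \<lesssim> a"
      and r: "b \<in> M" "r1 \<in> S C1" "r2 \<in> S C2" "r1 \<^bold>\<and> r2 \<lesssim> b" unfolding G_def by blast
    have M: "s1 \<in> M" "s2 \<in> M" "r1 \<in> M" "r2 \<in> M" using s r SM by auto
    let ?u = "(s1 \<^bold>\<and> r1) \<^bold>\<and> (s2 \<^bold>\<and> r2)"
    have u: "?u \<in> M" using M B.meet_in by auto
    have "?u \<lesssim> s1 \<^bold>\<and> s2" "?u \<lesssim> r1 \<^bold>\<and> r2"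
      using B.meet_mono B.meet1 B.meet2 B.meet_in M by auto
    hence "?u \<lesssim> a" "?u \<lesssim> b"
      using B.le_trans[OF _ s(4)] B.le_trans[OF _ r(4)] u M s r B.meet_in by auto
    hence "?u \<lesssim> a \<^bold>\<and> b" using B.meet_greatest s r u by auto
    thus "a \<^bold>\<and> b \<in> G" using GI B.meet_in s(1) r(1) Smeet[OF s(2) r(2)] Smeet[OF s(3) r(3)] by blast
  qed
  \<comment> \<open>Disjointness, made finite: a prime over the interval that avoids
    \<open>G\<close> would lie in both closed sets.\<close>
  have "\<exists>x p s1 s2. x \<in> L \<and> x \<notin> P \<and> p \<in> P' \<and> s1 \<in> S C1 \<and> s2 \<in> S C2 \<and> f x \<^bold>\<and> (s1 \<^bold>\<and> s2) \<lesssim> f p"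
  proof (rule ccontr)
    assume no: "\<not> ?thesis"
    obtain Q where Q: "B.lprime Q" "P' \<subseteq> pre Q" "pre Q \<subseteq> P" "botM \<in> Q" "Q \<inter> G = {}"
    proof (rule lprime_over[OF P' P B.bot_in G])
      fix x p g assume h: "x \<in> L" "x \<notin> P" "p \<in> P'" "g \<in> G" "f x \<^bold>\<and> g \<lesssim> f p \<^bold>\<or> botM"
      then obtain s1 s2 where s: "s1 \<in> S C1" "s2 \<in> S C2" "s1 \<^bold>\<and> s2 \<lesssim> g" "g \<in> M" unfolding G_def by blast
      have M: "f x \<in> M" "f p \<in> M" "s1 \<in> M" "s2 \<in> M" "s1 \<^bold>\<and> s2 \<in> M"
        using f_in h A.lprime_sub[OF P'] subsetD[OF SM s(1)] subsetD[OF SM s(2)] B.meet_in by auto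
      have 1: "f x \<^bold>\<and> (s1 \<^bold>\<and> s2) \<lesssim> f x \<^bold>\<and> g" using B.meet_mono[OF B.le_refl s(3)] M s by auto
      have 2: "f p \<^bold>\<or> botM \<lesssim> f p" using B.join_least[OF B.le_refl B.bot_le] M B.bot_in by auto
      have "f x \<^bold>\<and> (s1 \<^bold>\<and> s2) \<lesssim> f p"
        using B.le_trans[OF 1 B.le_trans[OF h(5) 2]] M s B.meet_in B.join_in B.bot_in by auto
      thus False using no h s by blast
    qed
    have sG: "s \<in> G" if "s \<in> S C1 \<or> s \<in> S C2" for s
      using that GI[of s s topM] GI[of s topM s] topS B.meet1 B.meet2 SM B.top_in by blast
    have "Q \<in> over P' P" unfolding over_def using Q by blast
    moreover have "Q \<in> C1"
    proof (rule ccontr)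
      assume "Q \<notin> C1"
      then obtain s where "s \<in> M" "s \<in> Q" "\<And>R. R \<in> C1 \<Longrightarrow> s \<notin> R"
        using B.closedin_separate[OF C(1) Q(1)] by blast
      thus False using sG[of s] Q(5) unfolding S_def by blast
    qed
    moreover have "Q \<in> C2"
    proof (rule ccontr)
      assume "Q \<notin> C2"
      then obtain s where "s \<in> M" "s \<in> Q" "\<And>R. R \<in> C2 \<Longrightarrow> s \<notin> R"
        using B.closedin_separate[OF C(2) Q(1)] by blast
      thus False using sG[of s] Q(5) unfolding S_def by blast
    qed
    ultimately show False using dis by blast
  qed
  then obtain x p s1 s2 where x: "x \<in> L" "x \<notin> P" "p \<in> P'" and s: "s1 \<in> S C1" "s2 \<in> S C2"
    and xle: "f x \<^bold>\<and> (s1 \<^bold>\<and> s2) \<lesssim> f p" by blast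
  have sM: "s1 \<in> M" "s2 \<in> M" using s SM by auto
  \<comment> \<open>Covering, made finite: a prime over the interval that contains \<open>s1\<close>
    and \<open>s2\<close> would lie in neither closed set.\<close>
  have "\<exists>y q. y \<in> L \<and> y \<notin> P \<and> q \<in> P' \<and> f y \<lesssim> f q \<^bold>\<or> (s1 \<^bold>\<or> s2)"
  proof (rule ccontr)
    assume no: "\<not> ?thesis"
    obtain Q where Q: "B.lprime Q" "P' \<subseteq> pre Q" "pre Q \<subseteq> P" "s1 \<^bold>\<or> s2 \<in> Q"
    proof (rule lprime_over[OF P' P B.join_in[OF sM] B.lfilter_up[OF B.top_in]])
      fix x p g assume h: "x \<in> L" "x \<notin> P" "p \<in> P'" "g \<in> {g\<in>M. topM \<lesssim> g}" "f x \<^bold>\<and> g \<lesssim> f p \<^bold>\<or> (s1 \<^bold>\<or> s2)"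
      have p: "p \<in> L" using h(3) A.lprime_sub[OF P'] by blast
      have 1: "f x \<lesssim> f x \<^bold>\<and> g"
        using h B.meet_greatest[OF B.le_refl B.le_trans[OF B.le_top]] f_in B.top_in by auto
      have "f x \<lesssim> f p \<^bold>\<or> (s1 \<^bold>\<or> s2)"
        using B.le_trans[OF 1 h(5)] f_in p h(1,4) B.meet_in B.join_in sM by auto
      thus False using no h by blast
    qed blast
    have "s1 \<in> Q" "s2 \<in> Q" using B.lprime_join_iff[OF Q(1) sM] Q(4) by auto
    hence "Q \<notin> C1" "Q \<notin> C2" using s unfolding S_def by auto
    thus False using cov Q unfolding over_def by blast
  qed
  then obtain y q where y: "y \<in> L" "y \<notin> P" "q \<in> P'" and yle: "f y \<lesssim> f q \<^bold>\<or> (s1 \<^bold>\<or> s2)" by blast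
  \<comment> \<open>Common choices, for which both inequalities hold at once: the meet
    \<open>z\<close> stays outside \<open>P\<close> and the join \<open>r\<close> stays in
    \<open>P'\<close>.\<close>
  define z where "z = x \<curlywedge> y"
  define r where "r = p \<curlyvee> q"
  have pq: "p \<in> L" "q \<in> L" using x y A.lprime_sub[OF P'] by auto
  have z: "z \<in> L" "z \<notin> P" unfolding z_def using A.lprimeD(3)[OF P x(1) y(1)] x y A.meet_in by auto
  have r: "r \<in> L" "r \<in> P'" unfolding r_def using A.lprime_join_iff[OF P' pq] x y A.join_in pq by auto
  note MM = f_in[OF x(1)] f_in[OF y(1)] f_in[OF z(1)] f_in[OF r(1)] f_in[OF pq(1)] f_in[OF pq(2)] sM
    B.meet_in[OF sM] B.join_in[OF sM]
  have zx: "f z \<lesssim> f x" "f z \<lesssim> f y" unfolding z_def using f_le_iff A.meet1 A.meet2 A.meet_in x y by auto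
  have pr: "f p \<lesssim> f r" "f q \<lesssim> f r" unfolding r_def using f_le_iff A.join1 A.join2 A.join_in pq by auto
  have fr: "f r \<lesssim> (s1 \<^bold>\<or> s2) \<^bold>\<or> f r" "s1 \<^bold>\<or> s2 \<lesssim> (s1 \<^bold>\<or> s2) \<^bold>\<or> f r" using B.join1 B.join2 MM by auto
  have in2: "(s1 \<^bold>\<or> s2) \<^bold>\<or> f r \<in> M" "f q \<^bold>\<or> (s1 \<^bold>\<or> s2) \<in> M" using B.join_in MM by auto
  have "f q \<^bold>\<or> (s1 \<^bold>\<or> s2) \<lesssim> (s1 \<^bold>\<or> s2) \<^bold>\<or> f r"
    by (rule B.join_least[OF B.le_trans[OF pr(2) fr(1)] fr(2)]) (use MM in2 in auto)
  hence zle: "f z \<lesssim> (s1 \<^bold>\<or> s2) \<^bold>\<or> f r"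
    using B.le_trans[OF B.le_trans[OF zx(2) yle]] MM in2 by auto
  have "f z \<^bold>\<and> (s1 \<^bold>\<and> s2) \<lesssim> f x \<^bold>\<and> (s1 \<^bold>\<and> s2)" using B.meet_mono[OF zx(1) B.le_refl] MM by auto
  hence zle2: "f z \<^bold>\<and> (s1 \<^bold>\<and> s2) \<lesssim> f r"
    using B.le_trans[OF _ B.le_trans[OF xle pr(1)]] MM B.meet_in by auto
  obtain x1 x2 where x12: "x1 \<in> L" "x2 \<in> L" "x1 \<curlywedge> x2 \<preceq> r" "f z \<^bold>\<and> s1 \<lesssim> f x1 \<^bold>\<or> f r" "f z \<^bold>\<and> s2 \<lesssim> f x2 \<^bold>\<or> f r"
    using splitting[OF z(1) r(1) sM zle zle2] by blast
  have key: "C \<inter> over P' P = {}" if h: "w \<in> P'" "s \<in> S C" "f z \<^bold>\<and> s \<lesssim> f w \<^bold>\<or> f r" "s \<in> M" for w s C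
  proof -
    have False if Q: "Q \<in> C" "Q \<in> over P' P" for Q
    proof -
      have Qp: "B.lprime Q" "P' \<subseteq> pre Q" "pre Q \<subseteq> P" using Q unfolding over_def by auto
      have "f w \<in> Q" "f r \<in> Q" using Qp(2) h(1) r(2) unfolding pre_def by auto
      moreover have wM: "f w \<in> M" using f_in h(1) A.lprime_sub[OF P'] by blast
      ultimately have "f w \<^bold>\<or> f r \<in> Q" using B.lprime_join_iff[OF Qp(1)] MM by blast
      hence "f z \<^bold>\<and> s \<in> Q" using B.lprime_mono[OF Qp(1)] h(3,4) MM B.meet_in by blast
      hence "f z \<in> Q \<or> s \<in> Q" using B.lprime_meet_iff[OF Qp(1)] MM h(4) by blast
      moreover have "f z \<notin> Q" using Qp(3) z unfolding pre_def by blast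
      moreover have "s \<notin> Q" using h(2) Q(1) unfolding S_def by blast
      ultimately show False by blast
    qed
    thus ?thesis by blast
  qed
  \<comment> \<open>If \<open>x1\<close> or \<open>x2\<close> lies in \<open>P'\<close>, the
    corresponding closed set has no prime over the interval, since such primes do not contain
    \<open>f z\<close>.\<close>
  have "x1 \<curlywedge> x2 \<in> P'" using A.lprime_mono[OF P' r(2) _ x12(3)] A.meet_in x12 by blast
  hence "x1 \<in> P' \<or> x2 \<in> P'" using A.lprimeD(3)[OF P' x12(1,2)] by blast
  thus ?thesis using key[OF _ s(1) x12(4) sM(1)] key[OF _ s(2) x12(5) sM(2)] by blast
qed

text \<open>The chain conditions for Zorn's lemma on the two sides of \<open>V\<close>. Membership
  in \<open>V\<close> is tested upstairs by the single element \<open>m\<close>, so a failure at the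
  limit is an inequality with one \<open>x\<close> and one \<open>p\<close>; it already occurs over
  one member of the chain.\<close>

lemma lprime_chain_pre:
  assumes sat: "\<And>Q. B.lprime Q \<Longrightarrow> m \<in> Q \<longleftrightarrow> pre Q \<in> V" and m: "m \<in> M"
    and ne: "\<C> \<noteq> {}" and pr: "\<And>R. R \<in> \<C> \<Longrightarrow> A.lprime R"
    and ch: "\<And>R R'. \<lbrakk>R \<in> \<C>; R' \<in> \<C>\<rbrakk> \<Longrightarrow> R \<subseteq> R' \<or> R' \<subseteq> R"
  shows "\<C> \<inter> V = {} \<Longrightarrow> \<Inter>\<C> \<notin> V" and "\<C> \<subseteq> V \<Longrightarrow> \<Union>\<C> \<in> V"
proof -
  assume V: "\<C> \<inter> V = {}"
  have I: "A.lprime (\<Inter>\<C>)" by (rule A.lprime_Inter_chain[OF ne pr ch])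
  obtain Q where Q: "B.lprime Q" "\<Inter>\<C> \<subseteq> pre Q" "pre Q \<subseteq> \<Inter>\<C>" "botM \<in> Q" "Q \<inter> {g\<in>M. m \<lesssim> g} = {}"
  proof (rule lprime_over[OF I I B.bot_in B.lfilter_up[OF m]])
    fix x p g assume h: "x \<in> L" "x \<notin> \<Inter>\<C>" "p \<in> \<Inter>\<C>" "g \<in> {g\<in>M. m \<lesssim> g}" "f x \<^bold>\<and> g \<lesssim> f p \<^bold>\<or> botM"
    obtain R where R: "R \<in> \<C>" "x \<notin> R" using h(2) by blast
    obtain Q where Q: "B.lprime Q" "pre Q = R" using lprime_over_exists[OF pr[OF R(1)]] by blast
    have M: "f x \<in> M" "f p \<in> M" "g \<in> M" using f_in h A.lprime_sub[OF I] by auto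
    have "f p \<in> Q" using h(3) R(1) Q(2) unfolding pre_def by blast
    hence "f p \<^bold>\<or> botM \<in> Q" using B.lprime_join_iff[OF Q(1) M(2) B.bot_in] B.lidealD(2)[OF B.lprimeD(1)[OF Q(1)]]
      by blast
    hence "f x \<^bold>\<and> g \<in> Q" using B.lprime_mono[OF Q(1) _ _ h(5)] M B.meet_in by blast
    hence "f x \<in> Q \<or> g \<in> Q" using B.lprime_meet_iff[OF Q(1) M(1,3)] by blast
    moreover have "f x \<notin> Q" using h(1) R(2) Q(2) unfolding pre_def by blast
    ultimately have "m \<in> Q" using B.lprime_mono[OF Q(1) _ m] h(4) by blast
    hence "R \<in> V" using sat[OF Q(1)] Q(2) by blast
    thus False using V R(1) by blast
  qed
  have "m \<notin> Q" using Q(5) m B.le_refl by blast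
  moreover have "pre Q = \<Inter>\<C>" using Q(2,3) by (intro subset_antisym)
  ultimately show "\<Inter>\<C> \<notin> V" using sat[OF Q(1)] by simp
next
  assume V: "\<C> \<subseteq> V"
  have I: "A.lprime (\<Union>\<C>)" by (rule A.lprime_Union_chain[OF ne pr ch])
  obtain Q where Q: "B.lprime Q" "\<Union>\<C> \<subseteq> pre Q" "pre Q \<subseteq> \<Union>\<C>" "m \<in> Q"
  proof (rule lprime_over[OF I I m B.lfilter_up[OF B.top_in]])
    fix x p g assume h: "x \<in> L" "x \<notin> \<Union>\<C>" "p \<in> \<Union>\<C>" "g \<in> {g\<in>M. topM \<lesssim> g}" "f x \<^bold>\<and> g \<lesssim> f p \<^bold>\<or> m"
    obtain R where R: "R \<in> \<C>" "p \<in> R" using h(3) by blast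
    obtain Q where Q: "B.lprime Q" "pre Q = R" using lprime_over_exists[OF pr[OF R(1)]] by blast
    have M: "f x \<in> M" "f p \<in> M" "g \<in> M" using f_in h A.lprime_sub[OF I] by auto
    have "f p \<in> Q" using R Q(2) unfolding pre_def by blast
    moreover have "m \<in> Q" using sat[OF Q(1)] Q(2) R(1) V by blast
    ultimately have "f p \<^bold>\<or> m \<in> Q" using B.lprime_join_iff[OF Q(1) M(2) m] by blast
    hence "f x \<^bold>\<and> g \<in> Q" using B.lprime_mono[OF Q(1) _ _ h(5)] M B.meet_in by blast
    hence "f x \<in> Q \<or> g \<in> Q" using B.lprime_meet_iff[OF Q(1) M(1,3)] by blast
    moreover have "g \<notin> Q" using B.lprimeD(2)[OF Q(1)] B.lprime_mono[OF Q(1) _ B.top_in] h(4) by blast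
    ultimately have "x \<in> R" using h(1) Q(2) unfolding pre_def by blast
    thus False using h(2) R(1) by blast
  qed blast
  moreover have "pre Q = \<Union>\<C>" using Q(2,3) by (intro subset_antisym)
  ultimately show "\<Union>\<C> \<in> V" using sat[OF Q(1)] Q(4) by simp
qed

text \<open>A violation of the claim could be narrowed down, by Zorn's lemma, to primes \<open>R1 \<subset> R2\<close> on different sides
  of \<open>V\<close> such that each prime between them is \<open>R1\<close> or \<open>R2\<close>; but the preimage of the interval
  is connected.\<close>

lemma saturated_specialization:
  assumes sat: "\<And>Q. B.lprime Q \<Longrightarrow> m \<in> Q \<longleftrightarrow> pre Q \<in> V" and m: "m \<in> M"
    and Q: "B.lprime Q" "B.lprime Q'" "m \<notin> Q" "m \<in> Q'"
  shows "\<not> pre Q' \<subseteq> pre Q"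
proof
  assume sub: "pre Q' \<subseteq> pre Q"
  define \<A>1 where "\<A>1 = {R. A.lprime R \<and> pre Q' \<subseteq> R \<and> R \<subseteq> pre Q \<and> R \<in> V}"
  have "pre Q' \<in> \<A>1" using sub sat[OF Q(2)] Q(4) lprime_pre[OF Q(2)] unfolding \<A>1_def by blast
  hence ne1: "\<A>1 \<noteq> {}" by blast
  obtain R1 where R1: "R1 \<in> \<A>1" "\<And>X. \<lbrakk>X \<in> \<A>1; R1 \<subseteq> X\<rbrakk> \<Longrightarrow> X = R1"
  proof (rule Zorn_maximal[OF ne1])
    fix \<C> assume C: "\<C> \<noteq> {}" "\<C> \<subseteq> \<A>1" "\<And>R R'. \<lbrakk>R \<in> \<C>; R' \<in> \<C>\<rbrakk> \<Longrightarrow> R \<subseteq> R' \<or> R' \<subseteq> R"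
    have pr: "\<And>R. R \<in> \<C> \<Longrightarrow> A.lprime R" and V: "\<C> \<subseteq> V" using C(2) unfolding \<A>1_def by auto
    have "A.lprime (\<Union>\<C>)" by (rule A.lprime_Union_chain[OF C(1) pr C(3)])
    moreover have "\<Union>\<C> \<in> V" by (rule lprime_chain_pre(2)[OF sat m C(1) pr C(3) V])
    moreover have "pre Q' \<subseteq> \<Union>\<C>" "\<Union>\<C> \<subseteq> pre Q" using C(1,2) unfolding \<A>1_def by blast+
    ultimately show "\<Union>\<C> \<in> \<A>1" unfolding \<A>1_def by blast
  qed blast
  define \<A>2 where "\<A>2 = {R. A.lprime R \<and> R1 \<subseteq> R \<and> R \<subseteq> pre Q \<and> R \<notin> V}"
  have "pre Q \<in> \<A>2" using R1(1) sat[OF Q(1)] Q(3) lprime_pre[OF Q(1)] unfolding \<A>2_def \<A>1_def by blast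
  hence ne2: "\<A>2 \<noteq> {}" by blast
  obtain R2 where R2: "R2 \<in> \<A>2" "\<And>X. \<lbrakk>X \<in> \<A>2; X \<subseteq> R2\<rbrakk> \<Longrightarrow> X = R2"
  proof (rule Zorn_minimal[OF ne2])
    fix \<C> assume C: "\<C> \<noteq> {}" "\<C> \<subseteq> \<A>2" "\<And>R R'. \<lbrakk>R \<in> \<C>; R' \<in> \<C>\<rbrakk> \<Longrightarrow> R \<subseteq> R' \<or> R' \<subseteq> R"
    have pr: "\<And>R. R \<in> \<C> \<Longrightarrow> A.lprime R" and V: "\<C> \<inter> V = {}" using C(2) unfolding \<A>2_def by auto
    have "A.lprime (\<Inter>\<C>)" by (rule A.lprime_Inter_chain[OF C(1) pr C(3)])
    moreover have "\<Inter>\<C> \<notin> V" by (rule lprime_chain_pre(1)[OF sat m C(1) pr C(3) V])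
    moreover have "R1 \<subseteq> \<Inter>\<C>" "\<Inter>\<C> \<subseteq> pre Q" using C(1,2) unfolding \<A>2_def by blast+
    ultimately show "\<Inter>\<C> \<in> \<A>2" unfolding \<A>2_def by blast
  qed blast
  have pr: "A.lprime R1" "A.lprime R2" "R1 \<in> V" "R2 \<notin> V" "R1 \<subseteq> R2" "R2 \<subseteq> pre Q" "pre Q' \<subseteq> R1"
    using R1(1) R2(1) unfolding \<A>1_def \<A>2_def by auto
  have "R1 \<noteq> R2" using pr by blast
  then obtain a where a: "a \<in> R2" "a \<notin> R1" using pr(5) by blast
  have aL: "a \<in> L" using a A.lprime_sub[OF pr(2)] by blast
  \<comment> \<open>Over the pair \<open>R1\<close>, \<open>R2\<close> the set \<open>C1\<close> is
    the part above \<open>R2\<close> and \<open>C2\<close> the part above \<open>R1\<close>. Both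
    are supports, hence closed.\<close>
  define C1 where "C1 = {Q. B.lprime Q \<and> m \<notin> Q}"
  define C2 where "C2 = {Q. B.lprime Q \<and> f a \<notin> Q}"
  have cl: "closedin B.ptop C1" "closedin B.ptop C2"
    unfolding C1_def C2_def using B.closedin_supp m f_in[OF aL] by auto
  have dich: "pre S \<in> V \<Longrightarrow> pre S = R1" "pre S \<notin> V \<Longrightarrow> pre S = R2" if S: "S \<in> over R1 R2" for S
  proof -
    have S': "A.lprime (pre S)" "R1 \<subseteq> pre S" "pre S \<subseteq> R2" using S lprime_pre unfolding over_def by auto
    { assume "pre S \<in> V" hence "pre S \<in> \<A>1" using S' pr unfolding \<A>1_def by blast
      thus "pre S = R1" using R1(2) S' by blast }
    { assume "pre S \<notin> V" hence "pre S \<in> \<A>2" using S' pr unfolding \<A>2_def by blast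
      thus "pre S = R2" using R2(2) S' by blast }
  qed
  have ov: "S \<in> C1 \<longleftrightarrow> pre S \<notin> V" "S \<in> C2 \<longleftrightarrow> a \<notin> pre S" if S: "S \<in> over R1 R2" for S
    using S sat[of S] aL unfolding over_def C1_def C2_def pre_def by blast+
  have "C1 \<inter> over R1 R2 = {} \<or> C2 \<inter> over R1 R2 = {}"
  proof (rule over_connected[OF pr(1,2) cl])
    show "over R1 R2 \<subseteq> C1 \<union> C2"
    proof
      fix S assume S: "S \<in> over R1 R2"
      show "S \<in> C1 \<union> C2" using ov[OF S] dich[OF S] a by blast
    qed
    have False if S: "S \<in> over R1 R2" "S \<in> C1" "S \<in> C2" for S
      using ov[OF S(1)] dich[OF S(1)] a S(2,3) by blast
    thus "C1 \<inter> C2 \<inter> over R1 R2 = {}" by blast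
  qed
  moreover obtain S where S: "B.lprime S" "pre S = R1" using lprime_over_exists[OF pr(1)] by blast
  have "S \<in> over R1 R2" using S pr unfolding over_def by blast
  hence "S \<in> C2 \<inter> over R1 R2" using ov(2)[of S] S(2) a by blast
  moreover obtain S' where S': "B.lprime S'" "pre S' = R2" using lprime_over_exists[OF pr(2)] by blast
  have "S' \<in> over R1 R2" using S' pr unfolding over_def by blast
  hence "S' \<in> C1 \<inter> over R1 R2" using ov(1)[of S'] S'(2) pr(4) by blast
  ultimately show False by blast
qed

text \<open>A prime containing \<open>m\<close> contains some \<open>f l\<close> above
  \<open>m\<close>: otherwise separation gives a prime that misses \<open>m\<close> and has a larger
  trace on \<open>L\<close>, against \<open>saturated_specialization\<close>. Up to equivalence the
  elements \<open>f l\<close> above \<open>m\<close> are closed under meets, so a second separation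
  puts one of them below \<open>m\<close>.\<close>

lemma saturated_in_image:
  assumes sat: "\<And>Q. B.lprime Q \<Longrightarrow> m \<in> Q \<longleftrightarrow> pre Q \<in> V" and m: "m \<in> M"
  obtains l where "l \<in> L" "f l \<lesssim> m" "m \<lesssim> f l"
proof -
  have ex: "\<exists>l\<in>L. m \<lesssim> f l \<and> f l \<in> Q'" if Q': "B.lprime Q'" "m \<in> Q'" for Q'
  proof (rule ccontr)
    assume no: "\<not> ?thesis"
    have I: "A.lideal (pre Q')" by (rule A.lprimeD(1)[OF lprime_pre[OF Q'(1)]])
    have "{y\<in>M. \<exists>p\<in>pre Q'. y \<lesssim> f p} \<inter> {g\<in>M. m \<lesssim> g} = {}"
    proof -
      have False if y: "y \<in> M" "p \<in> pre Q'" "y \<lesssim> f p" "m \<lesssim> y" for y p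
      proof -
        have "p \<in> L" "f p \<in> Q'" using y(2) unfolding pre_def by auto
        moreover have "m \<lesssim> f p" using B.le_trans[OF y(4,3) m y(1)] f_in \<open>p \<in> L\<close> by blast
        ultimately show False using no by blast
      qed
      thus ?thesis by blast
    qed
    from B.lprime_exists[OF lideal_image[OF I] B.lfilter_up[OF m] this]
    obtain Q where Q: "B.lprime Q" "{y\<in>M. \<exists>p\<in>pre Q'. y \<lesssim> f p} \<subseteq> Q" "Q \<inter> {g\<in>M. m \<lesssim> g} = {}" .
    have "m \<notin> Q" using Q(3) m B.le_refl by blast
    moreover have "pre Q' \<subseteq> pre Q"
    proof
      fix p assume p: "p \<in> pre Q'"
      hence pL: "p \<in> L" unfolding pre_def by blast
      hence "f p \<in> {y\<in>M. \<exists>p\<in>pre Q'. y \<lesssim> f p}" using p f_in B.le_refl by blast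
      thus "p \<in> pre Q" using Q(2) pL unfolding pre_def by blast
    qed
    ultimately show False using saturated_specialization[OF sat m Q(1) Q'(1) _ Q'(2)] by blast
  qed
  define G where "G = {g\<in>M. \<exists>l\<in>L. m \<lesssim> f l \<and> f l \<lesssim> g}"
  have GI: "g \<in> G" if "g \<in> M" "l \<in> L" "m \<lesssim> f l" "f l \<lesssim> g" for g l using that unfolding G_def by blast
  have G: "B.lfilter_base G" unfolding B.lfilter_base_def
  proof (intro conjI ballI)
    show "G \<subseteq> M" unfolding G_def by blast
    have "m \<lesssim> f top" using B.le_trans[OF B.le_top[OF m] f_top] m B.top_in f_in A.top_in by blast
    thus "topM \<in> G" by (rule GI[OF B.top_in A.top_in]) (use B.le_top f_in A.top_in in auto)
    fix a b assume "a \<in> G" "b \<in> G"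
    then obtain l k where a: "a \<in> M" "l \<in> L" "m \<lesssim> f l" "f l \<lesssim> a" and b: "b \<in> M" "k \<in> L" "m \<lesssim> f k" "f k \<lesssim> b"
      unfolding G_def by blast
    have M: "f l \<in> M" "f k \<in> M" "f (l \<curlywedge> k) \<in> M" "f l \<^bold>\<and> f k \<in> M" using a b f_in A.meet_in B.meet_in by auto
    have "m \<lesssim> f l \<^bold>\<and> f k" using B.meet_greatest a b M m by auto
    hence 1: "m \<lesssim> f (l \<curlywedge> k)" using B.le_trans[OF _ f_meet[OF a(2) b(2)]] M m by auto
    have "f (l \<curlywedge> k) \<lesssim> f l" "f (l \<curlywedge> k) \<lesssim> f k"
      using f_le_iff A.meet1 A.meet2 A.meet_in a b by auto
    hence "f (l \<curlywedge> k) \<lesssim> a" "f (l \<curlywedge> k) \<lesssim> b" using B.le_trans[OF _ a(4)] B.le_trans[OF _ b(4)] M a b by auto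
    hence "f (l \<curlywedge> k) \<lesssim> a \<^bold>\<and> b" using B.meet_greatest M a b by auto
    thus "a \<^bold>\<and> b \<in> G" using GI[OF _ _ 1] a b A.meet_in B.meet_in by auto
  qed
  have "{y\<in>M. y \<lesssim> m} \<inter> G \<noteq> {}"
  proof
    assume "{y\<in>M. y \<lesssim> m} \<inter> G = {}"
    from B.lprime_exists[OF B.lideal_down[OF m] G this]
    obtain Q where Q: "B.lprime Q" "{y\<in>M. y \<lesssim> m} \<subseteq> Q" "Q \<inter> G = {}" .
    have "m \<in> Q" using Q(2) m B.le_refl by auto
    then obtain l where l: "l \<in> L" "m \<lesssim> f l" "f l \<in> Q" using ex[OF Q(1)] by blast
    have "f l \<in> G" using GI[OF _ l(1,2)] f_in[OF l(1)] B.le_refl by auto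
    thus False using l(3) Q(3) by blast
  qed
  then obtain y l where y: "y \<in> M" "y \<lesssim> m" "l \<in> L" "m \<lesssim> f l" "f l \<lesssim> y" unfolding G_def by blast
  have "f l \<lesssim> m" using B.le_trans[OF y(5,2)] f_in y(1,3) m by blast
  thus thesis using that y by blast
qed

theorem spectral_quotient_pre: "spectral_quotient_map B.ptop A.ptop pre"
  unfolding spectral_quotient_map_def spectral_map_def
proof (intro conjI allI impI)
  show "spectral_space B.ptop" by (rule B.spectral_space_ptop)
  show "spectral_space A.ptop" by (rule A.spectral_space_ptop)
  have preD: "{Q \<in> topspace B.ptop. pre Q \<in> A.D a} = B.D (f a)" if "a \<in> L" for a
  proof -
    have "pre Q \<in> A.D a \<longleftrightarrow> f a \<in> Q" if "B.lprime Q" for Q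
      using lprime_pre[OF that] \<open>a \<in> L\<close> unfolding A.D_def pre_def by simp
    thus ?thesis unfolding B.topspace_ptop B.Pr_def B.D_def by blast
  qed
  show cont: "continuous_map B.ptop A.ptop pre" unfolding continuous_map_def
  proof (intro conjI allI impI)
    show "pre \<in> topspace B.ptop \<rightarrow> topspace A.ptop"
      unfolding A.topspace_ptop B.topspace_ptop A.Pr_def B.Pr_def using lprime_pre by auto
    fix V assume V: "openin A.ptop V"
    show "openin B.ptop {Q \<in> topspace B.ptop. pre Q \<in> V}" unfolding B.openin_ptop_iff
    proof (intro conjI ballI)
      show "{Q \<in> topspace B.ptop. pre Q \<in> V} \<subseteq> B.Pr" unfolding B.topspace_ptop by blast
      fix Q assume "Q \<in> {Q \<in> topspace B.ptop. pre Q \<in> V}"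
      hence Q: "pre Q \<in> V" by blast
      obtain a where a: "a \<in> L" "a \<in> pre Q" "A.D a \<subseteq> V" using V Q unfolding A.openin_ptop_iff by blast
      have "B.D (f a) \<subseteq> {Q \<in> topspace B.ptop. pre Q \<in> V}" unfolding preD[OF a(1), symmetric] using a(3) by blast
      moreover have "f a \<in> M" "f a \<in> Q" using a f_in unfolding pre_def by auto
      ultimately show "\<exists>b\<in>M. b \<in> Q \<and> B.D b \<subseteq> {Q \<in> topspace B.ptop. pre Q \<in> V}" by blast
    qed
  qed
  show surj: "pre ` topspace B.ptop = topspace A.ptop"
  proof
    show "pre ` topspace B.ptop \<subseteq> topspace A.ptop"
      unfolding A.topspace_ptop B.topspace_ptop A.Pr_def B.Pr_def using lprime_pre by blast
    show "topspace A.ptop \<subseteq> pre ` topspace B.ptop"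
    proof
      fix P assume "P \<in> topspace A.ptop"
      hence "A.lprime P" unfolding A.topspace_ptop A.Pr_def by blast
      then obtain Q where "B.lprime Q" "pre Q = P" using lprime_over_exists by blast
      thus "P \<in> pre ` topspace B.ptop" unfolding B.topspace_ptop B.Pr_def by blast
    qed
  qed
  { fix V assume "qc_open A.ptop V"
    then obtain a where "a \<in> L" "V = A.D a" unfolding A.qc_open_ptop_iff by blast
    thus "qc_open B.ptop {Q \<in> topspace B.ptop. pre Q \<in> V}"
      unfolding B.qc_open_ptop_iff using preD f_in by blast }
  fix V assume V: "V \<subseteq> topspace A.ptop" "qc_open B.ptop {Q \<in> topspace B.ptop. pre Q \<in> V}"
  then obtain m where m: "m \<in> M" "{Q \<in> topspace B.ptop. pre Q \<in> V} = B.D m" unfolding B.qc_open_ptop_iff by blast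
  have sat: "m \<in> Q \<longleftrightarrow> pre Q \<in> V" if "B.lprime Q" for Q
    using m(2) that unfolding B.topspace_ptop B.Pr_def B.D_def by blast
  obtain l where l: "l \<in> L" "f l \<lesssim> m" "m \<lesssim> f l" using saturated_in_image[OF sat m(1)] by blast
  \<comment> \<open>Surjectivity of \<open>pre\<close> recovers \<open>V\<close> from its
    preimage.\<close>
  have "V = A.D l"
  proof (rule Set.set_eqI)
    fix P
    have "A.lprime P" if "P \<in> V \<or> P \<in> A.D l" using that V(1) unfolding A.topspace_ptop A.Pr_def A.D_def by blast
    moreover have "P \<in> V \<longleftrightarrow> P \<in> A.D l" if P: "A.lprime P"
    proof -
      obtain Q where Q: "B.lprime Q" "pre Q = P" using lprime_over_exists[OF P] by blast
      have "m \<in> Q \<longleftrightarrow> f l \<in> Q" using B.lprime_mono[OF Q(1)] l m(1) f_in by blast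
      thus ?thesis using sat[OF Q(1)] Q(2) P l(1) unfolding A.D_def pre_def by blast
    qed
    ultimately show "P \<in> V \<longleftrightarrow> P \<in> A.D l" by blast
  qed
  thus "qc_open A.ptop V" unfolding A.qc_open_ptop_iff using l(1) by blast
qed

theorem connectedin_fibre:
  assumes "P \<in> topspace A.ptop" shows "connectedin B.ptop {Q \<in> topspace B.ptop. pre Q = P}"
proof -
  have P: "A.lprime P" using assms unfolding A.topspace_ptop A.Pr_def by blast
  have eq: "{Q \<in> topspace B.ptop. pre Q = P} = over P P"
    unfolding B.topspace_ptop B.Pr_def over_def by blast
  have "\<not> (\<exists>C1 C2. closedin B.ptop C1 \<and> closedin B.ptop C2 \<and> over P P \<subseteq> C1 \<union> C2 \<and>
      C1 \<inter> C2 \<inter> over P P = {} \<and> C1 \<inter> over P P \<noteq> {} \<and> C2 \<inter> over P P \<noteq> {})"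
    using over_connected[OF P P] by blast
  moreover have "over P P \<subseteq> topspace B.ptop" unfolding eq[symmetric] by blast
  ultimately show ?thesis unfolding eq connectedin_closedin by blast
qed

end

section \<open>Additive and triangulated categories\<close>

lemma hom_iff: "f \<in> Hom C x y \<longleftrightarrow> f \<in> Arr C \<and> Dom C f = x \<and> Cod C f = y"
  unfolding Hom_def by auto

context category begin

lemma comp_arr [simp]:
  assumes "f \<in> Arr C" "g \<in> Arr C" "Dom C g = Cod C f"
  shows "g \<cdot> f \<in> Arr C" "Dom C (g \<cdot> f) = Dom C f" "Cod C (g \<cdot> f) = Cod C g"
  using comp_hom[of f "Dom C f" "Cod C f" g "Cod C g"] assms by (auto simp: hom_iff)

lemma idm_arr [simp]:
  assumes "x \<in> Obj C" shows "idm C x \<in> Arr C" "Dom C (idm C x) = x" "Cod C (idm C x) = x"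
  using idm_hom[OF assms] by (auto simp: hom_iff)

lemma assoc_arr [simp]:
  assumes "f \<in> Arr C" "g \<in> Arr C" "h \<in> Arr C" "Dom C g = Cod C f" "Dom C h = Cod C g"
  shows "h \<cdot> g \<cdot> f = h \<cdot> (g \<cdot> f)"
  by (rule comp_assoc) (use assms in \<open>auto simp: hom_iff\<close>)

lemma comp_idm_arr [simp]: "f \<in> Arr C \<Longrightarrow> Dom C f = x \<Longrightarrow> f \<cdot> idm C x = f"
  using comp_idm[of f x "Cod C f"] by (simp add: hom_iff)

lemma idm_comp_arr [simp]: "f \<in> Arr C \<Longrightarrow> Cod C f = x \<Longrightarrow> idm C x \<cdot> f = f"
  using idm_comp[of f "Dom C f" x] by (simp add: hom_iff)

lemma hom_obj: "f \<in> Hom C x y \<Longrightarrow> x \<in> Obj C" "f \<in> Hom C x y \<Longrightarrow> y \<in> Obj C"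
  using dom_cod by (auto simp: hom_iff)

lemma dom_obj [simp]: "f \<in> Arr C \<Longrightarrow> Dom C f \<in> Obj C" "f \<in> Arr C \<Longrightarrow> Cod C f \<in> Obj C"
  using dom_cod by auto

lemma isoE:
  assumes "is_iso C x y f"
  obtains g where "f \<in> Hom C x y" "g \<in> Hom C y x" "g \<cdot> f = idm C x" "f \<cdot> g = idm C y"
  using assms unfolding is_iso_def by blast

lemma isoI: "\<lbrakk>f \<in> Hom C x y; g \<in> Hom C y x; g \<cdot> f = idm C x; f \<cdot> g = idm C y\<rbrakk> \<Longrightarrow> is_iso C x y f"
  unfolding is_iso_def by blast

lemma iso_hom: "is_iso C x y f \<Longrightarrow> f \<in> Hom C x y"
  unfolding is_iso_def by blast

lemma iso_idm: "x \<in> Obj C \<Longrightarrow> is_iso C x x (idm C x)"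
  by (rule isoI[of _ _ _ "idm C x"]) (auto simp: hom_iff)

lemma iso_comp:
  assumes "is_iso C x y f" "is_iso C y z g" shows "is_iso C x z (g \<cdot> f)"
proof -
  obtain f' where f: "f \<in> Hom C x y" "f' \<in> Hom C y x" "f' \<cdot> f = idm C x" "f \<cdot> f' = idm C y" using assms(1) by (rule isoE)
  obtain g' where g: "g \<in> Hom C y z" "g' \<in> Hom C z y" "g' \<cdot> g = idm C y" "g \<cdot> g' = idm C z" using assms(2) by (rule isoE)
  have "f' \<cdot> g' \<cdot> (g \<cdot> f) = f' \<cdot> (g' \<cdot> g) \<cdot> f" using f(1,2) g(1,2) by (simp add: hom_iff)
  also have "\<dots> = idm C x" unfolding g(3) using f by (simp add: hom_iff)
  finally have 1: "f' \<cdot> g' \<cdot> (g \<cdot> f) = idm C x" .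
  have "g \<cdot> f \<cdot> (f' \<cdot> g') = g \<cdot> (f \<cdot> f') \<cdot> g'" using f(1,2) g(1,2) by (simp add: hom_iff)
  also have "\<dots> = idm C z" unfolding f(4) using g by (simp add: hom_iff)
  finally have 2: "g \<cdot> f \<cdot> (f' \<cdot> g') = idm C z" .
  show ?thesis by (rule isoI[OF _ _ 1 2]) (use f g in \<open>auto simp: hom_iff\<close>)
qed

lemma iso_inverse_ex:
  assumes "is_iso C x y f" obtains g where "is_iso C y x g" "g \<cdot> f = idm C x" "f \<cdot> g = idm C y"
  using isoE[OF assms] isoI by metis

lemma inverse_arrow:
  assumes "is_iso C x y f"
  shows "inverse_arrow C x y f \<in> Hom C y x" "inverse_arrow C x y f \<cdot> f = idm C x" "f \<cdot> inverse_arrow C x y f = idm C y"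
proof -
  obtain g where g: "f \<in> Hom C x y" "g \<in> Hom C y x" "g \<cdot> f = idm C x" "f \<cdot> g = idm C y" using assms by (rule isoE)
  have "inverse_arrow C x y f = g" unfolding inverse_arrow_def
  proof (rule the_equality)
    show "g \<in> Hom C y x \<and> g \<cdot> f = idm C x \<and> f \<cdot> g = idm C y" using g by blast
    fix g' assume g': "g' \<in> Hom C y x \<and> g' \<cdot> f = idm C x \<and> f \<cdot> g' = idm C y"
    have "g' \<cdot> f \<cdot> g = g' \<cdot> (f \<cdot> g)" by (rule comp_assoc[OF g(2,1) conjunct1[OF g']])
    thus "g' = g" using g g' by (simp add: hom_iff)
  qed
  thus "inverse_arrow C x y f \<in> Hom C y x" "inverse_arrow C x y f \<cdot> f = idm C x" "f \<cdot> inverse_arrow C x y f = idm C y"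
    using g by auto
qed

lemma iso_cancel_left:
  assumes "is_iso C x y i" "f \<in> Hom C w x" "g \<in> Hom C w x" "i \<cdot> f = i \<cdot> g" shows "f = g"
proof -
  obtain j where j: "i \<in> Hom C x y" "j \<in> Hom C y x" "j \<cdot> i = idm C x" using assms(1) by (rule isoE)
  have "j \<cdot> i \<cdot> f = j \<cdot> i \<cdot> g" using assms j(1,2) by (simp add: hom_iff)
  thus ?thesis unfolding j(3) using assms by (simp add: hom_iff)
qed

lemma iso_cancel_right:
  assumes "is_iso C x y i" "f \<in> Hom C y w" "g \<in> Hom C y w" "f \<cdot> i = g \<cdot> i" shows "f = g"
proof -
  obtain j where j: "i \<in> Hom C x y" "j \<in> Hom C y x" "i \<cdot> j = idm C y" using assms(1) by (rule isoE)
  have "f \<cdot> (i \<cdot> j) = (f \<cdot> i) \<cdot> j" using assms(2) j(1,2) by (simp add: hom_iff)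
  also have "\<dots> = g \<cdot> (i \<cdot> j)" unfolding assms(4) using assms(3) j(1,2) by (simp add: hom_iff)
  finally show ?thesis unfolding j(3) using assms by (simp add: hom_iff)
qed

end

section \<open>Arithmetic of hom groups and zero arrows\<close>

context additive_category begin

lemma zerom_hom: "x \<in> Obj C \<Longrightarrow> y \<in> Obj C \<Longrightarrow> zerom C x y \<in> Hom C x y"
  using comm_group.axioms(2)[OF hom_comm_group, THEN group.is_monoid, THEN monoid.one_closed]
  unfolding hom_group_def by simp

lemma zerom_arr [simp]:
  assumes "x \<in> Obj C" "y \<in> Obj C"
  shows "zerom C x y \<in> Arr C" "Dom C (zerom C x y) = x" "Cod C (zerom C x y) = y"
  using zerom_hom[OF assms] by (auto simp: hom_iff)

lemma addm_hom: assumes "f \<in> Hom C x y" "g \<in> Hom C x y" shows "f \<boxplus> g \<in> Hom C x y"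
  using comm_group.axioms(2)[OF hom_comm_group, THEN group.is_monoid, THEN monoid.m_closed, of x y f g] hom_obj[OF assms(1)] assms
  unfolding hom_group_def by simp

lemma addm_arr [simp]:
  assumes "f \<in> Arr C" "g \<in> Arr C" "Dom C f = Dom C g" "Cod C f = Cod C g"
  shows "f \<boxplus> g \<in> Arr C" "Dom C (f \<boxplus> g) = Dom C g" "Cod C (f \<boxplus> g) = Cod C g"
  using addm_hom[of f "Dom C g" "Cod C g" g] assms by (auto simp: hom_iff)

lemma neg_eq: "f \<in> Hom C x y \<Longrightarrow> neg C f = inv\<^bsub>hom_group C x y\<^esub> f"
  unfolding neg_def by (simp add: hom_iff)

lemma neg_hom: assumes "f \<in> Hom C x y" shows "neg C f \<in> Hom C x y"
  using comm_group.axioms(2)[OF hom_comm_group, THEN group.inv_closed, of x y f] hom_obj[OF assms] assms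
  unfolding neg_eq[OF assms] by (simp add: hom_group_def)

lemma neg_arr [simp]:
  assumes "f \<in> Arr C" shows "neg C f \<in> Arr C" "Dom C (neg C f) = Dom C f" "Cod C (neg C f) = Cod C f"
  using neg_hom[of f "Dom C f" "Cod C f"] assms by (auto simp: hom_iff)

lemma addm_assoc: assumes "f \<in> Hom C x y" "g \<in> Hom C x y" "h \<in> Hom C x y" shows "f \<boxplus> g \<boxplus> h = f \<boxplus> (g \<boxplus> h)"
  using comm_group.axioms(2)[OF hom_comm_group, THEN group.is_monoid, THEN monoid.m_assoc, of x y f g h] hom_obj[OF assms(1)] assms
  unfolding hom_group_def by simp

lemma addm_commute: assumes "f \<in> Hom C x y" "g \<in> Hom C x y" shows "f \<boxplus> g = g \<boxplus> f"
  using comm_group.axioms(1)[OF hom_comm_group, THEN comm_monoid.m_comm, of x y f g] hom_obj[OF assms(1)] assms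
  unfolding hom_group_def by simp

lemma addm_zero [simp]: assumes "f \<in> Arr C" "Dom C f = x" "Cod C f = y" shows "f \<boxplus> zerom C x y = f" "zerom C x y \<boxplus> f = f"
  using comm_group.axioms(2)[OF hom_comm_group, THEN group.is_monoid, THEN monoid.r_one, of x y f]
    comm_group.axioms(2)[OF hom_comm_group, THEN group.is_monoid, THEN monoid.l_one, of x y f] assms
    dom_obj[OF assms(1)]
  unfolding hom_group_def by (auto simp: hom_iff)

lemma addm_neg: assumes "f \<in> Hom C x y" shows "f \<boxplus> neg C f = zerom C x y" "neg C f \<boxplus> f = zerom C x y"
  using comm_group.axioms(2)[OF hom_comm_group, THEN group.r_inv, of x y f]
    comm_group.axioms(2)[OF hom_comm_group, THEN group.l_inv, of x y f] hom_obj[OF assms] assms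
  unfolding neg_eq[OF assms] by (simp_all add: hom_group_def)

lemma addm_cancel:
  assumes "f \<in> Hom C x y" "g \<in> Hom C x y" "h \<in> Hom C x y" "f \<boxplus> g = f \<boxplus> h" shows "g = h"
proof -
  have "neg C f \<boxplus> f \<boxplus> g = neg C f \<boxplus> f \<boxplus> h"
    using assms addm_assoc[OF neg_hom[OF assms(1)] assms(1)] by simp
  thus ?thesis using addm_neg[OF assms(1)] assms by (simp add: hom_iff)
qed

lemma comp_zero [simp]: assumes "f \<in> Arr C" "Dom C f = y" "x \<in> Obj C" shows "f \<cdot> zerom C x y = zerom C x (Cod C f)"
proof -
  let ?z = "zerom C x y"
  have y: "y \<in> Obj C" using assms by auto
  have z: "?z \<in> Hom C x y" using zerom_hom assms y by auto
  have f: "f \<in> Hom C y (Cod C f)" using assms by (simp add: hom_iff)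
  have fz: "f \<cdot> ?z \<in> Hom C x (Cod C f)" using comp_hom z f by auto
  have "f \<cdot> ?z \<boxplus> f \<cdot> ?z = f \<cdot> ?z \<boxplus> zerom C x (Cod C f)"
    using addm_comp[OF z z f] fz z y assms by (simp add: hom_iff)
  thus ?thesis using addm_cancel fz zerom_hom assms by (metis dom_obj(2))
qed

lemma zero_comp [simp]: assumes "f \<in> Arr C" "Cod C f = x" "y \<in> Obj C" shows "zerom C x y \<cdot> f = zerom C (Dom C f) y"
proof -
  let ?z = "zerom C x y"
  have x: "x \<in> Obj C" using assms by auto
  have z: "?z \<in> Hom C x y" using zerom_hom assms x by auto
  have f: "f \<in> Hom C (Dom C f) x" using assms by (simp add: hom_iff)
  have fz: "?z \<cdot> f \<in> Hom C (Dom C f) y" using comp_hom z f by auto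
  have "?z \<cdot> f \<boxplus> ?z \<cdot> f = ?z \<cdot> f \<boxplus> zerom C (Dom C f) y"
    using comp_addm[OF f z z] fz z x assms by (simp add: hom_iff)
  thus ?thesis using addm_cancel fz zerom_hom assms by (metis dom_obj(1))
qed

lemma neg_unique: assumes "f \<in> Hom C x y" "g \<in> Hom C x y" "f \<boxplus> g = zerom C x y" shows "g = neg C f"
  by (rule addm_cancel[OF assms(1,2) neg_hom[OF assms(1)]]) (simp add: assms addm_neg[OF assms(1)])

lemma neg_neg: assumes "f \<in> Hom C x y" shows "neg C (neg C f) = f"
  using neg_unique[OF neg_hom[OF assms] assms] addm_neg[OF assms] by simp

lemma neg_zero: assumes "x \<in> Obj C" "y \<in> Obj C" shows "neg C (zerom C x y) = zerom C x y"
  using neg_unique[OF zerom_hom zerom_hom, of x y] assms by simp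

lemma comp_neg: assumes "f \<in> Hom C x y" "g \<in> Hom C y z" shows "g \<cdot> neg C f = neg C (g \<cdot> f)"
proof (rule neg_unique)
  show "g \<cdot> f \<boxplus> g \<cdot> neg C f = zerom C x z"
    using addm_comp[OF assms(1) neg_hom[OF assms(1)] assms(2)] addm_neg[OF assms(1)] assms hom_obj[OF assms(1)]
    by (simp add: hom_iff)
qed (rule comp_hom[OF assms], rule comp_hom[OF neg_hom[OF assms(1)] assms(2)])

lemma neg_comp: assumes "f \<in> Hom C x y" "g \<in> Hom C y z" shows "neg C g \<cdot> f = neg C (g \<cdot> f)"
proof (rule neg_unique)
  show "g \<cdot> f \<boxplus> neg C g \<cdot> f = zerom C x z"
    using comp_addm[OF assms(1) assms(2) neg_hom[OF assms(2)]] addm_neg[OF assms(2)] assms hom_obj[OF assms(2)]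
    by (simp add: hom_iff)
qed (rule comp_hom[OF assms], rule comp_hom[OF assms(1) neg_hom[OF assms(2)]])

definition sub :: "'a \<Rightarrow> 'a \<Rightarrow> 'a" where "sub f g = f \<boxplus> neg C g"

lemma sub_hom: "\<lbrakk>f \<in> Hom C x y; g \<in> Hom C x y\<rbrakk> \<Longrightarrow> sub f g \<in> Hom C x y"
  unfolding sub_def using addm_hom neg_hom by auto

lemma sub_arr [simp]:
  assumes "f \<in> Arr C" "g \<in> Arr C" "Dom C f = Dom C g" "Cod C f = Cod C g"
  shows "sub f g \<in> Arr C" "Dom C (sub f g) = Dom C g" "Cod C (sub f g) = Cod C g"
  using assms unfolding sub_def by auto

lemma comp_sub: "\<lbrakk>f \<in> Hom C x y; g \<in> Hom C x y; h \<in> Hom C y z\<rbrakk> \<Longrightarrow> h \<cdot> sub f g = sub (h \<cdot> f) (h \<cdot> g)"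
  unfolding sub_def using addm_comp neg_hom comp_neg by auto

lemma sub_comp: "\<lbrakk>f \<in> Hom C x y; g \<in> Hom C y z; h \<in> Hom C y z\<rbrakk> \<Longrightarrow> sub g h \<cdot> f = sub (g \<cdot> f) (h \<cdot> f)"
  unfolding sub_def using comp_addm neg_hom neg_comp by auto

lemma sub_self: "f \<in> Hom C x y \<Longrightarrow> sub f f = zerom C x y"
  unfolding sub_def using addm_neg by auto

lemma sub_add: assumes "f \<in> Hom C x y" "g \<in> Hom C x y" shows "sub f g \<boxplus> g = f"
  unfolding sub_def using addm_assoc[OF assms(1) neg_hom[OF assms(2)] assms(2)] addm_neg[OF assms(2)] assms
  by (simp add: hom_iff)

lemma sub_zero_eq: assumes "f \<in> Hom C x y" "g \<in> Hom C x y" "sub f g = zerom C x y" shows "f = g"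
  using sub_add[OF assms(1,2)] assms by (simp add: hom_iff)

lemma zero_object_hom:
  assumes z: "zero_object C z" and f: "f \<in> Arr C"
  shows "Dom C f = z \<Longrightarrow> f = zerom C z (Cod C f)" "Cod C f = z \<Longrightarrow> f = zerom C (Dom C f) z"
proof -
  have zo: "z \<in> Obj C" "idm C z = zerom C z z" using z unfolding zero_object_def by auto
  { assume d: "Dom C f = z"
    have "f = f \<cdot> idm C z" using d f by simp
    also have "\<dots> = zerom C z (Cod C f)" unfolding zo(2) using d f zo by simp
    finally show "f = zerom C z (Cod C f)" . }
  { assume d: "Cod C f = z"
    have "f = idm C z \<cdot> f" using d f by simp
    also have "\<dots> = zerom C (Dom C f) z" unfolding zo(2) using d f zo by simp
    finally show "f = zerom C (Dom C f) z" . }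
qed

text \<open>Vanishing without naming source and target, so that it passes through composites and
  tensor products whose objects are only controlled up to isomorphism.\<close>

definition isz :: "'a \<Rightarrow> bool" where "isz f \<longleftrightarrow> f \<in> Arr C \<and> f = zerom C (Dom C f) (Cod C f)"

lemma isz_zerom: "x \<in> Obj C \<Longrightarrow> y \<in> Obj C \<Longrightarrow> isz (zerom C x y)"
  unfolding isz_def by simp

lemma iszD: "isz f \<Longrightarrow> f \<in> Arr C" "isz f \<Longrightarrow> Dom C f = x \<Longrightarrow> Cod C f = y \<Longrightarrow> f = zerom C x y"
  unfolding isz_def by auto

lemma isz_comp_left: assumes "isz f" "g \<in> Arr C" "Dom C g = Cod C f" shows "isz (g \<cdot> f)"
proof -
  have f: "f \<in> Arr C" "f = zerom C (Dom C f) (Cod C f)" using assms unfolding isz_def by auto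
  have "g \<cdot> f = g \<cdot> zerom C (Dom C f) (Cod C f)" using f(2) by simp
  also have "\<dots> = zerom C (Dom C f) (Cod C g)" using f(1) assms(2,3) by simp
  finally show ?thesis unfolding isz_def using f(1) assms(2,3) by simp
qed

lemma isz_comp_right: assumes "isz g" "f \<in> Arr C" "Dom C g = Cod C f" shows "isz (g \<cdot> f)"
proof -
  have g: "g \<in> Arr C" "g = zerom C (Dom C g) (Cod C g)" using assms unfolding isz_def by auto
  have "g \<cdot> f = zerom C (Dom C g) (Cod C g) \<cdot> f" using g(2) by simp
  also have "\<dots> = zerom C (Dom C f) (Cod C g)" using g(1) assms(2,3) by simp
  finally show ?thesis unfolding isz_def using g(1) assms(2,3) by simp
qed

lemma isz_iso_left: assumes "is_iso C x y i" "f \<in> Hom C w x" "isz (i \<cdot> f)" shows "isz f"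
proof -
  obtain j where j: "i \<in> Hom C x y" "j \<in> Hom C y x" "j \<cdot> i = idm C x" using assms(1) by (rule isoE)
  have "isz (j \<cdot> (i \<cdot> f))" by (rule isz_comp_left[OF assms(3)]) (use j assms in \<open>auto simp: hom_iff\<close>)
  also have "j \<cdot> (i \<cdot> f) = j \<cdot> i \<cdot> f" using j(1,2) assms(2) by (simp add: hom_iff)
  finally show ?thesis unfolding j(3) using assms(2) by (simp add: hom_iff)
qed

lemma isz_iso_right: assumes "is_iso C x y i" "f \<in> Hom C y w" "isz (f \<cdot> i)" shows "isz f"
proof -
  obtain j where j: "i \<in> Hom C x y" "j \<in> Hom C y x" "i \<cdot> j = idm C y" using assms(1) by (rule isoE)
  have "isz (f \<cdot> i \<cdot> j)" by (rule isz_comp_right[OF assms(3)]) (use j assms in \<open>auto simp: hom_iff\<close>)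
  also have "f \<cdot> i \<cdot> j = f \<cdot> (i \<cdot> j)" using j assms(2) by (simp add: hom_iff)
  finally show ?thesis unfolding j(3) using assms(2) by (simp add: hom_iff)
qed

lemma isz_neg: assumes "isz f" shows "isz (neg C f)"
proof -
  have f: "f \<in> Arr C" "f = zerom C (Dom C f) (Cod C f)" using assms unfolding isz_def by auto
  have "neg C f = neg C (zerom C (Dom C f) (Cod C f))" using f(2) by simp
  also have "\<dots> = zerom C (Dom C f) (Cod C f)" by (rule neg_zero) (use f in auto)
  finally show ?thesis using f isz_zerom[of "Dom C f" "Cod C f"] by simp
qed

end

lemma cat_functorD:
  assumes "cat_functor C D Fo Fa"
  shows "x \<in> Obj C \<Longrightarrow> Fo x \<in> Obj D"
    and "x \<in> Obj C \<Longrightarrow> Fa (idm C x) = idm D (Fo x)"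
    and "f \<in> Hom C x y \<Longrightarrow> Fa f \<in> Hom D (Fo x) (Fo y)"
    and "\<lbrakk>f \<in> Hom C x y; g \<in> Hom C y z\<rbrakk> \<Longrightarrow> Fa (g \<cdot>\<^bsub>C\<^esub> f) = Fa g \<cdot>\<^bsub>D\<^esub> Fa f"
  using assms unfolding cat_functor_def by (simp, simp, simp, metis)

section \<open>Weak kernels, weak cokernels and split triangles\<close>

context triangulated_category begin

lemmas shift_functor = shift_additive[unfolded additive_functor_def, THEN conjunct1]

lemma sho_obj [simp]: "x \<in> Obj C \<Longrightarrow> Sho C x \<in> Obj C"
  by (rule cat_functorD(1)[OF shift_functor])

lemma sha_idm: "x \<in> Obj C \<Longrightarrow> Sha C (idm C x) = idm C (Sho C x)"
  by (rule cat_functorD(2)[OF shift_functor])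

lemma sha_hom: "f \<in> Hom C x y \<Longrightarrow> Sha C f \<in> Hom C (Sho C x) (Sho C y)"
  by (rule cat_functorD(3)[OF shift_functor])

lemma sha_arr [simp]:
  assumes "f \<in> Arr C" shows "Sha C f \<in> Arr C" "Dom C (Sha C f) = Sho C (Dom C f)" "Cod C (Sha C f) = Sho C (Cod C f)"
  using sha_hom[of f "Dom C f" "Cod C f"] assms by (auto simp: hom_iff)

lemma sha_comp: "\<lbrakk>f \<in> Hom C x y; g \<in> Hom C y z\<rbrakk> \<Longrightarrow> Sha C (g \<cdot> f) = Sha C g \<cdot> Sha C f"
  by (rule cat_functorD(4)[OF shift_functor])

lemma sha_comp_arr: "\<lbrakk>f \<in> Arr C; g \<in> Arr C; Dom C g = Cod C f\<rbrakk> \<Longrightarrow> Sha C (g \<cdot> f) = Sha C g \<cdot> Sha C f"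
  by (rule sha_comp[of f "Dom C f" "Cod C f" g "Cod C g"]) (auto simp: hom_iff)

lemma sha_add: "\<lbrakk>f \<in> Hom C x y; g \<in> Hom C x y\<rbrakk> \<Longrightarrow> Sha C (f \<boxplus> g) = Sha C f \<boxplus> Sha C g"
  using shift_additive unfolding additive_functor_def by blast

lemma sha_zero: assumes "x \<in> Obj C" "y \<in> Obj C" shows "Sha C (zerom C x y) = zerom C (Sho C x) (Sho C y)"
proof (rule addm_cancel)
  let ?z = "zerom C x y"
  show "Sha C ?z \<in> Hom C (Sho C x) (Sho C y)" "Sha C ?z \<in> Hom C (Sho C x) (Sho C y)" using sha_hom zerom_hom assms by auto
  show "zerom C (Sho C x) (Sho C y) \<in> Hom C (Sho C x) (Sho C y)" using zerom_hom assms by auto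
  show "Sha C ?z \<boxplus> Sha C ?z = Sha C ?z \<boxplus> zerom C (Sho C x) (Sho C y)"
    using sha_add[OF zerom_hom zerom_hom, of x y] assms by simp
qed

lemma sha_inj: assumes "f \<in> Hom C x y" "g \<in> Hom C x y" "Sha C f = Sha C g" shows "f = g"
proof -
  have "inj_on (Sha C) (Hom C x y)"
    using shift_fully_faithful hom_obj[OF assms(1)] unfolding fully_faithful_def bij_betw_def by blast
  thus ?thesis using assms unfolding inj_on_def by blast
qed

lemma sha_full:
  assumes "f \<in> Hom C (Sho C x) (Sho C y)" "x \<in> Obj C" "y \<in> Obj C"
  obtains g where "g \<in> Hom C x y" "Sha C g = f"
proof -
  have "Sha C ` Hom C x y = Hom C (Sho C x) (Sho C y)"
    using shift_fully_faithful assms unfolding fully_faithful_def bij_betw_def by blast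
  hence "f \<in> Sha C ` Hom C x y" using assms(1) by simp
  thus thesis by (rule imageE) (use that in auto)
qed

lemma isz_sha: assumes "f \<in> Arr C" shows "isz (Sha C f) \<longleftrightarrow> isz f"
proof
  assume "isz f"
  hence "f = zerom C (Dom C f) (Cod C f)" unfolding isz_def by blast
  hence "Sha C f = zerom C (Sho C (Dom C f)) (Sho C (Cod C f))" using sha_zero assms by (metis dom_obj)
  thus "isz (Sha C f)" using isz_zerom assms by simp
next
  assume "isz (Sha C f)"
  hence "Sha C f = Sha C (zerom C (Dom C f) (Cod C f))" using sha_zero assms unfolding isz_def by simp
  hence "f = zerom C (Dom C f) (Cod C f)"
    by (rule sha_inj[of f "Dom C f" "Cod C f", rotated -1]) (use assms zerom_hom in \<open>auto simp: hom_iff\<close>)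
  thus "isz f" unfolding isz_def using assms by simp
qed

lemma sha_iso: assumes "is_iso C x y f" shows "is_iso C (Sho C x) (Sho C y) (Sha C f)"
proof -
  obtain g where g: "f \<in> Hom C x y" "g \<in> Hom C y x" "g \<cdot> f = idm C x" "f \<cdot> g = idm C y" using assms by (rule isoE)
  show ?thesis
    by (rule isoI[OF sha_hom[OF g(1)] sha_hom[OF g(2)]])
      (simp_all add: sha_comp[OF g(1,2), symmetric] sha_comp[OF g(2,1), symmetric] g(3,4) sha_idm hom_obj[OF g(1)])
qed

lemma zero_object_sho: assumes "zero_object C z" shows "zero_object C (Sho C z)"
  using assms sha_idm[of z] sha_zero[of z z] unfolding zero_object_def by simp

definition tri :: "'o \<Rightarrow> 'o \<Rightarrow> 'o \<Rightarrow> 'a \<Rightarrow> 'a \<Rightarrow> 'a \<Rightarrow> bool" where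
  "tri x y z f g h \<longleftrightarrow> f \<in> Hom C x y \<and> g \<in> Hom C y z \<and> h \<in> Hom C z (Sho C x) \<and> (f, g, h) \<in> Tri C"

lemma tri_in:
  assumes "tri x y z f g h"
  shows "f \<in> Hom C x y" "g \<in> Hom C y z" "h \<in> Hom C z (Sho C x)" "(f, g, h) \<in> Tri C"
    "x \<in> Obj C" "y \<in> Obj C" "z \<in> Obj C"
  using assms hom_obj unfolding tri_def by blast+

lemma triI: "(f, g, h) \<in> Tri C \<Longrightarrow> tri (Dom C f) (Cod C f) (Cod C g) f g h"
  unfolding tri_def hom_iff using tri_typed by auto

lemma triI': assumes "(f, g, h) \<in> Tri C" "f \<in> Hom C x y" "Cod C g = z" shows "tri x y z f g h"
  using triI[OF assms(1)] assms(2,3) by (simp add: hom_iff)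

lemma ex_tri: assumes "f \<in> Hom C x y" obtains z g h where "tri x y z f g h"
  using tri_complete[of f] triI[of f] assms unfolding hom_iff by blast

lemma tri_rot: assumes "tri x y z f g h" shows "tri y z (Sho C x) g h (neg C (Sha C f))"
  using tri_rotate[of f x y g z h] tri_in[OF assms] neg_hom sha_hom unfolding tri_def by blast

lemma tri_rot_iff:
  assumes "f \<in> Hom C x y" "g \<in> Hom C y z" "h \<in> Hom C z (Sho C x)"
  shows "tri x y z f g h \<longleftrightarrow> tri y z (Sho C x) g h (neg C (Sha C f))"
  using tri_rotate[OF assms] assms neg_hom sha_hom unfolding tri_def by blast

lemma tri_idm: "x \<in> Obj C \<Longrightarrow> zero_object C z \<Longrightarrow> tri x x z (idm C x) (zerom C x z) (zerom C z (Sho C x))"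
  unfolding tri_def using tri_id idm_hom zerom_hom by (auto simp: zero_object_def)

text \<open>Rotation is read backwards: the rotated triangle is an identity triangle whose third
  object is the shift of \<open>z\<close>, so nothing has to be desuspended.\<close>

lemma tri_zero_idm:
  assumes x: "x \<in> Obj C" and z: "zero_object C z"
  shows "tri z x x (zerom C z x) (idm C x) (zerom C x (Sho C z))"
proof -
  have zo: "z \<in> Obj C" using z unfolding zero_object_def by blast
  have "neg C (Sha C (zerom C z x)) = zerom C (Sho C z) (Sho C x)" using sha_zero neg_zero x zo by simp
  thus ?thesis
    using tri_rot_iff[of "zerom C z x" z x "idm C x" x "zerom C x (Sho C z)"] tri_idm[OF x zero_object_sho[OF z]]
      zerom_hom idm_hom x zo by simp
qed

lemma tri_mor:
  assumes "tri x y z f g h" "tri x' y' z' f' g' h'" "a \<in> Hom C x x'" "b \<in> Hom C y y'" "b \<cdot> f = f' \<cdot> a"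
  obtains c where "c \<in> Hom C z z'" "c \<cdot> g = g' \<cdot> b" "h' \<cdot> c = Sha C a \<cdot> h"
proof -
  note T = tri_in[OF assms(1)] and T' = tri_in[OF assms(2)]
  have e: "Dom C f = x" "Dom C f' = x'" "Cod C f = y" "Cod C f' = y'" "Cod C g = z" "Cod C g' = z'"
    using T(1,2) T'(1,2) by (auto simp: hom_iff)
  show thesis using tri_morphism[OF T(4) T'(4), unfolded e, OF assms(3-5)] that by blast
qed

text \<open>Map the identity triangle of \<open>x\<close> to the given one by the identity and
  \<open>f\<close>; the completing arrow starts at a zero object.\<close>

lemma tri_comp_zero: assumes "tri x y z f g h" shows "g \<cdot> f = zerom C x z"
proof -
  note T = tri_in[OF assms]
  obtain w where w: "zero_object C w" using ex_zero_object by blast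
  hence wo: "w \<in> Obj C" unfolding zero_object_def by blast
  obtain c where c: "c \<in> Hom C w z" "c \<cdot> zerom C x w = g \<cdot> f"
    using tri_mor[OF tri_idm[OF T(5) w] assms idm_hom[OF T(5)] T(1)] T by (auto simp: hom_iff)
  thus ?thesis using T wo by (simp add: hom_iff)
qed

text \<open>The weak cokernel property: \<open>k\<close> and a zero arrow form a square towards the
  triangle 0 -> w -> w, and \<open>m\<close> is the completing arrow.\<close>

lemma tri_contra:
  assumes "tri x y z f g h" "k \<in> Hom C y w" "isz (k \<cdot> f)"
  obtains m where "m \<in> Hom C z w" "k = m \<cdot> g"
proof -
  note T = tri_in[OF assms(1)]
  obtain n where o: "zero_object C n" using ex_zero_object by blast
  hence oo: "n \<in> Obj C" unfolding zero_object_def by blast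
  have w: "w \<in> Obj C" using hom_obj assms(2) by blast
  have "k \<cdot> f = zerom C x w" using iszD(2)[OF assms(3)] T assms(2) by (simp add: hom_iff)
  hence "k \<cdot> f = zerom C n w \<cdot> zerom C x n" using oo w T by simp
  then obtain m where "m \<in> Hom C z w" "m \<cdot> g = idm C w \<cdot> k"
    using tri_mor[OF assms(1) tri_zero_idm[OF w o] zerom_hom[OF T(5) oo] assms(2)] by blast
  thus thesis using that assms(2) by (simp add: hom_iff)
qed

lemma neg_isz_comp: assumes "f \<in> Hom C x y" "g \<in> Hom C y z" "isz (neg C g \<cdot> f)" shows "isz (g \<cdot> f)"
  using isz_neg[OF assms(3)] neg_comp[OF assms(1,2)] neg_neg[OF comp_hom[OF assms(1,2)]] by simp

lemma isz_neg_comp: assumes "f \<in> Hom C x y" "g \<in> Hom C y z" "isz (g \<cdot> f)" shows "isz (neg C g \<cdot> f)"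
  using isz_neg[OF assms(3)] neg_comp[OF assms(1,2)] by simp

text \<open>The weak kernel property. Completion only supplies a third arrow, so both triangles are
  rotated until the wanted arrow stands there, as an arrow \<open>c\<close> between shifts;
  \<open>m\<close> exists because the shift is full. The rotation signs occur on both sides.\<close>

lemma tri_cov:
  assumes "tri x y z f g h" "k \<in> Hom C w y" "isz (g \<cdot> k)"
  obtains m where "m \<in> Hom C w x" "k = f \<cdot> m"
proof -
  note T = tri_in[OF assms(1)]
  obtain n where o: "zero_object C n" using ex_zero_object by blast
  hence oo: "n \<in> Obj C" unfolding zero_object_def by blast
  have w: "w \<in> Obj C" using hom_obj assms(2) by blast
  have "g \<cdot> k = zerom C w z" using iszD(2)[OF assms(3)] T assms(2) by (simp add: hom_iff)
  hence "zerom C n z \<cdot> zerom C w n = g \<cdot> k" using oo w T by simp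
  then obtain c where c: "c \<in> Hom C (Sho C w) (Sho C x)" "neg C (Sha C f) \<cdot> c = Sha C k \<cdot> neg C (Sha C (idm C w))"
    using tri_mor[OF tri_rot[OF tri_idm[OF w o]] tri_rot[OF assms(1)] assms(2) zerom_hom[OF oo T(7)]] by blast
  obtain m where m: "m \<in> Hom C w x" "Sha C m = c" using sha_full[OF c(1) w T(5)] by blast
  have fm: "f \<cdot> m \<in> Hom C w y" using comp_hom m T by blast
  have "neg C (Sha C (f \<cdot> m)) = neg C (Sha C k)"
  proof -
    have "neg C (Sha C (f \<cdot> m)) = neg C (Sha C f) \<cdot> c"
      using sha_comp[OF m(1) T(1)] neg_comp[OF c(1) sha_hom[OF T(1)]] m(2) by simp
    also have "\<dots> = neg C (Sha C k \<cdot> Sha C (idm C w))"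
      unfolding c(2) by (rule comp_neg[OF sha_hom[OF idm_hom[OF w]] sha_hom[OF assms(2)]])
    also have "Sha C k \<cdot> Sha C (idm C w) = Sha C k" using sha_idm[OF w] assms(2) by (simp add: hom_iff)
    finally show ?thesis .
  qed
  hence "neg C (neg C (Sha C (f \<cdot> m))) = neg C (neg C (Sha C k))" by simp
  hence "Sha C (f \<cdot> m) = Sha C k" using neg_neg[OF sha_hom[OF fm]] neg_neg[OF sha_hom[OF assms(2)]] by simp
  hence "f \<cdot> m = k" using sha_inj[OF fm assms(2)] by blast
  thus thesis using that m by blast
qed

lemma tri_comp_zero3: assumes "tri x y z f g h" shows "isz (Sha C f \<cdot> h)"
proof -
  note T = tri_in[OF assms]
  have "neg C (Sha C f) \<cdot> h = zerom C z (Sho C y)" by (rule tri_comp_zero[OF tri_rot[OF tri_rot[OF assms]]])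
  hence "isz (neg C (Sha C f) \<cdot> h)" using isz_zerom T by simp
  thus ?thesis by (rule neg_isz_comp[OF T(3) sha_hom[OF T(1)]])
qed

lemma tri_contra2:
  assumes "tri x y z f g h" "k \<in> Hom C z w" "isz (k \<cdot> g)"
  obtains m where "m \<in> Hom C (Sho C x) w" "k = m \<cdot> h"
  by (rule tri_contra[OF tri_rot[OF assms(1)] assms(2,3)])

lemma tri_cov2:
  assumes "tri x y z f g h" "k \<in> Hom C w z" "isz (h \<cdot> k)"
  obtains m where "m \<in> Hom C w y" "k = g \<cdot> m"
  by (rule tri_cov[OF tri_rot[OF assms(1)] assms(2,3)])

lemma tri_cov3:
  assumes "tri x y z f g h" "k \<in> Hom C w (Sho C x)" "isz (Sha C f \<cdot> k)"
  obtains m where "m \<in> Hom C w z" "k = h \<cdot> m"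
  by (rule tri_cov[OF tri_rot[OF tri_rot[OF assms(1)]] assms(2)
      isz_neg_comp[OF assms(2) sha_hom[OF tri_in(1)[OF assms(1)]] assms(3)]])

text \<open>The retraction forces \<open>h = 0\<close>, since \<open>Sha C f\<close> composed with
  \<open>h\<close> vanishes. So \<open>g\<close> is an epimorphism, and the remainder
  \<open>id - f p\<close>, which kills \<open>f\<close>, factors through \<open>g\<close> by a
  section \<open>j\<close>. This connects retracts, in terms of which ideals are treated below, with
  the biproduct summands in \<open>thick\<close>.\<close>

lemma split_biproduct:
  assumes t: "tri x y z f g h" and p: "p \<in> Hom C y x" "p \<cdot> f = idm C x"
  shows "is_biproduct C x z y"
proof -
  note T = tri_in[OF t]
  have "isz (Sha C p \<cdot> (Sha C f \<cdot> h))"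
    by (rule isz_comp_left[OF tri_comp_zero3[OF t]]) (use T p in \<open>auto simp: hom_iff\<close>)
  also have "Sha C p \<cdot> (Sha C f \<cdot> h) = Sha C p \<cdot> Sha C f \<cdot> h" using T p by (simp add: hom_iff)
  also have "Sha C p \<cdot> Sha C f = idm C (Sho C x)" using sha_comp[OF T(1) p(1)] p(2) sha_idm T(5) by simp
  finally have h: "isz h" using T(3) by (simp add: hom_iff)
  let ?e = "sub (idm C y) (f \<cdot> p)"
  have fp: "f \<cdot> p \<in> Hom C y y" using comp_hom p(1) T(1) by blast
  have e: "?e \<in> Hom C y y" using sub_hom idm_hom T fp by blast
  have "?e \<cdot> f = zerom C x y"
    using sub_comp[OF T(1) idm_hom[OF T(6)] fp] T p sub_self[OF T(1)] by (simp add: hom_iff)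
  hence "isz (?e \<cdot> f)" using isz_zerom T by simp
  then obtain j where j: "j \<in> Hom C z y" "?e = j \<cdot> g" using tri_contra[OF t e] by blast
  have gf: "g \<cdot> f = zerom C x z" by (rule tri_comp_zero[OF t])
  have ge: "g \<cdot> ?e = g"
  proof -
    have "g \<cdot> ?e = sub (g \<cdot> idm C y) (g \<cdot> (f \<cdot> p))" by (rule comp_sub[OF idm_hom[OF T(6)] fp T(2)])
    also have "g \<cdot> (f \<cdot> p) = g \<cdot> f \<cdot> p" using T p by (simp add: hom_iff)
    also have "\<dots> = zerom C y z" unfolding gf using T p by (simp add: hom_iff)
    finally show ?thesis using T neg_zero unfolding sub_def by (simp add: hom_iff)
  qed
  have pe: "p \<cdot> ?e = zerom C y x"
  proof -
    have "p \<cdot> ?e = sub (p \<cdot> idm C y) (p \<cdot> (f \<cdot> p))" by (rule comp_sub[OF idm_hom[OF T(6)] fp p(1)])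
    also have "p \<cdot> (f \<cdot> p) = p \<cdot> f \<cdot> p" using T p(1) by (simp add: hom_iff)
    also have "\<dots> = p" unfolding p(2) using p(1) by (simp add: hom_iff)
    finally show ?thesis using p(1) sub_self[OF p(1)] by (simp add: hom_iff)
  qed
  have epi: "k = zerom C z w" if k: "k \<in> Hom C z w" "isz (k \<cdot> g)" for k w
  proof -
    obtain m where m: "m \<in> Hom C (Sho C x) w" "k = m \<cdot> h" using tri_contra2[OF t k] by blast
    have "isz k" unfolding m(2) by (rule isz_comp_left[OF h]) (use m T in \<open>auto simp: hom_iff\<close>)
    thus ?thesis using iszD(2) k(1) by (simp add: hom_iff)
  qed
  have gj: "g \<cdot> j = idm C z"
  proof -
    have gj': "g \<cdot> j \<in> Hom C z z" using comp_hom j T by blast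
    have "g \<cdot> j \<cdot> g = g" using ge j T by (simp add: hom_iff)
    hence "sub (g \<cdot> j) (idm C z) \<cdot> g = zerom C y z"
      using sub_comp[OF T(2) gj' idm_hom[OF T(7)]] sub_self[OF T(2)] T by (simp add: hom_iff)
    hence "isz (sub (g \<cdot> j) (idm C z) \<cdot> g)" using isz_zerom T by simp
    hence "sub (g \<cdot> j) (idm C z) = zerom C z z" using epi sub_hom[OF gj' idm_hom[OF T(7)]] by blast
    thus ?thesis by (rule sub_zero_eq[OF gj' idm_hom[OF T(7)]])
  qed
  have pj: "p \<cdot> j = zerom C z x"
  proof (rule epi)
    show "p \<cdot> j \<in> Hom C z x" using comp_hom p(1) j by blast
    have "p \<cdot> j \<cdot> g = zerom C y x" using pe j p T by (simp add: hom_iff)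
    thus "isz (p \<cdot> j \<cdot> g)" using isz_zerom T by simp
  qed
  have sum: "f \<cdot> p \<boxplus> j \<cdot> g = idm C y"
    unfolding j(2)[symmetric] using sub_add[OF idm_hom[OF T(6)] fp] addm_commute[OF fp e] by simp
  show ?thesis unfolding is_biproduct_def
    using T(1,2) p j(1) gj gf pj sum by blast
qed

lemma iso_tri:
  assumes f: "is_iso C x y f" and z: "zero_object C z"
  shows "tri x y z f (zerom C y z) (zerom C z (Sho C x))"
proof -
  obtain g where g: "is_iso C y x g" "g \<cdot> f = idm C x" "f \<cdot> g = idm C y" using iso_inverse_ex[OF f] by blast
  have xy: "f \<in> Hom C x y" "x \<in> Obj C" "y \<in> Obj C" "z \<in> Obj C"
    using iso_hom[OF f] hom_obj z unfolding zero_object_def by auto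
  have "(f, zerom C y z, zerom C z (Sho C x)) \<in> Tri C"
    by (rule tri_iso[of "idm C x" "zerom C x z" "zerom C z (Sho C x)" f x y "zerom C y z" z _ "idm C x" f "idm C z"])
      (use tri_id[OF xy(2) z] xy f zerom_hom iso_idm sha_idm in \<open>auto simp: hom_iff\<close>)
  thus ?thesis unfolding tri_def using xy zerom_hom by auto
qed

lemma octa:
  assumes "tri x y z f f1 f2" "tri y w v g g1 g2" "tri x w u (g \<cdot> f) k1 k2"
  obtains a b where "tri z u v a b (Sha C f1 \<cdot> g2)" "a \<cdot> f1 = k1 \<cdot> g" "b \<cdot> k1 = g1"
proof -
  note T = tri_in[OF assms(1)] and T2 = tri_in[OF assms(2)] and T3 = tri_in[OF assms(3)]
  obtain a b where ab: "a \<in> Hom C (Cod C f1) (Cod C k1)" "b \<in> Hom C (Cod C k1) (Cod C g1)"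
    "(a, b, Sha C f1 \<cdot> g2) \<in> Tri C" "a \<cdot> f1 = k1 \<cdot> g" "b \<cdot> k1 = g1"
    using octahedral[OF T(1) T2(1) T(4) T2(4) T3(4)] by blast
  have "tri z u v a b (Sha C f1 \<cdot> g2)"
    by (rule triI'[OF ab(3)]) (use ab T T2 T3 in \<open>auto simp: hom_iff\<close>)
  thus thesis using that ab by blast
qed

end

section \<open>Tensor products and null arrows\<close>

context symmetric_monoidal_category begin

lemma tobj_closed [simp]: "x \<in> Obj C \<Longrightarrow> y \<in> Obj C \<Longrightarrow> x \<odot> y \<in> Obj C" by (rule tobj_obj)

lemma unit_closed [simp]: "unit C \<in> Obj C" by (rule unit_obj)

lemma tarr_arr [simp]:
  assumes "f \<in> Arr C" "g \<in> Arr C"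
  shows "f \<star> g \<in> Arr C" "Dom C (f \<star> g) = Dom C f \<odot> Dom C g" "Cod C (f \<star> g) = Cod C f \<odot> Cod C g"
  using tarr_hom[of f "Dom C f" "Cod C f" g "Dom C g" "Cod C g"] assms by (auto simp: hom_iff)

lemma tarr_comp_arr:
  assumes "f \<in> Arr C" "f' \<in> Arr C" "g \<in> Arr C" "g' \<in> Arr C" "Dom C f' = Cod C f" "Dom C g' = Cod C g"
  shows "(f' \<star> g') \<cdot> (f \<star> g) = (f' \<cdot> f) \<star> (g' \<cdot> g)"
  by (rule tarr_comp[symmetric]) (use assms in \<open>auto simp: hom_iff\<close>)

lemma tarr_idm_arr [simp]: "x \<in> Obj C \<Longrightarrow> y \<in> Obj C \<Longrightarrow> idm C x \<star> idm C y = idm C (x \<odot> y)"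
  by (rule tarr_idm)

lemma assoc_hom: "\<lbrakk>x \<in> Obj C; y \<in> Obj C; z \<in> Obj C\<rbrakk> \<Longrightarrow> assoc C x y z \<in> Hom C ((x \<odot> y) \<odot> z) (x \<odot> (y \<odot> z))"
  by (rule iso_hom[OF assoc_iso])

lemma assoc_in [simp]:
  assumes "x \<in> Obj C" "y \<in> Obj C" "z \<in> Obj C"
  shows "assoc C x y z \<in> Arr C" "Dom C (assoc C x y z) = (x \<odot> y) \<odot> z" "Cod C (assoc C x y z) = x \<odot> (y \<odot> z)"
  using assoc_hom[OF assms] by (auto simp: hom_iff)

lemma braid_in [simp]:
  assumes "x \<in> Obj C" "y \<in> Obj C"
  shows "braid C x y \<in> Arr C" "Dom C (braid C x y) = x \<odot> y" "Cod C (braid C x y) = y \<odot> x"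
  using iso_hom[OF braid_iso[OF assms]] by (auto simp: hom_iff)

lemma lunit_in [simp]:
  assumes "x \<in> Obj C"
  shows "lunit C x \<in> Arr C" "Dom C (lunit C x) = unit C \<odot> x" "Cod C (lunit C x) = x"
  using iso_hom[OF lunit_iso[OF assms]] by (auto simp: hom_iff)

lemma runit_in [simp]:
  assumes "x \<in> Obj C"
  shows "runit C x \<in> Arr C" "Dom C (runit C x) = x \<odot> unit C" "Cod C (runit C x) = x"
  using iso_hom[OF runit_iso[OF assms]] by (auto simp: hom_iff)

lemma tarr_iso:
  assumes "is_iso C x y f" "is_iso C x' y' g" shows "is_iso C (x \<odot> x') (y \<odot> y') (f \<star> g)"
proof -
  obtain f' where f: "f \<in> Hom C x y" "f' \<in> Hom C y x" "f' \<cdot> f = idm C x" "f \<cdot> f' = idm C y" using assms(1) by (rule isoE)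
  obtain g' where g: "g \<in> Hom C x' y'" "g' \<in> Hom C y' x'" "g' \<cdot> g = idm C x'" "g \<cdot> g' = idm C y'" using assms(2) by (rule isoE)
  show ?thesis
    by (rule isoI[OF tarr_hom[OF f(1) g(1)] tarr_hom[OF f(2) g(2)]])
      (simp_all add: tarr_comp[OF f(1,2) g(1,2), symmetric] tarr_comp[OF f(2,1) g(2,1), symmetric] f(3,4) g(3,4)
        hom_obj[OF f(1)] hom_obj[OF g(1)])
qed

text \<open>Modulo this relation the tensor product of arrows is associative and commutative, so that vanishing of
  tensor products can be tracked without coherence diagrams.\<close>

definition eqv :: "'a \<Rightarrow> 'a \<Rightarrow> bool" (infix "\<doteq>" 50) where
  "f \<doteq> g \<longleftrightarrow> f \<in> Arr C \<and> g \<in> Arr C \<and>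
     (\<exists>a b. is_iso C (Dom C f) (Dom C g) a \<and> is_iso C (Cod C f) (Cod C g) b \<and> b \<cdot> f = g \<cdot> a)"

lemma eqvI:
  assumes "f \<in> Hom C x y" "g \<in> Hom C x' y'" "is_iso C x x' a" "is_iso C y y' b" "b \<cdot> f = g \<cdot> a"
  shows "f \<doteq> g"
  using assms unfolding eqv_def hom_iff by blast

lemma eqvE:
  assumes "f \<doteq> g"
  obtains a b where "f \<in> Hom C (Dom C f) (Cod C f)" "g \<in> Hom C (Dom C g) (Cod C g)"
    "is_iso C (Dom C f) (Dom C g) a" "is_iso C (Cod C f) (Cod C g) b" "b \<cdot> f = g \<cdot> a"
  using assms unfolding eqv_def hom_iff by blast

lemma eqv_refl: "f \<in> Arr C \<Longrightarrow> f \<doteq> f"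
  by (rule eqvI[of f "Dom C f" "Cod C f" f _ _ "idm C (Dom C f)" "idm C (Cod C f)"]) (auto simp: hom_iff iso_idm)

lemma eqv_arr: "f \<doteq> g \<Longrightarrow> f \<in> Arr C" "f \<doteq> g \<Longrightarrow> g \<in> Arr C"
  unfolding eqv_def by auto

lemma eqv_sym: assumes "f \<doteq> g" shows "g \<doteq> f"
proof -
  obtain a b where h: "f \<in> Hom C (Dom C f) (Cod C f)" "g \<in> Hom C (Dom C g) (Cod C g)"
    "is_iso C (Dom C f) (Dom C g) a" "is_iso C (Cod C f) (Cod C g) b" "b \<cdot> f = g \<cdot> a" using assms by (rule eqvE)
  obtain a' where a': "is_iso C (Dom C g) (Dom C f) a'" "a' \<cdot> a = idm C (Dom C f)" "a \<cdot> a' = idm C (Dom C g)"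
    using iso_inverse_ex[OF h(3)] by blast
  obtain b' where b': "is_iso C (Cod C g) (Cod C f) b'" "b' \<cdot> b = idm C (Cod C f)" "b \<cdot> b' = idm C (Cod C g)"
    using iso_inverse_ex[OF h(4)] by blast
  note H = h(1,2) iso_hom[OF h(3)] iso_hom[OF h(4)] iso_hom[OF a'(1)] iso_hom[OF b'(1)]
  have "b' \<cdot> g = b' \<cdot> g \<cdot> (a \<cdot> a')" unfolding a'(3) using H by (simp add: hom_iff)
  also have "\<dots> = b' \<cdot> (g \<cdot> a) \<cdot> a'" using H by (simp add: hom_iff)
  also have "\<dots> = (b' \<cdot> b) \<cdot> (f \<cdot> a')" unfolding h(5)[symmetric] using H by (simp add: hom_iff)
  also have "\<dots> = f \<cdot> a'" unfolding b'(2) using H by (simp add: hom_iff)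
  finally show ?thesis by (rule eqvI[OF h(2,1) a'(1) b'(1)])
qed

lemma eqv_trans [trans]: assumes "f \<doteq> g" "g \<doteq> h" shows "f \<doteq> h"
proof -
  obtain a b where 1: "f \<in> Hom C (Dom C f) (Cod C f)" "g \<in> Hom C (Dom C g) (Cod C g)"
    "is_iso C (Dom C f) (Dom C g) a" "is_iso C (Cod C f) (Cod C g) b" "b \<cdot> f = g \<cdot> a" using assms(1) by (rule eqvE)
  obtain c d where 2: "g \<in> Hom C (Dom C g) (Cod C g)" "h \<in> Hom C (Dom C h) (Cod C h)"
    "is_iso C (Dom C g) (Dom C h) c" "is_iso C (Cod C g) (Cod C h) d" "d \<cdot> g = h \<cdot> c" using assms(2) by (rule eqvE)
  note H = 1(1,2) 2(2) iso_hom[OF 1(3)] iso_hom[OF 1(4)] iso_hom[OF 2(3)] iso_hom[OF 2(4)]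
  have "d \<cdot> b \<cdot> f = d \<cdot> (b \<cdot> f)" using H by (simp add: hom_iff)
  also have "\<dots> = (d \<cdot> g) \<cdot> a" unfolding 1(5) using H by (simp add: hom_iff)
  also have "\<dots> = h \<cdot> (c \<cdot> a)" unfolding 2(5) using H by (simp add: hom_iff)
  finally show ?thesis by (rule eqvI[OF 1(1) 2(2) iso_comp[OF 1(3) 2(3)] iso_comp[OF 1(4) 2(4)]])
qed

lemma eqv_tarr: assumes "f \<doteq> f'" "g \<doteq> g'" shows "f \<star> g \<doteq> f' \<star> g'"
proof -
  obtain a b where 1: "f \<in> Hom C (Dom C f) (Cod C f)" "f' \<in> Hom C (Dom C f') (Cod C f')"
    "is_iso C (Dom C f) (Dom C f') a" "is_iso C (Cod C f) (Cod C f') b" "b \<cdot> f = f' \<cdot> a" using assms(1) by (rule eqvE)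
  obtain c d where 2: "g \<in> Hom C (Dom C g) (Cod C g)" "g' \<in> Hom C (Dom C g') (Cod C g')"
    "is_iso C (Dom C g) (Dom C g') c" "is_iso C (Cod C g) (Cod C g') d" "d \<cdot> g = g' \<cdot> c" using assms(2) by (rule eqvE)
  have "(b \<star> d) \<cdot> (f \<star> g) = (f' \<star> g') \<cdot> (a \<star> c)"
    using tarr_comp[OF 1(1) iso_hom[OF 1(4)] 2(1) iso_hom[OF 2(4)]] tarr_comp[OF iso_hom[OF 1(3)] 1(2) iso_hom[OF 2(3)] 2(2)]
      1(5) 2(5) by simp
  thus ?thesis by (rule eqvI[OF tarr_hom[OF 1(1) 2(1)] tarr_hom[OF 1(2) 2(2)] tarr_iso[OF 1(3) 2(3)] tarr_iso[OF 1(4) 2(4)]])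
qed

lemma eqv_comm: assumes "f \<in> Arr C" "g \<in> Arr C" shows "f \<star> g \<doteq> g \<star> f"
proof -
  have f: "f \<in> Hom C (Dom C f) (Cod C f)" "g \<in> Hom C (Dom C g) (Cod C g)" using assms by (auto simp: hom_iff)
  show ?thesis
    by (rule eqvI[OF tarr_hom[OF f] tarr_hom[OF f(2,1)] braid_iso braid_iso braid_natural[OF f]]) (use assms in auto)
qed

lemma eqv_assoc: assumes "f \<in> Arr C" "g \<in> Arr C" "h \<in> Arr C" shows "(f \<star> g) \<star> h \<doteq> f \<star> (g \<star> h)"
proof -
  have f: "f \<in> Hom C (Dom C f) (Cod C f)" "g \<in> Hom C (Dom C g) (Cod C g)" "h \<in> Hom C (Dom C h) (Cod C h)"
    using assms by (auto simp: hom_iff)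
  show ?thesis
    by (rule eqvI[OF tarr_hom[OF tarr_hom[OF f(1,2)] f(3)] tarr_hom[OF f(1) tarr_hom[OF f(2,3)]] assoc_iso assoc_iso
          assoc_natural[OF f]]) (use assms in auto)
qed

lemma eqv_lcomm: assumes "f \<in> Arr C" "g \<in> Arr C" "h \<in> Arr C" shows "f \<star> (g \<star> h) \<doteq> g \<star> (f \<star> h)"
proof -
  have "f \<star> (g \<star> h) \<doteq> (f \<star> g) \<star> h" by (rule eqv_sym[OF eqv_assoc[OF assms]])
  also have "(f \<star> g) \<star> h \<doteq> (g \<star> f) \<star> h" by (rule eqv_tarr[OF eqv_comm eqv_refl]) (use assms in auto)
  also have "(g \<star> f) \<star> h \<doteq> g \<star> (f \<star> h)" by (rule eqv_assoc) (use assms in auto)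
  finally show ?thesis .
qed

lemma eqv_iso_comp:
  assumes "is_iso C x' x a" "f \<in> Hom C x y" "is_iso C y y' b" shows "b \<cdot> f \<cdot> a \<doteq> f"
proof -
  obtain c where c: "is_iso C y' y c" "c \<cdot> b = idm C y" "b \<cdot> c = idm C y'" using iso_inverse_ex[OF assms(3)] by blast
  note H = iso_hom[OF assms(1)] iso_hom[OF assms(3)] iso_hom[OF c(1)] assms(2)
  have "c \<cdot> (b \<cdot> f \<cdot> a) = c \<cdot> b \<cdot> (f \<cdot> a)" using H by (simp add: hom_iff)
  also have "\<dots> = f \<cdot> a" unfolding c(2) using H by (simp add: hom_iff)
  finally show ?thesis by (rule eqvI[OF _ assms(2) assms(1) c(1), rotated]) (use H in \<open>auto simp: hom_iff\<close>)
qed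

end

section \<open>Exactness of the tensor product and arrows killed by tensoring\<close>

context tt_category begin

lemma isz_eqv: assumes "f \<doteq> g" shows "isz f \<longleftrightarrow> isz g"
proof -
  have *: "isz g" if fg: "f \<doteq> g" "isz f" for f g
  proof -
    obtain a b where h: "f \<in> Hom C (Dom C f) (Cod C f)" "g \<in> Hom C (Dom C g) (Cod C g)"
      "is_iso C (Dom C f) (Dom C g) a" "is_iso C (Cod C f) (Cod C g) b" "b \<cdot> f = g \<cdot> a" using fg(1) by (rule eqvE)
    have "isz (b \<cdot> f)" by (rule isz_comp_left[OF fg(2)]) (use iso_hom[OF h(4)] in \<open>auto simp: hom_iff\<close>)
    thus ?thesis unfolding h(5) by (rule isz_iso_right[OF h(3,2)])
  qed
  show ?thesis using * assms eqv_sym[OF assms] by blast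
qed

lemma isz_tarr_left: assumes "isz f" "g \<in> Arr C" shows "isz (f \<star> g)"
proof -
  let ?z = "zerom C (Dom C f) (Cod C f)"
  have f: "f \<in> Arr C" "f = ?z" using assms(1) unfolding isz_def by auto
  have z: "?z \<in> Hom C (Dom C f) (Cod C f)" by (rule zerom_hom) (use f(1) in auto)
  have g: "g \<in> Hom C (Dom C g) (Cod C g)" using assms(2) by (simp add: hom_iff)
  have t: "?z \<star> g \<in> Hom C (Dom C f \<odot> Dom C g) (Cod C f \<odot> Cod C g)" by (rule tarr_hom[OF z g])
  have zz: "?z \<boxplus> ?z = ?z" using f(1) by simp
  have "?z \<star> g \<boxplus> ?z \<star> g = ?z \<star> g \<boxplus> zerom C (Dom C f \<odot> Dom C g) (Cod C f \<odot> Cod C g)"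
    unfolding tarr_addm[OF z z g, symmetric] zz using t by (simp add: hom_iff)
  hence "?z \<star> g = zerom C (Dom C f \<odot> Dom C g) (Cod C f \<odot> Cod C g)"
    by (rule addm_cancel[OF t t, rotated]) (use zerom_hom f(1) assms(2) in auto)
  hence "isz (?z \<star> g)" using isz_zerom f(1) assms(2) by simp
  thus ?thesis using f(2) by simp
qed

lemma isz_tarr_right: assumes "isz f" "g \<in> Arr C" shows "isz (g \<star> f)"
  using isz_eqv[OF eqv_comm[of f g]] isz_tarr_left[OF assms] assms iszD(1)[OF assms(1)] by blast

lemma tsh_in [simp]:
  assumes "x \<in> Obj C" "y \<in> Obj C"
  shows "tsh C x y \<in> Arr C" "Dom C (tsh C x y) = Sho C x \<odot> y" "Cod C (tsh C x y) = Sho C (x \<odot> y)"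
  using iso_hom[OF tsh_iso[OF assms]] by (auto simp: hom_iff)

lemma eqv_sha: assumes "f \<in> Arr C" "g \<in> Arr C" shows "Sha C f \<star> g \<doteq> Sha C (f \<star> g)"
proof -
  have f: "f \<in> Hom C (Dom C f) (Cod C f)" "g \<in> Hom C (Dom C g) (Cod C g)" using assms by (auto simp: hom_iff)
  show ?thesis
    by (rule eqvI[OF tarr_hom[OF sha_hom[OF f(1)] f(2)] sha_hom[OF tarr_hom[OF f]] tsh_iso tsh_iso tsh_natural[OF f]])
      (use assms in auto)
qed

lemma tsh'_iso: assumes "x \<in> Obj C" "y \<in> Obj C" shows "is_iso C (x \<odot> Sho C y) (Sho C (x \<odot> y)) (tsh' C x y)"
proof -
  have "is_iso C (x \<odot> Sho C y) (Sho C (x \<odot> y)) (Sha C (braid C y x) \<cdot> (tsh C y x \<cdot> braid C x (Sho C y)))"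
    by (rule iso_comp[OF iso_comp[OF braid_iso tsh_iso] sha_iso[OF braid_iso]]) (use assms in auto)
  also have "Sha C (braid C y x) \<cdot> (tsh C y x \<cdot> braid C x (Sho C y)) = tsh' C x y"
    unfolding tsh'_def using assms by simp
  finally show ?thesis .
qed

lemma tsh'_in [simp]:
  assumes "x \<in> Obj C" "y \<in> Obj C"
  shows "tsh' C x y \<in> Arr C" "Dom C (tsh' C x y) = x \<odot> Sho C y" "Cod C (tsh' C x y) = Sho C (x \<odot> y)"
  using iso_hom[OF tsh'_iso[OF assms]] by (auto simp: hom_iff)

lemma tsh'_natural:
  assumes f: "f \<in> Hom C x x'" and g: "g \<in> Hom C y y'"
  shows "tsh' C x' y' \<cdot> (f \<star> Sha C g) = Sha C (f \<star> g) \<cdot> tsh' C x y"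
proof -
  have o: "x \<in> Obj C" "x' \<in> Obj C" "y \<in> Obj C" "y' \<in> Obj C" using hom_obj assms by auto
  have H: "f \<in> Arr C" "g \<in> Arr C" "Dom C f = x" "Cod C f = x'" "Dom C g = y" "Cod C g = y'" using f g by (auto simp: hom_iff)
  let ?b = "\<lambda>x y. braid C x y"
  have "tsh' C x' y' \<cdot> (f \<star> Sha C g) = Sha C (?b y' x') \<cdot> (tsh C y' x' \<cdot> (?b x' (Sho C y') \<cdot> (f \<star> Sha C g)))"
    unfolding tsh'_def using o H by simp
  also have "?b x' (Sho C y') \<cdot> (f \<star> Sha C g) = (Sha C g \<star> f) \<cdot> ?b x (Sho C y)" by (rule braid_natural[OF f sha_hom[OF g]])
  also have "Sha C (?b y' x') \<cdot> (tsh C y' x' \<cdot> ((Sha C g \<star> f) \<cdot> ?b x (Sho C y))) =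
      Sha C (?b y' x') \<cdot> ((tsh C y' x' \<cdot> (Sha C g \<star> f)) \<cdot> ?b x (Sho C y))" using o H by simp
  also have "tsh C y' x' \<cdot> (Sha C g \<star> f) = Sha C (g \<star> f) \<cdot> tsh C y x" by (rule tsh_natural[OF g f])
  also have "Sha C (?b y' x') \<cdot> (Sha C (g \<star> f) \<cdot> tsh C y x \<cdot> ?b x (Sho C y)) =
      Sha C (?b y' x') \<cdot> Sha C (g \<star> f) \<cdot> (tsh C y x \<cdot> ?b x (Sho C y))" using o H by simp
  also have "Sha C (?b y' x') \<cdot> Sha C (g \<star> f) = Sha C (?b y' x' \<cdot> (g \<star> f))" using sha_comp_arr o H by simp
  also have "?b y' x' \<cdot> (g \<star> f) = (f \<star> g) \<cdot> ?b y x" by (rule braid_natural[OF g f])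
  also have "Sha C ((f \<star> g) \<cdot> ?b y x) = Sha C (f \<star> g) \<cdot> Sha C (?b y x)" using sha_comp_arr o H by simp
  also have "Sha C (f \<star> g) \<cdot> Sha C (?b y x) \<cdot> (tsh C y x \<cdot> ?b x (Sho C y)) = Sha C (f \<star> g) \<cdot> tsh' C x y"
    unfolding tsh'_def using o H by simp
  finally show ?thesis .
qed

lemma tri_tensor:
  assumes "tri x y z f g h" "w \<in> Obj C"
  shows "tri (x \<odot> w) (y \<odot> w) (z \<odot> w) (f \<star> idm C w) (g \<star> idm C w) (tsh C x w \<cdot> (h \<star> idm C w))"
proof -
  note T = tri_in[OF assms(1)]
  have "Dom C f = x" using T by (simp add: hom_iff)
  thus ?thesis using triI'[OF tensor_exact[OF T(4) assms(2)]] T assms(2) by (simp add: hom_iff)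
qed

text \<open>The braiding maps the triangle tensored on the right isomorphically to this one;
  \<open>tsh'\<close> is the conjugate of \<open>tsh\<close> by braidings, which gives the third
  square.\<close>

lemma tri_tensor_left:
  assumes t: "tri x y z f g h" and w: "w \<in> Obj C"
  shows "tri (w \<odot> x) (w \<odot> y) (w \<odot> z) (idm C w \<star> f) (idm C w \<star> g) (tsh' C w x \<cdot> (idm C w \<star> h))"
proof -
  note T = tri_in[OF t] and T' = tri_in[OF tri_tensor[OF t w]]
  let ?b = "\<lambda>x. braid C x w"
  have H: "f \<in> Arr C" "g \<in> Arr C" "h \<in> Arr C" "Dom C f = x" "Cod C f = y" "Dom C g = y" "Cod C g = z" "Dom C h = z"
    "Cod C h = Sho C x" using T by (auto simp: hom_iff)
  have "tsh' C w x \<cdot> (idm C w \<star> h) \<cdot> ?b z = Sha C (?b x) \<cdot> (tsh C x w \<cdot> (braid C w (Sho C x) \<cdot> (idm C w \<star> h) \<cdot> ?b z))"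
    unfolding tsh'_def using T(5-7) w H by simp
  also have "braid C w (Sho C x) \<cdot> (idm C w \<star> h) = (h \<star> idm C w) \<cdot> braid C w z"
    by (rule braid_natural[OF idm_hom[OF w] T(3)])
  also have "(h \<star> idm C w) \<cdot> braid C w z \<cdot> ?b z = h \<star> idm C w"
    using braid_braid[OF T(7) w] T(5-7) w H by simp
  finally have 3: "Sha C (?b x) \<cdot> (tsh C x w \<cdot> (h \<star> idm C w)) = tsh' C w x \<cdot> (idm C w \<star> h) \<cdot> ?b z" by simp
  have "(idm C w \<star> f, idm C w \<star> g, tsh' C w x \<cdot> (idm C w \<star> h)) \<in> Tri C"
  proof (rule tri_iso[OF T'(4)])
    show "Sha C (?b x) \<cdot> (tsh C x w \<cdot> (h \<star> idm C w)) = tsh' C w x \<cdot> (idm C w \<star> h) \<cdot> ?b z" by (rule 3)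
    show "?b y \<cdot> (f \<star> idm C w) = (idm C w \<star> f) \<cdot> ?b x" by (rule braid_natural[OF T(1) idm_hom[OF w]])
    show "?b z \<cdot> (g \<star> idm C w) = (idm C w \<star> g) \<cdot> ?b y" by (rule braid_natural[OF T(2) idm_hom[OF w]])
    show "is_iso C (Dom C (f \<star> idm C w)) (w \<odot> x) (?b x)" using braid_iso T(5) w H by simp
    show "is_iso C (Cod C (f \<star> idm C w)) (w \<odot> y) (?b y)" using braid_iso T(6) w H by simp
    show "is_iso C (Cod C (g \<star> idm C w)) (w \<odot> z) (?b z)" using braid_iso T(7) w H by simp
  qed (use T w H in \<open>auto simp: hom_iff\<close>)
  thus ?thesis unfolding tri_def using T w H by (auto simp: hom_iff)
qed

lemma tens_cov2:
  assumes t: "tri x y z f g h" and w: "w \<in> Obj C" and k: "k \<in> Hom C v (w \<odot> z)" "isz ((idm C w \<star> h) \<cdot> k)"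
  obtains m where "m \<in> Hom C v (w \<odot> y)" "k = (idm C w \<star> g) \<cdot> m"
proof -
  note T = tri_in[OF t]
  have "isz (tsh' C w x \<cdot> ((idm C w \<star> h) \<cdot> k))"
    by (rule isz_comp_left[OF k(2)]) (use T w k(1) in \<open>auto simp: hom_iff\<close>)
  hence "isz (tsh' C w x \<cdot> (idm C w \<star> h) \<cdot> k)" using T w k(1) by (simp add: hom_iff)
  thus thesis using tri_cov2[OF tri_tensor_left[OF t w] k(1)] that by blast
qed

text \<open>A tensored triangle carries the isomorphism \<open>tsh'\<close> on its connecting arrow.
  Naturality moves it past the shifted arrow, and it is cancelled at the end.\<close>

lemma tens_cov3:
  assumes t: "tri x y z f g h" and w: "w \<in> Obj C" and k: "k \<in> Hom C v (w \<odot> Sho C x)" "isz ((idm C w \<star> Sha C f) \<cdot> k)"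
  obtains m where "m \<in> Hom C v (w \<odot> z)" "k = (idm C w \<star> h) \<cdot> m"
proof -
  note T = tri_in[OF t]
  have tk: "tsh' C w x \<cdot> k \<in> Hom C v (Sho C (w \<odot> x))" using T w k(1) by (simp add: hom_iff)
  have "isz (tsh' C w y \<cdot> ((idm C w \<star> Sha C f) \<cdot> k))"
    by (rule isz_comp_left[OF k(2)]) (use T w k(1) in \<open>auto simp: hom_iff\<close>)
  also have "tsh' C w y \<cdot> ((idm C w \<star> Sha C f) \<cdot> k) = (tsh' C w y \<cdot> (idm C w \<star> Sha C f)) \<cdot> k"
    using T w k(1) by (simp add: hom_iff)
  also have "\<dots> = Sha C (idm C w \<star> f) \<cdot> (tsh' C w x \<cdot> k)"
    unfolding tsh'_natural[OF idm_hom[OF w] T(1)] using T w k(1) by (simp add: hom_iff)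
  finally obtain m where m: "m \<in> Hom C v (w \<odot> z)" "tsh' C w x \<cdot> k = tsh' C w x \<cdot> (idm C w \<star> h) \<cdot> m"
    using tri_cov3[OF tri_tensor_left[OF t w] tk] by blast
  have "tsh' C w x \<cdot> k = tsh' C w x \<cdot> ((idm C w \<star> h) \<cdot> m)" using m T w by (simp add: hom_iff)
  hence "k = (idm C w \<star> h) \<cdot> m"
    by (rule iso_cancel_left[OF tsh'_iso[OF w T(5)] k(1), rotated]) (use m T w in \<open>auto simp: hom_iff\<close>)
  thus thesis using that m by blast
qed

lemma tarr_slide1: assumes "f \<in> Hom C x y" "g \<in> Hom C x' y'" shows "(idm C y \<star> g) \<cdot> (f \<star> idm C x') = f \<star> g"
proof -
  have "(idm C y \<star> g) \<cdot> (f \<star> idm C x') = (idm C y \<cdot> f) \<star> (g \<cdot> idm C x')"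
    by (rule tarr_comp_arr) (use assms hom_obj[OF assms(1)] hom_obj[OF assms(2)] in \<open>auto simp: hom_iff\<close>)
  thus ?thesis using assms by (simp add: hom_iff)
qed

lemma tarr_slide2: assumes "f \<in> Hom C x y" "g \<in> Hom C x' y'" shows "(f \<star> idm C y') \<cdot> (idm C x \<star> g) = f \<star> g"
proof -
  have "(f \<star> idm C y') \<cdot> (idm C x \<star> g) = (f \<cdot> idm C x) \<star> (idm C y' \<cdot> g)"
    by (rule tarr_comp_arr) (use assms hom_obj[OF assms(1)] hom_obj[OF assms(2)] in \<open>auto simp: hom_iff\<close>)
  thus ?thesis using assms by (simp add: hom_iff)
qed

lemma tarr_comp_l: assumes "u \<in> Hom C w t" "f \<in> Hom C x y" "g \<in> Hom C y z" shows "(idm C t \<star> g) \<cdot> (u \<star> f) = u \<star> (g \<cdot> f)"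
proof -
  have "(idm C t \<star> g) \<cdot> (u \<star> f) = (idm C t \<cdot> u) \<star> (g \<cdot> f)"
    by (rule tarr_comp_arr) (use assms hom_obj[OF assms(1)] in \<open>auto simp: hom_iff\<close>)
  thus ?thesis using assms by (simp add: hom_iff)
qed

lemma tarr_comp_r: assumes "u \<in> Hom C w t" "f \<in> Hom C x y" "g \<in> Hom C y z" shows "(u \<star> g) \<cdot> (idm C w \<star> f) = u \<star> (g \<cdot> f)"
proof -
  have "(u \<star> g) \<cdot> (idm C w \<star> f) = (u \<cdot> idm C w) \<star> (g \<cdot> f)"
    by (rule tarr_comp_arr) (use assms hom_obj[OF assms(1)] in \<open>auto simp: hom_iff\<close>)
  thus ?thesis using assms by (simp add: hom_iff)
qed

text \<open>A set of denominators, as far as vanishing is concerned: two successive tensor factors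
  can be contracted to one. Closure under \<open>\<star>\<close> itself is not demanded, so that the
  image of such a set under a functor, which preserves tensor products only up to isomorphism, again
  qualifies.\<close>

definition null_system :: "'a set \<Rightarrow> bool" where
  "null_system V \<longleftrightarrow> V \<subseteq> Arr C \<and> V \<noteq> {} \<and>
     (\<forall>u\<in>V. \<forall>v\<in>V. \<exists>t\<in>V. \<forall>f\<in>Arr C. isz (u \<star> (v \<star> f)) \<longrightarrow> isz (t \<star> f))"

definition nul :: "'a set \<Rightarrow> 'a \<Rightarrow> bool" where
  "nul V f \<longleftrightarrow> f \<in> Arr C \<and> (\<exists>u\<in>V. isz (u \<star> f))"

lemma null_systemD:
  assumes "null_system V"
  shows "u \<in> V \<Longrightarrow> u \<in> Arr C" "V \<noteq> {}"
  using assms unfolding null_system_def by auto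

lemma null_system_comp:
  assumes "null_system V" "u \<in> V" "v \<in> V" obtains t where "t \<in> V" "\<And>f. f \<in> Arr C \<Longrightarrow> isz (u \<star> (v \<star> f)) \<Longrightarrow> isz (t \<star> f)"
  using assms unfolding null_system_def by meson

lemma nul_isz: assumes "null_system V" "isz f" shows "nul V f"
  using null_systemD[OF assms(1)] isz_tarr_right[OF assms(2)] iszD(1)[OF assms(2)] unfolding nul_def by blast

lemma nul_arr: "nul V f \<Longrightarrow> f \<in> Arr C" unfolding nul_def by blast

lemma nul_comp_left:
  assumes V: "null_system V" and f: "nul V f" and g: "g \<in> Arr C" "Dom C g = Cod C f" shows "nul V (g \<cdot> f)"
proof -
  obtain u where u: "u \<in> V" "isz (u \<star> f)" "f \<in> Arr C" using f unfolding nul_def by blast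
  have uA: "u \<in> Arr C" using null_systemD(1)[OF V u(1)] .
  have "isz ((idm C (Cod C u) \<star> g) \<cdot> (u \<star> f))" by (rule isz_comp_left[OF u(2)]) (use u g uA in auto)
  moreover have "(idm C (Cod C u) \<star> g) \<cdot> (u \<star> f) = u \<star> (g \<cdot> f)"
    by (rule tarr_comp_l[of u "Dom C u" _ f "Dom C f" "Cod C f" g "Cod C g"]) (use u(3) g uA in \<open>auto simp: hom_iff\<close>)
  ultimately have "isz (u \<star> (g \<cdot> f))" by simp
  moreover have "g \<cdot> f \<in> Arr C" using u(3) g by simp
  ultimately show ?thesis unfolding nul_def using u(1) by blast
qed

lemma nul_comp_right:
  assumes V: "null_system V" and g: "nul V g" and f: "f \<in> Arr C" "Dom C g = Cod C f" shows "nul V (g \<cdot> f)"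
proof -
  obtain u where u: "u \<in> V" "isz (u \<star> g)" "g \<in> Arr C" using g unfolding nul_def by blast
  have uA: "u \<in> Arr C" using null_systemD(1)[OF V u(1)] .
  have "isz ((u \<star> g) \<cdot> (idm C (Dom C u) \<star> f))" by (rule isz_comp_right[OF u(2)]) (use u f uA in auto)
  moreover have "(u \<star> g) \<cdot> (idm C (Dom C u) \<star> f) = u \<star> (g \<cdot> f)"
    by (rule tarr_comp_r[of u _ "Cod C u" f "Dom C f" "Cod C f" g "Cod C g"]) (use u(3) f uA in \<open>auto simp: hom_iff\<close>)
  ultimately have "isz (u \<star> (g \<cdot> f))" by simp
  moreover have "g \<cdot> f \<in> Arr C" using u(3) f by simp
  ultimately show ?thesis unfolding nul_def using u(1) by blast
qed

lemma nul_eqv: assumes V: "null_system V" and "f \<doteq> g" "nul V f" shows "nul V g"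
proof -
  obtain u where u: "u \<in> V" "isz (u \<star> f)" using assms unfolding nul_def by blast
  have "isz (u \<star> g)" using isz_eqv[OF eqv_tarr[OF eqv_refl assms(2)]] u null_systemD(1)[OF V u(1)] by blast
  thus ?thesis using u eqv_arr[OF assms(2)] unfolding nul_def by blast
qed

lemma nul_tarr: assumes V: "null_system V" and "nul V f" "g \<in> Arr C" shows "nul V (g \<star> f)"
proof -
  obtain u where u: "u \<in> V" "isz (u \<star> f)" "f \<in> Arr C" using assms unfolding nul_def by blast
  have uA: "u \<in> Arr C" using null_systemD(1)[OF V u(1)] .
  have "isz (u \<star> (g \<star> f))" using isz_eqv[OF eqv_lcomm[OF uA assms(3) u(3)]] isz_tarr_right[OF u(2) assms(3)] by blast
  thus ?thesis using u assms unfolding nul_def by auto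
qed

lemma nul_tarr': assumes V: "null_system V" and "nul V f" "g \<in> Arr C" shows "nul V (f \<star> g)"
  by (rule nul_eqv[OF V eqv_comm nul_tarr[OF V assms(2,3)]]) (use assms nul_arr in auto)

text \<open>The factorization shows that \<open>u \<star> f\<close> is killed by some
  \<open>v\<close>; the closure condition contracts \<open>v\<close> and \<open>u\<close> to a
  single member of \<open>V\<close> that kills \<open>f\<close>.\<close>

lemma nul_factor_left:
  assumes V: "null_system V" "u \<in> V" and f: "f \<in> Arr C" and g: "nul V g" and k: "k \<in> Arr C" "Cod C k = Cod C u \<odot> Dom C g"
    and eq: "u \<star> f = (idm C (Cod C u) \<star> g) \<cdot> k"
  shows "nul V f"
proof -
  have uA: "u \<in> Arr C" using null_systemD(1)[OF V] .
  have gA: "g \<in> Arr C" using nul_arr[OF g] .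
  have "nul V (u \<star> f)" unfolding eq
    by (rule nul_comp_right[OF V(1) nul_tarr[OF V(1) g]]) (use uA gA k in auto)
  then obtain v where v: "v \<in> V" "isz (v \<star> (u \<star> f))" unfolding nul_def by blast
  obtain t where t: "t \<in> V" "\<And>f. f \<in> Arr C \<Longrightarrow> isz (v \<star> (u \<star> f)) \<Longrightarrow> isz (t \<star> f)"
    using null_system_comp[OF V(1) v(1) V(2)] by blast
  show ?thesis unfolding nul_def using f t(1) t(2)[OF f v(2)] by blast
qed

lemma nul_factor_right:
  assumes V: "null_system V" "u \<in> V" and f: "f \<in> Arr C" and g: "nul V g" and k: "k \<in> Arr C" "Dom C k = Dom C u \<odot> Cod C g"
    and eq: "u \<star> f = k \<cdot> (idm C (Dom C u) \<star> g)"
  shows "nul V f"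
proof -
  have uA: "u \<in> Arr C" using null_systemD(1)[OF V] .
  have gA: "g \<in> Arr C" using nul_arr[OF g] .
  have "nul V (u \<star> f)" unfolding eq
    by (rule nul_comp_left[OF V(1) nul_tarr[OF V(1) g]]) (use uA gA k in auto)
  then obtain v where v: "v \<in> V" "isz (v \<star> (u \<star> f))" unfolding nul_def by blast
  obtain t where t: "t \<in> V" "\<And>f. f \<in> Arr C \<Longrightarrow> isz (v \<star> (u \<star> f)) \<Longrightarrow> isz (t \<star> f)"
    using null_system_comp[OF V(1) v(1) V(2)] by blast
  show ?thesis unfolding nul_def using f t(1) t(2)[OF f v(2)] by blast
qed

text \<open>An object vanishes in a localization once the arrows on both sides of it in a triangle
  do. Concretely, as \<open>u \<star> h\<close> is zero, \<open>u\<close> tensored with the identity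
  of \<open>z\<close> factors through \<open>id \<star> g\<close>, which is null.\<close>

lemma nul_cone:
  assumes V: "null_system V" and t: "tri x y z f g h" and g: "nul V g" and h: "nul V h" shows "nul V (idm C z)"
proof -
  note T = tri_in[OF t]
  obtain u where u: "u \<in> V" "isz (u \<star> h)" using h unfolding nul_def by blast
  have uA: "u \<in> Arr C" using null_systemD(1)[OF V u(1)] .
  have uh: "u \<in> Hom C (Dom C u) (Cod C u)" using uA by (simp add: hom_iff)
  have k: "u \<star> idm C z \<in> Hom C (Dom C u \<odot> z) (Cod C u \<odot> z)" using uA T by (simp add: hom_iff)
  have "(idm C (Cod C u) \<star> h) \<cdot> (u \<star> idm C z) = u \<star> h" by (rule tarr_slide1[OF uh T(3)])
  hence "isz ((idm C (Cod C u) \<star> h) \<cdot> (u \<star> idm C z))" using u(2) by simp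
  then obtain m where m: "m \<in> Hom C (Dom C u \<odot> z) (Cod C u \<odot> y)" "u \<star> idm C z = (idm C (Cod C u) \<star> g) \<cdot> m"
    using tens_cov2[OF t _ k] uA by auto
  show ?thesis by (rule nul_factor_left[OF V u(1) _ g _ _ m(2)]) (use m T in \<open>auto simp: hom_iff\<close>)
qed

lemma nul_sha: assumes V: "null_system V" and f: "f \<in> Arr C" shows "nul V (Sha C f) \<longleftrightarrow> nul V f"
proof -
  have "isz (u \<star> Sha C f) \<longleftrightarrow> isz (u \<star> f)" if "u \<in> V" for u
  proof -
    have u: "u \<in> Arr C" using null_systemD(1)[OF V that] .
    have "isz (u \<star> Sha C f) \<longleftrightarrow> isz (Sha C f \<star> u)" by (rule isz_eqv[OF eqv_comm]) (use u f in auto)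
    also have "\<dots> \<longleftrightarrow> isz (Sha C (f \<star> u))" by (rule isz_eqv[OF eqv_sha[OF f u]])
    also have "\<dots> \<longleftrightarrow> isz (f \<star> u)" by (rule isz_sha) (use u f in auto)
    also have "\<dots> \<longleftrightarrow> isz (u \<star> f)" by (rule isz_eqv[OF eqv_comm[OF f u]])
    finally show ?thesis .
  qed
  thus ?thesis unfolding nul_def using f by auto
qed

text \<open>Products serve to kill several objects at once, since a product kills whatever one of
  its factors kills.\<close>

lemma null_system_prod:
  assumes V: "null_system V" and W: "null_system W" shows "null_system {v \<star> w | v w. v \<in> V \<and> w \<in> W}"
  unfolding null_system_def
proof (intro conjI ballI)
  note VA = null_systemD(1)[OF V] and WA = null_systemD(1)[OF W]
  let ?P = "{v \<star> w | v w. v \<in> V \<and> w \<in> W}"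
  show "?P \<subseteq> Arr C" using VA WA by auto
  show "?P \<noteq> {}" using null_systemD(2)[OF V] null_systemD(2)[OF W] by blast
  fix p q assume "p \<in> ?P" "q \<in> ?P"
  then obtain v w v' w' where p: "p = v \<star> w" "v \<in> V" "w \<in> W" and q: "q = v' \<star> w'" "v' \<in> V" "w' \<in> W" by blast
  obtain t where t: "t \<in> V" "\<And>f. f \<in> Arr C \<Longrightarrow> isz (v \<star> (v' \<star> f)) \<Longrightarrow> isz (t \<star> f)" using null_system_comp[OF V p(2) q(2)] by blast
  obtain s where s: "s \<in> W" "\<And>f. f \<in> Arr C \<Longrightarrow> isz (w \<star> (w' \<star> f)) \<Longrightarrow> isz (s \<star> f)" using null_system_comp[OF W p(3) q(3)] by blast
  note A = VA[OF p(2)] VA[OF q(2)] WA[OF p(3)] WA[OF q(3)] VA[OF t(1)] WA[OF s(1)]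
  have "isz ((t \<star> s) \<star> f)" if f: "f \<in> Arr C" and z: "isz (p \<star> (q \<star> f))" for f
  proof -
    \<comment> \<open>The four factors are sorted so that each system can contract its own
      pair.\<close>
    have "p \<star> (q \<star> f) \<doteq> (v \<star> w) \<star> (v' \<star> (w' \<star> f))"
      unfolding p(1) q(1) by (rule eqv_tarr[OF eqv_refl eqv_assoc]) (use A f in auto)
    also have "\<dots> \<doteq> v \<star> (w \<star> (v' \<star> (w' \<star> f)))" by (rule eqv_assoc) (use A f in auto)
    also have "\<dots> \<doteq> v \<star> (v' \<star> (w \<star> (w' \<star> f)))" by (rule eqv_tarr[OF eqv_refl eqv_lcomm]) (use A f in auto)
    finally have "isz (v \<star> (v' \<star> (w \<star> (w' \<star> f))))" using z isz_eqv by blast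
    hence "isz (t \<star> (w \<star> (w' \<star> f)))" using t(2)[of "w \<star> (w' \<star> f)"] A f by simp
    moreover have "t \<star> (w \<star> (w' \<star> f)) \<doteq> w \<star> (w' \<star> (t \<star> f))"
    proof -
      have "t \<star> (w \<star> (w' \<star> f)) \<doteq> w \<star> (t \<star> (w' \<star> f))" by (rule eqv_lcomm) (use A f in auto)
      also have "\<dots> \<doteq> w \<star> (w' \<star> (t \<star> f))" by (rule eqv_tarr[OF eqv_refl eqv_lcomm]) (use A f in auto)
      finally show ?thesis .
    qed
    ultimately have "isz (w \<star> (w' \<star> (t \<star> f)))" using isz_eqv by blast
    hence "isz (s \<star> (t \<star> f))" using s(2)[of "t \<star> f"] A f by simp
    moreover have "s \<star> (t \<star> f) \<doteq> (t \<star> s) \<star> f"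
    proof -
      have "s \<star> (t \<star> f) \<doteq> t \<star> (s \<star> f)" by (rule eqv_lcomm) (use A f in auto)
      also have "\<dots> \<doteq> (t \<star> s) \<star> f" by (rule eqv_sym[OF eqv_assoc]) (use A f in auto)
      finally show ?thesis .
    qed
    ultimately show ?thesis using isz_eqv by blast
  qed
  moreover have "t \<star> s \<in> ?P" using t(1) s(1) by blast
  ultimately show "\<exists>t\<in>?P. \<forall>f\<in>Arr C. isz (p \<star> (q \<star> f)) \<longrightarrow> isz (t \<star> f)" by blast
qed

end

section \<open>Ideals in rigid categories\<close>

context category begin

definition isoc :: "'o \<Rightarrow> 'o \<Rightarrow> bool" where "isoc x y \<longleftrightarrow> (\<exists>f. is_iso C x y f)"

lemma isocI: "is_iso C x y f \<Longrightarrow> isoc x y" unfolding isoc_def by blast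

lemma isoc_refl: "x \<in> Obj C \<Longrightarrow> isoc x x" unfolding isoc_def using iso_idm by blast

lemma isoc_sym: "isoc x y \<Longrightarrow> isoc y x" unfolding isoc_def using iso_inverse_ex by metis

lemma isoc_trans [trans]: "isoc x y \<Longrightarrow> isoc y z \<Longrightarrow> isoc x z" unfolding isoc_def using iso_comp by metis

end

context symmetric_monoidal_category begin

lemma isoc_tensor: "isoc x y \<Longrightarrow> isoc x' y' \<Longrightarrow> isoc (x \<odot> x') (y \<odot> y')"
  unfolding isoc_def using tarr_iso by metis

lemma isoc_assoc: "\<lbrakk>x \<in> Obj C; y \<in> Obj C; z \<in> Obj C\<rbrakk> \<Longrightarrow> isoc ((x \<odot> y) \<odot> z) (x \<odot> (y \<odot> z))"
  by (rule isocI[OF assoc_iso])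

lemma isoc_comm: "\<lbrakk>x \<in> Obj C; y \<in> Obj C\<rbrakk> \<Longrightarrow> isoc (x \<odot> y) (y \<odot> x)"
  by (rule isocI[OF braid_iso])

lemma isoc_unit: "x \<in> Obj C \<Longrightarrow> isoc (unit C \<odot> x) x"
  by (rule isocI[OF lunit_iso])

lemma isoc_rcomm: assumes "x \<in> Obj C" "y \<in> Obj C" "z \<in> Obj C" shows "isoc ((x \<odot> y) \<odot> z) ((x \<odot> z) \<odot> y)"
proof -
  have "isoc ((x \<odot> y) \<odot> z) (x \<odot> (y \<odot> z))" by (rule isoc_assoc[OF assms])
  also have "isoc (x \<odot> (y \<odot> z)) (x \<odot> (z \<odot> y))" by (rule isoc_tensor[OF isoc_refl isoc_comm]) (use assms in auto)
  also have "isoc (x \<odot> (z \<odot> y)) ((x \<odot> z) \<odot> y)" by (rule isoc_sym[OF isoc_assoc]) (use assms in auto)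
  finally show ?thesis .
qed

text \<open>Admitting twists of the unit as targets avoids desuspending the cone of a coevaluation.\<close>

inductive_set twists :: "'o set" where
  twist_shift: "Sho C (unit C) \<in> twists"
| twist_tensor: "\<lbrakk>s \<in> twists; t \<in> twists\<rbrakk> \<Longrightarrow> s \<odot> t \<in> twists"

end

text \<open>\<open>K_dual\<close> keeps from duality that coevaluation tensored with
  \<open>x\<close> is a split monomorphism. Both the nilpotence argument and the radicality of
  ideals rest on this.\<close>

locale rigid_subcategory = tt_category C
  for C :: "('o, 'a, 'm) tt_data_scheme" (structure) +
  fixes K :: "'o set"
  assumes K_obj: "x \<in> K \<Longrightarrow> x \<in> Obj C"
    and K_zero: "zero_object C x \<Longrightarrow> x \<in> K"
    and K_shift: "x \<in> K \<Longrightarrow> Sho C x \<in> K"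
    and K_cone: "\<lbrakk>tri x y z f g h; x \<in> K; y \<in> K\<rbrakk> \<Longrightarrow> z \<in> K"
    and K_tensor: "\<lbrakk>x \<in> K; y \<in> K\<rbrakk> \<Longrightarrow> x \<odot> y \<in> K"
    and K_unit: "unit C \<in> K"
    and K_dual: "x \<in> K \<Longrightarrow> \<exists>d\<in>K. \<exists>coev\<in>Hom C (unit C) (x \<odot> d). \<exists>r\<in>Hom C ((x \<odot> d) \<odot> x) (unit C \<odot> x).
          r \<cdot> (coev \<star> idm C x) = idm C (unit C \<odot> x)"
begin

text \<open>Closure under retracts replaces closure under biproduct summands, as retracts are what
  the arguments produce; \<open>thick_tensor_ideal_iff\<close> compares the two notions.\<close>

definition tt_ideal :: "'o set \<Rightarrow> bool" where
  "tt_ideal J \<longleftrightarrow> J \<subseteq> K \<and> (\<forall>x. zero_object C x \<longrightarrow> x \<in> J) \<and> (\<forall>x\<in>K. Sho C x \<in> J \<longleftrightarrow> x \<in> J) \<and>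
     (\<forall>x y z f g h. tri x y z f g h \<and> x \<in> J \<and> y \<in> J \<longrightarrow> z \<in> J) \<and>
     (\<forall>x\<in>K. \<forall>s\<in>J. \<forall>i\<in>Hom C x s. \<forall>p\<in>Hom C s x. p \<cdot> i = idm C x \<longrightarrow> x \<in> J) \<and>
     (\<forall>x\<in>J. \<forall>y\<in>K. x \<odot> y \<in> J)"

lemma tt_idealI:
  assumes "J \<subseteq> K" "\<And>x. zero_object C x \<Longrightarrow> x \<in> J" "\<And>x. x \<in> K \<Longrightarrow> Sho C x \<in> J \<longleftrightarrow> x \<in> J"
    and "\<And>x y z f g h. \<lbrakk>tri x y z f g h; x \<in> J; y \<in> J\<rbrakk> \<Longrightarrow> z \<in> J"
    and "\<And>x s i p. \<lbrakk>x \<in> K; s \<in> J; i \<in> Hom C x s; p \<in> Hom C s x; p \<cdot> i = idm C x\<rbrakk> \<Longrightarrow> x \<in> J"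
    and "\<And>x y. \<lbrakk>x \<in> J; y \<in> K\<rbrakk> \<Longrightarrow> x \<odot> y \<in> J"
  shows "tt_ideal J"
  unfolding tt_ideal_def
proof (intro conjI allI ballI impI, goal_cases)
  case 1 show ?case by (rule assms(1))
next
  case (2 x) thus ?case by (rule assms(2))
next
  case (3 x) thus ?case by (rule assms(3))
next
  case (4 x y z f g h) thus ?case using assms(4) by blast
next
  case (5 x s i p) show ?case by (rule assms(5)[OF 5])
next
  case (6 x y) show ?case by (rule assms(6)[OF 6])
qed

lemma tt_idealD:
  assumes "tt_ideal J"
  shows "x \<in> J \<Longrightarrow> x \<in> K" "zero_object C x \<Longrightarrow> x \<in> J" "x \<in> K \<Longrightarrow> Sho C x \<in> J \<longleftrightarrow> x \<in> J"
    and "\<lbrakk>tri x y z f g h; x \<in> J; y \<in> J\<rbrakk> \<Longrightarrow> z \<in> J"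
    and "\<lbrakk>x \<in> K; s \<in> J; i \<in> Hom C x s; p \<in> Hom C s x; p \<cdot> i = idm C x\<rbrakk> \<Longrightarrow> x \<in> J"
    and "\<lbrakk>x \<in> J; y \<in> K\<rbrakk> \<Longrightarrow> x \<odot> y \<in> J"
proof -
  note h = assms[unfolded tt_ideal_def]
  note h2 = conjunct2[OF h] note h3 = conjunct2[OF h2] note h4 = conjunct2[OF h3]
  note h5 = conjunct2[OF h4] note h6 = conjunct2[OF h5]
  show "x \<in> J \<Longrightarrow> x \<in> K" using conjunct1[OF h] by blast
  show "zero_object C x \<Longrightarrow> x \<in> J" using conjunct1[OF h2] by blast
  show "x \<in> K \<Longrightarrow> Sho C x \<in> J \<longleftrightarrow> x \<in> J" using conjunct1[OF h3] by blast
  show "\<lbrakk>tri x y z f g h; x \<in> J; y \<in> J\<rbrakk> \<Longrightarrow> z \<in> J" using conjunct1[OF h4] by blast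
  show "\<lbrakk>x \<in> K; s \<in> J; i \<in> Hom C x s; p \<in> Hom C s x; p \<cdot> i = idm C x\<rbrakk> \<Longrightarrow> x \<in> J" using conjunct1[OF h5] by blast
  show "\<lbrakk>x \<in> J; y \<in> K\<rbrakk> \<Longrightarrow> x \<odot> y \<in> J" using h6 by blast
qed

text \<open>An isomorphic copy of \<open>x\<close> is a cone of the zero arrow from a zero object to
  \<open>x\<close>.\<close>

lemma K_isoc: assumes "isoc x y" "x \<in> K" shows "y \<in> K"
proof -
  obtain f where f: "is_iso C x y f" using assms(1) unfolding isoc_def by blast
  obtain n where n: "zero_object C n" using ex_zero_object by blast
  have o: "n \<in> Obj C" "f \<in> Hom C x y" "x \<in> Obj C" "y \<in> Obj C"
    using n iso_hom[OF f] hom_obj unfolding zero_object_def by blast+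
  have "neg C (Sha C (zerom C n x)) = zerom C (Sho C n) (Sho C x)" using sha_zero neg_zero o by simp
  hence "tri n x y (zerom C n x) f (zerom C y (Sho C n))"
    using tri_rot_iff[of "zerom C n x" n x f y "zerom C y (Sho C n)"] iso_tri[OF f zero_object_sho[OF n]]
      zerom_hom o by simp
  thus ?thesis using K_cone K_zero[OF n] assms(2) by blast
qed

lemma ideal_isoc: assumes J: "tt_ideal J" and "isoc x y" "x \<in> J" shows "y \<in> J"
proof -
  obtain f where f: "is_iso C x y f" using assms(2) unfolding isoc_def by blast
  obtain g where g: "f \<in> Hom C x y" "g \<in> Hom C y x" "g \<cdot> f = idm C x" "f \<cdot> g = idm C y" using f by (rule isoE)
  show ?thesis by (rule tt_idealD(5)[OF J K_isoc[OF assms(2) tt_idealD(1)[OF J assms(3)]] assms(3) g(2,1,4)])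
qed

lemma ideal_left: "\<lbrakk>tt_ideal J; x \<in> J; y \<in> K\<rbrakk> \<Longrightarrow> y \<odot> x \<in> J"
  using ideal_isoc[OF _ isoc_comm[of x y]] tt_idealD(1,6) K_obj by metis

lemma ideal_middle: assumes J: "tt_ideal J" and t: "tri x y z f g h" and "x \<in> J" "z \<in> J" "y \<in> K" shows "y \<in> J"
  using tt_idealD(4)[OF J tri_rot[OF tri_rot[OF t]] assms(4)] tt_idealD(3)[OF J] tt_idealD(1)[OF J assms(3)] assms by blast

text \<open>Allows checking on generators: if \<open>a \<odot> b\<close> lies in \<open>J\<close>,
  then so does \<open>a' \<odot> b\<close> for everything \<open>a'\<close> in the ideal generated
  by \<open>a\<close>.\<close>

lemma ideal_preimage_tensor:
  assumes J: "tt_ideal J" and b: "b \<in> K" shows "tt_ideal {y\<in>K. y \<odot> b \<in> J}"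
proof (rule tt_idealI)
  have bo: "b \<in> Obj C" using K_obj b by blast
  show "{y\<in>K. y \<odot> b \<in> J} \<subseteq> K" by blast
  fix x assume x: "zero_object C x"
  hence xo: "x \<in> Obj C" unfolding zero_object_def by blast
  have "isz (idm C x)" using x isz_zerom[of x x] unfolding zero_object_def by simp
  hence "isz (idm C x \<star> idm C b)" using isz_tarr_left bo by simp
  hence "zero_object C (x \<odot> b)" unfolding zero_object_def using iszD(2)[of "idm C (x \<odot> b)"] xo bo by simp
  thus "x \<in> {y\<in>K. y \<odot> b \<in> J}" using tt_idealD(2)[OF J] K_zero[OF x] by blast
next
  fix x assume x: "x \<in> K"
  have i: "isoc (Sho C x \<odot> b) (Sho C (x \<odot> b))" using isocI[OF tsh_iso] K_obj x b by blast
  have "Sho C x \<odot> b \<in> J \<longleftrightarrow> Sho C (x \<odot> b) \<in> J" using ideal_isoc[OF J] i isoc_sym by blast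
  also have "\<dots> \<longleftrightarrow> x \<odot> b \<in> J" by (rule tt_idealD(3)[OF J K_tensor[OF x b]])
  finally show "Sho C x \<in> {y\<in>K. y \<odot> b \<in> J} \<longleftrightarrow> x \<in> {y\<in>K. y \<odot> b \<in> J}" using x K_shift by blast
next
  fix x y z f g h assume t: "tri x y z f g h" and xy: "x \<in> {y\<in>K. y \<odot> b \<in> J}" "y \<in> {y\<in>K. y \<odot> b \<in> J}"
  have "z \<odot> b \<in> J" using tt_idealD(4)[OF J tri_tensor[OF t K_obj[OF b]]] xy by blast
  thus "z \<in> {y\<in>K. y \<odot> b \<in> J}" using K_cone[OF t] xy by blast
next
  fix x s i p assume h: "x \<in> K" "s \<in> {y\<in>K. y \<odot> b \<in> J}" "i \<in> Hom C x s" "p \<in> Hom C s x" "p \<cdot> i = idm C x"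
  note ib = idm_hom[OF K_obj[OF b]]
  have "(p \<star> idm C b) \<cdot> (i \<star> idm C b) = idm C (x \<odot> b)"
    using tarr_comp[OF h(3,4) ib ib] h(5) K_obj[OF b] K_obj[OF h(1)] by simp
  thus "x \<in> {y\<in>K. y \<odot> b \<in> J}"
    using tt_idealD(5)[OF J K_tensor[OF h(1) b] _ tarr_hom[OF h(3) ib] tarr_hom[OF h(4) ib]] h(1,2) by blast
next
  fix x y assume h: "x \<in> {y\<in>K. y \<odot> b \<in> J}" "y \<in> K"
  have "isoc ((x \<odot> b) \<odot> y) ((x \<odot> y) \<odot> b)" using isoc_rcomm h b K_obj by blast
  moreover have "(x \<odot> b) \<odot> y \<in> J" using tt_idealD(6)[OF J] h by blast
  ultimately show "x \<odot> y \<in> {y\<in>K. y \<odot> b \<in> J}" using ideal_isoc[OF J] K_tensor h by blast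
qed

lemma ideal_preimage_tensor':
  assumes J: "tt_ideal J" and b: "b \<in> K" shows "tt_ideal {y\<in>K. b \<odot> y \<in> J}"
proof -
  have "b \<odot> y \<in> J \<longleftrightarrow> y \<odot> b \<in> J" if "y \<in> K" for y
    using ideal_isoc[OF J] isoc_comm K_obj that b by blast
  hence "{y\<in>K. b \<odot> y \<in> J} = {y\<in>K. y \<odot> b \<in> J}" by blast
  thus ?thesis using ideal_preimage_tensor[OF J b] by simp
qed

text \<open>The arrow becomes invertible in the Verdier quotient of \<open>K\<close> by
  \<open>J\<close>. One cone is asked to lie in \<open>J\<close>; by \<open>cof_cone\<close> all of
  them then do.\<close>

definition cof :: "'o set \<Rightarrow> 'a \<Rightarrow> bool" where
  "cof J f \<longleftrightarrow> Dom C f \<in> K \<and> Cod C f \<in> K \<and> (\<exists>x y z g h. tri x y z f g h \<and> z \<in> J)"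

lemma cofI: "\<lbrakk>tri x y z f g h; x \<in> K; y \<in> K; z \<in> J\<rbrakk> \<Longrightarrow> cof J f"
  unfolding cof_def using tri_in(1) hom_iff by metis

lemma cofE:
  assumes "cof J f" obtains z g h where "tri (Dom C f) (Cod C f) z f g h" "z \<in> J" "Dom C f \<in> K" "Cod C f \<in> K"
proof -
  obtain x y z g h where t: "tri x y z f g h" "z \<in> J" using assms unfolding cof_def by blast
  have "x = Dom C f" "y = Cod C f" using tri_in(1)[OF t(1)] by (auto simp: hom_iff)
  thus thesis using that t assms unfolding cof_def by blast
qed

text \<open>By the octahedron the cone of the composite is an extension of the two given
  cones.\<close>

lemma cof_comp:
  assumes J: "tt_ideal J" and f: "cof J f" and g: "cof J g" and eq: "Dom C g = Cod C f" shows "cof J (g \<cdot> f)"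
proof -
  obtain z f1 f2 where tf: "tri (Dom C f) (Cod C f) z f f1 f2" "z \<in> J" "Dom C f \<in> K" "Cod C f \<in> K" using f by (rule cofE)
  obtain v g1 g2 where tg: "tri (Dom C g) (Cod C g) v g g1 g2" "v \<in> J" "Dom C g \<in> K" "Cod C g \<in> K" using g by (rule cofE)
  note tg' = tg(1)[unfolded eq]
  have gf: "g \<cdot> f \<in> Hom C (Dom C f) (Cod C g)" using comp_hom tri_in(1)[OF tf(1)] tri_in(1)[OF tg'] by blast
  obtain u k1 k2 where tk: "tri (Dom C f) (Cod C g) u (g \<cdot> f) k1 k2" using ex_tri[OF gf] by blast
  obtain a b where "tri z u v a b (Sha C f1 \<cdot> g2)" using octa[OF tf(1) tg' tk] by blast
  hence "u \<in> J" using ideal_middle[OF J] tf(2) tg(2) K_cone[OF tk tf(3) tg(4)] by blast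
  thus ?thesis using cofI[OF tk tf(3) tg(4)] by blast
qed

lemma cof_iso: assumes J: "tt_ideal J" and "is_iso C x y f" "x \<in> K" shows "cof J f"
proof -
  obtain n where n: "zero_object C n" using ex_zero_object by blast
  have "y \<in> K" using K_isoc[OF isocI[OF assms(2)] assms(3)] .
  thus ?thesis using cofI[OF iso_tri[OF assms(2) n] assms(3)] tt_idealD(2)[OF J n] by blast
qed

text \<open>The octahedron for \<open>f\<close> followed by an identity compares two cones of
  \<open>f\<close>, with a zero object as third term.\<close>

lemma cof_cone: assumes J: "tt_ideal J" and "cof J f" and t: "tri x y z f g h" shows "z \<in> J"
proof -
  have xy: "Dom C f = x" "Cod C f = y" using tri_in(1)[OF t] by (auto simp: hom_iff)
  obtain z0 g0 h0 where t0: "tri x y z0 f g0 h0" "z0 \<in> J" "x \<in> K" "y \<in> K" using cofE[OF assms(2)] xy by metis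
  obtain n where n: "zero_object C n" using ex_zero_object by blast
  have "idm C y \<cdot> f = f" using tri_in(1)[OF t] by (simp add: hom_iff)
  hence t': "tri x y z (idm C y \<cdot> f) g h" using t by simp
  obtain a b where "tri z0 z n a b (Sha C g0 \<cdot> zerom C n (Sho C y))"
    using octa[OF t0(1) tri_idm[OF K_obj[OF t0(4)] n] t'] by blast
  thus ?thesis using ideal_middle[OF J] t0 tt_idealD(2)[OF J n] K_cone[OF t t0(3,4)] by blast
qed

text \<open>Write the tensor product as \<open>f \<star> id\<close> followed by
  \<open>id \<star> g\<close>; their cones are tensor multiples of the given ones.\<close>

lemma cof_tarr: assumes J: "tt_ideal J" and f: "cof J f" and g: "cof J g" shows "cof J (f \<star> g)"
proof -
  obtain z f1 f2 where tf: "tri (Dom C f) (Cod C f) z f f1 f2" "z \<in> J" "Dom C f \<in> K" "Cod C f \<in> K" using f by (rule cofE)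
  obtain v g1 g2 where tg: "tri (Dom C g) (Cod C g) v g g1 g2" "v \<in> J" "Dom C g \<in> K" "Cod C g \<in> K" using g by (rule cofE)
  note F = tri_in[OF tf(1)] and G = tri_in[OF tg(1)]
  have 1: "cof J (f \<star> idm C (Dom C g))"
    using cofI[OF tri_tensor[OF tf(1) G(5)]] K_tensor tf tg tt_idealD(6)[OF J] by blast
  have 2: "cof J (idm C (Cod C f) \<star> g)"
    using cofI[OF tri_tensor_left[OF tg(1) F(6)]] K_tensor tf tg ideal_left[OF J] by blast
  have "cof J ((idm C (Cod C f) \<star> g) \<cdot> (f \<star> idm C (Dom C g)))"
    by (rule cof_comp[OF J 1 2]) (use F G in \<open>simp add: hom_iff\<close>)
  thus ?thesis using tarr_slide1[OF F(1) G(1)] by simp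
qed

lemma cof_idm: "tt_ideal J \<Longrightarrow> x \<in> K \<Longrightarrow> cof J (idm C x)"
  using cof_iso iso_idm K_obj by blast

lemma cof_eqv: assumes J: "tt_ideal J" and f: "cof J f" and e: "f \<doteq> g" shows "cof J g"
proof -
  obtain a b where h: "f \<in> Hom C (Dom C f) (Cod C f)" "g \<in> Hom C (Dom C g) (Cod C g)"
    "is_iso C (Dom C f) (Dom C g) a" "is_iso C (Cod C f) (Cod C g) b" "b \<cdot> f = g \<cdot> a" using e by (rule eqvE)
  obtain a' where a': "is_iso C (Dom C g) (Dom C f) a'" "a' \<cdot> a = idm C (Dom C f)" "a \<cdot> a' = idm C (Dom C g)"
    using iso_inverse_ex[OF h(3)] by blast
  have k: "Dom C f \<in> K" "Cod C f \<in> K" using f unfolding cof_def by auto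
  have dg: "Dom C g \<in> K" using K_isoc[OF isocI[OF h(3)] k(1)] .
  note H = h(1,2) iso_hom[OF h(3)] iso_hom[OF h(4)] iso_hom[OF a'(1)]
  have "cof J (b \<cdot> f)" by (rule cof_comp[OF J f cof_iso[OF J h(4) k(2)]]) (use H in \<open>simp add: hom_iff\<close>)
  hence "cof J (b \<cdot> f \<cdot> a')"
    by (rule cof_comp[OF J cof_iso[OF J a'(1) dg]]) (use H in \<open>simp add: hom_iff\<close>)
  moreover have "b \<cdot> f \<cdot> a' = g"
  proof -
    have "b \<cdot> f \<cdot> a' = g \<cdot> (a \<cdot> a')" unfolding h(5) using H by (simp add: hom_iff)
    thus ?thesis unfolding a'(3) using H by (simp add: hom_iff)
  qed
  ultimately show ?thesis by simp
qed

section \<open>Twists of the unit reflect membership in ideals\<close>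

lemma twists_K: "t \<in> twists \<Longrightarrow> t \<in> K"
  by (induction rule: twists.induct) (auto intro: K_shift K_unit K_tensor)

definition detects :: "'o \<Rightarrow> bool" where
  "detects t \<longleftrightarrow> t \<in> K \<and> (\<forall>J a. tt_ideal J \<and> a \<in> K \<and> t \<odot> a \<in> J \<longrightarrow> a \<in> J)"

lemma detectsD: "\<lbrakk>detects t; tt_ideal J; a \<in> K; t \<odot> a \<in> J\<rbrakk> \<Longrightarrow> a \<in> J" "detects t \<Longrightarrow> t \<in> K"
  unfolding detects_def by blast+

lemma detects_isoc: assumes "detects t" "isoc t s" shows "detects s"
  unfolding detects_def
proof (intro conjI allI impI)
  show "s \<in> K" using K_isoc assms detectsD(2) by blast
  fix J a assume h: "tt_ideal J \<and> a \<in> K \<and> s \<odot> a \<in> J"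
  have "isoc (s \<odot> a) (t \<odot> a)" using isoc_tensor[OF isoc_sym[OF assms(2)] isoc_refl] h K_obj by blast
  hence "t \<odot> a \<in> J" using ideal_isoc h by blast
  thus "a \<in> J" using detectsD(1)[OF assms(1)] h by blast
qed

lemma detects_tensor: assumes "detects s" "detects t" shows "detects (s \<odot> t)"
  unfolding detects_def
proof (intro conjI allI impI)
  note k = detectsD(2)[OF assms(1)] detectsD(2)[OF assms(2)]
  show "s \<odot> t \<in> K" using K_tensor k by blast
  fix J a assume h: "tt_ideal J \<and> a \<in> K \<and> (s \<odot> t) \<odot> a \<in> J"
  have "s \<odot> (t \<odot> a) \<in> J" using ideal_isoc[OF _ isoc_assoc] h K_obj k by blast
  hence "t \<odot> a \<in> J" using detectsD(1)[OF assms(1)] K_tensor[OF k(2)] h by blast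
  thus "a \<in> J" using detectsD(1)[OF assms(2)] h by blast
qed

lemma detects_shift_unit: "detects (Sho C (unit C))"
  unfolding detects_def
proof (intro conjI allI impI)
  show "Sho C (unit C) \<in> K" using K_shift K_unit by blast
  fix J a assume h: "tt_ideal J \<and> a \<in> K \<and> Sho C (unit C) \<odot> a \<in> J"
  hence J: "tt_ideal J" by blast
  have ao: "a \<in> Obj C" using h K_obj by blast
  have "Sho C (unit C \<odot> a) \<in> J" using ideal_isoc[OF J isocI[OF tsh_iso]] h ao unit_obj by blast
  hence "unit C \<odot> a \<in> J" using tt_idealD(3)[OF J] K_tensor K_unit h by blast
  thus "a \<in> J" using ideal_isoc[OF J isoc_unit[OF ao]] by blast
qed

lemma detects_twist: "t \<in> twists \<Longrightarrow> detects t"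
  by (induction rule: twists.induct) (auto intro: detects_shift_unit detects_tensor)

text \<open>Tensor multiples of these arrows are cofinal among the denominators of the Verdier quotient by \<open>J\<close>, so
  \<open>nul (loc J) f\<close> says that \<open>f\<close> vanishes in that quotient, which is never constructed.\<close>

definition loc :: "'o set \<Rightarrow> 'a set" where
  "loc J = {u \<in> Arr C. Cod C u \<in> twists \<and> cof J u}"

lemma null_system_loc: assumes J: "tt_ideal J" shows "null_system (loc J)"
  unfolding null_system_def
proof (intro conjI ballI)
  show "loc J \<subseteq> Arr C" unfolding loc_def by blast
  have "idm C (Sho C (unit C)) \<in> loc J"
    unfolding loc_def using cof_idm[OF J K_shift[OF K_unit]] twist_shift by simp
  thus "loc J \<noteq> {}" by blast
  fix u v assume u: "u \<in> loc J" and v: "v \<in> loc J"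
  have A: "u \<in> Arr C" "v \<in> Arr C" using u v unfolding loc_def by auto
  have "u \<star> v \<in> loc J" unfolding loc_def
    using A u v cof_tarr[OF J] twist_tensor by (auto simp: loc_def)
  moreover have "isz ((u \<star> v) \<star> f)" if "f \<in> Arr C" "isz (u \<star> (v \<star> f))" for f
    using isz_eqv[OF eqv_assoc[OF A that(1)]] that(2) by blast
  ultimately show "\<exists>t\<in>loc J. \<forall>f\<in>Arr C. isz (u \<star> (v \<star> f)) \<longrightarrow> isz (t \<star> f)" by blast
qed

text \<open>Nilpotence of the fibre of coevaluation. Rotating its triangle shows that
  \<open>h\<close> has a shift of \<open>b \<odot> d\<close> as cone, which lies in
  \<open>J\<close>, so \<open>h\<close> is a denominator. The shifted coevaluation composed with
  \<open>h\<close> is zero, and coevaluation tensored with \<open>b\<close> is split mono; hence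
  tensoring with \<open>b\<close> kills \<open>h\<close>.\<close>

lemma loc_kills: assumes J: "tt_ideal J" and b: "b \<in> J" shows "nul (loc J) (idm C b)"
proof -
  have bK: "b \<in> K" "b \<in> Obj C" using tt_idealD(1)[OF J b] K_obj by auto
  obtain d coev r where d: "d \<in> K" "coev \<in> Hom C (unit C) (b \<odot> d)" "r \<in> Hom C ((b \<odot> d) \<odot> b) (unit C \<odot> b)"
    "r \<cdot> (coev \<star> idm C b) = idm C (unit C \<odot> b)" using K_dual[OF bK(1)] by blast
  obtain c g h where t: "tri (unit C) (b \<odot> d) c coev g h" using ex_tri[OF d(2)] by blast
  note T = tri_in[OF t]
  have bd: "b \<odot> d \<in> J" using tt_idealD(6)[OF J b d(1)] .
  have cK: "c \<in> K" using K_cone[OF t K_unit] tt_idealD(1)[OF J bd] by blast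
  have "cof J h"
    by (rule cofI[OF tri_rot[OF tri_rot[OF t]] cK K_shift[OF K_unit]]) (use tt_idealD(3)[OF J tt_idealD(1)[OF J bd]] bd in blast)
  hence hl: "h \<in> loc J" unfolding loc_def using T(3) twist_shift by (simp add: hom_iff)
  have "isz (h \<star> idm C b)"
  proof -
    have hA: "h \<in> Arr C" "coev \<in> Arr C" using T by (auto simp: hom_iff)
    have "isz ((Sha C coev \<cdot> h) \<star> idm C b)" by (rule isz_tarr_left[OF tri_comp_zero3[OF t]]) (use bK in auto)
    also have "(Sha C coev \<cdot> h) \<star> idm C b = (Sha C coev \<star> idm C b) \<cdot> (h \<star> idm C b)"
      using tarr_comp[OF T(3) sha_hom[OF T(1)] idm_hom[OF bK(2)] idm_hom[OF bK(2)]] bK(2) by simp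
    finally have z: "isz ((Sha C coev \<star> idm C b) \<cdot> (h \<star> idm C b))" .
    let ?t = "tsh C (b \<odot> d) b" and ?s = "tsh C (unit C) b"
    have o: "d \<in> Obj C" "unit C \<in> Obj C" "c \<in> Obj C" using d K_obj T by auto
    have hb: "h \<star> idm C b \<in> Hom C (c \<odot> b) (Sho C (unit C) \<odot> b)" using T bK(2) by (simp add: hom_iff)
    have Sr: "Sha C r \<in> Hom C (Sho C ((b \<odot> d) \<odot> b)) (Sho C (unit C \<odot> b))" by (rule sha_hom[OF d(3)])
    have cb: "coev \<star> idm C b \<in> Hom C (unit C \<odot> b) ((b \<odot> d) \<odot> b)" by (rule tarr_hom[OF d(2) idm_hom[OF bK(2)]])
    have th: "?t \<in> Hom C (Sho C (b \<odot> d) \<odot> b) (Sho C ((b \<odot> d) \<odot> b))" "?s \<in> Hom C (Sho C (unit C) \<odot> b) (Sho C (unit C \<odot> b))"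
      using o bK(2) by (auto simp: hom_iff)
    \<comment> \<open>The shifted retraction removes the coevaluation and leaves
      \<open>h \<star> id\<close> followed by the isomorphism \<open>?s\<close>.\<close>
    have "isz (Sha C r \<cdot> ?t \<cdot> ((Sha C coev \<star> idm C b) \<cdot> (h \<star> idm C b)))"
      by (rule isz_comp_left[OF z]) (use Sr th o bK(2) d hA T in \<open>auto simp: hom_iff\<close>)
    also have "Sha C r \<cdot> ?t \<cdot> ((Sha C coev \<star> idm C b) \<cdot> (h \<star> idm C b)) =
        Sha C r \<cdot> ((?t \<cdot> (Sha C coev \<star> idm C b)) \<cdot> (h \<star> idm C b))"
      using Sr th o bK(2) hA T d(2) by (simp add: hom_iff)
    also have "?t \<cdot> (Sha C coev \<star> idm C b) = Sha C (coev \<star> idm C b) \<cdot> ?s"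
      by (rule tsh_natural[OF d(2) idm_hom[OF bK(2)]])
    also have "Sha C r \<cdot> (Sha C (coev \<star> idm C b) \<cdot> ?s \<cdot> (h \<star> idm C b)) = (Sha C r \<cdot> Sha C (coev \<star> idm C b)) \<cdot> (?s \<cdot> (h \<star> idm C b))"
      using Sr th o bK(2) hA T d(2) by (simp add: hom_iff)
    also have "Sha C r \<cdot> Sha C (coev \<star> idm C b) = idm C (Sho C (unit C \<odot> b))"
      using sha_comp[OF cb d(3)] d(4) sha_idm bK(2) by simp
    also have "idm C (Sho C (unit C \<odot> b)) \<cdot> (?s \<cdot> (h \<star> idm C b)) = ?s \<cdot> (h \<star> idm C b)"
      using th hb by (simp add: hom_iff)
    finally show ?thesis using isz_iso_left[OF tsh_iso[OF o(2) bK(2)] hb] by blast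
  qed
  thus ?thesis unfolding nul_def using hl bK(2) by auto
qed

text \<open>A zero arrow splits its triangle: \<open>y\<close> and the shift of \<open>x\<close> are
  retracts of the cone.\<close>

lemma zero_map_summand:
  assumes J: "tt_ideal J" and t: "tri x y z f g h" and f: "isz f" and z: "z \<in> J" and xy: "x \<in> K" "y \<in> K"
  shows "x \<in> J" "y \<in> J"
proof -
  note T = tri_in[OF t]
  have "isz (idm C y \<cdot> f)" using f T by (simp add: hom_iff)
  then obtain p where p: "p \<in> Hom C z y" "idm C y = p \<cdot> g" using tri_contra[OF t idm_hom[OF T(6)]] by blast
  show "y \<in> J" by (rule tt_idealD(5)[OF J xy(2) z T(2) p(1) p(2)[symmetric]])
  have "isz (Sha C f \<cdot> idm C (Sho C x))" using f isz_sha[of f] T by (simp add: hom_iff)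
  then obtain j where j: "j \<in> Hom C (Sho C x) z" "idm C (Sho C x) = h \<cdot> j"
    using tri_cov3[OF t idm_hom[of "Sho C x"]] T by auto
  have "Sho C x \<in> J" by (rule tt_idealD(5)[OF J K_shift[OF xy(1)] z j(1) T(3) j(2)[symmetric]])
  thus "x \<in> J" using tt_idealD(3)[OF J xy(1)] by blast
qed

text \<open>For the converse, if \<open>u\<close> tensored with \<open>a\<close> is zero, then the
  target of \<open>u\<close> tensored with \<open>a\<close> is a retract of an object of
  \<open>J\<close>, and that target is a twist, which can be removed. In this form, as vanishing of
  an arrow, membership can be carried along a faithful functor.\<close>

lemma ideal_mem_iff: assumes J: "tt_ideal J" and a: "a \<in> K" shows "a \<in> J \<longleftrightarrow> nul (loc J) (idm C a)"
proof
  assume "a \<in> J" thus "nul (loc J) (idm C a)" by (rule loc_kills[OF J])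
next
  assume "nul (loc J) (idm C a)"
  then obtain u where u: "u \<in> loc J" "isz (u \<star> idm C a)" unfolding nul_def by blast
  have uA: "u \<in> Arr C" "Cod C u \<in> twists" "cof J u" using u(1) unfolding loc_def by auto
  obtain z g h where t: "tri (Dom C u) (Cod C u) z u g h" "z \<in> J" "Dom C u \<in> K" "Cod C u \<in> K" using uA(3) by (rule cofE)
  have "Cod C u \<odot> a \<in> J"
    by (rule zero_map_summand(2)[OF J tri_tensor[OF t(1) K_obj[OF a]] u(2) tt_idealD(6)[OF J t(2) a]
          K_tensor[OF t(3) a] K_tensor[OF t(4) a]])
  thus "a \<in> J" using detectsD(1)[OF detects_twist[OF uA(2)] J a] by blast
qed

section \<open>Ideals attached to null systems\<close>

definition killed :: "'a set \<Rightarrow> 'o set" where "killed V = {x\<in>K. nul V (idm C x)}"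

lemma killedI: "x \<in> K \<Longrightarrow> nul V (idm C x) \<Longrightarrow> x \<in> killed V" unfolding killed_def by blast

lemma nul_factor:
  assumes V: "null_system V" and f: "f \<in> Hom C x j" "g \<in> Hom C j y" and j: "j \<in> killed V" shows "nul V (g \<cdot> f)"
proof -
  have jn: "nul V (idm C j)" "j \<in> Obj C" using j K_obj unfolding killed_def by auto
  have "nul V (idm C j \<cdot> f)" by (rule nul_comp_right[OF V jn(1)]) (use f jn(2) in \<open>auto simp: hom_iff\<close>)
  hence "nul V (g \<cdot> (idm C j \<cdot> f))" by (rule nul_comp_left[OF V]) (use f jn(2) in \<open>auto simp: hom_iff\<close>)
  thus ?thesis using f by (simp add: hom_iff)
qed

text \<open>The case with content is the cone, settled by \<open>nul_cone\<close>. The generality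
  matters: the result is applied to images of \<open>loc J\<close> under a functor and to products
  of systems, whose killed objects are not known beforehand.\<close>

lemma tt_ideal_killed: assumes V: "null_system V" shows "tt_ideal (killed V)"
proof (rule tt_idealI)
  show "killed V \<subseteq> K" unfolding killed_def by blast
  fix x assume x: "zero_object C x"
  have "isz (idm C x)" using x isz_zerom[of x x] unfolding zero_object_def by simp
  thus "x \<in> killed V" using K_zero[OF x] nul_isz[OF V] killedI by blast
next
  fix x assume x: "x \<in> K"
  have "nul V (idm C (Sho C x)) \<longleftrightarrow> nul V (idm C x)"
    using nul_sha[OF V, of "idm C x"] sha_idm K_obj[OF x] by simp
  thus "Sho C x \<in> killed V \<longleftrightarrow> x \<in> killed V" unfolding killed_def using x K_shift by blast
next
  fix x y z f g h assume t: "tri x y z f g h" and xy: "x \<in> killed V" "y \<in> killed V"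
  note T = tri_in[OF t]
  have k: "x \<in> K" "y \<in> K" using xy unfolding killed_def by auto
  have "nul V (g \<cdot> idm C y)" by (rule nul_factor[OF V idm_hom[OF T(6)] T(2) xy(2)])
  hence g: "nul V g" using T by (simp add: hom_iff)
  have "Sho C x \<in> killed V"
    unfolding killed_def using xy(1) nul_sha[OF V, of "idm C x"] sha_idm[OF T(5)] T(5) K_shift[OF k(1)] by (simp add: killed_def)
  hence "nul V (idm C (Sho C x) \<cdot> h)" using nul_factor[OF V T(3) idm_hom] T(5) by simp
  hence h: "nul V h" using T by (simp add: hom_iff)
  show "z \<in> killed V" by (rule killedI[OF K_cone[OF t k] nul_cone[OF V t g h]])
next
  fix x s i p assume h: "x \<in> K" "s \<in> killed V" "i \<in> Hom C x s" "p \<in> Hom C s x" "p \<cdot> i = idm C x"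
  show "x \<in> killed V" by (rule killedI[OF h(1)]) (use nul_factor[OF V h(3,4,2)] h(5) in simp)
next
  fix x y assume h: "x \<in> killed V" "y \<in> K"
  have x: "x \<in> K" "nul V (idm C x)" using h(1) unfolding killed_def by auto
  have "nul V (idm C x \<star> idm C y)" by (rule nul_tarr'[OF V x(2)]) (use K_obj h(2) in auto)
  hence "nul V (idm C (x \<odot> y))" using K_obj x(1) h(2) by simp
  thus "x \<odot> y \<in> killed V" using killedI K_tensor x(1) h(2) by blast
qed

lemma killed_loc: assumes "tt_ideal J" shows "killed (loc J) = J"
  unfolding killed_def using ideal_mem_iff[OF assms] tt_idealD(1)[OF assms] by blast

text \<open>The next two lemmas express that, in the quotient by \<open>J\<close>, an arrow which agrees with an isomorphism
  is invertible, and that a vanishing isomorphism has vanishing target.\<close>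

lemma cof_congruent:
  assumes J: "tt_ideal J" and q: "cof J (e1 \<boxplus> e2)" and e: "e1 \<in> Hom C x y" "e2 \<in> Hom C x y"
    and e2: "a \<in> Hom C x j" "b \<in> Hom C j y" "e2 = b \<cdot> a" "j \<in> J"
  shows "cof J e1"
proof -
  let ?V = "loc J" and ?q = "e1 \<boxplus> e2"
  note V = null_system_loc[OF J]
  have jk: "j \<in> killed ?V" "Sho C j \<in> killed ?V"
    using killed_loc[OF J] e2(4) tt_idealD(3)[OF J tt_idealD(1)[OF J e2(4)]] by auto
  have qh: "?q \<in> Hom C x y" by (rule addm_hom[OF e])
  have xy: "x \<in> K" "y \<in> K" using q qh unfolding cof_def by (auto simp: hom_iff)
  obtain d q1 q2 where tq: "tri x y d ?q q1 q2" "d \<in> J" using cofE[OF q] qh unfolding hom_iff by metis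
  note Q = tri_in[OF tq(1)]
  have dk: "d \<in> killed ?V" using killed_loc[OF J] tq(2) by simp
  have q1: "nul ?V q1" using nul_factor[OF V Q(2) idm_hom[OF Q(7)] dk] Q by (simp add: hom_iff)
  have q2: "nul ?V q2" using nul_factor[OF V idm_hom[OF Q(7)] Q(3) dk] Q by (simp add: hom_iff)
  obtain z g h where t: "tri x y z e1 g h" using ex_tri[OF e(1)] by blast
  note T = tri_in[OF t]
  \<comment> \<open>Since \<open>g\<close> annihilates \<open>e1\<close>, composing it with
    \<open>?q\<close> leaves only the part through \<open>j\<close>, which is null.\<close>
  have "g \<cdot> ?q = g \<cdot> e1 \<boxplus> g \<cdot> e2" by (rule addm_comp[OF e T(2)])
  also have "\<dots> = g \<cdot> e2" using tri_comp_zero[OF t] T e(2) by (simp add: hom_iff)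
  also have "\<dots> = (g \<cdot> b) \<cdot> a" using e2 T by (simp add: hom_iff)
  finally have "nul ?V (g \<cdot> ?q)" using nul_factor[OF V e2(1) comp_hom[OF e2(2) T(2)] jk(1)] by simp
  then obtain u where u: "u \<in> ?V" "isz (u \<star> (g \<cdot> ?q))" unfolding nul_def by blast
  have uA: "u \<in> Arr C" using null_systemD(1)[OF V u(1)] .
  have uh: "u \<in> Hom C (Dom C u) (Cod C u)" using uA by (simp add: hom_iff)
  have ug: "u \<star> g \<in> Hom C (Dom C u \<odot> y) (Cod C u \<odot> z)" by (rule tarr_hom[OF uh T(2)])
  have "isz ((u \<star> g) \<cdot> (idm C (Dom C u) \<star> ?q))" using u(2) tarr_comp_r[OF uh qh T(2)] by simp
  then obtain m where m: "m \<in> Hom C (Dom C u \<odot> d) (Cod C u \<odot> z)" "u \<star> g = m \<cdot> (idm C (Dom C u) \<star> q1)"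
    using tri_contra[OF tri_tensor_left[OF tq(1)] ug] uA by auto
  have g: "nul ?V g"
    by (rule nul_factor_right[OF V u(1) _ q1 _ _ m(2)]) (use m T Q in \<open>auto simp: hom_iff\<close>)
  \<comment> \<open>The dual argument for the arrow leaving the cone, with lifts in place of
    extensions.\<close>
  have "Sha C ?q \<cdot> h = Sha C e1 \<cdot> h \<boxplus> Sha C e2 \<cdot> h"
    unfolding sha_add[OF e] by (rule comp_addm[OF T(3) sha_hom[OF e(1)] sha_hom[OF e(2)]])
  also have "Sha C e1 \<cdot> h = zerom C z (Sho C y)" using iszD(2)[OF tri_comp_zero3[OF t]] T e by (simp add: hom_iff)
  also have "zerom C z (Sho C y) \<boxplus> Sha C e2 \<cdot> h = Sha C b \<cdot> (Sha C a \<cdot> h)"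
    using sha_comp[OF e2(1,2)] e2 T e by (simp add: hom_iff)
  finally have "nul ?V (Sha C ?q \<cdot> h)"
    using nul_factor[OF V comp_hom[OF T(3) sha_hom[OF e2(1)]] sha_hom[OF e2(2)] jk(2)] by simp
  then obtain v where v: "v \<in> ?V" "isz (v \<star> (Sha C ?q \<cdot> h))" unfolding nul_def by blast
  have vA: "v \<in> Arr C" using null_systemD(1)[OF V v(1)] .
  have vh: "v \<in> Hom C (Dom C v) (Cod C v)" using vA by (simp add: hom_iff)
  have vg: "v \<star> h \<in> Hom C (Dom C v \<odot> z) (Cod C v \<odot> Sho C x)" by (rule tarr_hom[OF vh T(3)])
  have "isz ((idm C (Cod C v) \<star> Sha C ?q) \<cdot> (v \<star> h))" using v(2) tarr_comp_l[OF vh T(3) sha_hom[OF qh]] by simp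
  then obtain k where k: "k \<in> Hom C (Dom C v \<odot> z) (Cod C v \<odot> d)" "v \<star> h = (idm C (Cod C v) \<star> q2) \<cdot> k"
    using tens_cov3[OF tq(1) _ vg] vA by auto
  have h: "nul ?V h"
    by (rule nul_factor_left[OF V v(1) _ q2 _ _ k(2)]) (use k T Q in \<open>auto simp: hom_iff\<close>)
  have "z \<in> killed ?V" by (rule killedI[OF K_cone[OF t xy] nul_cone[OF V t g h]])
  thus ?thesis using cofI[OF t xy] killed_loc[OF J] by simp
qed

lemma cof_factor:
  assumes J: "tt_ideal J" and f: "cof J f" "f \<in> Hom C x y"
    and e: "a \<in> Hom C x j" "b \<in> Hom C j y" "f = b \<cdot> a" "j \<in> J"
  shows "y \<in> J"
proof -
  let ?V = "loc J"
  note V = null_system_loc[OF J]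
  obtain z g h where t: "tri x y z f g h" "z \<in> J" using cofE[OF f(1)] f(2) unfolding hom_iff by metis
  have y: "y \<in> K" using f unfolding cof_def by (auto simp: hom_iff)
  note T = tri_in[OF t(1)]
  have zk: "z \<in> killed ?V" "j \<in> killed ?V" using killed_loc[OF J] t(2) e(4) by auto
  have fn: "nul ?V f" using nul_factor[OF V e(1,2) zk(2)] e(3) by simp
  have "nul ?V g" using nul_factor[OF V T(2) idm_hom[OF T(7)] zk(1)] T by (simp add: hom_iff)
  then obtain u where u: "u \<in> ?V" "isz (u \<star> g)" unfolding nul_def by blast
  have uA: "u \<in> Arr C" using null_systemD(1)[OF V u(1)] .
  have uh: "u \<in> Hom C (Dom C u) (Cod C u)" using uA by (simp add: hom_iff)
  have k: "u \<star> idm C y \<in> Hom C (Dom C u \<odot> y) (Cod C u \<odot> y)" by (rule tarr_hom[OF uh idm_hom[OF T(6)]])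
  have "isz ((idm C (Cod C u) \<star> g) \<cdot> (u \<star> idm C y))" using u(2) tarr_slide1[OF uh T(2)] by simp
  then obtain m where m: "m \<in> Hom C (Dom C u \<odot> y) (Cod C u \<odot> x)" "u \<star> idm C y = (idm C (Cod C u) \<star> f) \<cdot> m"
    using tri_cov[OF tri_tensor_left[OF t(1)] k] uA by auto
  have "nul ?V (idm C y)"
    by (rule nul_factor_left[OF V u(1) _ fn _ _ m(2)]) (use m T in \<open>auto simp: hom_iff\<close>)
  thus ?thesis using ideal_mem_iff[OF J y] by blast
qed

end

section \<open>The lattice of principal ideals and the Balmer spectrum\<close>

context rigid_subcategory begin

text \<open>Inclusion of the ideals generated by \<open>a\<close> and by \<open>b\<close>.\<close>

definition ile :: "'o \<Rightarrow> 'o \<Rightarrow> bool" where "ile a b \<longleftrightarrow> (\<forall>J. tt_ideal J \<and> b \<in> J \<longrightarrow> a \<in> J)"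

definition gen :: "'o \<Rightarrow> 'o set" where "gen b = {a\<in>K. ile a b}"

text \<open>The cone of the zero arrow \<open>a \<rightarrow> b\<close> is \<open>b \<oplus> \<Sigma>a\<close>, which generates the same ideal as \<open>a \<oplus> b\<close>.\<close>

definition cjoin :: "'o \<Rightarrow> 'o \<Rightarrow> 'o" where "cjoin a b = (SOME z. \<exists>g h. tri a b z (zerom C a b) g h)"

definition zob :: 'o where "zob = (SOME x. zero_object C x)"

lemma ileD: "ile a b \<Longrightarrow> tt_ideal J \<Longrightarrow> b \<in> J \<Longrightarrow> a \<in> J" unfolding ile_def by blast

lemma ileI: "(\<And>J. tt_ideal J \<Longrightarrow> b \<in> J \<Longrightarrow> a \<in> J) \<Longrightarrow> ile a b" unfolding ile_def by blast

lemma zero_object_zob: "zero_object C zob" unfolding zob_def by (rule someI_ex[OF ex_zero_object])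

lemma tt_ideal_gen: assumes "b \<in> K" shows "tt_ideal (gen b)"
proof (rule tt_idealI)
  show "gen b \<subseteq> K" unfolding gen_def by blast
  fix x assume "zero_object C x" thus "x \<in> gen b" unfolding gen_def ile_def using K_zero tt_idealD(2) by blast
next
  fix x assume x: "x \<in> K"
  have "ile (Sho C x) b \<longleftrightarrow> ile x b" unfolding ile_def using tt_idealD(3)[OF _ x] by blast
  thus "Sho C x \<in> gen b \<longleftrightarrow> x \<in> gen b" unfolding gen_def using x K_shift by blast
next
  fix x y z f g h assume t: "tri x y z f g h" "x \<in> gen b" "y \<in> gen b"
  have "ile z b" by (rule ileI) (use t tt_idealD(4)[OF _ t(1)] ileD in \<open>auto simp: gen_def\<close>)
  thus "z \<in> gen b" unfolding gen_def using K_cone[OF t(1)] t(2,3) unfolding gen_def by blast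
next
  fix x s i p assume h: "x \<in> K" "s \<in> gen b" "i \<in> Hom C x s" "p \<in> Hom C s x" "p \<cdot> i = idm C x"
  have "ile x b" by (rule ileI) (use tt_idealD(5)[OF _ h(1) _ h(3-5)] h(2) ileD in \<open>auto simp: gen_def\<close>)
  thus "x \<in> gen b" unfolding gen_def using h(1) by blast
next
  fix x y assume h: "x \<in> gen b" "y \<in> K"
  have "ile (x \<odot> y) b" by (rule ileI) (use tt_idealD(6)[OF _ _ h(2)] h(1) ileD in \<open>auto simp: gen_def\<close>)
  thus "x \<odot> y \<in> gen b" unfolding gen_def using K_tensor h unfolding gen_def by blast
qed

lemma gen_self: "b \<in> K \<Longrightarrow> b \<in> gen b" unfolding gen_def ile_def by blast

lemma gen_least: "tt_ideal J \<Longrightarrow> b \<in> J \<Longrightarrow> a \<in> gen b \<Longrightarrow> a \<in> J" unfolding gen_def using ileD by blast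

lemma cjoin_tri:
  assumes "a \<in> Obj C" "b \<in> Obj C" obtains g h where "tri a b (cjoin a b) (zerom C a b) g h"
proof -
  have "\<exists>z g h. tri a b z (zerom C a b) g h" using ex_tri[OF zerom_hom[OF assms]] by blast
  hence "\<exists>g h. tri a b (cjoin a b) (zerom C a b) g h" unfolding cjoin_def by (rule someI_ex)
  thus thesis using that by blast
qed

lemma cjoin_K: assumes "a \<in> K" "b \<in> K" shows "cjoin a b \<in> K"
proof -
  obtain g h where "tri a b (cjoin a b) (zerom C a b) g h" using cjoin_tri K_obj assms by blast
  thus ?thesis using K_cone assms by blast
qed

lemma cjoin_iff: assumes J: "tt_ideal J" and k: "a \<in> K" "b \<in> K" shows "cjoin a b \<in> J \<longleftrightarrow> a \<in> J \<and> b \<in> J"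
proof -
  obtain g h where t: "tri a b (cjoin a b) (zerom C a b) g h" using cjoin_tri K_obj k by blast
  have z: "isz (zerom C a b)" using isz_zerom K_obj k by blast
  show ?thesis using tt_idealD(4)[OF J t] zero_map_summand[OF J t z _ k] by blast
qed

text \<open>Rigidity makes every ideal radical: up to isomorphism, \<open>x\<close> is a retract of
  a tensor multiple of \<open>x \<odot> x\<close>.\<close>

lemma tensor_self: assumes J: "tt_ideal J" and x: "x \<in> K" "x \<odot> x \<in> J" shows "x \<in> J"
proof -
  obtain d coev r where d: "d \<in> K" "coev \<in> Hom C (unit C) (x \<odot> d)" "r \<in> Hom C ((x \<odot> d) \<odot> x) (unit C \<odot> x)"
    "r \<cdot> (coev \<star> idm C x) = idm C (unit C \<odot> x)" using K_dual[OF x(1)] by blast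
  have "(x \<odot> x) \<odot> d \<in> J" by (rule tt_idealD(6)[OF J x(2) d(1)])
  hence "(x \<odot> d) \<odot> x \<in> J" using ideal_isoc[OF J isoc_rcomm] K_obj x(1) d(1) by blast
  hence "unit C \<odot> x \<in> J"
    using tt_idealD(5)[OF J K_tensor[OF K_unit x(1)] _ tarr_hom[OF d(2) idm_hom[OF K_obj[OF x(1)]]] d(3,4)] by blast
  thus ?thesis using ideal_isoc[OF J isoc_unit[OF K_obj[OF x(1)]]] by blast
qed

sublocale lat: distributive_preorder K ile cjoin "tobj C" zob "unit C"
proof
  show "\<And>a. ile a a" unfolding ile_def by blast
  show "\<And>a b c. ile a b \<Longrightarrow> ile b c \<Longrightarrow> ile a c" unfolding ile_def by blast
  show "\<And>a b. a \<in> K \<Longrightarrow> b \<in> K \<Longrightarrow> cjoin a b \<in> K" by (rule cjoin_K)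
  show "\<And>a b. a \<in> K \<Longrightarrow> b \<in> K \<Longrightarrow> a \<odot> b \<in> K" by (rule K_tensor)
  show "zob \<in> K" by (rule K_zero[OF zero_object_zob])
  show "unit C \<in> K" by (rule K_unit)
  fix a b assume k: "a \<in> K" "b \<in> K"
  show "ile a (cjoin a b)" "ile b (cjoin a b)" unfolding ile_def using cjoin_iff k by blast+
  show "ile (a \<odot> b) a" unfolding ile_def using tt_idealD(6) k by blast
  show "ile (a \<odot> b) b" unfolding ile_def using ideal_left k by blast
  fix c assume c: "c \<in> K"
  { assume "ile a c" "ile b c" thus "ile (cjoin a b) c" unfolding ile_def using cjoin_iff k by blast }
  { assume h: "ile c a" "ile c b"
    show "ile c (a \<odot> b)"
    proof (rule ileI)
      fix J assume J: "tt_ideal J" "a \<odot> b \<in> J"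
      \<comment> \<open>The factors of \<open>a \<odot> b\<close> are exchanged for \<open>c\<close>
        one at a time; then radicality removes the square.\<close>
      have "c \<in> {y\<in>K. y \<odot> b \<in> J}" by (rule ileD[OF h(1) ideal_preimage_tensor[OF J(1) k(2)]]) (use J k in blast)
      hence "c \<in> {y\<in>K. c \<odot> y \<in> J}" using ileD[OF h(2) ideal_preimage_tensor'[OF J(1) c]] k by blast
      thus "c \<in> J" using tensor_self[OF J(1) c] by blast
    qed }
  show "ile (a \<odot> cjoin b c) (cjoin (a \<odot> b) (a \<odot> c))"
  proof (rule ileI)
    fix J assume J: "tt_ideal J" "cjoin (a \<odot> b) (a \<odot> c) \<in> J"
    hence "b \<in> {y\<in>K. a \<odot> y \<in> J}" "c \<in> {y\<in>K. a \<odot> y \<in> J}" using cjoin_iff K_tensor k c by auto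
    hence "cjoin b c \<in> {y\<in>K. a \<odot> y \<in> J}" using cjoin_iff[OF ideal_preimage_tensor'[OF J(1) k(1)] k(2) c] by blast
    thus "a \<odot> cjoin b c \<in> J" by blast
  qed
  show "ile zob a" unfolding ile_def using tt_idealD(2) zero_object_zob by blast
  show "ile a (unit C)"
  proof (rule ileI)
    fix J assume J: "tt_ideal J" "unit C \<in> J"
    have "unit C \<odot> a \<in> J" by (rule tt_idealD(6)[OF J k(1)])
    thus "a \<in> J" using ideal_isoc[OF J(1) isoc_unit[OF K_obj[OF k(1)]]] by blast
  qed
qed

text \<open>A lattice ideal is closed under triangles because a cone lies below the join of the
  other two vertices; shifts and retracts lie below the object they come from.\<close>

lemma lprime_iff:
  "lat.lprime P \<longleftrightarrow> tt_ideal P \<and> P \<noteq> K \<and> (\<forall>x\<in>K. \<forall>y\<in>K. x \<odot> y \<in> P \<longrightarrow> x \<in> P \<or> y \<in> P)"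
proof
  assume P: "lat.lprime P"
  note mono = lat.lprime_mono[OF P]
  note sub = subsetD[OF lat.lprime_sub[OF P]]
  have "tt_ideal P"
  proof (rule tt_idealI)
    show "P \<subseteq> K" by (rule lat.lprime_sub[OF P])
    have bot: "zob \<in> P" by (rule lat.lidealD(2)[OF lat.lprimeD(1)[OF P]])
    fix x assume x: "zero_object C x"
    have "ile x zob" unfolding ile_def using tt_idealD(2) x by blast
    thus "x \<in> P" using mono[OF bot K_zero[OF x]] by blast
  next
    fix x assume x: "x \<in> K"
    have "ile x (Sho C x)" "ile (Sho C x) x" unfolding ile_def using tt_idealD(3)[OF _ x] by blast+
    thus "Sho C x \<in> P \<longleftrightarrow> x \<in> P" using mono x K_shift by blast
  next
    fix x y z f g h assume t: "tri x y z f g h" and xy: "x \<in> P" "y \<in> P"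
    have k: "x \<in> K" "y \<in> K" using xy sub by auto
    have "ile z (cjoin x y)" unfolding ile_def using tt_idealD(4)[OF _ t] cjoin_iff[OF _ k] by blast
    moreover have "cjoin x y \<in> P" using lat.lprime_join_iff[OF P k] xy by blast
    ultimately show "z \<in> P" using mono K_cone[OF t k] by blast
  next
    fix x s i p assume h: "x \<in> K" "s \<in> P" "i \<in> Hom C x s" "p \<in> Hom C s x" "p \<cdot> i = idm C x"
    have "ile x s" unfolding ile_def using tt_idealD(5)[OF _ h(1) _ h(3-5)] by blast
    thus "x \<in> P" using mono h by blast
  next
    fix x y assume "x \<in> P" "y \<in> K"
    thus "x \<odot> y \<in> P" using mono lat.meet1 K_tensor sub by blast
  qed
  moreover have "P \<noteq> K" using lat.lprimeD(2)[OF P] K_unit by blast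
  ultimately show "tt_ideal P \<and> P \<noteq> K \<and> (\<forall>x\<in>K. \<forall>y\<in>K. x \<odot> y \<in> P \<longrightarrow> x \<in> P \<or> y \<in> P)"
    using lat.lprimeD(3)[OF P] by blast
next
  assume P: "tt_ideal P \<and> P \<noteq> K \<and> (\<forall>x\<in>K. \<forall>y\<in>K. x \<odot> y \<in> P \<longrightarrow> x \<in> P \<or> y \<in> P)"
  hence J: "tt_ideal P" and ne: "P \<noteq> K" by auto
  show "lat.lprime P" unfolding lat.lprime_def lat.lideal_def
  proof (intro conjI ballI impI)
    show "P \<subseteq> K" using tt_idealD(1)[OF J] by blast
    show "zob \<in> P" by (rule tt_idealD(2)[OF J zero_object_zob])
    show "unit C \<notin> P"
    proof
      assume "unit C \<in> P"
      hence "x \<in> P" if "x \<in> K" for x using ileD[OF lat.le_top[OF that] J] by blast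
      thus False using ne tt_idealD(1)[OF J] by blast
    qed
    fix a b assume "a \<in> P"
    { assume "b \<in> K" "ile b a" thus "b \<in> P" using ileD J \<open>a \<in> P\<close> by blast }
    { assume "b \<in> P" thus "cjoin a b \<in> P" using cjoin_iff[OF J] tt_idealD(1)[OF J] \<open>a \<in> P\<close> by blast }
  next
    fix a b assume "a \<in> K" "b \<in> K" "a \<odot> b \<in> P" thus "a \<in> P \<or> b \<in> P" using P by blast
  qed
qed

lemma Hom_full: "x \<in> K \<Longrightarrow> y \<in> K \<Longrightarrow> Hom (full_subcategory C K) x y = Hom C x y"
  unfolding Hom_def full_subcategory_def by auto

lemma full_sel [simp]:
  "Obj (full_subcategory C K) = K" "Dom (full_subcategory C K) = Dom C" "Cod (full_subcategory C K) = Cod C"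
  "idm (full_subcategory C K) = idm C" "compm (full_subcategory C K) = compm C"
  "zerom (full_subcategory C K) = zerom C" "addm (full_subcategory C K) = addm C"
  "Sho (full_subcategory C K) = Sho C" "tobj (full_subcategory C K) = tobj C"
  unfolding full_subcategory_def by simp_all

lemma zero_full: "zero_object (full_subcategory C K) x \<longleftrightarrow> zero_object C x"
  unfolding zero_object_def using K_obj K_zero[of x] unfolding zero_object_def by auto

lemma biproduct_full:
  assumes "x \<in> K" "y \<in> K" "s \<in> K" shows "is_biproduct (full_subcategory C K) x y s \<longleftrightarrow> is_biproduct C x y s"
  unfolding is_biproduct_def using assms by (simp add: Hom_full)

lemma Tri_full:
  "(f, g, h) \<in> Tri (full_subcategory C K) \<longleftrightarrow> (\<exists>x\<in>K. \<exists>y\<in>K. \<exists>z\<in>K. tri x y z f g h)"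
proof
  assume "(f, g, h) \<in> Tri (full_subcategory C K)"
  hence h: "(f, g, h) \<in> Tri C" "Dom C f \<in> K" "Cod C f \<in> K" "Cod C g \<in> K" unfolding full_subcategory_def by auto
  thus "\<exists>x\<in>K. \<exists>y\<in>K. \<exists>z\<in>K. tri x y z f g h" using triI[OF h(1)] by blast
next
  assume "\<exists>x\<in>K. \<exists>y\<in>K. \<exists>z\<in>K. tri x y z f g h"
  then obtain x y z where k: "x \<in> K" "y \<in> K" "z \<in> K" and t: "tri x y z f g h" by blast
  thus "(f, g, h) \<in> Tri (full_subcategory C K)"
    unfolding full_subcategory_def using tri_in[OF t] by (auto simp: hom_iff)
qed

text \<open>From summands to retracts: the cone of the inclusion serves as a complement. It lies in
  \<open>K\<close>, so the biproduct is one of the subcategory.\<close>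

lemma thick_tensor_ideal_iff: "thick_tensor_ideal (full_subcategory C K) P \<longleftrightarrow> tt_ideal P"
proof
  assume "thick_tensor_ideal (full_subcategory C K) P"
  hence h: "P \<subseteq> K" "\<forall>x. zero_object C x \<longrightarrow> x \<in> P" "\<forall>x\<in>K. Sho C x \<in> P \<longleftrightarrow> x \<in> P"
    "\<forall>(f, g, h) \<in> Tri (full_subcategory C K). Dom C f \<in> P \<and> Cod C f \<in> P \<longrightarrow> Cod C g \<in> P"
    "\<forall>x\<in>K. \<forall>y\<in>K. \<forall>s\<in>P. is_biproduct (full_subcategory C K) x y s \<longrightarrow> x \<in> P"
    "\<forall>x\<in>P. \<forall>y\<in>K. x \<odot> y \<in> P"
    unfolding thick_tensor_ideal_def thick_def zero_full full_sel by auto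
  show "tt_ideal P"
  proof (rule tt_idealI)
    show "P \<subseteq> K" by (rule h(1))
    show "zero_object C x \<Longrightarrow> x \<in> P" for x using h(2) by blast
    show "x \<in> K \<Longrightarrow> Sho C x \<in> P \<longleftrightarrow> x \<in> P" for x using h(3) by blast
    show "x \<in> P \<Longrightarrow> y \<in> K \<Longrightarrow> x \<odot> y \<in> P" for x y using h(6) by blast
    { fix x y z f g k assume t: "tri x y z f g k" and xy: "x \<in> P" "y \<in> P"
      have k: "x \<in> K" "y \<in> K" "z \<in> K" using xy h(1) K_cone[OF t] by auto
      hence "(f, g, k) \<in> Tri (full_subcategory C K)" unfolding Tri_full using t by blast
      moreover have "Dom C f = x" "Cod C f = y" "Cod C g = z" using tri_in[OF t] by (auto simp: hom_iff)
      ultimately show "z \<in> P" using h(4) xy by fastforce }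
    fix x s i p assume x: "x \<in> K" and s: "s \<in> P" and ip: "i \<in> Hom C x s" "p \<in> Hom C s x" "p \<cdot> i = idm C x"
    obtain z g k where t: "tri x s z i g k" using ex_tri[OF ip(1)] by blast
    have sK: "s \<in> K" using s h(1) by blast
    have z: "z \<in> K" using K_cone[OF t x sK] .
    have "is_biproduct (full_subcategory C K) x z s"
      unfolding biproduct_full[OF x z sK] by (rule split_biproduct[OF t ip(2,3)])
    thus "x \<in> P" using h(5) x z s by blast
  qed
next
  assume J: "tt_ideal P"
  note JD = tt_idealD[OF J]
  have "thick (full_subcategory C K) P" unfolding thick_def zero_full full_sel
  proof (intro conjI allI impI ballI)
    show "P \<subseteq> K" using JD(1) by blast
    show "zero_object C x \<Longrightarrow> x \<in> P" for x by (rule JD(2))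
    show "x \<in> K \<Longrightarrow> Sho C x \<in> P \<longleftrightarrow> x \<in> P" for x by (rule JD(3))
    fix t assume "t \<in> Tri (full_subcategory C K)"
    moreover obtain f g h where t: "t = (f, g, h)" by (cases t)
    ultimately have "(f, g, h) \<in> Tri (full_subcategory C K)" by simp
    then obtain x y z where tr: "tri x y z f g h" unfolding Tri_full by blast
    have "Dom C f = x" "Cod C f = y" "Cod C g = z" using tri_in[OF tr] by (auto simp: hom_iff)
    thus "case t of (f, g, h) \<Rightarrow> Dom C f \<in> P \<and> Cod C f \<in> P \<longrightarrow> Cod C g \<in> P"
      unfolding t using JD(4)[OF tr] by simp
  next
    fix x y s assume k: "x \<in> K" "y \<in> K" "s \<in> P" and b: "is_biproduct (full_subcategory C K) x y s"
    obtain i p where "i \<in> Hom C x s" "p \<in> Hom C s x" "p \<cdot> i = idm C x"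
      using b[unfolded biproduct_full[OF k(1,2) JD(1)[OF k(3)]]] unfolding is_biproduct_def by blast
    thus "x \<in> P" using JD(5) k by blast
  qed
  thus "thick_tensor_ideal (full_subcategory C K) P"
    unfolding thick_tensor_ideal_def full_sel using JD(6) by blast
qed

lemma Spc_full: "Spc (full_subcategory C K) = lat.Pr"
  unfolding Spc_def lat.Pr_def lprime_iff thick_tensor_ideal_iff full_sel by blast

lemma Spc_topology_full: "Spc_topology (full_subcategory C K) = lat.ptop"
proof -
  have "Spc (full_subcategory C K) - supp (full_subcategory C K) x = lat.D x" for x
    unfolding supp_def Spc_full lat.D_def lat.Pr_def by blast
  thus ?thesis unfolding Spc_topology_def lat.ptop_def by simp
qed

lemma loc_tarr: assumes J: "tt_ideal J" and "u \<in> loc J" "v \<in> loc J" shows "u \<star> v \<in> loc J"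
proof -
  have A: "u \<in> Arr C" "v \<in> Arr C" using assms unfolding loc_def by auto
  thus ?thesis using assms cof_tarr[OF J] twist_tensor by (auto simp: loc_def)
qed

lemma cof_mono: "cof J f \<Longrightarrow> J \<subseteq> J' \<Longrightarrow> cof J' f" unfolding cof_def by blast

end

section \<open>Splitting the cone of a tensor product of arrows\<close>

context tt_category begin

lemma null_system_prodI:
  assumes V: "null_system V" and W: "null_system W"
  shows "nul V f \<Longrightarrow> nul {v \<star> w | v w. v \<in> V \<and> w \<in> W} f" "nul W f \<Longrightarrow> nul {v \<star> w | v w. v \<in> V \<and> w \<in> W} f"
proof -
  note VA = null_systemD(1)[OF V] and WA = null_systemD(1)[OF W]
  { assume f: "nul V f"
    then obtain v where v: "v \<in> V" "isz (v \<star> f)" "f \<in> Arr C" unfolding nul_def by blast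
    obtain w where w: "w \<in> W" using null_systemD(2)[OF W] by blast
    have "isz (w \<star> (v \<star> f))" by (rule isz_tarr_right[OF v(2) WA[OF w]])
    hence "isz (v \<star> (w \<star> f))" using isz_eqv[OF eqv_lcomm[OF WA[OF w] VA[OF v(1)] v(3)]] by blast
    hence "isz ((v \<star> w) \<star> f)" using isz_eqv[OF eqv_assoc[OF VA[OF v(1)] WA[OF w] v(3)]] by blast
    thus "nul {v \<star> w | v w. v \<in> V \<and> w \<in> W} f" unfolding nul_def using v w by blast }
  { assume f: "nul W f"
    then obtain w where w: "w \<in> W" "isz (w \<star> f)" "f \<in> Arr C" unfolding nul_def by blast
    obtain v where v: "v \<in> V" using null_systemD(2)[OF V] by blast
    have "isz (v \<star> (w \<star> f))" by (rule isz_tarr_right[OF w(2) VA[OF v]])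
    hence "isz ((v \<star> w) \<star> f)" using isz_eqv[OF eqv_assoc[OF VA[OF v] WA[OF w(1)] w(3)]] by blast
    thus "nul {v \<star> w | v w. v \<in> V \<and> w \<in> W} f" unfolding nul_def using v w by blast }
qed

text \<open>In the octahedron on \<open>v1 \<star> v2 = (id \<star> v2) \<cdot> (v1 \<star> id)\<close> the connecting arrow \<open>t1 \<odot> c2 \<rightarrow> \<Sigma>(c1 \<odot> w2)\<close>
  factors through \<open>c1 \<odot> c2\<close>. If \<open>c1 \<odot> c2\<close> vanishes, the cone of \<open>v1 \<star> v2\<close> splits.\<close>

lemma cone_tensor_splits:
  assumes V: "null_system V" and t1: "tri w1 t1 c1 v1 g1 h1" and t2: "tri w2 t2 c2 v2 g2 h2"
    and n: "nul V (idm C (c1 \<odot> c2))"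
  obtains c k1 k2 a b u s r where "tri (w1 \<odot> w2) (t1 \<odot> t2) c (v1 \<star> v2) k1 k2"
    "a \<in> Hom C (c1 \<odot> w2) c" "b \<in> Hom C c (t1 \<odot> c2)" "u \<in> V"
    "s \<in> Hom C (Dom C u \<odot> (t1 \<odot> c2)) (Cod C u \<odot> c)" "r \<in> Hom C (Dom C u \<odot> c) (Cod C u \<odot> (c1 \<odot> w2))"
    "u \<star> idm C c = (idm C (Cod C u) \<star> a) \<cdot> r \<boxplus> s \<cdot> (idm C (Dom C u) \<star> b)"
proof -
  note T = tri_in[OF t1] and S = tri_in[OF t2]
  let ?f = "v1 \<star> idm C w2" and ?g = "idm C t1 \<star> v2"
  have fg: "?g \<cdot> ?f = v1 \<star> v2" by (rule tarr_slide1[OF T(1) S(1)])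
  obtain c k1 k2 where tk: "tri (w1 \<odot> w2) (t1 \<odot> t2) c (v1 \<star> v2) k1 k2"
    using ex_tri[OF tarr_hom[OF T(1) S(1)]] by blast
  let ?f1 = "g1 \<star> idm C w2" and ?k = "tsh' C t1 w2 \<cdot> (idm C t1 \<star> h2)"
  obtain a b where ab: "tri (c1 \<odot> w2) c (t1 \<odot> c2) a b (Sha C ?f1 \<cdot> ?k)"
    using octa[OF tri_tensor[OF t1 S(5)] tri_tensor_left[OF t2 T(6)] tk[folded fg]] by blast
  note A = tri_in[OF ab]
  \<comment> \<open>Naturality of \<open>tsh'\<close> brings \<open>g1\<close> and \<open>h2\<close>
    into one tensor product, which is then cut at \<open>c1 \<odot> c2\<close>.\<close>
  have "Sha C ?f1 \<cdot> ?k = Sha C ?f1 \<cdot> tsh' C t1 w2 \<cdot> (idm C t1 \<star> h2)" using T S by (simp add: hom_iff)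
  also have "Sha C ?f1 \<cdot> tsh' C t1 w2 = tsh' C c1 w2 \<cdot> (g1 \<star> Sha C (idm C w2))"
    by (rule tsh'_natural[OF T(2) idm_hom[OF S(5)], symmetric])
  also have "tsh' C c1 w2 \<cdot> (g1 \<star> Sha C (idm C w2)) \<cdot> (idm C t1 \<star> h2) =
      tsh' C c1 w2 \<cdot> ((g1 \<star> idm C (Sho C w2)) \<cdot> (idm C t1 \<star> h2))"
    using T S sha_idm[OF S(5)] by (simp add: hom_iff)
  also have "(g1 \<star> idm C (Sho C w2)) \<cdot> (idm C t1 \<star> h2) = g1 \<star> h2" by (rule tarr_slide2[OF T(2) S(3)])
  also have "g1 \<star> h2 = (idm C c1 \<star> h2) \<cdot> (g1 \<star> idm C c2)" by (rule tarr_slide1[OF T(2) S(3), symmetric])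
  also have "tsh' C c1 w2 \<cdot> ((idm C c1 \<star> h2) \<cdot> (g1 \<star> idm C c2)) =
      (tsh' C c1 w2 \<cdot> (idm C c1 \<star> h2)) \<cdot> (idm C (c1 \<odot> c2) \<cdot> (g1 \<star> idm C c2))" using T S by (simp add: hom_iff)
  finally have eq: "Sha C ?f1 \<cdot> ?k = (tsh' C c1 w2 \<cdot> (idm C c1 \<star> h2)) \<cdot> (idm C (c1 \<odot> c2) \<cdot> (g1 \<star> idm C c2))" .
  have "nul V (Sha C ?f1 \<cdot> ?k)"
    unfolding eq by (rule nul_comp_left[OF V nul_comp_right[OF V n]]) (use T S in \<open>auto simp: hom_iff\<close>)
  then obtain u where u: "u \<in> V" "isz (u \<star> (Sha C ?f1 \<cdot> ?k))" unfolding nul_def by blast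
  have uh: "u \<in> Hom C (Dom C u) (Cod C u)" using null_systemD(1)[OF V u(1)] by (simp add: hom_iff)
  note uo = hom_obj[OF uh]
  have ut: "u \<star> idm C (t1 \<odot> c2) \<in> Hom C (Dom C u \<odot> (t1 \<odot> c2)) (Cod C u \<odot> (t1 \<odot> c2))"
    by (rule tarr_hom[OF uh idm_hom[OF A(7)]])
  \<comment> \<open>As \<open>u\<close> kills the connecting arrow, \<open>b\<close> acquires a
    section \<open>s\<close> up to the denominator \<open>u\<close>.\<close>
  have "isz ((idm C (Cod C u) \<star> (Sha C ?f1 \<cdot> ?k)) \<cdot> (u \<star> idm C (t1 \<odot> c2)))"
    unfolding tarr_slide1[OF uh A(3)] by (rule u(2))
  then obtain s where s: "s \<in> Hom C (Dom C u \<odot> (t1 \<odot> c2)) (Cod C u \<odot> c)"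
    "u \<star> idm C (t1 \<odot> c2) = (idm C (Cod C u) \<star> b) \<cdot> s"
    using tens_cov2[OF ab uo(2) ut] by blast
  let ?uc = "u \<star> idm C c" and ?sb = "s \<cdot> (idm C (Dom C u) \<star> b)"
  have uc: "?uc \<in> Hom C (Dom C u \<odot> c) (Cod C u \<odot> c)" by (rule tarr_hom[OF uh idm_hom[OF A(6)]])
  have wb: "idm C (Dom C u) \<star> b \<in> Hom C (Dom C u \<odot> c) (Dom C u \<odot> (t1 \<odot> c2))" by (rule tarr_hom[OF idm_hom[OF uo(1)] A(2)])
  have rb: "idm C (Cod C u) \<star> b \<in> Hom C (Cod C u \<odot> c) (Cod C u \<odot> (t1 \<odot> c2))" by (rule tarr_hom[OF idm_hom[OF uo(2)] A(2)])
  have sb: "?sb \<in> Hom C (Dom C u \<odot> c) (Cod C u \<odot> c)" by (rule comp_hom[OF wb s(1)])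
  \<comment> \<open>What remains of \<open>?uc\<close> after subtracting \<open>?sb\<close> is
    annihilated by \<open>b\<close>, so it factors through \<open>a\<close>.\<close>
  have "(idm C (Cod C u) \<star> b) \<cdot> ?sb = (idm C (Cod C u) \<star> b) \<cdot> s \<cdot> (idm C (Dom C u) \<star> b)"
    by (rule comp_assoc[OF wb s(1) rb, symmetric])
  also have "\<dots> = u \<star> b" unfolding s(2)[symmetric] by (rule tarr_slide2[OF uh A(2)])
  finally have "(idm C (Cod C u) \<star> b) \<cdot> ?sb = (idm C (Cod C u) \<star> b) \<cdot> ?uc"
    using tarr_slide1[OF uh A(2)] by simp
  hence "(idm C (Cod C u) \<star> b) \<cdot> sub ?uc ?sb = zerom C (Dom C u \<odot> c) (Cod C u \<odot> (t1 \<odot> c2))"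
    unfolding comp_sub[OF uc sb rb] using sub_self[OF comp_hom[OF uc rb]] by simp
  hence "isz ((idm C (Cod C u) \<star> b) \<cdot> sub ?uc ?sb)" using isz_zerom A uo by simp
  then obtain r where r: "r \<in> Hom C (Dom C u \<odot> c) (Cod C u \<odot> (c1 \<odot> w2))" "sub ?uc ?sb = (idm C (Cod C u) \<star> a) \<cdot> r"
    using tri_cov[OF tri_tensor_left[OF ab uo(2)] sub_hom[OF uc sb]] by blast
  have "?uc = (idm C (Cod C u) \<star> a) \<cdot> r \<boxplus> ?sb" using sub_add[OF uc sb] r(2) by simp
  thus thesis using that[OF tk A(1,2) u(1) s(1) r(1)] by blast
qed

text \<open>Since \<open>v1 \<star> v2\<close> kills \<open>f\<close>, the arrow
  \<open>id \<star> f\<close> extends over the cone of \<open>v1 \<star> v2\<close>, and the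
  splitting of that cone cuts the extension into a part through \<open>c1\<close> and a part through
  \<open>c2\<close>. The sources \<open>w1\<close>, \<open>w2\<close> and the cones occur only in
  the middle objects; the ends involve \<open>u\<close>, \<open>f\<close> and the targets
  \<open>t1\<close>, \<open>t2\<close>. This is what makes the two parts liftable later.\<close>

lemma arrow_splits:
  assumes V: "null_system V" and t1: "tri w1 t1 c1 v1 g1 h1" and t2: "tri w2 t2 c2 v2 g2 h2"
    and n: "nul V (idm C (c1 \<odot> c2))" and f: "f \<in> Hom C y z" and fz: "isz ((v1 \<star> v2) \<star> f)"
  obtains u a1 b1 a2 b2 where "u \<in> V"
    "a1 \<in> Hom C (Dom C u \<odot> ((t1 \<odot> t2) \<odot> y)) ((Cod C u \<odot> (c1 \<odot> w2)) \<odot> y)"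
    "b1 \<in> Hom C ((Cod C u \<odot> (c1 \<odot> w2)) \<odot> y) (Cod C u \<odot> ((t1 \<odot> t2) \<odot> z))"
    "a2 \<in> Hom C (Dom C u \<odot> ((t1 \<odot> t2) \<odot> y)) ((Dom C u \<odot> (t1 \<odot> c2)) \<odot> y)"
    "b2 \<in> Hom C ((Dom C u \<odot> (t1 \<odot> c2)) \<odot> y) (Cod C u \<odot> ((t1 \<odot> t2) \<odot> z))"
    "u \<star> (idm C (t1 \<odot> t2) \<star> f) = b1 \<cdot> a1 \<boxplus> b2 \<cdot> a2"
proof -
  note T = tri_in[OF t1] and S = tri_in[OF t2]
  obtain c k1 k2 a b u s r where tk: "tri (w1 \<odot> w2) (t1 \<odot> t2) c (v1 \<star> v2) k1 k2"
    and ab: "a \<in> Hom C (c1 \<odot> w2) c" "b \<in> Hom C c (t1 \<odot> c2)" and u: "u \<in> V"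
    and s: "s \<in> Hom C (Dom C u \<odot> (t1 \<odot> c2)) (Cod C u \<odot> c)" and r: "r \<in> Hom C (Dom C u \<odot> c) (Cod C u \<odot> (c1 \<odot> w2))"
    and eq: "u \<star> idm C c = (idm C (Cod C u) \<star> a) \<cdot> r \<boxplus> s \<cdot> (idm C (Dom C u) \<star> b)"
    by (rule cone_tensor_splits[OF V t1 t2 n])
  note A = tri_in[OF tk]
  have uh: "u \<in> Hom C (Dom C u) (Cod C u)" using null_systemD(1)[OF V u] by (simp add: hom_iff)
  note uo = hom_obj[OF uh] and yo = hom_obj[OF f]
  let ?W = "Dom C u" and ?R = "Cod C u" and ?T = "t1 \<odot> t2"
  have To: "?T \<in> Obj C" using T S by simp
  have tf: "idm C ?T \<star> f \<in> Hom C (?T \<odot> y) (?T \<odot> z)" by (rule tarr_hom[OF idm_hom[OF To] f])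
  have "isz ((idm C ?T \<star> f) \<cdot> ((v1 \<star> v2) \<star> idm C y))" unfolding tarr_slide1[OF A(1) f] by (rule fz)
  then obtain q where q: "q \<in> Hom C (c \<odot> y) (?T \<odot> z)" "idm C ?T \<star> f = q \<cdot> (k1 \<star> idm C y)"
    using tri_contra[OF tri_tensor[OF tk yo(1)] tf] by blast
  note yi = idm_hom[OF yo(1)]
  have ky: "k1 \<star> idm C y \<in> Hom C (?T \<odot> y) (c \<odot> y)" by (rule tarr_hom[OF A(2) yi])
  have 1: "u \<star> (idm C ?T \<star> f) = (idm C ?R \<star> q) \<cdot> (u \<star> (k1 \<star> idm C y))"
    unfolding q(2) by (rule tarr_comp_l[OF uh ky q(1), symmetric])
  \<comment> \<open>Rebracketing brings \<open>k1\<close> next to \<open>u\<close>, where the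
    splitting of \<open>c\<close> can be substituted.\<close>
  let ?A = "assoc C ?R c y"
  obtain i where i: "is_iso C (?W \<odot> (?T \<odot> y)) ((?W \<odot> ?T) \<odot> y) i" "assoc C ?W ?T y \<cdot> i = idm C (?W \<odot> (?T \<odot> y))"
    using iso_inverse_ex[OF assoc_iso[OF uo(1) To yo(1)]] by metis
  note ih = iso_hom[OF i(1)]
  have Ah: "?A \<in> Hom C ((?R \<odot> c) \<odot> y) (?R \<odot> (c \<odot> y))" by (rule assoc_hom[OF uo(2) A(7) yo(1)])
  have uk: "u \<star> k1 \<in> Hom C (?W \<odot> ?T) (?R \<odot> c)" by (rule tarr_hom[OF uh A(2)])
  have uky: "u \<star> (k1 \<star> idm C y) \<in> Hom C (?W \<odot> (?T \<odot> y)) (?R \<odot> (c \<odot> y))" by (rule tarr_hom[OF uh ky])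
  have "?A \<cdot> ((u \<star> k1) \<star> idm C y) \<cdot> i = (u \<star> (k1 \<star> idm C y)) \<cdot> assoc C ?W ?T y \<cdot> i"
    unfolding assoc_natural[OF uh A(2) yi] ..
  also have "\<dots> = (u \<star> (k1 \<star> idm C y)) \<cdot> (assoc C ?W ?T y \<cdot> i)"
    by (rule comp_assoc[OF ih assoc_hom[OF uo(1) To yo(1)] uky])
  also have "\<dots> = u \<star> (k1 \<star> idm C y)" unfolding i(2) using uky by (simp add: hom_iff)
  finally have 2: "u \<star> (k1 \<star> idm C y) = ?A \<cdot> ((u \<star> k1) \<star> idm C y) \<cdot> i" by simp
  have wk: "idm C ?W \<star> k1 \<in> Hom C (?W \<odot> ?T) (?W \<odot> c)" by (rule tarr_hom[OF idm_hom[OF uo(1)] A(2)])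
  have ra: "idm C ?R \<star> a \<in> Hom C (?R \<odot> (c1 \<odot> w2)) (?R \<odot> c)" by (rule tarr_hom[OF idm_hom[OF uo(2)] ab(1)])
  have wb: "idm C ?W \<star> b \<in> Hom C (?W \<odot> c) (?W \<odot> (t1 \<odot> c2))" by (rule tarr_hom[OF idm_hom[OF uo(1)] ab(2)])
  let ?p1 = "r \<cdot> (idm C ?W \<star> k1)" and ?p2 = "(idm C ?W \<star> b) \<cdot> (idm C ?W \<star> k1)"
  have p: "?p1 \<in> Hom C (?W \<odot> ?T) (?R \<odot> (c1 \<odot> w2))" "?p2 \<in> Hom C (?W \<odot> ?T) (?W \<odot> (t1 \<odot> c2))"
    by (rule comp_hom[OF wk r], rule comp_hom[OF wk wb])
  let ?P1 = "(idm C ?R \<star> a) \<cdot> ?p1" and ?P2 = "s \<cdot> ?p2"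
  have P: "?P1 \<in> Hom C (?W \<odot> ?T) (?R \<odot> c)" "?P2 \<in> Hom C (?W \<odot> ?T) (?R \<odot> c)"
    by (rule comp_hom[OF p(1) ra], rule comp_hom[OF p(2) s])
  have "u \<star> k1 = (u \<star> idm C c) \<cdot> (idm C ?W \<star> k1)" by (rule tarr_slide2[OF uh A(2), symmetric])
  also have "\<dots> = (idm C ?R \<star> a) \<cdot> r \<cdot> (idm C ?W \<star> k1) \<boxplus> s \<cdot> (idm C ?W \<star> b) \<cdot> (idm C ?W \<star> k1)"
    unfolding eq by (rule comp_addm[OF wk comp_hom[OF r ra] comp_hom[OF wb s]])
  also have "\<dots> = ?P1 \<boxplus> ?P2" using comp_assoc[OF wk r ra] comp_assoc[OF wk wb s] by simp
  finally have 3: "u \<star> k1 = ?P1 \<boxplus> ?P2" .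
  have 4: "(u \<star> k1) \<star> idm C y = (?P1 \<star> idm C y) \<boxplus> (?P2 \<star> idm C y)" unfolding 3 by (rule tarr_addm[OF P yi])
  have Py: "?P1 \<star> idm C y \<in> Hom C ((?W \<odot> ?T) \<odot> y) ((?R \<odot> c) \<odot> y)" "?P2 \<star> idm C y \<in> Hom C ((?W \<odot> ?T) \<odot> y) ((?R \<odot> c) \<odot> y)"
    by (rule tarr_hom[OF P(1) yi], rule tarr_hom[OF P(2) yi])
  have rq: "idm C ?R \<star> q \<in> Hom C (?R \<odot> (c \<odot> y)) (?R \<odot> (?T \<odot> z))" by (rule tarr_hom[OF idm_hom[OF uo(2)] q(1)])
  let ?B = "(idm C ?R \<star> q) \<cdot> ?A"
  have Bh: "?B \<in> Hom C ((?R \<odot> c) \<odot> y) (?R \<odot> (?T \<odot> z))" by (rule comp_hom[OF Ah rq])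
  let ?Py = "(?P1 \<star> idm C y) \<boxplus> (?P2 \<star> idm C y)"
  have Pyh: "?Py \<in> Hom C ((?W \<odot> ?T) \<odot> y) ((?R \<odot> c) \<odot> y)" by (rule addm_hom[OF Py])
  have "u \<star> (idm C ?T \<star> f) = (idm C ?R \<star> q) \<cdot> (?A \<cdot> ?Py \<cdot> i)" unfolding 1 2 4 ..
  also have "\<dots> = ?B \<cdot> ?Py \<cdot> i"
    using comp_assoc[OF ih Pyh Ah] comp_assoc[OF comp_hom[OF ih Pyh] Ah rq] comp_assoc[OF ih Pyh Bh] by simp
  also have "?B \<cdot> ?Py = ?B \<cdot> (?P1 \<star> idm C y) \<boxplus> ?B \<cdot> (?P2 \<star> idm C y)" by (rule addm_comp[OF Py Bh])
  also have "(?B \<cdot> (?P1 \<star> idm C y) \<boxplus> ?B \<cdot> (?P2 \<star> idm C y)) \<cdot> i = ?B \<cdot> (?P1 \<star> idm C y) \<cdot> i \<boxplus> ?B \<cdot> (?P2 \<star> idm C y) \<cdot> i"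
    by (rule comp_addm[OF ih comp_hom[OF Py(1) Bh] comp_hom[OF Py(2) Bh]])
  finally have main: "u \<star> (idm C ?T \<star> f) = ?B \<cdot> (?P1 \<star> idm C y) \<cdot> i \<boxplus> ?B \<cdot> (?P2 \<star> idm C y) \<cdot> i" .
  have py: "?p1 \<star> idm C y \<in> Hom C ((?W \<odot> ?T) \<odot> y) ((?R \<odot> (c1 \<odot> w2)) \<odot> y)" "?p2 \<star> idm C y \<in> Hom C ((?W \<odot> ?T) \<odot> y) ((?W \<odot> (t1 \<odot> c2)) \<odot> y)"
    by (rule tarr_hom[OF p(1) yi], rule tarr_hom[OF p(2) yi])
  have ray: "(idm C ?R \<star> a) \<star> idm C y \<in> Hom C ((?R \<odot> (c1 \<odot> w2)) \<odot> y) ((?R \<odot> c) \<odot> y)" by (rule tarr_hom[OF ra yi])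
  have sy: "s \<star> idm C y \<in> Hom C ((?W \<odot> (t1 \<odot> c2)) \<odot> y) ((?R \<odot> c) \<odot> y)" by (rule tarr_hom[OF s yi])
  have yy: "idm C y \<cdot> idm C y = idm C y" using yo by simp
  have f1: "?P1 \<star> idm C y = ((idm C ?R \<star> a) \<star> idm C y) \<cdot> (?p1 \<star> idm C y)"
    using tarr_comp[OF p(1) ra yi yi] unfolding yy .
  have f2: "?P2 \<star> idm C y = (s \<star> idm C y) \<cdot> (?p2 \<star> idm C y)" using tarr_comp[OF p(2) s yi yi] unfolding yy .
  show thesis
  proof (rule that[OF u])
    show "(?p1 \<star> idm C y) \<cdot> i \<in> Hom C (?W \<odot> (?T \<odot> y)) ((?R \<odot> (c1 \<odot> w2)) \<odot> y)" by (rule comp_hom[OF ih py(1)])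
    show "?B \<cdot> ((idm C ?R \<star> a) \<star> idm C y) \<in> Hom C ((?R \<odot> (c1 \<odot> w2)) \<odot> y) (?R \<odot> (?T \<odot> z))" by (rule comp_hom[OF ray Bh])
    show "(?p2 \<star> idm C y) \<cdot> i \<in> Hom C (?W \<odot> (?T \<odot> y)) ((?W \<odot> (t1 \<odot> c2)) \<odot> y)" by (rule comp_hom[OF ih py(2)])
    show "?B \<cdot> (s \<star> idm C y) \<in> Hom C ((?W \<odot> (t1 \<odot> c2)) \<odot> y) (?R \<odot> (?T \<odot> z))" by (rule comp_hom[OF sy Bh])
    have "?B \<cdot> (?P1 \<star> idm C y) \<cdot> i = ?B \<cdot> ((idm C ?R \<star> a) \<star> idm C y) \<cdot> ((?p1 \<star> idm C y) \<cdot> i)"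
      unfolding f1 comp_assoc[OF py(1) ray Bh, symmetric] by (rule comp_assoc[OF ih py(1) comp_hom[OF ray Bh]])
    moreover have "?B \<cdot> (?P2 \<star> idm C y) \<cdot> i = ?B \<cdot> (s \<star> idm C y) \<cdot> ((?p2 \<star> idm C y) \<cdot> i)"
      unfolding f2 comp_assoc[OF py(2) sy Bh, symmetric] by (rule comp_assoc[OF ih py(2) comp_hom[OF sy Bh]])
    ultimately show "u \<star> (idm C ?T \<star> f) = ?B \<cdot> ((idm C ?R \<star> a) \<star> idm C y) \<cdot> ((?p1 \<star> idm C y) \<cdot> i) \<boxplus>
        ?B \<cdot> (s \<star> idm C y) \<cdot> ((?p2 \<star> idm C y) \<cdot> i)" unfolding main by simp
  qed
qed

end

section \<open>Fully faithful functors\<close>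

locale tt_functor_pair = A: tt_category C + B: tt_category D + tt_functor C D F
  for C :: "('o, 'a, 'm) tt_data_scheme" and D :: "('p, 'b, 'n) tt_data_scheme"
    and F :: "('o, 'a, 'p, 'b, 'k) tt_functor_data_scheme"
begin

lemmas F_functor = additive[unfolded additive_functor_def, THEN conjunct1]
lemmas F_obj = cat_functorD(1)[OF F_functor]
lemmas F_idm = cat_functorD(2)[OF F_functor]
lemmas F_hom = cat_functorD(3)[OF F_functor]
lemmas F_comp = cat_functorD(4)[OF F_functor]

lemma F_arr:
  assumes "f \<in> Arr C"
  shows "farr F f \<in> Arr D" "Dom D (farr F f) = fobj F (Dom C f)" "Cod D (farr F f) = fobj F (Cod C f)"
  using F_hom[of f "Dom C f" "Cod C f"] assms by (auto simp: hom_iff)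

lemma F_add: "\<lbrakk>f \<in> Hom C x y; g \<in> Hom C x y\<rbrakk> \<Longrightarrow> farr F (f \<boxplus>\<^bsub>C\<^esub> g) = farr F f \<boxplus>\<^bsub>D\<^esub> farr F g"
  using additive unfolding additive_functor_def by blast

lemma F_zero: assumes "x \<in> Obj C" "y \<in> Obj C" shows "farr F (zerom C x y) = zerom D (fobj F x) (fobj F y)"
proof -
  let ?z = "zerom C x y"
  note z = A.zerom_hom[OF assms]
  have "?z \<boxplus>\<^bsub>C\<^esub> ?z = ?z" using assms by simp
  hence "farr F ?z \<boxplus>\<^bsub>D\<^esub> farr F ?z = farr F ?z \<boxplus>\<^bsub>D\<^esub> zerom D (fobj F x) (fobj F y)"
    using F_add[OF z z] F_hom[OF z] by (simp add: hom_iff)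
  thus ?thesis by (rule B.addm_cancel[OF F_hom[OF z] F_hom[OF z] B.zerom_hom[OF F_obj[OF assms(1)] F_obj[OF assms(2)]]])
qed

lemma F_iso: assumes "is_iso C x y f" shows "is_iso D (fobj F x) (fobj F y) (farr F f)"
proof -
  obtain g where g: "f \<in> Hom C x y" "g \<in> Hom C y x" "g \<cdot>\<^bsub>C\<^esub> f = idm C x" "f \<cdot>\<^bsub>C\<^esub> g = idm C y"
    using assms by (rule A.isoE)
  note o = A.hom_obj[OF g(1)]
  show ?thesis
    by (rule B.isoI[OF F_hom[OF g(1)] F_hom[OF g(2)]])
      (use F_comp[OF g(1,2)] F_comp[OF g(2,1)] g(3,4) F_idm o in auto)
qed

end

locale rigid_functor =
  A: rigid_subcategory C K + B: rigid_subcategory D L + tt_functor_pair C D F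
  for C :: "('o, 'a, 'm) tt_data_scheme" and K :: "'o set"
    and D :: "('p, 'b, 'n) tt_data_scheme" and L :: "'p set"
    and F :: "('o, 'a, 'p, 'b, 'k) tt_functor_data_scheme" +
  assumes F_K: "x \<in> K \<Longrightarrow> fobj F x \<in> L"
    and ff: "fully_faithful C D (fobj F) (farr F)"
begin

lemma F_inj: assumes "f \<in> Hom C x y" "g \<in> Hom C x y" "farr F f = farr F g" shows "f = g"
proof -
  have "inj_on (farr F) (Hom C x y)"
    using ff A.hom_obj[OF assms(1)] unfolding fully_faithful_def bij_betw_def by blast
  thus ?thesis using assms unfolding inj_on_def by blast
qed

lemma F_full:
  assumes "f \<in> Hom D (fobj F x) (fobj F y)" "x \<in> Obj C" "y \<in> Obj C"
  obtains g where "g \<in> Hom C x y" "farr F g = f"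
proof -
  have "farr F ` Hom C x y = Hom D (fobj F x) (fobj F y)"
    using ff assms unfolding fully_faithful_def bij_betw_def by blast
  hence "f \<in> farr F ` Hom C x y" using assms(1) by simp
  thus thesis by (rule imageE) (use that in auto)
qed

lemma F_isz: assumes "f \<in> Arr C" shows "B.isz (farr F f) \<longleftrightarrow> A.isz f"
proof
  note fh = F_arr[OF assms]
  have f: "f \<in> Hom C (Dom C f) (Cod C f)" using assms by (simp add: hom_iff)
  note o = A.hom_obj[OF f]
  { assume "A.isz f"
    hence "f = zerom C (Dom C f) (Cod C f)" unfolding A.isz_def by blast
    hence "farr F f = zerom D (fobj F (Dom C f)) (fobj F (Cod C f))" using F_zero[OF o] by simp
    thus "B.isz (farr F f)" unfolding B.isz_def using fh by simp }
  { assume "B.isz (farr F f)"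
    hence "farr F f = farr F (zerom C (Dom C f) (Cod C f))" unfolding B.isz_def using fh F_zero[OF o] by simp
    hence "f = zerom C (Dom C f) (Cod C f)" by (rule F_inj[OF f A.zerom_hom[OF o]])
    thus "A.isz f" unfolding A.isz_def using assms by simp }
qed

lemma F_tri:
  assumes "A.tri x y z f g h"
  shows "B.tri (fobj F x) (fobj F y) (fobj F z) (farr F f) (farr F g) (fsh F x \<cdot>\<^bsub>D\<^esub> farr F h)"
proof -
  note T = A.tri_in[OF assms]
  have "Dom C f = x" using T by (simp add: hom_iff)
  hence "(farr F f, farr F g, fsh F x \<cdot>\<^bsub>D\<^esub> farr F h) \<in> Tri D" using exact[OF T(4)] by simp
  moreover have "fsh F x \<cdot>\<^bsub>D\<^esub> farr F h \<in> Hom D (fobj F z) (Sho D (fobj F x))"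
    by (rule B.comp_hom[OF F_hom[OF T(3)] B.iso_hom[OF fsh_iso[OF T(5)]]])
  ultimately show ?thesis unfolding B.tri_def using F_hom[OF T(1)] F_hom[OF T(2)] by blast
qed

lemma F_isoc_shift: "x \<in> Obj C \<Longrightarrow> B.isoc (fobj F (Sho C x)) (Sho D (fobj F x))"
  by (rule B.isocI[OF fsh_iso])

lemma F_isoc_tensor: "x \<in> Obj C \<Longrightarrow> y \<in> Obj C \<Longrightarrow> B.isoc (fobj F x \<odot>\<^bsub>D\<^esub> fobj F y) (fobj F (x \<odot>\<^bsub>C\<^esub> y))"
  by (rule B.isocI[OF fmul_iso])

lemma F_isoc_unit: "B.isoc (unit D) (fobj F (unit C))"
  by (rule B.isocI[OF funit_iso])

lemma F_eqv_tensor: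
  assumes "u \<in> Arr C" "v \<in> Arr C" shows "B.eqv (farr F u \<star>\<^bsub>D\<^esub> farr F v) (farr F (u \<star>\<^bsub>C\<^esub> v))"
proof -
  have u: "u \<in> Hom C (Dom C u) (Cod C u)" "v \<in> Hom C (Dom C v) (Cod C v)" using assms by (auto simp: hom_iff)
  show ?thesis
    by (rule B.eqvI[OF B.tarr_hom[OF F_hom[OF u(1)] F_hom[OF u(2)]] F_hom[OF A.tarr_hom[OF u]] fmul_iso fmul_iso
          fmul_natural[OF u]]) (use assms in auto)
qed

lemma F_zero_object: assumes "zero_object C x" shows "zero_object D (fobj F x)"
proof -
  have x: "x \<in> Obj C" "idm C x = zerom C x x" using assms unfolding zero_object_def by auto
  have "idm D (fobj F x) = zerom D (fobj F x) (fobj F x)" using F_idm[OF x(1)] F_zero[OF x(1,1)] x(2) by simp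
  thus ?thesis unfolding zero_object_def using F_obj x by blast
qed

lemma F_preimage: assumes J: "B.tt_ideal J" shows "A.tt_ideal {x\<in>K. fobj F x \<in> J}"
proof (rule A.tt_idealI)
  note iso = B.ideal_isoc[OF J] and JD = B.tt_idealD[OF J]
  show "{x\<in>K. fobj F x \<in> J} \<subseteq> K" by blast
  show "x \<in> {x\<in>K. fobj F x \<in> J}" if "zero_object C x" for x
    using JD(2)[OF F_zero_object[OF that]] A.K_zero[OF that] by blast
  show "Sho C x \<in> {x\<in>K. fobj F x \<in> J} \<longleftrightarrow> x \<in> {x\<in>K. fobj F x \<in> J}" if x: "x \<in> K" for x
  proof -
    note i = F_isoc_shift[OF A.K_obj[OF x]]
    have "fobj F (Sho C x) \<in> J \<longleftrightarrow> Sho D (fobj F x) \<in> J" using iso[OF i] iso[OF B.isoc_sym[OF i]] by blast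
    thus ?thesis using JD(3)[OF F_K[OF x]] x A.K_shift by blast
  qed
  show "z \<in> {x\<in>K. fobj F x \<in> J}"
    if t: "A.tri x y z f g h" and xy: "x \<in> {x\<in>K. fobj F x \<in> J}" "y \<in> {x\<in>K. fobj F x \<in> J}" for x y z f g h
    using JD(4)[OF F_tri[OF t]] xy A.K_cone[OF t] by blast
  show "x \<in> {x\<in>K. fobj F x \<in> J}"
    if h: "x \<in> K" "s \<in> {x\<in>K. fobj F x \<in> J}" "i \<in> Hom C x s" "p \<in> Hom C s x" "p \<cdot>\<^bsub>C\<^esub> i = idm C x" for x s i p
  proof -
    have "farr F p \<cdot>\<^bsub>D\<^esub> farr F i = idm D (fobj F x)" using F_comp[OF h(3,4)] h(5) F_idm[OF A.K_obj[OF h(1)]] by simp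
    thus ?thesis using JD(5)[OF F_K[OF h(1)] _ F_hom[OF h(3)] F_hom[OF h(4)]] h(1,2) by blast
  qed
  show "x \<odot>\<^bsub>C\<^esub> y \<in> {x\<in>K. fobj F x \<in> J}" if h: "x \<in> {x\<in>K. fobj F x \<in> J}" "y \<in> K" for x y
  proof -
    have "fobj F x \<odot>\<^bsub>D\<^esub> fobj F y \<in> J" using JD(6) h F_K by blast
    hence "fobj F (x \<odot>\<^bsub>C\<^esub> y) \<in> J" using iso[OF F_isoc_tensor] h A.K_obj by blast
    thus ?thesis using A.K_tensor h by blast
  qed
qed

lemma F_ile: assumes "A.ile a b" "a \<in> K" "b \<in> K" shows "B.ile (fobj F a) (fobj F b)"
  by (rule B.ileI) (use A.ileD[OF assms(1) F_preimage] assms(3) in blast)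

text \<open>Two factors are contracted to the image of \<open>u \<star> v\<close>, which agrees with
  the tensor product of the images up to isomorphism of arrows.\<close>

lemma null_system_F_loc:
  assumes J: "A.tt_ideal J" shows "B.null_system (farr F ` A.loc J)"
  unfolding B.null_system_def
proof (intro conjI ballI)
  have lA: "u \<in> Arr C" if "u \<in> A.loc J" for u using that unfolding A.loc_def by blast
  show "farr F ` A.loc J \<subseteq> Arr D" using lA F_arr by auto
  show "farr F ` A.loc J \<noteq> {}" using A.null_systemD(2)[OF A.null_system_loc[OF J]] by blast
  fix u' v' assume "u' \<in> farr F ` A.loc J" "v' \<in> farr F ` A.loc J"
  then obtain u v where u: "u \<in> A.loc J" "u' = farr F u" and v: "v \<in> A.loc J" "v' = farr F v" by blast
  note uA = lA[OF u(1)] lA[OF v(1)]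
  have "B.isz (farr F (u \<star>\<^bsub>C\<^esub> v) \<star>\<^bsub>D\<^esub> f)" if f: "f \<in> Arr D" "B.isz (u' \<star>\<^bsub>D\<^esub> (v' \<star>\<^bsub>D\<^esub> f))" for f
  proof -
    have "B.isz ((u' \<star>\<^bsub>D\<^esub> v') \<star>\<^bsub>D\<^esub> f)"
      using B.isz_eqv[OF B.eqv_assoc[of u' v' f]] f F_arr(1)[OF uA(1)] F_arr(1)[OF uA(2)] u(2) v(2) by blast
    thus ?thesis
      using B.isz_eqv[OF B.eqv_tarr[OF F_eqv_tensor[OF uA] B.eqv_refl[OF f(1)]]] u(2) v(2) by blast
  qed
  moreover have "farr F (u \<star>\<^bsub>C\<^esub> v) \<in> farr F ` A.loc J" using A.loc_tarr[OF J u(1) v(1)] by blast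
  ultimately show "\<exists>t\<in>farr F ` A.loc J. \<forall>f\<in>Arr D. B.isz (u' \<star>\<^bsub>D\<^esub> (v' \<star>\<^bsub>D\<^esub> f)) \<longrightarrow> B.isz (t \<star>\<^bsub>D\<^esub> f)" by blast
qed

text \<open>A faithful functor preserves and reflects the vanishing of \<open>u\<close> tensored
  with \<open>a\<close>. So membership in \<open>J\<close> can be tested in the target, by
  denominators that come from the source.\<close>

lemma nul_F_loc:
  assumes J: "A.tt_ideal J" and a: "a \<in> K"
  shows "B.nul (farr F ` A.loc J) (idm D (fobj F a)) \<longleftrightarrow> a \<in> J"
proof -
  have ao: "a \<in> Obj C" using A.K_obj a by blast
  have "B.isz (farr F u \<star>\<^bsub>D\<^esub> idm D (fobj F a)) \<longleftrightarrow> A.isz (u \<star>\<^bsub>C\<^esub> idm C a)" if u: "u \<in> A.loc J" for u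
  proof -
    have uA: "u \<in> Arr C" "idm C a \<in> Arr C" using u ao unfolding A.loc_def by auto
    have "B.isz (farr F u \<star>\<^bsub>D\<^esub> farr F (idm C a)) \<longleftrightarrow> B.isz (farr F (u \<star>\<^bsub>C\<^esub> idm C a))"
      by (rule B.isz_eqv[OF F_eqv_tensor[OF uA]])
    also have "\<dots> \<longleftrightarrow> A.isz (u \<star>\<^bsub>C\<^esub> idm C a)" by (rule F_isz) (use uA in simp)
    finally show ?thesis using F_idm[OF ao] by simp
  qed
  hence "B.nul (farr F ` A.loc J) (idm D (fobj F a)) \<longleftrightarrow> A.nul (A.loc J) (idm C a)"
    unfolding A.nul_def B.nul_def using ao F_obj[OF ao] by auto
  thus ?thesis using A.ideal_mem_iff[OF J a] by simp
qed

text \<open>To reflect the order, use the ideal of objects killed by the image of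
  \<open>loc J\<close>. It contains \<open>fobj F b\<close>, hence \<open>fobj F a\<close>, and
  \<open>nul_F_loc\<close> identifies its preimage with \<open>J\<close>.\<close>

lemma F_ile_iff: assumes a: "a \<in> K" and b: "b \<in> K" shows "B.ile (fobj F a) (fobj F b) \<longleftrightarrow> A.ile a b"
proof
  assume h: "B.ile (fobj F a) (fobj F b)"
  show "A.ile a b"
  proof (rule A.ileI)
    fix J assume J: "A.tt_ideal J" "b \<in> J"
    let ?V = "farr F ` A.loc J"
    note V = null_system_F_loc[OF J(1)]
    have "fobj F b \<in> B.killed ?V" using nul_F_loc[OF J(1) b] J(2) F_K[OF b] by (intro B.killedI) auto
    hence "fobj F a \<in> B.killed ?V" by (rule B.ileD[OF h B.tt_ideal_killed[OF V]])
    thus "a \<in> J" using nul_F_loc[OF J(1) a] unfolding B.killed_def by blast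
  qed
next
  assume "A.ile a b" thus "B.ile (fobj F a) (fobj F b)" by (rule F_ile[OF _ a b])
qed

text \<open>Used to cancel, in the target, the codomains of denominators that come from the
  source.\<close>

lemma F_detects: "t \<in> A.twists \<Longrightarrow> B.detects (fobj F t)"
proof (induction rule: A.twists.induct)
  case twist_shift
  have "B.isoc (fobj F (Sho C (unit C))) (Sho D (fobj F (unit C)))" by (rule F_isoc_shift) simp
  moreover have "B.isoc (Sho D (fobj F (unit C))) (Sho D (unit D))"
    by (rule B.isoc_sym[OF B.isocI[OF B.sha_iso[OF funit_iso]]])
  ultimately show ?case using B.detects_isoc[OF B.detects_shift_unit B.isoc_sym[OF B.isoc_trans]] by blast
next
  case (twist_tensor s t)
  have "s \<in> Obj C" "t \<in> Obj C" using A.twists_K A.K_obj twist_tensor by auto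
  thus ?case using B.detects_isoc[OF B.detects_tensor[OF twist_tensor.IH] F_isoc_tensor] by blast
qed

text \<open>Twists are built from the unit by a shift and tensor products, all preserved up to
  isomorphism. Hence codomains of denominators of the target lift, although their domains may
  not.\<close>

lemma twist_image: "t \<in> B.twists \<Longrightarrow> \<exists>s\<in>K. B.isoc (fobj F s) t"
proof (induction rule: B.twists.induct)
  case twist_shift
  have "B.isoc (fobj F (Sho C (unit C))) (Sho D (fobj F (unit C)))" by (rule F_isoc_shift) simp
  moreover have "B.isoc (Sho D (fobj F (unit C))) (Sho D (unit D))"
    by (rule B.isoc_sym[OF B.isocI[OF B.sha_iso[OF funit_iso]]])
  ultimately show ?case using B.isoc_trans A.K_shift[OF A.K_unit] by blast
next
  case (twist_tensor s t)
  then obtain a b where ab: "a \<in> K" "B.isoc (fobj F a) s" "b \<in> K" "B.isoc (fobj F b) t" by blast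
  have "B.isoc (fobj F (a \<odot>\<^bsub>C\<^esub> b)) (fobj F a \<odot>\<^bsub>D\<^esub> fobj F b)"
    by (rule B.isoc_sym[OF F_isoc_tensor]) (use A.K_obj ab in auto)
  also have "B.isoc \<dots> (s \<odot>\<^bsub>D\<^esub> t)" by (rule B.isoc_tensor[OF ab(2,4)])
  finally show ?case using A.K_tensor ab by blast
qed

lemma F_cof:
  assumes J: "A.tt_ideal J" and J': "\<And>x. x \<in> J \<Longrightarrow> fobj F x \<in> J'" and u: "A.cof J u"
  shows "B.cof J' (farr F u)"
proof -
  obtain z g h where t: "A.tri (Dom C u) (Cod C u) z u g h" "z \<in> J" "Dom C u \<in> K" "Cod C u \<in> K" using u by (rule A.cofE)
  show ?thesis by (rule B.cofI[OF F_tri[OF t(1)] F_K[OF t(3)] F_K[OF t(4)] J'[OF t(2)]])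
qed

text \<open>Fullness for arrows whose ends are only isomorphic to images; \<open>eqv\<close> absorbs
  the chosen isomorphisms.\<close>

lemma lift_arrow:
  assumes "B.isoc (fobj F x) x'" "B.isoc (fobj F y) y'" "e \<in> Hom D x' y'" "x \<in> Obj C" "y \<in> Obj C"
  obtains g where "g \<in> Hom C x y" "B.eqv (farr F g) e"
proof -
  obtain i j where i: "is_iso D (fobj F x) x' i" and j0: "is_iso D (fobj F y) y' j" using assms unfolding B.isoc_def by blast
  obtain j' where j: "is_iso D y' (fobj F y) j'" using B.iso_inverse_ex[OF j0] by blast
  have h: "j' \<cdot>\<^bsub>D\<^esub> e \<cdot>\<^bsub>D\<^esub> i \<in> Hom D (fobj F x) (fobj F y)"
    by (rule B.comp_hom[OF B.iso_hom[OF i] B.comp_hom[OF assms(3) B.iso_hom[OF j]]])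
  obtain g where g: "g \<in> Hom C x y" "farr F g = j' \<cdot>\<^bsub>D\<^esub> e \<cdot>\<^bsub>D\<^esub> i" by (rule F_full[OF h assms(4,5)])
  show thesis using that[OF g(1)] g(2) B.eqv_iso_comp[OF i assms(3) j] by simp
qed

end

section \<open>Realizing complementary pieces over the source\<close>

context rigid_subcategory begin

text \<open>Modulo \<open>J\<close> the summand through \<open>j'\<close> vanishes, so
  \<open>e\<close> alone is invertible, and so is the equivalent arrow \<open>g\<close>.\<close>

lemma summand_cone:
  assumes J: "tt_ideal J" and q: "cof J (e \<boxplus> e')" and e: "e \<in> Hom C x y" "e' \<in> Hom C x y"
    and f': "a' \<in> Hom C x j'" "b' \<in> Hom C j' y" "e' = b' \<cdot> a'" "j' \<in> J"
    and ee: "e \<doteq> g" and t: "tri v w c g g1 g2"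
  shows "c \<in> J"
  using cof_cone[OF J cof_eqv[OF J cof_congruent[OF J q e f'] ee] t] .

text \<open>Having its cone in \<open>J\<close>, the arrow \<open>g\<close> is invertible modulo
  \<open>J\<close>, and so is \<open>e\<close> tensored with \<open>s\<close>. But the latter
  factors through an object of \<open>J\<close>, so its target vanishes as well.\<close>

lemma summand_cone':
  assumes J: "tt_ideal J" and s: "s \<in> K" and e: "e \<in> Hom C x y"
    and f: "a \<in> Hom C x j" "b \<in> Hom C j y" "e = b \<cdot> a" "j \<odot> s \<in> J"
    and eg: "g \<doteq> e" and t: "tri v w c g g1 g2" and k: "v \<in> K" "w \<in> K" and c: "c \<in> J"
  shows "y \<odot> s \<in> J"
proof -
  have so: "s \<in> Obj C" using K_obj s by blast
  note si = idm_hom[OF so]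
  have "cof J g" by (rule cofI[OF t k c])
  hence "cof J e" by (rule cof_eqv[OF J _ eg])
  hence ce: "cof J (e \<star> idm C s)" by (rule cof_tarr[OF J _ cof_idm[OF J s]])
  have "e \<star> idm C s = (b \<star> idm C s) \<cdot> (a \<star> idm C s)"
    using tarr_comp[OF f(1,2) si si] so f(3) by simp
  thus ?thesis
    by (rule cof_factor[OF J ce tarr_hom[OF e si] tarr_hom[OF f(1) si] tarr_hom[OF f(2) si] _ f(4)])
qed

end

context rigid_functor begin

text \<open>The arrows \<open>e1\<close> and \<open>e2\<close> in the proof are the projections of
  \<open>F x\<close> to its two parts modulo \<open>F p\<close>, up to denominators. The cone of a
  projection is the complementary part; therefore \<open>x1\<close> comes from \<open>e2\<close> and
  \<open>x2\<close> from \<open>e1\<close>.\<close>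

theorem splitting_property:
  assumes x: "x \<in> K" and p: "p \<in> K" and s: "s1 \<in> L" "s2 \<in> L"
    and le1: "B.ile (fobj F x) (B.cjoin (B.cjoin s1 s2) (fobj F p))"
    and le2: "B.ile (fobj F x \<odot>\<^bsub>D\<^esub> (s1 \<odot>\<^bsub>D\<^esub> s2)) (fobj F p)"
  shows "\<exists>x1\<in>K. \<exists>x2\<in>K. A.ile (x1 \<odot>\<^bsub>C\<^esub> x2) p \<and> B.ile (fobj F x \<odot>\<^bsub>D\<^esub> s1) (B.cjoin (fobj F x1) (fobj F p)) \<and>
      B.ile (fobj F x \<odot>\<^bsub>D\<^esub> s2) (B.cjoin (fobj F x2) (fobj F p))"
proof -
  define z where "z = fobj F x"
  define P where "P = fobj F p"
  define z1 where "z1 = z \<odot>\<^bsub>D\<^esub> s1"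
  define z2 where "z2 = z \<odot>\<^bsub>D\<^esub> s2"
  have xo: "x \<in> Obj C" using A.K_obj x by blast
  have k: "z \<in> L" "P \<in> L" "z1 \<in> L" "z2 \<in> L" unfolding z_def P_def z1_def z2_def using F_K x p s B.K_tensor by auto
  have ko: "z \<in> Obj D" "P \<in> Obj D" "s1 \<in> Obj D" "s2 \<in> Obj D" using B.K_obj k s by auto
  note le1' = le1[folded z_def P_def] and le2' = le2[folded z_def P_def]
  define J where "J = B.gen P"
  have J: "B.tt_ideal J" unfolding J_def by (rule B.tt_ideal_gen[OF k(2)])
  have Jle: "J \<subseteq> I" if "B.tt_ideal I" "P \<in> I" for I unfolding J_def using B.gen_least[OF that] by blast
  have PJ: "P \<in> J" unfolding J_def by (rule B.gen_self[OF k(2)])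
  have zss: "z \<odot>\<^bsub>D\<^esub> (s1 \<odot>\<^bsub>D\<^esub> s2) \<in> J" by (rule B.ileD[OF le2' J PJ])
  have z1s2: "z1 \<odot>\<^bsub>D\<^esub> s2 \<in> J"
    unfolding z1_def by (rule B.ideal_isoc[OF J B.isoc_sym[OF B.isoc_assoc] zss]) (use ko in auto)
  have z2s1: "z2 \<odot>\<^bsub>D\<^esub> s1 \<in> J"
    by (rule B.ideal_isoc[OF J _ z1s2]) (use B.isoc_rcomm[OF ko(1,3,4)] in \<open>simp add: z1_def z2_def\<close>)
  have z1z2: "z1 \<odot>\<^bsub>D\<^esub> z2 \<in> J"
  proof -
    have "(z1 \<odot>\<^bsub>D\<^esub> s2) \<odot>\<^bsub>D\<^esub> z \<in> J" by (rule B.tt_idealD(6)[OF J z1s2 k(1)])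
    moreover have "B.isoc ((z1 \<odot>\<^bsub>D\<^esub> s2) \<odot>\<^bsub>D\<^esub> z) (z1 \<odot>\<^bsub>D\<^esub> z2)"
    proof -
      have "B.isoc ((z1 \<odot>\<^bsub>D\<^esub> s2) \<odot>\<^bsub>D\<^esub> z) (z1 \<odot>\<^bsub>D\<^esub> (s2 \<odot>\<^bsub>D\<^esub> z))" by (rule B.isoc_assoc) (use B.K_obj k s in auto)
      also have "B.isoc \<dots> (z1 \<odot>\<^bsub>D\<^esub> (z \<odot>\<^bsub>D\<^esub> s2))"
        by (rule B.isoc_tensor[OF B.isoc_refl B.isoc_comm]) (use B.K_obj k s in auto)
      finally show ?thesis unfolding z2_def .
    qed
    ultimately show ?thesis using B.ideal_isoc[OF J] by blast
  qed
  define Jp where "Jp = A.gen p"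
  have Jp: "A.tt_ideal Jp" "p \<in> Jp" unfolding Jp_def using A.tt_ideal_gen A.gen_self p by auto
  \<comment> \<open>Denominators modulo \<open>P\<close> are taken from the source, so their ends
    are images of objects of the source.\<close>
  define V where "V = farr F ` A.loc Jp"
  have V: "B.null_system V" unfolding V_def by (rule null_system_F_loc[OF Jp(1)])
  have PV: "P \<in> B.killed V" unfolding V_def P_def using nul_F_loc[OF Jp(1) p] Jp(2) F_K[OF p] by (intro B.killedI) auto
  have FJ: "fobj F y \<in> J" if "y \<in> Jp" for y
    using that F_ile[of y p] p F_K unfolding Jp_def A.gen_def J_def B.gen_def P_def by blast
  define V1 where "V1 = B.loc (B.gen z1)"
  define V2 where "V2 = B.loc (B.gen z2)"
  note J1 = B.tt_ideal_gen[OF k(3)] and J2 = B.tt_ideal_gen[OF k(4)]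
  have V12: "B.null_system V1" "B.null_system V2" unfolding V1_def V2_def using B.null_system_loc J1 J2 by auto
  \<comment> \<open>The system \<open>W\<close> is built to kill \<open>z1\<close>,
    \<open>z2\<close> and \<open>P\<close> simultaneously, each through one of its factors.\<close>
  define N where "N = {v \<star>\<^bsub>D\<^esub> w | v w. v \<in> V1 \<and> w \<in> V2}"
  define W where "W = {v \<star>\<^bsub>D\<^esub> w | v w. v \<in> N \<and> w \<in> V}"
  have N: "B.null_system N" unfolding N_def by (rule B.null_system_prod[OF V12])
  have W: "B.null_system W" unfolding W_def by (rule B.null_system_prod[OF N V])
  define I where "I = B.killed W"
  have I: "B.tt_ideal I" unfolding I_def by (rule B.tt_ideal_killed[OF W])
  have "z1 \<in> I" unfolding I_def
  proof (rule B.killedI[OF k(3)])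
    have "B.nul V1 (idm D z1)" unfolding V1_def by (rule B.loc_kills[OF J1 B.gen_self[OF k(3)]])
    hence "B.nul N (idm D z1)" unfolding N_def by (rule B.null_system_prodI(1)[OF V12])
    thus "B.nul W (idm D z1)" unfolding W_def by (rule B.null_system_prodI(1)[OF N V])
  qed
  moreover have "z2 \<in> I" unfolding I_def
  proof (rule B.killedI[OF k(4)])
    have "B.nul V2 (idm D z2)" unfolding V2_def by (rule B.loc_kills[OF J2 B.gen_self[OF k(4)]])
    hence "B.nul N (idm D z2)" unfolding N_def by (rule B.null_system_prodI(2)[OF V12])
    thus "B.nul W (idm D z2)" unfolding W_def by (rule B.null_system_prodI(1)[OF N V])
  qed
  moreover have "P \<in> I" unfolding I_def
    by (rule B.killedI[OF k(2)]) (use PV B.null_system_prodI(2)[OF N V] in \<open>simp add: W_def B.killed_def\<close>)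
  \<comment> \<open>The elements \<open>s1\<close>, \<open>s2\<close> and \<open>P\<close> are
    carried into \<open>I\<close> by tensoring with \<open>z\<close>; by \<open>le1\<close> so is
    \<open>z\<close> itself, and radicality puts \<open>z\<close> into \<open>I\<close>.\<close>
  ultimately have zI: "s1 \<in> {y\<in>L. z \<odot>\<^bsub>D\<^esub> y \<in> I}" "s2 \<in> {y\<in>L. z \<odot>\<^bsub>D\<^esub> y \<in> I}" "P \<in> {y\<in>L. z \<odot>\<^bsub>D\<^esub> y \<in> I}"
    using s k B.ideal_left[OF I] unfolding z1_def z2_def by auto
  have zI': "B.tt_ideal {y\<in>L. z \<odot>\<^bsub>D\<^esub> y \<in> I}" by (rule B.ideal_preimage_tensor'[OF I k(1)])
  have "B.cjoin (B.cjoin s1 s2) P \<in> {y\<in>L. z \<odot>\<^bsub>D\<^esub> y \<in> I}"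
    using B.cjoin_iff[OF zI' B.cjoin_K[OF s] k(2)] B.cjoin_iff[OF zI' s] zI by blast
  hence "z \<odot>\<^bsub>D\<^esub> z \<in> I" using B.ileD[OF le1' zI'] by blast
  hence "z \<in> I" by (rule B.tensor_self[OF I k(1)])
  hence "B.nul W (idm D z)" unfolding I_def B.killed_def by blast
  then obtain v1 v2 u where v: "v1 \<in> V1" "v2 \<in> V2" "u \<in> V" and vz: "B.isz (((v1 \<star>\<^bsub>D\<^esub> v2) \<star>\<^bsub>D\<^esub> u) \<star>\<^bsub>D\<^esub> idm D z)"
    unfolding B.nul_def W_def N_def by blast
  have vA: "v1 \<in> Arr D" "v2 \<in> Arr D" "u \<in> Arr D" using v B.null_systemD(1) V12 V by blast+
  have uz: "B.isz ((v1 \<star>\<^bsub>D\<^esub> v2) \<star>\<^bsub>D\<^esub> (u \<star>\<^bsub>D\<^esub> idm D z))"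
    using B.isz_eqv[OF B.eqv_assoc[of "v1 \<star>\<^bsub>D\<^esub> v2" u "idm D z"]] vz vA ko by simp
  obtain u0 where u0: "u0 \<in> A.loc Jp" "u = farr F u0" using v(3) unfolding V_def by blast
  have u0': "u0 \<in> Arr C" "Cod C u0 \<in> A.twists" "A.cof Jp u0" using u0(1) unfolding A.loc_def by auto
  have v1': "Cod D v1 \<in> B.twists" "B.cof (B.gen z1) v1" using v(1) unfolding V1_def B.loc_def by auto
  have v2': "Cod D v2 \<in> B.twists" "B.cof (B.gen z2) v2" using v(2) unfolding V2_def B.loc_def by auto
  obtain c1 g1 h1 where t1: "B.tri (Dom D v1) (Cod D v1) c1 v1 g1 h1" "c1 \<in> B.gen z1" "Dom D v1 \<in> L" "Cod D v1 \<in> L"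
    using v1'(2) by (rule B.cofE)
  obtain c2 g2 h2 where t2: "B.tri (Dom D v2) (Cod D v2) c2 v2 g2 h2" "c2 \<in> B.gen z2" "Dom D v2 \<in> L" "Cod D v2 \<in> L"
    using v2'(2) by (rule B.cofE)
  let ?T = "Cod D v1 \<odot>\<^bsub>D\<^esub> Cod D v2"
  have cK: "c1 \<in> L" "c2 \<in> L" using t1(2) t2(2) unfolding B.gen_def by auto
  have pre: "a \<odot>\<^bsub>D\<^esub> b \<in> J" if "a \<in> B.gen y" "y \<odot>\<^bsub>D\<^esub> b \<in> J" "b \<in> L" "y \<in> L" for a b y
    using B.gen_least[OF B.ideal_preimage_tensor[OF J that(3)], of y a] that by blast
  \<comment> \<open>The cones \<open>c1\<close> and \<open>c2\<close> inherit from the generators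
    \<open>z1\<close> and \<open>z2\<close> that their product lies in \<open>J\<close>.\<close>
  have "z1 \<odot>\<^bsub>D\<^esub> c2 \<in> J"
    using B.gen_least[OF B.ideal_preimage_tensor'[OF J k(3)], of z2 c2] z1z2 k t2(2) by blast
  hence cJ: "c1 \<odot>\<^bsub>D\<^esub> c2 \<in> J" by (rule pre[OF t1(2) _ cK(2) k(3)])
  have "c1 \<odot>\<^bsub>D\<^esub> c2 \<in> B.killed V" using Jle[OF B.tt_ideal_killed[OF V] PV] cJ by blast
  hence n: "B.nul V (idm D (c1 \<odot>\<^bsub>D\<^esub> c2))" unfolding B.killed_def by blast
  have uh: "u \<in> Hom D (fobj F (Dom C u0)) (fobj F (Cod C u0))" using F_hom[of u0] u0'(1) u0(2) by (simp add: hom_iff)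
  have u0K: "Dom C u0 \<in> K" "Cod C u0 \<in> K" using u0'(3) unfolding A.cof_def by auto
  let ?y = "fobj F (Dom C u0) \<odot>\<^bsub>D\<^esub> z" and ?w = "fobj F (Cod C u0) \<odot>\<^bsub>D\<^esub> z"
  have fh: "u \<star>\<^bsub>D\<^esub> idm D z \<in> Hom D ?y ?w" by (rule B.tarr_hom[OF uh B.idm_hom[OF ko(1)]])
  \<comment> \<open>The splitting is applied to \<open>u\<close> tensored with \<open>z\<close>,
    which is itself invertible modulo \<open>J\<close>; its two summands are the projections up to
    denominators.\<close>
  obtain u' a1 b1 a2 b2 where u': "u' \<in> V"
    and E1: "a1 \<in> Hom D (Dom D u' \<odot>\<^bsub>D\<^esub> (?T \<odot>\<^bsub>D\<^esub> ?y)) ((Cod D u' \<odot>\<^bsub>D\<^esub> (c1 \<odot>\<^bsub>D\<^esub> Dom D v2)) \<odot>\<^bsub>D\<^esub> ?y)"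
      "b1 \<in> Hom D ((Cod D u' \<odot>\<^bsub>D\<^esub> (c1 \<odot>\<^bsub>D\<^esub> Dom D v2)) \<odot>\<^bsub>D\<^esub> ?y) (Cod D u' \<odot>\<^bsub>D\<^esub> (?T \<odot>\<^bsub>D\<^esub> ?w))"
    and E2: "a2 \<in> Hom D (Dom D u' \<odot>\<^bsub>D\<^esub> (?T \<odot>\<^bsub>D\<^esub> ?y)) ((Dom D u' \<odot>\<^bsub>D\<^esub> (Cod D v1 \<odot>\<^bsub>D\<^esub> c2)) \<odot>\<^bsub>D\<^esub> ?y)"
      "b2 \<in> Hom D ((Dom D u' \<odot>\<^bsub>D\<^esub> (Cod D v1 \<odot>\<^bsub>D\<^esub> c2)) \<odot>\<^bsub>D\<^esub> ?y) (Cod D u' \<odot>\<^bsub>D\<^esub> (?T \<odot>\<^bsub>D\<^esub> ?w))"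
    and eq: "u' \<star>\<^bsub>D\<^esub> (idm D ?T \<star>\<^bsub>D\<^esub> (u \<star>\<^bsub>D\<^esub> idm D z)) = b1 \<cdot>\<^bsub>D\<^esub> a1 \<boxplus>\<^bsub>D\<^esub> b2 \<cdot>\<^bsub>D\<^esub> a2"
    by (rule B.arrow_splits[OF V t1(1) t2(1) n fh uz])
  obtain u1 where u1: "u1 \<in> A.loc Jp" "u' = farr F u1" using u' unfolding V_def by blast
  have u1': "u1 \<in> Arr C" "Cod C u1 \<in> A.twists" "A.cof Jp u1" using u1(1) unfolding A.loc_def by auto
  have u1K: "Dom C u1 \<in> K" "Cod C u1 \<in> K" using u1'(3) unfolding A.cof_def by auto
  have u'd: "Dom D u' = fobj F (Dom C u1)" "Cod D u' = fobj F (Cod C u1)" using F_arr[OF u1'(1)] u1(2) by auto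
  have u'L: "Dom D u' \<in> L" "Cod D u' \<in> L" unfolding u'd using F_K u1K by auto
  have TT: "?T \<in> B.twists" by (rule B.twist_tensor[OF v1'(1) v2'(1)])
  have TL: "?T \<in> L" by (rule B.twists_K[OF TT])
  have yL: "?y \<in> L" "?w \<in> L" using F_K u0K B.K_tensor k by auto
  let ?j1 = "(Cod D u' \<odot>\<^bsub>D\<^esub> (c1 \<odot>\<^bsub>D\<^esub> Dom D v2)) \<odot>\<^bsub>D\<^esub> ?y"
  let ?j2 = "(Dom D u' \<odot>\<^bsub>D\<^esub> (Cod D v1 \<odot>\<^bsub>D\<^esub> c2)) \<odot>\<^bsub>D\<^esub> ?y"
  let ?src = "Dom D u' \<odot>\<^bsub>D\<^esub> (?T \<odot>\<^bsub>D\<^esub> ?y)" and ?tgt = "Cod D u' \<odot>\<^bsub>D\<^esub> (?T \<odot>\<^bsub>D\<^esub> ?w)"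
  have j1: "?j1 \<in> H" if "B.tt_ideal H" "c1 \<in> H" for H
    by (rule B.tt_idealD(6)[OF that(1) B.ideal_left[OF that(1) B.tt_idealD(6)[OF that t2(3)] u'L(2)] yL(1)])
  have j2: "?j2 \<in> H" if "B.tt_ideal H" "c2 \<in> H" for H
    by (rule B.tt_idealD(6)[OF that(1) B.ideal_left[OF that(1) B.ideal_left[OF that t1(4)] u'L(1)] yL(1)])
  define e1 where "e1 = b1 \<cdot>\<^bsub>D\<^esub> a1"
  define e2 where "e2 = b2 \<cdot>\<^bsub>D\<^esub> a2"
  have e: "e1 \<in> Hom D ?src ?tgt" "e2 \<in> Hom D ?src ?tgt" unfolding e1_def e2_def
    by (rule B.comp_hom[OF E1], rule B.comp_hom[OF E2])
  \<comment> \<open>The sum is a tensor product of identities and images of denominators, hence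
    invertible modulo \<open>J\<close>.\<close>
  have cq: "B.cof J (e1 \<boxplus>\<^bsub>D\<^esub> e2)"
    unfolding e1_def e2_def eq[symmetric] u1(2) u0(2)
    by (intro B.cof_tarr[OF J] F_cof[OF Jp(1) FJ] u1'(3) u0'(3) B.cof_idm[OF J] TL k(1))
  have cq': "B.cof J (e2 \<boxplus>\<^bsub>D\<^esub> e1)" using cq B.addm_commute[OF e] by simp
  \<comment> \<open>All four tensor factors of the ends of \<open>e1\<close> and \<open>e2\<close>
    are now images of objects of the source; \<open>r\<close> accounts for the twist
    \<open>?T\<close>.\<close>
  obtain r where r: "r \<in> K" "B.isoc (fobj F r) ?T" using twist_image[OF TT] by blast
  have img: "B.isoc (fobj F (a \<odot>\<^bsub>C\<^esub> (r \<odot>\<^bsub>C\<^esub> (b \<odot>\<^bsub>C\<^esub> x)))) (fobj F a \<odot>\<^bsub>D\<^esub> (?T \<odot>\<^bsub>D\<^esub> (fobj F b \<odot>\<^bsub>D\<^esub> z)))"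
    if ab: "a \<in> K" "b \<in> K" for a b
  proof -
    note o = A.K_obj[OF ab(1)] A.K_obj[OF ab(2)] A.K_obj[OF r(1)] xo
    note i = B.isoc_sym[OF F_isoc_tensor] B.isoc_refl[OF F_obj]
    have "B.isoc (fobj F (r \<odot>\<^bsub>C\<^esub> (b \<odot>\<^bsub>C\<^esub> x))) (fobj F r \<odot>\<^bsub>D\<^esub> fobj F (b \<odot>\<^bsub>C\<^esub> x))" by (rule i(1)) (use o in auto)
    also have "B.isoc \<dots> (?T \<odot>\<^bsub>D\<^esub> (fobj F b \<odot>\<^bsub>D\<^esub> z))" unfolding z_def
      by (rule B.isoc_tensor[OF r(2) i(1)]) (use o in auto)
    finally have 1: "B.isoc (fobj F (r \<odot>\<^bsub>C\<^esub> (b \<odot>\<^bsub>C\<^esub> x))) (?T \<odot>\<^bsub>D\<^esub> (fobj F b \<odot>\<^bsub>D\<^esub> z))" .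
    have "B.isoc (fobj F (a \<odot>\<^bsub>C\<^esub> (r \<odot>\<^bsub>C\<^esub> (b \<odot>\<^bsub>C\<^esub> x)))) (fobj F a \<odot>\<^bsub>D\<^esub> fobj F (r \<odot>\<^bsub>C\<^esub> (b \<odot>\<^bsub>C\<^esub> x)))"
      by (rule i(1)) (use o in auto)
    also have "B.isoc \<dots> (fobj F a \<odot>\<^bsub>D\<^esub> (?T \<odot>\<^bsub>D\<^esub> (fobj F b \<odot>\<^bsub>D\<^esub> z)))"
      by (rule B.isoc_tensor[OF i(2) 1]) (use o in auto)
    finally show ?thesis .
  qed
  let ?xs = "Dom C u1 \<odot>\<^bsub>C\<^esub> (r \<odot>\<^bsub>C\<^esub> (Dom C u0 \<odot>\<^bsub>C\<^esub> x))" and ?xt = "Cod C u1 \<odot>\<^bsub>C\<^esub> (r \<odot>\<^bsub>C\<^esub> (Cod C u0 \<odot>\<^bsub>C\<^esub> x))"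
  have xK: "?xs \<in> K" "?xt \<in> K" using A.K_tensor u1K u0K r x by auto
  note isos = img[OF u1K(1) u0K(1), folded u'd] img[OF u1K(2) u0K(2), folded u'd]
  obtain d1 where d1: "d1 \<in> Hom C ?xs ?xt" "B.eqv (farr F d1) e1"
    by (rule lift_arrow[OF isos e(1) A.K_obj[OF xK(1)] A.K_obj[OF xK(2)]])
  obtain d2 where d2: "d2 \<in> Hom C ?xs ?xt" "B.eqv (farr F d2) e2"
    by (rule lift_arrow[OF isos e(2) A.K_obj[OF xK(1)] A.K_obj[OF xK(2)]])
  \<comment> \<open>The indices cross: \<open>e1\<close> factors through an object generated by
    \<open>z1\<close>, so the cone of its lift carries the part of \<open>z2\<close>.\<close>
  obtain x2 k2 l2 where x2: "A.tri ?xs ?xt x2 d1 k2 l2" using A.ex_tri[OF d1(1)] by blast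
  obtain x1 k1 l1 where x1: "A.tri ?xs ?xt x1 d2 k1 l1" using A.ex_tri[OF d2(1)] by blast
  have x12: "x1 \<in> K" "x2 \<in> K" using A.K_cone[OF x1 xK] A.K_cone[OF x2 xK] by auto
  note FX = F_K[OF x12(1)] F_K[OF x12(2)] F_K[OF xK(1)] F_K[OF xK(2)]
  \<comment> \<open>Modulo an ideal containing \<open>z2\<close> and \<open>P\<close> the summand
    \<open>e2\<close> vanishes, so \<open>e1\<close> is invertible and its cone vanishes.\<close>
  have m2: "fobj F x2 \<in> H" if H: "B.tt_ideal H" "z2 \<in> H" "P \<in> H" for H
  proof -
    have "c2 \<in> H" using B.gen_least[OF H(1,2) t2(2)] .
    thus ?thesis
      using B.summand_cone[OF H(1) B.cof_mono[OF cq Jle[OF H(1,3)]] e E2 e2_def j2[OF H(1)] B.eqv_sym[OF d1(2)] F_tri[OF x2]]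
      by blast
  qed
  have m1: "fobj F x1 \<in> H" if H: "B.tt_ideal H" "z1 \<in> H" "P \<in> H" for H
  proof -
    have "c1 \<in> H" using B.gen_least[OF H(1,2) t1(2)] .
    thus ?thesis
      using B.summand_cone[OF H(1) B.cof_mono[OF cq' Jle[OF H(1,3)]] e(2,1) E1 e1_def j1[OF H(1)] B.eqv_sym[OF d2(2)] F_tri[OF x1]]
      by blast
  qed
  \<comment> \<open>The factors of the target other than \<open>z\<close> are twists or images of
    twists, which are cancelled one after another.\<close>
  have tgt: "z \<odot>\<^bsub>D\<^esub> s \<in> H" if H: "B.tt_ideal H" "s \<in> L" "?tgt \<odot>\<^bsub>D\<^esub> s \<in> H" for H s
  proof -
    let ?I = "{y\<in>L. y \<odot>\<^bsub>D\<^esub> s \<in> H}"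
    have I: "B.tt_ideal ?I" by (rule B.ideal_preimage_tensor[OF H(1,2)])
    have Tw: "?T \<odot>\<^bsub>D\<^esub> ?w \<in> L" using B.K_tensor TL yL by blast
    have "?tgt \<in> ?I" using H(3) B.K_tensor[OF u'L(2) Tw] by blast
    hence "?T \<odot>\<^bsub>D\<^esub> ?w \<in> ?I" using B.detectsD(1)[OF F_detects[OF u1'(2)] I Tw] unfolding u'd by blast
    hence "?w \<in> ?I" using B.detectsD(1)[OF B.detects_twist[OF TT] I yL(2)] by blast
    hence "z \<in> ?I" using B.detectsD(1)[OF F_detects[OF u0'(2)] I k(1)] by blast
    thus ?thesis by blast
  qed
  have c1s2: "c1 \<odot>\<^bsub>D\<^esub> s2 \<in> J" by (rule pre[OF t1(2) z1s2 s(2) k(3)])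
  have c2s1: "c2 \<odot>\<^bsub>D\<^esub> s1 \<in> J" by (rule pre[OF t2(2) z2s1 s(1) k(4)])
  \<comment> \<open>Conversely, if the cone vanishes, \<open>e1\<close> is invertible; but tensoring
    with \<open>s2\<close> kills the object it factors through.\<close>
  have n2: "z2 \<in> H" if H: "B.tt_ideal H" "fobj F x2 \<in> H" "P \<in> H" for H
  proof -
    have "c1 \<in> {y\<in>L. y \<odot>\<^bsub>D\<^esub> s2 \<in> H}" using c1s2 Jle[OF H(1,3)] cK by blast
    hence "?j1 \<odot>\<^bsub>D\<^esub> s2 \<in> H" using j1[OF B.ideal_preimage_tensor[OF H(1) s(2)]] by blast
    hence "?tgt \<odot>\<^bsub>D\<^esub> s2 \<in> H"
      by (rule B.summand_cone'[OF H(1) s(2) e(1) E1 e1_def _ d1(2) F_tri[OF x2] FX(3,4) H(2)])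
    thus ?thesis unfolding z2_def by (rule tgt[OF H(1) s(2)])
  qed
  have n1: "z1 \<in> H" if H: "B.tt_ideal H" "fobj F x1 \<in> H" "P \<in> H" for H
  proof -
    have "c2 \<in> {y\<in>L. y \<odot>\<^bsub>D\<^esub> s1 \<in> H}" using c2s1 Jle[OF H(1,3)] cK by blast
    hence "?j2 \<odot>\<^bsub>D\<^esub> s1 \<in> H" using j2[OF B.ideal_preimage_tensor[OF H(1) s(1)]] by blast
    hence "?tgt \<odot>\<^bsub>D\<^esub> s1 \<in> H"
      by (rule B.summand_cone'[OF H(1) s(1) e(2) E2 e2_def _ d2(2) F_tri[OF x1] FX(3,4) H(2)])
    thus ?thesis unfolding z1_def by (rule tgt[OF H(1) s(1)])
  qed
  have "B.ile (fobj F (x1 \<odot>\<^bsub>C\<^esub> x2)) P"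
  proof (rule B.ileI)
    fix H assume H: "B.tt_ideal H" "P \<in> H"
    have sub: "J \<subseteq> H" by (rule Jle[OF H])
    \<comment> \<open>The images of \<open>x2\<close> and \<open>x1\<close> are reduced to
      \<open>z2\<close> and \<open>z1\<close>, whose product lies in \<open>J\<close>.\<close>
    let ?I1 = "{y\<in>L. z1 \<odot>\<^bsub>D\<^esub> y \<in> H}"
    have "z2 \<in> ?I1" "P \<in> ?I1" using z1z2 sub k B.ideal_left[OF H k(3)] by auto
    hence "fobj F x2 \<in> ?I1" by (rule m2[OF B.ideal_preimage_tensor'[OF H(1) k(3)]])
    hence "z1 \<in> {y\<in>L. y \<odot>\<^bsub>D\<^esub> fobj F x2 \<in> H}" using k by blast
    moreover have "P \<in> {y\<in>L. y \<odot>\<^bsub>D\<^esub> fobj F x2 \<in> H}" using B.tt_idealD(6)[OF H FX(2)] k by blast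
    ultimately have "fobj F x1 \<in> {y\<in>L. y \<odot>\<^bsub>D\<^esub> fobj F x2 \<in> H}"
      by (rule m1[OF B.ideal_preimage_tensor[OF H(1) FX(2)]])
    hence "fobj F x1 \<odot>\<^bsub>D\<^esub> fobj F x2 \<in> H" by blast
    thus "fobj F (x1 \<odot>\<^bsub>C\<^esub> x2) \<in> H" using B.ideal_isoc[OF H(1) F_isoc_tensor] A.K_obj x12 by blast
  qed
  hence "A.ile (x1 \<odot>\<^bsub>C\<^esub> x2) p" using F_ile_iff A.K_tensor x12 p unfolding P_def by blast
  moreover have "B.ile z1 (B.cjoin (fobj F x1) P)"
    by (rule B.ileI) (use n1 B.cjoin_iff[OF _ FX(1) k(2)] in blast)
  moreover have "B.ile z2 (B.cjoin (fobj F x2) P)"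
    by (rule B.ileI) (use n2 B.cjoin_iff[OF _ FX(2) k(2)] in blast)
  ultimately show ?thesis using x12 unfolding z1_def z2_def z_def P_def by blast
qed

sublocale lat: distributive_preorder_hom K A.ile A.cjoin "tobj C" A.zob "unit C" L B.ile B.cjoin "tobj D" B.zob "unit D" "fobj F"
proof
  show "\<And>a. a \<in> K \<Longrightarrow> fobj F a \<in> L" by (rule F_K)
  show "\<And>a b. a \<in> K \<Longrightarrow> b \<in> K \<Longrightarrow> B.ile (fobj F a) (fobj F b) \<longleftrightarrow> A.ile a b" by (rule F_ile_iff)
  show "B.ile (fobj F (A.cjoin a b)) (B.cjoin (fobj F a) (fobj F b))" if k: "a \<in> K" "b \<in> K" for a b
  proof (rule B.ileI)
    fix J assume J: "B.tt_ideal J" "B.cjoin (fobj F a) (fobj F b) \<in> J"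
    hence "a \<in> {x\<in>K. fobj F x \<in> J} \<and> b \<in> {x\<in>K. fobj F x \<in> J}" using B.cjoin_iff F_K k by auto
    hence "A.cjoin a b \<in> {x\<in>K. fobj F x \<in> J}" using A.cjoin_iff[OF F_preimage[OF J(1)] k] by blast
    thus "fobj F (A.cjoin a b) \<in> J" by blast
  qed
  show "B.ile (fobj F a \<odot>\<^bsub>D\<^esub> fobj F b) (fobj F (a \<odot>\<^bsub>C\<^esub> b))" if k: "a \<in> K" "b \<in> K" for a b
    by (rule B.ileI) (use B.ideal_isoc[OF _ B.isoc_sym[OF F_isoc_tensor]] A.K_obj k in blast)
  show "B.ile (fobj F A.zob) B.zob"
    by (rule B.ileI) (use B.tt_idealD(2) F_zero_object[OF A.zero_object_zob] in blast)
  show "B.ile (unit D) (fobj F (unit C))"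
    by (rule B.ileI) (use B.ideal_isoc[OF _ B.isoc_sym[OF F_isoc_unit]] in blast)
qed (rule splitting_property)

theorem spectral_quotient_fibres:
  defines "X \<equiv> Spc_topology (full_subcategory D L)" and "Y \<equiv> Spc_topology (full_subcategory C K)"
    and "\<phi> \<equiv> Spc_map (full_subcategory C K) F"
  shows "spectral_quotient_map X Y \<phi> \<and> (\<forall>P \<in> topspace Y. connectedin X {Q \<in> topspace X. \<phi> Q = P})"
proof -
  have "\<phi> = lat.pre" unfolding \<phi>_def Spc_map_def lat.pre_def by auto
  thus ?thesis
    unfolding X_def Y_def A.Spc_topology_full B.Spc_topology_full
    using lat.spectral_quotient_pre lat.connectedin_fibre by simp
qed

end

section \<open>Compact objects\<close>

context category begin

lemma coproductD:
  assumes "is_coproduct C I y c \<iota>"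
  shows "c \<in> Obj C" "i \<in> I \<Longrightarrow> \<iota> i \<in> Hom C (y i) c"
    and "\<lbrakk>z \<in> Obj C; \<And>i. i \<in> I \<Longrightarrow> f i \<in> Hom C (y i) z\<rbrakk> \<Longrightarrow> \<exists>!g. g \<in> Hom C c z \<and> (\<forall>i\<in>I. g \<cdot> \<iota> i = f i)"
proof -
  note h = assms[unfolded is_coproduct_def]
  show "c \<in> Obj C" by (rule conjunct1[OF h])
  show "i \<in> I \<Longrightarrow> \<iota> i \<in> Hom C (y i) c" by (rule bspec[OF conjunct1[OF conjunct2[OF h]]])
  assume z: "z \<in> Obj C" and f: "\<And>i. i \<in> I \<Longrightarrow> f i \<in> Hom C (y i) z"
  have "\<forall>i\<in>I. f i \<in> Hom C (y i) z" using f by blast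
  thus "\<exists>!g. g \<in> Hom C c z \<and> (\<forall>i\<in>I. g \<cdot> \<iota> i = f i)"
    by (rule mp[OF spec[OF bspec[OF conjunct2[OF conjunct2[OF h]] z], of f]])
qed

lemma coproduct_map:
  assumes c: "is_coproduct C I y c \<iota>" and z: "z \<in> Obj C" and f: "\<And>i. i \<in> I \<Longrightarrow> f i \<in> Hom C (y i) z"
  obtains g where "g \<in> Hom C c z" "\<And>i. i \<in> I \<Longrightarrow> g \<cdot> \<iota> i = f i"
  using ex1_implies_ex[OF coproductD(3)[where f = f, OF c z f]] by blast

lemma coproduct_ext:
  assumes c: "is_coproduct C I y c \<iota>" and g: "g \<in> Hom C c z" "g' \<in> Hom C c z"
    and eq: "\<And>i. i \<in> I \<Longrightarrow> g \<cdot> \<iota> i = g' \<cdot> \<iota> i"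
  shows "g = g'"
proof -
  have h: "g' \<cdot> \<iota> i \<in> Hom C (y i) z" if "i \<in> I" for i by (rule comp_hom[OF coproductD(2)[OF c that] g(2)])
  have "\<exists>!k. k \<in> Hom C c z \<and> (\<forall>i\<in>I. k \<cdot> \<iota> i = g' \<cdot> \<iota> i)"
    by (rule coproductD(3)[OF c hom_obj(2)[OF g(1)] h])
  thus ?thesis using g eq by blast
qed

lemma iso_two_of_three:
  assumes "is_iso C y z g" "f \<in> Hom C x y" "is_iso C x z (g \<cdot> f)" shows "is_iso C x y f"
proof -
  obtain g' where g': "is_iso C z y g'" "g' \<cdot> g = idm C y" "g \<cdot> g' = idm C z" using iso_inverse_ex[OF assms(1)] by blast
  have "is_iso C x y (g' \<cdot> (g \<cdot> f))" by (rule iso_comp[OF assms(3) g'(1)])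
  also have "g' \<cdot> (g \<cdot> f) = g' \<cdot> g \<cdot> f" by (rule comp_assoc[OF assms(2) iso_hom[OF assms(1)] iso_hom[OF g'(1)], symmetric])
  finally show ?thesis unfolding g'(2) using assms(2) by (simp add: hom_iff)
qed

end

section \<open>Finitely supported arrows into coproducts\<close>

context additive_category begin

abbreviation gsum :: "'o \<Rightarrow> 'o \<Rightarrow> ('i \<Rightarrow> 'a) \<Rightarrow> 'i set \<Rightarrow> 'a" where
  "gsum x y \<equiv> gfinprod (hom_group C x y)"

lemma hom_group_sel [simp]:
  "carrier (hom_group C x y) = Hom C x y" "\<one>\<^bsub>hom_group C x y\<^esub> = zerom C x y" "f \<otimes>\<^bsub>hom_group C x y\<^esub> g = f \<boxplus> g"
  unfolding hom_group_def by simp_all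

lemma hom_comm_monoid: "x \<in> Obj C \<Longrightarrow> y \<in> Obj C \<Longrightarrow> comm_monoid (hom_group C x y)"
  using comm_group.axioms(1)[OF hom_comm_group] .

lemma hom_group_group: "x \<in> Obj C \<Longrightarrow> y \<in> Obj C \<Longrightarrow> group (hom_group C x y)"
  using comm_group.axioms(2)[OF hom_comm_group] .

lemma gsum_hom: "\<lbrakk>x \<in> Obj C; y \<in> Obj C; \<And>i. i \<in> A \<Longrightarrow> f i \<in> Hom C x y\<rbrakk> \<Longrightarrow> gsum x y f A \<in> Hom C x y"
  using comm_monoid.gfinprod_closed[OF hom_comm_monoid, of x y f A] by auto

lemma gsum_empty: "x \<in> Obj C \<Longrightarrow> y \<in> Obj C \<Longrightarrow> gsum x y f {} = zerom C x y"
  using comm_monoid.finprod_empty[OF hom_comm_monoid] unfolding gfinprod_def by simp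

lemma gsum_insert:
  assumes "x \<in> Obj C" "y \<in> Obj C" "finite A" "i \<notin> A" "\<And>j. j \<in> insert i A \<Longrightarrow> f j \<in> Hom C x y"
  shows "gsum x y f (insert i A) = f i \<boxplus> gsum x y f A"
  using comm_monoid.gfinprod_insert[OF hom_comm_monoid[OF assms(1,2)], of A f i] assms(3-5) by auto

lemma comp_gsum:
  assumes "finite A" "\<And>i. i \<in> A \<Longrightarrow> f i \<in> Hom C x y" "g \<in> Hom C y z" "x \<in> Obj C"
  shows "g \<cdot> gsum x y f A = gsum x z (\<lambda>i. g \<cdot> f i) A"
  using assms(1,2)
proof (induction A)
  case empty
  show ?case using assms(3,4) hom_obj[OF assms(3)] by (simp add: hom_iff gsum_empty)
next
  case (insert i A)
  have o: "y \<in> Obj C" "z \<in> Obj C" using hom_obj[OF assms(3)] by auto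
  have fi: "f i \<in> Hom C x y" using insert.prems by blast
  have "gsum x y f A \<in> Hom C x y" by (rule gsum_hom[OF assms(4) o(1)]) (use insert.prems in blast)
  hence "g \<cdot> (f i \<boxplus> gsum x y f A) = g \<cdot> f i \<boxplus> g \<cdot> gsum x y f A" by (rule addm_comp[OF fi _ assms(3)])
  also have "g \<cdot> gsum x y f A = gsum x z (\<lambda>i. g \<cdot> f i) A" by (rule insert.IH) (use insert.prems in blast)
  also have "g \<cdot> f i \<boxplus> \<dots> = gsum x z (\<lambda>i. g \<cdot> f i) (insert i A)"
    by (rule gsum_insert[symmetric, OF assms(4) o(2) insert.hyps]) (use comp_hom[OF insert.prems assms(3)] in blast)
  finally show ?case using gsum_insert[OF assms(4) o(1) insert.hyps insert.prems] by simp
qed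

lemma gsum_comp:
  assumes "finite A" "\<And>i. i \<in> A \<Longrightarrow> f i \<in> Hom C x y" "g \<in> Hom C w x" "y \<in> Obj C"
  shows "gsum x y f A \<cdot> g = gsum w y (\<lambda>i. f i \<cdot> g) A"
  using assms(1,2)
proof (induction A)
  case empty
  show ?case using assms(3,4) hom_obj[OF assms(3)] by (simp add: hom_iff gsum_empty)
next
  case (insert i A)
  have o: "w \<in> Obj C" "x \<in> Obj C" using hom_obj[OF assms(3)] by auto
  have fi: "f i \<in> Hom C x y" using insert.prems by blast
  have "gsum x y f A \<in> Hom C x y" by (rule gsum_hom[OF o(2) assms(4)]) (use insert.prems in blast)
  hence "(f i \<boxplus> gsum x y f A) \<cdot> g = f i \<cdot> g \<boxplus> gsum x y f A \<cdot> g" by (rule comp_addm[OF assms(3) fi])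
  also have "gsum x y f A \<cdot> g = gsum w y (\<lambda>i. f i \<cdot> g) A" by (rule insert.IH) (use insert.prems in blast)
  also have "f i \<cdot> g \<boxplus> \<dots> = gsum w y (\<lambda>i. f i \<cdot> g) (insert i A)"
    by (rule gsum_insert[symmetric, OF o(1) assms(4) insert.hyps]) (use comp_hom[OF assms(3) insert.prems] in blast)
  finally show ?case using gsum_insert[OF o(2) assms(4) insert.hyps insert.prems] by simp
qed

lemma gsum_cong:
  assumes "x \<in> Obj C" "y \<in> Obj C" "\<And>i. i \<in> A \<Longrightarrow> g i \<in> Hom C x y" "\<And>i. i \<in> A \<Longrightarrow> f i = g i"
  shows "gsum x y f A = gsum x y g A"
  by (rule comm_monoid.gfinprod_cong[OF hom_comm_monoid[OF assms(1,2)]]) (use assms in \<open>auto simp: simp_implies_def\<close>)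

lemma gsum_support:
  assumes "x \<in> Obj C" "y \<in> Obj C" "S \<subseteq> A" "\<And>i. i \<in> A - S \<Longrightarrow> f i = zerom C x y" "\<And>i. i \<in> A \<Longrightarrow> f i \<in> Hom C x y"
  shows "gsum x y f S = gsum x y f A"
  by (rule comm_monoid.gfinprod_mono_neutral_cong_left[OF hom_comm_monoid[OF assms(1,2)] assms(3)]) (use assms in auto)

lemma gsum_delta:
  assumes "x \<in> Obj C" "y \<in> Obj C" "j \<in> A" "f j \<in> Hom C x y" "\<And>i. i \<in> A \<Longrightarrow> i \<noteq> j \<Longrightarrow> f i = zerom C x y"
  shows "gsum x y f A = f j"
proof -
  have fA: "f i \<in> Hom C x y" if "i \<in> A" for i using assms that zerom_hom by (cases "i = j") auto
  have "gsum x y f {j} = gsum x y f A" by (rule gsum_support) (use assms fA in auto)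
  moreover have "gsum x y f {j} = f j \<boxplus> gsum x y f {}" by (rule gsum_insert) (use assms in auto)
  ultimately show ?thesis using assms(1,2,4) by (simp add: hom_iff gsum_empty)
qed

text \<open>The projector of the coproduct onto the summands indexed by \<open>J\<close>; it stands
  in for the subcoproduct.\<close>

definition part :: "'i set \<Rightarrow> ('i \<Rightarrow> 'o) \<Rightarrow> 'o \<Rightarrow> ('i \<Rightarrow> 'a) \<Rightarrow> 'i set \<Rightarrow> 'a \<Rightarrow> bool" where
  "part I y c \<iota> J e \<longleftrightarrow> e \<in> Hom C c c \<and> (\<forall>i\<in>I. e \<cdot> \<iota> i = (if i \<in> J then \<iota> i else zerom C (y i) c))"

lemma partD:
  assumes "part I y c \<iota> J e"
  shows "e \<in> Hom C c c" "i \<in> I \<Longrightarrow> i \<in> J \<Longrightarrow> e \<cdot> \<iota> i = \<iota> i" "i \<in> I \<Longrightarrow> i \<notin> J \<Longrightarrow> e \<cdot> \<iota> i = zerom C (y i) c"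
  using assms unfolding part_def by auto

lemma coproduct_obj: assumes "is_coproduct C I y c \<iota>" "i \<in> I" shows "y i \<in> Obj C"
  using hom_obj(1)[OF coproductD(2)[OF assms]] .

lemma part_ex: assumes c: "is_coproduct C I y c \<iota>" obtains e where "part I y c \<iota> J e"
proof -
  have "(if i \<in> J then \<iota> i else zerom C (y i) c) \<in> Hom C (y i) c" if "i \<in> I" for i
    using coproductD(2)[OF c that] zerom_hom coproduct_obj[OF c that] coproductD(1)[OF c] by simp
  then obtain e where "e \<in> Hom C c c" "\<And>i. i \<in> I \<Longrightarrow> e \<cdot> \<iota> i = (if i \<in> J then \<iota> i else zerom C (y i) c)"
    using coproduct_map[where f = "\<lambda>i. if i \<in> J then \<iota> i else zerom C (y i) c", OF c coproductD(1)[OF c]] by blast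
  thus thesis using that unfolding part_def by blast
qed

lemma part_unique: assumes "is_coproduct C I y c \<iota>" "part I y c \<iota> J e" "part I y c \<iota> J e'" shows "e = e'"
  by (rule coproduct_ext[OF assms(1) partD(1)[OF assms(2)] partD(1)[OF assms(3)]]) (use assms(2,3) in \<open>auto simp: part_def\<close>)

lemma part_mono:
  assumes c: "is_coproduct C I y c \<iota>" and e: "part I y c \<iota> J e" and e': "part I y c \<iota> J' e'" and J: "J \<subseteq> J'"
  shows "e' \<cdot> e = e"
proof (rule coproduct_ext[OF c comp_hom[OF partD(1)[OF e] partD(1)[OF e']] partD(1)[OF e]])
  fix i assume i: "i \<in> I"
  note ii = coproductD(2)[OF c i]
  have "e' \<cdot> e \<cdot> \<iota> i = e' \<cdot> (e \<cdot> \<iota> i)" by (rule comp_assoc[OF ii partD(1)[OF e] partD(1)[OF e']])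
  also have "\<dots> = e \<cdot> \<iota> i"
  proof (cases "i \<in> J")
    case True thus ?thesis using partD(2)[OF e i] partD(2)[OF e' i] J by auto
  next
    case False
    thus ?thesis using partD(3)[OF e i False] partD(1)[OF e'] coproduct_obj[OF c i] by (simp add: hom_iff)
  qed
  finally show "e' \<cdot> e \<cdot> \<iota> i = e \<cdot> \<iota> i" .
qed

text \<open>Says that \<open>f\<close> lands in a finite part of the coproduct. A fixed-point
  equation is easier to move through composites and tensor products than a finite sum of
  components.\<close>

definition fin_supp :: "'i set \<Rightarrow> ('i \<Rightarrow> 'o) \<Rightarrow> 'o \<Rightarrow> ('i \<Rightarrow> 'a) \<Rightarrow> 'a \<Rightarrow> bool" where
  "fin_supp I y c \<iota> f \<longleftrightarrow> (\<exists>J e. finite J \<and> J \<subseteq> I \<and> part I y c \<iota> J e \<and> e \<cdot> f = f)"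

lemma projections:
  assumes c: "is_coproduct C I y c \<iota>"
  obtains \<pi> where "\<And>j. j \<in> I \<Longrightarrow> \<pi> j \<in> Hom C c (y j)" "\<And>j. j \<in> I \<Longrightarrow> \<pi> j \<cdot> \<iota> j = idm C (y j)"
    "\<And>i j. \<lbrakk>i \<in> I; j \<in> I; i \<noteq> j\<rbrakk> \<Longrightarrow> \<pi> j \<cdot> \<iota> i = zerom C (y i) (y j)"
proof -
  have ex: "\<exists>p. p \<in> Hom C c (y j) \<and> (\<forall>i\<in>I. p \<cdot> \<iota> i = (if i = j then idm C (y j) else zerom C (y i) (y j)))" if j: "j \<in> I" for j
  proof -
    have "(if i = j then idm C (y j) else zerom C (y i) (y j)) \<in> Hom C (y i) (y j)" if "i \<in> I" for i
      using idm_hom zerom_hom coproduct_obj[OF c] j that by simp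
    from ex1_implies_ex[OF coproductD(3)[where f = "\<lambda>i. if i = j then idm C (y j) else zerom C (y i) (y j)", OF c coproduct_obj[OF c j] this]]
    show ?thesis .
  qed
  define \<pi> where "\<pi> j = (SOME p. p \<in> Hom C c (y j) \<and>
      (\<forall>i\<in>I. p \<cdot> \<iota> i = (if i = j then idm C (y j) else zerom C (y i) (y j))))" for j
  have "\<pi> j \<in> Hom C c (y j) \<and> (\<forall>i\<in>I. \<pi> j \<cdot> \<iota> i = (if i = j then idm C (y j) else zerom C (y i) (y j)))"
    if "j \<in> I" for j unfolding \<pi>_def by (rule someI_ex[OF ex[OF that]])
  thus thesis using that[of \<pi>] by simp
qed

text \<open>The projections recover all components, so the canonical map is always injective and
  surjectivity is at stake. Its image consists of the finitely supported arrows, because the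
  projector onto a finite \<open>J\<close> is the sum over \<open>J\<close> of the inclusions
  composed with the projections.\<close>

lemma fin_supp_iff_iso:
  assumes c: "is_coproduct C I y c \<iota>" and x: "x \<in> Obj C"
  shows "(\<lambda>\<phi>. gsum x c (\<lambda>i. \<iota> i \<cdot> \<phi> i) I) \<in> iso (sum_group I (\<lambda>i. hom_group C x (y i))) (hom_group C x c) \<longleftrightarrow>
    (\<forall>f\<in>Hom C x c. fin_supp I y c \<iota> f)"
proof -
  let ?S = "sum_group I (\<lambda>i. hom_group C x (y i))"
  let ?h = "\<lambda>\<phi>. gsum x c (\<lambda>i. \<iota> i \<cdot> \<phi> i) I"
  have co: "c \<in> Obj C" by (rule coproductD(1)[OF c])
  note ih = coproductD(2)[OF c] and yo = coproduct_obj[OF c]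
  have car: "carrier ?S = {\<phi> \<in> \<Pi>\<^sub>E i\<in>I. Hom C x (y i). finite {i \<in> I. \<phi> i \<noteq> zerom C x (y i)}}"
    using carrier_sum_group[of I "\<lambda>i. hom_group C x (y i)"] hom_group_group[OF x yo] by simp
  have ip: "\<iota> i \<cdot> \<phi> i \<in> Hom C x c" if "\<phi> \<in> carrier ?S" "i \<in> I" for \<phi> i
    using comp_hom[OF _ ih[OF that(2)]] that unfolding car by (auto simp: PiE_iff)
  have supp: "?h \<phi> = gsum x c (\<lambda>i. \<iota> i \<cdot> \<phi> i) {i\<in>I. \<phi> i \<noteq> zerom C x (y i)}" if "\<phi> \<in> carrier ?S" for \<phi>
  proof (rule gsum_support[symmetric, OF x co])
    fix i assume "i \<in> I - {i\<in>I. \<phi> i \<noteq> zerom C x (y i)}"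
    thus "\<iota> i \<cdot> \<phi> i = zerom C x c" using ih x by (simp add: hom_iff)
  qed (use ip[OF that] in auto)
  have hom: "?h \<in> hom ?S (hom_group C x c)"
  proof (rule comm_group.hom_group_sum[OF hom_comm_group[OF x co]])
    fix i assume i: "i \<in> I"
    show "group (hom_group C x (y i))" by (rule hom_group_group[OF x yo[OF i]])
    show "(\<cdot>) (\<iota> i) \<in> hom (hom_group C x (y i)) (hom_group C x c)"
      unfolding hom_def using comp_hom[OF _ ih[OF i]] addm_comp[OF _ _ ih[OF i]] by auto
  qed
  obtain \<pi> where \<pi>: "\<And>j. j \<in> I \<Longrightarrow> \<pi> j \<in> Hom C c (y j)" "\<And>j. j \<in> I \<Longrightarrow> \<pi> j \<cdot> \<iota> j = idm C (y j)"
    "\<And>i j. \<lbrakk>i \<in> I; j \<in> I; i \<noteq> j\<rbrakk> \<Longrightarrow> \<pi> j \<cdot> \<iota> i = zerom C (y i) (y j)" using projections[OF c] by blast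
  have pj: "\<pi> j \<cdot> ?h \<phi> = \<phi> j" if p: "\<phi> \<in> carrier ?S" and j: "j \<in> I" for \<phi> j
  proof -
    have ph: "\<phi> i \<in> Hom C x (y i)" if "i \<in> I" for i using p that unfolding car by (auto simp: PiE_iff)
    have fin: "finite {i\<in>I. \<phi> i \<noteq> zerom C x (y i)}" using p unfolding car by blast
    let ?f = "\<lambda>i. \<pi> j \<cdot> (\<iota> i \<cdot> \<phi> i)"
    have f: "?f i = \<pi> j \<cdot> \<iota> i \<cdot> \<phi> i" if "i \<in> I" for i
      by (rule comp_assoc[OF ph[OF that] ih[OF that] \<pi>(1)[OF j], symmetric])
    have fj: "?f j = \<phi> j" unfolding f[OF j] \<pi>(2)[OF j] using ph[OF j] by (simp add: hom_iff)
    have f0: "?f i = zerom C x (y j)" if "i \<in> I" "i \<noteq> j" for i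
      unfolding f[OF that(1)] \<pi>(3)[OF that(1) j that(2)] using ph[OF that(1)] yo[OF j] by (simp add: hom_iff)
    have fh: "?f i \<in> Hom C x (y j)" if "i \<in> I" for i
      using comp_hom[OF comp_hom[OF ph[OF that] ih[OF that]] \<pi>(1)[OF j]] .
    have "\<pi> j \<cdot> ?h \<phi> = gsum x (y j) ?f {i\<in>I. \<phi> i \<noteq> zerom C x (y i)}"
      unfolding supp[OF p] by (rule comp_gsum[OF fin _ \<pi>(1)[OF j] x]) (use ip[OF p] in blast)
    also have "\<dots> = gsum x (y j) ?f I"
    proof (rule gsum_support[OF x yo[OF j]])
      fix i assume i: "i \<in> I - {i\<in>I. \<phi> i \<noteq> zerom C x (y i)}"
      hence "\<iota> i \<cdot> \<phi> i = zerom C x c" using ih x by (simp add: hom_iff)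
      thus "?f i = zerom C x (y j)" using \<pi>(1)[OF j] x by (simp add: hom_iff)
    qed (use fh in auto)
    also have "\<dots> = ?f j" by (rule gsum_delta[where f = ?f, OF x yo[OF j] j fh[OF j] f0])
    finally show ?thesis unfolding fj .
  qed
  have inj: "inj_on ?h (carrier ?S)"
  proof (rule inj_onI)
    fix \<phi> \<psi> assume p: "\<phi> \<in> carrier ?S" "\<psi> \<in> carrier ?S" "?h \<phi> = ?h \<psi>"
    have "\<phi> j = \<psi> j" if "j \<in> I" for j using pj[OF p(1) that] pj[OF p(2) that] p(3) by simp
    thus "\<phi> = \<psi>" using p(1,2) unfolding car by (intro PiE_ext[of \<phi> I]) auto
  qed
  have "?h \<in> iso ?S (hom_group C x c) \<longleftrightarrow> ?h ` carrier ?S = Hom C x c"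
    unfolding iso_def bij_betw_def using hom inj by auto
  also have "\<dots> \<longleftrightarrow> (\<forall>f\<in>Hom C x c. f \<in> ?h ` carrier ?S)"
    using hom unfolding hom_def by auto
  also have "\<dots> \<longleftrightarrow> (\<forall>f\<in>Hom C x c. fin_supp I y c \<iota> f)"
  proof (rule ball_cong[OF refl])
    fix f assume f: "f \<in> Hom C x c"
    show "f \<in> ?h ` carrier ?S \<longleftrightarrow> fin_supp I y c \<iota> f"
    proof
      assume "f \<in> ?h ` carrier ?S"
      then obtain \<phi> where p: "\<phi> \<in> carrier ?S" "f = ?h \<phi>" by blast
      let ?J = "{i\<in>I. \<phi> i \<noteq> zerom C x (y i)}"
      have fin: "finite ?J" using p(1) unfolding car by blast
      obtain e where e: "part I y c \<iota> ?J e" using part_ex[OF c] by blast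
      have "e \<cdot> f = gsum x c (\<lambda>i. e \<cdot> (\<iota> i \<cdot> \<phi> i)) ?J"
        unfolding p(2) supp[OF p(1)] by (rule comp_gsum[OF fin _ partD(1)[OF e] x]) (use ip[OF p(1)] in blast)
      also have "\<dots> = gsum x c (\<lambda>i. \<iota> i \<cdot> \<phi> i) ?J"
      proof (rule gsum_cong[OF x co])
        fix i assume i: "i \<in> ?J"
        show "\<iota> i \<cdot> \<phi> i \<in> Hom C x c" using ip[OF p(1)] i by blast
        have "\<phi> i \<in> Hom C x (y i)" using p(1) i unfolding car by (auto simp: PiE_iff)
        hence "e \<cdot> (\<iota> i \<cdot> \<phi> i) = e \<cdot> \<iota> i \<cdot> \<phi> i" using comp_assoc[OF _ ih partD(1)[OF e]] i by simp
        also have "e \<cdot> \<iota> i = \<iota> i" using partD(2)[OF e] i by blast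
        finally show "e \<cdot> (\<iota> i \<cdot> \<phi> i) = \<iota> i \<cdot> \<phi> i" .
      qed
      finally have "e \<cdot> f = f" unfolding p(2) supp[OF p(1)] .
      thus "fin_supp I y c \<iota> f" unfolding fin_supp_def using fin e by blast
    next
      assume "fin_supp I y c \<iota> f"
      then obtain J e where J: "finite J" "J \<subseteq> I" "part I y c \<iota> J e" "e \<cdot> f = f" unfolding fin_supp_def by blast
      let ?e = "gsum c c (\<lambda>i. \<iota> i \<cdot> \<pi> i) J"
      have ipi: "\<iota> i \<cdot> \<pi> i \<in> Hom C c c" if "i \<in> I" for i by (rule comp_hom[OF \<pi>(1)[OF that] ih[OF that]])
      have eh: "?e \<in> Hom C c c" by (rule gsum_hom[OF co co]) (use ipi J(2) in blast)
      have ipk: "\<iota> i \<cdot> \<pi> i \<cdot> \<iota> k = \<iota> i \<cdot> (\<pi> i \<cdot> \<iota> k)" if "i \<in> I" "k \<in> I" for i k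
        by (rule comp_assoc[OF ih[OF that(2)] \<pi>(1)[OF that(1)] ih[OF that(1)]])
      have "part I y c \<iota> J ?e" unfolding part_def
      proof (intro conjI ballI eh)
        fix k assume k: "k \<in> I"
        let ?f = "\<lambda>i. \<iota> i \<cdot> \<pi> i \<cdot> \<iota> k"
        have "?e \<cdot> \<iota> k = gsum (y k) c ?f J" by (rule gsum_comp[OF J(1) _ ih[OF k] co]) (use ipi J(2) in blast)
        moreover have f0: "?f i = zerom C (y k) c" if "i \<in> I" "i \<noteq> k" for i
          unfolding ipk[OF that(1) k] using \<pi>(3)[OF k that(1)] that ih[OF that(1)] yo[OF k] by (simp add: hom_iff)
        have fk: "?f k = \<iota> k" unfolding ipk[OF k k] \<pi>(2)[OF k] using ih[OF k] by (simp add: hom_iff)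
        have "gsum (y k) c ?f J = (if k \<in> J then \<iota> k else zerom C (y k) c)"
        proof (cases "k \<in> J")
          case True
          have "gsum (y k) c ?f J = ?f k" by (rule gsum_delta[where f = ?f, OF yo[OF k] co True]) (use fk ih[OF k] f0 J(2) in auto)
          thus ?thesis using True fk by simp
        next
          case False
          have fJ: "?f i = zerom C (y k) c" if "i \<in> J" for i using f0[of i] that False J(2) by auto
          have "gsum (y k) c ?f {} = gsum (y k) c ?f J"
            by (rule gsum_support[OF yo[OF k] co]) (use fJ zerom_hom[OF yo[OF k] co] in auto)
          thus ?thesis using False unfolding gsum_empty[OF yo[OF k] co] by simp
        qed
        ultimately show "?e \<cdot> \<iota> k = (if k \<in> J then \<iota> k else zerom C (y k) c)" by simp
      qed
      hence "?e = e" by (rule part_unique[OF c _ J(3)])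
      hence ef: "?e \<cdot> f = f" using J(4) by simp
      let ?p = "\<lambda>i\<in>I. if i \<in> J then \<pi> i \<cdot> f else zerom C x (y i)"
      have pf: "\<pi> i \<cdot> f \<in> Hom C x (y i)" if "i \<in> I" for i by (rule comp_hom[OF f \<pi>(1)[OF that]])
      have pS: "?p \<in> carrier ?S" unfolding car
      proof (intro CollectI conjI)
        show "?p \<in> (\<Pi>\<^sub>E i\<in>I. Hom C x (y i))" using pf zerom_hom[OF x yo] by auto
        show "finite {i\<in>I. ?p i \<noteq> zerom C x (y i)}" by (rule finite_subset[OF _ J(1)]) auto
      qed
      have hp: "?h ?p = f"
      proof -
        have "gsum x c (\<lambda>i. \<iota> i \<cdot> ?p i) J = ?h ?p"
        proof (rule gsum_support[OF x co J(2)])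
          fix i assume i: "i \<in> I - J"
          thus "\<iota> i \<cdot> ?p i = zerom C x c" using ih x by (simp add: hom_iff)
        next
          fix i assume "i \<in> I" thus "\<iota> i \<cdot> ?p i \<in> Hom C x c" by (rule ip[OF pS])
        qed
        moreover have "gsum x c (\<lambda>i. \<iota> i \<cdot> ?p i) J = gsum x c (\<lambda>i. \<iota> i \<cdot> \<pi> i \<cdot> f) J"
        proof (rule gsum_cong[OF x co])
          fix i assume i: "i \<in> J"
          hence iI: "i \<in> I" using J(2) by blast
          show "\<iota> i \<cdot> \<pi> i \<cdot> f \<in> Hom C x c" by (rule comp_hom[OF f ipi[OF iI]])
          show "\<iota> i \<cdot> ?p i = \<iota> i \<cdot> \<pi> i \<cdot> f" using i iI comp_assoc[OF f \<pi>(1)[OF iI] ih[OF iI]] by simp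
        qed
        moreover have "?e \<cdot> f = gsum x c (\<lambda>i. \<iota> i \<cdot> \<pi> i \<cdot> f) J"
          by (rule gsum_comp[OF J(1) _ f co]) (use ipi J(2) in blast)
        ultimately show ?thesis using ef by simp
      qed
      show "f \<in> ?h ` carrier ?S" by (rule image_eqI[where x = ?p]) (rule hp[symmetric], rule pS)
    qed
  qed
  finally show ?thesis .
qed

definition small_coproduct :: "'u set \<Rightarrow> 'u set \<Rightarrow> ('u \<Rightarrow> 'o) \<Rightarrow> 'o \<Rightarrow> ('u \<Rightarrow> 'a) \<Rightarrow> bool" where
  "small_coproduct U I y c \<iota> \<longleftrightarrow> I \<subseteq> U \<and> small U I \<and> y \<in> I \<rightarrow> Obj C \<and> is_coproduct C I y c \<iota>"

lemma compactI:
  assumes "x \<in> Obj C" "\<And>I y c \<iota> f. \<lbrakk>small_coproduct U I y c \<iota>; f \<in> Hom C x c\<rbrakk> \<Longrightarrow> fin_supp I y c \<iota> f"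
  shows "compact_object U C x"
  unfolding compact_object_def
proof (intro conjI allI ballI impI assms(1))
  fix I y c \<iota> assume "I \<subseteq> U" "y \<in> I \<rightarrow> Obj C" "small U I \<and> is_coproduct C I y c \<iota>"
  hence s: "small_coproduct U I y c \<iota>" and c: "is_coproduct C I y c \<iota>" unfolding small_coproduct_def by auto
  show "(\<lambda>\<phi>. gsum x c (\<lambda>i. \<iota> i \<cdot> \<phi> i) I) \<in> iso (sum_group I (\<lambda>i. hom_group C x (y i))) (hom_group C x c)"
    unfolding fin_supp_iff_iso[OF c assms(1)] using assms(2)[OF s] by blast
qed

lemma compactD:
  assumes "compact_object U C x"
  shows "x \<in> Obj C" "\<lbrakk>small_coproduct U I y c \<iota>; f \<in> Hom C x c\<rbrakk> \<Longrightarrow> fin_supp I y c \<iota> f"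
proof -
  note h = assms[unfolded compact_object_def]
  show x: "x \<in> Obj C" by (rule conjunct1[OF h])
  assume s: "small_coproduct U I y c \<iota>" and f: "f \<in> Hom C x c"
  hence I: "I \<subseteq> U" "y \<in> I \<rightarrow> Obj C" "small U I \<and> is_coproduct C I y c \<iota>" unfolding small_coproduct_def by auto
  have "(\<lambda>\<phi>. gsum x c (\<lambda>i. \<iota> i \<cdot> \<phi> i) I) \<in> iso (sum_group I (\<lambda>i. hom_group C x (y i))) (hom_group C x c)"
    using conjunct2[OF h] I by simp
  thus "fin_supp I y c \<iota> f" unfolding fin_supp_iff_iso[OF conjunct2[OF I(3)] x] using f by blast
qed

end

context additive_category begin

lemma fin_suppI: "\<lbrakk>finite J; J \<subseteq> I; part I y c \<iota> J e; e \<cdot> f = f\<rbrakk> \<Longrightarrow> fin_supp I y c \<iota> f"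
  unfolding fin_supp_def by blast

lemma fin_suppE:
  assumes "fin_supp I y c \<iota> f" obtains J e where "finite J" "J \<subseteq> I" "part I y c \<iota> J e" "e \<cdot> f = f"
  using assms unfolding fin_supp_def by blast

lemma small_coproduct_is: "small_coproduct U I y c \<iota> \<Longrightarrow> is_coproduct C I y c \<iota>"
  unfolding small_coproduct_def by blast

lemma compact_retract:
  assumes s: "compact_object U C s" and i: "i \<in> Hom C x s" and p: "p \<in> Hom C s x" and pi: "p \<cdot> i = idm C x"
  shows "compact_object U C x"
proof (rule compactI)
  show "x \<in> Obj C" using hom_obj[OF i] by blast
  fix I y c \<iota> f assume sc: "small_coproduct U I y c \<iota>" and f: "f \<in> Hom C x c"
  obtain J e where J: "finite J" "J \<subseteq> I" "part I y c \<iota> J e" "e \<cdot> (f \<cdot> p) = f \<cdot> p"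
    using compactD(2)[OF s sc comp_hom[OF p f]] by (rule fin_suppE)
  note e = partD(1)[OF J(3)]
  have "e \<cdot> f = e \<cdot> (f \<cdot> p) \<cdot> i"
    using comp_assoc[OF i comp_hom[OF p f] e] comp_assoc[OF i p f] pi f by (simp add: hom_iff)
  also have "\<dots> = f" unfolding J(4) using comp_assoc[OF i p f] pi f by (simp add: hom_iff)
  finally show "fin_supp I y c \<iota> f" by (rule fin_suppI[OF J(1-3)])
qed

lemma compact_isoc: assumes "compact_object U C x" "isoc x y" shows "compact_object U C y"
proof -
  obtain f where "is_iso C x y f" using assms(2) unfolding isoc_def by blast
  then obtain g where "f \<in> Hom C x y" "g \<in> Hom C y x" "f \<cdot> g = idm C y" using isoE by metis
  thus ?thesis using compact_retract[OF assms(1), of g y f] by blast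
qed

lemma compact_zero: assumes x: "zero_object C x" shows "compact_object U C x"
proof (rule compactI)
  show "x \<in> Obj C" using x unfolding zero_object_def by blast
  fix I y c \<iota> f assume sc: "small_coproduct U I y c \<iota>" and f: "f \<in> Hom C x c"
  obtain e where e: "part I y c \<iota> {} e" using part_ex[OF small_coproduct_is[OF sc]] by blast
  note eh = partD(1)[OF e]
  have "e \<cdot> f = zerom C x c" using zero_object_hom(1)[OF x, of "e \<cdot> f"] f eh by (simp add: hom_iff)
  also have "\<dots> = f" using zero_object_hom(1)[OF x, of f] f by (simp add: hom_iff)
  finally show "fin_supp I y c \<iota> f" by (intro fin_suppI[OF _ _ e]) auto
qed

end

section \<open>Compact objects are closed under shifts and cones\<close>

context triangulated_category begin

text \<open>The shift is only an equivalence, so a coproduct must be desuspended before compactness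
  of \<open>x\<close> applies: its summands and \<open>c\<close> are replaced by chosen
  desuspensions, and full faithfulness supplies the inclusions. The projector found there is shifted
  back.\<close>

lemma compact_shift: assumes x: "compact_object U C x" shows "compact_object U C (Sho C x)"
proof (rule compactI)
  have xo: "x \<in> Obj C" by (rule compactD(1)[OF x])
  show "Sho C x \<in> Obj C" using xo by simp
  fix I y c \<iota> f assume sc: "small_coproduct U I y c \<iota>" and f: "f \<in> Hom C (Sho C x) c"
  note ic = small_coproduct_is[OF sc]
  note co = coproductD(1)[OF ic] and ih = coproductD(2)[OF ic] and yo = coproduct_obj[OF ic]
  have desusp: "\<exists>p. fst p \<in> Obj C \<and> is_iso C (Sho C (fst p)) v (snd p)" if vo: "v \<in> Obj C" for v
  proof -
    obtain u h where "u \<in> Obj C" "is_iso C (Sho C u) v h"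
      using shift_ess_surj vo unfolding essentially_surjective_def by blast
    thus ?thesis by (intro exI[of _ "(u, h)"]) simp
  qed
  \<comment> \<open>\<open>d v\<close> is a chosen desuspension of \<open>v\<close>, and
    \<open>t v\<close> the isomorphism from its shift to \<open>v\<close>.\<close>
  define w where "w v = (SOME p. fst p \<in> Obj C \<and> is_iso C (Sho C (fst p)) v (snd p))" for v
  define d where "d v = fst (w v)" for v
  define t where "t v = snd (w v)" for v
  have dt: "d v \<in> Obj C" "is_iso C (Sho C (d v)) v (t v)" if "v \<in> Obj C" for v
    using someI_ex[OF desusp[OF that]] unfolding w_def d_def t_def by auto
  note th = iso_hom[OF dt(2)]
  obtain s where s: "s \<in> Hom C c (Sho C (d c))" "s \<cdot> t c = idm C (Sho C (d c))" "t c \<cdot> s = idm C c"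
    using isoE[OF dt(2)[OF co]] by metis
  note tc = th[OF co]
  define k where "k i = (SOME g. g \<in> Hom C (d (y i)) (d c) \<and> Sha C g = s \<cdot> (\<iota> i \<cdot> t (y i)))" for i
  have k: "k i \<in> Hom C (d (y i)) (d c)" "Sha C (k i) = s \<cdot> (\<iota> i \<cdot> t (y i))" if i: "i \<in> I" for i
  proof -
    have h: "s \<cdot> (\<iota> i \<cdot> t (y i)) \<in> Hom C (Sho C (d (y i))) (Sho C (d c))"
      by (rule comp_hom[OF comp_hom[OF th[OF yo[OF i]] ih[OF i]] s(1)])
    have "\<exists>g. g \<in> Hom C (d (y i)) (d c) \<and> Sha C g = s \<cdot> (\<iota> i \<cdot> t (y i))"
      by (rule sha_full[OF h dt(1)[OF yo[OF i]] dt(1)[OF co]]) blast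
    from someI_ex[OF this] show "k i \<in> Hom C (d (y i)) (d c)" "Sha C (k i) = s \<cdot> (\<iota> i \<cdot> t (y i))" unfolding k_def by auto
  qed
  have tk: "t c \<cdot> Sha C (k i) = \<iota> i \<cdot> t (y i)" if i: "i \<in> I" for i
  proof -
    have it: "\<iota> i \<cdot> t (y i) \<in> Hom C (Sho C (d (y i))) c" by (rule comp_hom[OF th[OF yo[OF i]] ih[OF i]])
    show ?thesis unfolding k(2)[OF i] comp_assoc[OF it s(1) tc, symmetric] s(3) using it by (simp add: hom_iff)
  qed
  have "is_coproduct C I (\<lambda>i. d (y i)) (d c) k" unfolding is_coproduct_def
  proof (intro conjI ballI allI impI)
    show "d c \<in> Obj C" by (rule dt(1)[OF co])
    show "k i \<in> Hom C (d (y i)) (d c)" if "i \<in> I" for i by (rule k(1)[OF that])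
    fix z g assume z: "z \<in> Obj C" and g: "\<forall>i\<in>I. g i \<in> Hom C (d (y i)) z"
    have inv: "\<exists>r. r \<in> Hom C v (Sho C (d v)) \<and> r \<cdot> t v = idm C (Sho C (d v))" if "v \<in> Obj C" for v
      using isoE[OF dt(2)[OF that]] by metis
    define r where "r v = (SOME r. r \<in> Hom C v (Sho C (d v)) \<and> r \<cdot> t v = idm C (Sho C (d v)))" for v
    have r: "r v \<in> Hom C v (Sho C (d v))" "r v \<cdot> t v = idm C (Sho C (d v))" if "v \<in> Obj C" for v
      using someI_ex[OF inv[OF that]] unfolding r_def by auto
    have sg: "Sha C (g i) \<in> Hom C (Sho C (d (y i))) (Sho C z)" if "i \<in> I" for i using sha_hom g that by blast
    have gr: "Sha C (g i) \<cdot> r (y i) \<in> Hom C (y i) (Sho C z)" if "i \<in> I" for i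
      by (rule comp_hom[OF r(1)[OF yo[OF that]] sg[OF that]])
    \<comment> \<open>The universal property of \<open>d c\<close> is obtained from that of
      \<open>c\<close> by shifting the whole family.\<close>
    obtain G where G: "G \<in> Hom C c (Sho C z)" "\<And>i. i \<in> I \<Longrightarrow> G \<cdot> \<iota> i = Sha C (g i) \<cdot> r (y i)"
      using coproduct_map[where f = "\<lambda>i. Sha C (g i) \<cdot> r (y i)", OF ic sho_obj[OF z] gr] by blast
    obtain G' where G': "G' \<in> Hom C (d c) z" "Sha C G' = G \<cdot> t c"
      by (rule sha_full[OF comp_hom[OF tc G(1)] dt(1)[OF co] z])
    show "\<exists>!h. h \<in> Hom C (d c) z \<and> (\<forall>i\<in>I. h \<cdot> k i = g i)"
    proof (rule ex1I[of _ G'])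
      have "G' \<cdot> k i = g i" if i: "i \<in> I" for i
      proof (rule sha_inj[OF comp_hom[OF k(1)[OF i] G'(1)] bspec[OF g i]])
        have "Sha C (G' \<cdot> k i) = G \<cdot> t c \<cdot> Sha C (k i)" using sha_comp[OF k(1)[OF i] G'(1)] G'(2) by simp
        also have "\<dots> = G \<cdot> (\<iota> i \<cdot> t (y i))" using comp_assoc[OF sha_hom[OF k(1)[OF i]] tc G(1)] tk[OF i] by simp
        also have "\<dots> = Sha C (g i) \<cdot> r (y i) \<cdot> t (y i)"
          using comp_assoc[OF th[OF yo[OF i]] ih[OF i] G(1)] G(2)[OF i] by simp
        also have "\<dots> = Sha C (g i)"
          using comp_assoc[OF th[OF yo[OF i]] r(1)[OF yo[OF i]] sg[OF i]] r(2)[OF yo[OF i]] sg[OF i] by (simp add: hom_iff)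
        finally show "Sha C (G' \<cdot> k i) = Sha C (g i)" .
      qed
      thus "G' \<in> Hom C (d c) z \<and> (\<forall>i\<in>I. G' \<cdot> k i = g i)" using G'(1) by blast
      fix h assume h: "h \<in> Hom C (d c) z \<and> (\<forall>i\<in>I. h \<cdot> k i = g i)"
      have hh: "h \<in> Hom C (d c) z" using h by blast
      have hk: "h \<cdot> k i = G' \<cdot> k i" if "i \<in> I" for i using h \<open>G' \<in> _ \<and> _\<close> that by simp
      have "Sha C h \<cdot> s = Sha C G' \<cdot> s"
      proof (rule coproduct_ext[OF ic comp_hom[OF s(1) sha_hom[OF hh]] comp_hom[OF s(1) sha_hom[OF G'(1)]]])
        fix i assume i: "i \<in> I"
        have *: "q \<cdot> s \<cdot> \<iota> i \<cdot> t (y i) = q \<cdot> Sha C (k i)" if q: "q \<in> Hom C (Sho C (d c)) (Sho C z)" for q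
          unfolding k(2)[OF i]
          using comp_assoc[OF ih[OF i] s(1) q] comp_assoc[OF th[OF yo[OF i]] comp_hom[OF ih[OF i] s(1)] q]
            comp_assoc[OF th[OF yo[OF i]] ih[OF i] s(1)] by simp
        have "Sha C h \<cdot> Sha C (k i) = Sha C G' \<cdot> Sha C (k i)"
          using sha_comp[OF k(1)[OF i] hh] sha_comp[OF k(1)[OF i] G'(1)] hk[OF i] by simp
        hence "Sha C h \<cdot> s \<cdot> \<iota> i \<cdot> t (y i) = Sha C G' \<cdot> s \<cdot> \<iota> i \<cdot> t (y i)"
          using *[OF sha_hom[OF hh]] *[OF sha_hom[OF G'(1)]] by simp
        thus "Sha C h \<cdot> s \<cdot> \<iota> i = Sha C G' \<cdot> s \<cdot> \<iota> i"
          by (rule iso_cancel_right[OF dt(2)[OF yo[OF i]] comp_hom[OF ih[OF i] comp_hom[OF s(1) sha_hom[OF hh]]]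
                comp_hom[OF ih[OF i] comp_hom[OF s(1) sha_hom[OF G'(1)]]]])
      qed
      hence "Sha C h \<cdot> s \<cdot> t c = Sha C G' \<cdot> s \<cdot> t c" by simp
      hence "Sha C h = Sha C G'"
        using comp_assoc[OF tc s(1) sha_hom[OF hh]] comp_assoc[OF tc s(1) sha_hom[OF G'(1)]] s(2)
          sha_hom[OF hh] sha_hom[OF G'(1)] by (simp add: hom_iff)
      thus "h = G'" by (rule sha_inj[OF hh G'(1)])
    qed
  qed
  moreover have "I \<subseteq> U" "small U I" using sc unfolding small_coproduct_def by auto
  moreover have "(\<lambda>i. d (y i)) \<in> I \<rightarrow> Obj C" using dt(1)[OF yo] by blast
  ultimately have sc': "small_coproduct U I (\<lambda>i. d (y i)) (d c) k" unfolding small_coproduct_def by blast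
  obtain f' where f': "f' \<in> Hom C x (d c)" "Sha C f' = s \<cdot> f" by (rule sha_full[OF comp_hom[OF f s(1)] xo dt(1)[OF co]])
  obtain J e where J: "finite J" "J \<subseteq> I" "part I (\<lambda>i. d (y i)) (d c) k J e" "e \<cdot> f' = f'"
    using compactD(2)[OF x sc' f'(1)] by (rule fin_suppE)
  note e = partD(1)[OF J(3)] and se = sha_hom[OF partD(1)[OF J(3)]]
  \<comment> \<open>The projector on the desuspension, shifted and conjugated back to
    \<open>c\<close>.\<close>
  let ?e = "t c \<cdot> (Sha C e \<cdot> s)"
  have es: "Sha C e \<cdot> s \<in> Hom C c (Sho C (d c))" by (rule comp_hom[OF s(1) se])
  have eh: "?e \<in> Hom C c c" by (rule comp_hom[OF es tc])
  have main: "?e \<cdot> \<iota> i \<cdot> t (y i) = t c \<cdot> Sha C (e \<cdot> k i)" if i: "i \<in> I" for i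
  proof -
    have it: "\<iota> i \<cdot> t (y i) \<in> Hom C (Sho C (d (y i))) c" by (rule comp_hom[OF th[OF yo[OF i]] ih[OF i]])
    have "?e \<cdot> \<iota> i \<cdot> t (y i) = t c \<cdot> (Sha C e \<cdot> (s \<cdot> (\<iota> i \<cdot> t (y i))))"
      using comp_assoc[OF th[OF yo[OF i]] ih[OF i] eh] comp_assoc[OF it es tc] comp_assoc[OF it s(1) se] by simp
    also have "\<dots> = t c \<cdot> Sha C (e \<cdot> k i)" using k(2)[OF i] sha_comp[OF k(1)[OF i] e] by simp
    finally show ?thesis .
  qed
  have "part I y c \<iota> J ?e" unfolding part_def
  proof (intro conjI ballI eh)
    fix i assume i: "i \<in> I"
    note cancel = iso_cancel_right[OF dt(2)[OF yo[OF i]] comp_hom[OF ih[OF i] eh]]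
    show "?e \<cdot> \<iota> i = (if i \<in> J then \<iota> i else zerom C (y i) c)"
    proof (cases "i \<in> J")
      case True
      have "?e \<cdot> \<iota> i = \<iota> i"
        by (rule cancel[OF ih[OF i]]) (simp only: main[OF i] partD(2)[OF J(3) i True] tk[OF i])
      thus ?thesis using True by simp
    next
      case False
      have z: "zerom C (y i) c \<in> Hom C (y i) c" by (rule zerom_hom[OF yo[OF i] co])
      have "?e \<cdot> \<iota> i = zerom C (y i) c"
      proof (rule cancel[OF z])
        have "t c \<cdot> Sha C (zerom C (d (y i)) (d c)) = zerom C (Sho C (d (y i))) c"
          using sha_zero[OF dt(1)[OF yo[OF i]] dt(1)[OF co]] tc dt(1)[OF yo[OF i]] by (simp add: hom_iff)
        moreover have "zerom C (y i) c \<cdot> t (y i) = zerom C (Sho C (d (y i))) c"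
          using th[OF yo[OF i]] co by (simp add: hom_iff)
        ultimately show "?e \<cdot> \<iota> i \<cdot> t (y i) = zerom C (y i) c \<cdot> t (y i)"
          unfolding main[OF i] partD(3)[OF J(3) i False] by simp
      qed
      thus ?thesis using False by simp
    qed
  qed
  moreover have "?e \<cdot> f = f"
  proof -
    have "?e \<cdot> f = t c \<cdot> (Sha C e \<cdot> (s \<cdot> f))" using comp_assoc[OF f es tc] comp_assoc[OF f s(1) se] by simp
    also have "\<dots> = t c \<cdot> (s \<cdot> f)" using sha_comp[OF f'(1) e] f'(2) J(4) by simp
    also have "\<dots> = t c \<cdot> s \<cdot> f" by (rule comp_assoc[OF f s(1) tc, symmetric])
    also have "\<dots> = f" unfolding s(3) using f by (simp add: hom_iff)
    finally show ?thesis .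
  qed
  ultimately show "fin_supp I y c \<iota> f" by (rule fin_suppI[OF J(1,2)])
qed

text \<open>A five-lemma argument with projectors: \<open>e\<close> fixes the composite of
  \<open>k\<close> with \<open>g\<close>, the remainder factors through the shift of
  \<open>x\<close> by an arrow fixed by some \<open>e'\<close>, and the projector onto the union of
  the two index sets fixes both contributions.\<close>

lemma compact_cone:
  assumes t: "tri x y z f g h" and x: "compact_object U C x" and y: "compact_object U C y"
  shows "compact_object U C z"
proof (rule compactI)
  note T = tri_in[OF t]
  show "z \<in> Obj C" by (rule T(7))
  fix I v c \<iota> k assume sc: "small_coproduct U I v c \<iota>" and k: "k \<in> Hom C z c"
  note ic = small_coproduct_is[OF sc]
  obtain J e where J: "finite J" "J \<subseteq> I" "part I v c \<iota> J e" "e \<cdot> (k \<cdot> g) = k \<cdot> g"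
    using compactD(2)[OF y sc comp_hom[OF T(2) k]] by (rule fin_suppE)
  note e = partD(1)[OF J(3)]
  have ek: "e \<cdot> k \<in> Hom C z c" by (rule comp_hom[OF k e])
  let ?r = "sub k (e \<cdot> k)"
  have r: "?r \<in> Hom C z c" by (rule sub_hom[OF k ek])
  have "?r \<cdot> g = zerom C y c"
    unfolding sub_comp[OF T(2) k ek] comp_assoc[OF T(2) k e] J(4) by (rule sub_self[OF comp_hom[OF T(2) k]])
  hence "isz (?r \<cdot> g)" using isz_zerom[OF T(6) hom_obj(2)[OF k]] by simp
  then obtain m where m: "m \<in> Hom C (Sho C x) c" "?r = m \<cdot> h" using tri_contra2[OF t r] by blast
  obtain J' e' where J': "finite J'" "J' \<subseteq> I" "part I v c \<iota> J' e'" "e' \<cdot> m = m"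
    using compactD(2)[OF compact_shift[OF x] sc m(1)] by (rule fin_suppE)
  note e' = partD(1)[OF J'(3)]
  obtain e2 where e2: "part I v c \<iota> (J \<union> J') e2" using part_ex[OF ic] by blast
  note e2h = partD(1)[OF e2]
  have 1: "e2 \<cdot> e = e" by (rule part_mono[OF ic J(3) e2]) blast
  have 2: "e2 \<cdot> e' = e'" by (rule part_mono[OF ic J'(3) e2]) blast
  have "e2 \<cdot> m = e2 \<cdot> e' \<cdot> m" using comp_assoc[OF m(1) e' e2h] J'(4) by simp
  hence e2m: "e2 \<cdot> m = m" unfolding 2 J'(4) .
  have "e2 \<cdot> ?r = e2 \<cdot> m \<cdot> h" using comp_assoc[OF T(3) m(1) e2h] m(2) by simp
  hence e2r: "e2 \<cdot> ?r = ?r" unfolding e2m m(2)[symmetric] .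
  have "e2 \<cdot> k = e2 \<cdot> (?r \<boxplus> e \<cdot> k)" using sub_add[OF k ek] by simp
  also have "\<dots> = e2 \<cdot> ?r \<boxplus> e2 \<cdot> (e \<cdot> k)" by (rule addm_comp[OF r ek e2h])
  also have "e2 \<cdot> (e \<cdot> k) = e \<cdot> k" using comp_assoc[OF k e e2h] 1 by simp
  also have "e2 \<cdot> ?r \<boxplus> e \<cdot> k = k" unfolding e2r by (rule sub_add[OF k ek])
  finally show "fin_supp I v c \<iota> k" by (intro fin_suppI[OF _ _ e2]) (use J J' in auto)
qed

end

section \<open>Coproducts and the tensor product\<close>

context tt_category begin

text \<open>Tensoring with \<open>d\<close> is a left adjoint, as the category is closed: a family
  is transposed to the internal hom, glued there and transposed back.\<close>

lemma tensor_coproduct: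
  assumes sc: "small_coproduct U I y c \<iota>" and d: "d \<in> Obj C"
  shows "small_coproduct U I (\<lambda>i. y i \<odot> d) (c \<odot> d) (\<lambda>i. \<iota> i \<star> idm C d)"
proof -
  note ic = small_coproduct_is[OF sc]
  note co = coproductD(1)[OF ic] and ih = coproductD(2)[OF ic] and yo = coproduct_obj[OF ic]
  note di = idm_hom[OF d]
  have "is_coproduct C I (\<lambda>i. y i \<odot> d) (c \<odot> d) (\<lambda>i. \<iota> i \<star> idm C d)" unfolding is_coproduct_def
  proof (intro conjI ballI allI impI)
    show "c \<odot> d \<in> Obj C" using co d by simp
    show "\<iota> i \<star> idm C d \<in> Hom C (y i \<odot> d) (c \<odot> d)" if "i \<in> I" for i by (rule tarr_hom[OF ih[OF that] di])
    fix z f assume z: "z \<in> Obj C" and f: "\<forall>i\<in>I. f i \<in> Hom C (y i \<odot> d) z"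
    obtain h ev where "is_internal_hom C d z h ev" using closed[OF d z] by blast
    hence hev: "h \<in> Obj C" "ev \<in> Hom C (h \<odot> d) z"
      and tr: "\<And>v k. \<lbrakk>v \<in> Obj C; k \<in> Hom C (v \<odot> d) z\<rbrakk> \<Longrightarrow> \<exists>!g. g \<in> Hom C v h \<and> ev \<cdot> (g \<star> idm C d) = k"
      unfolding is_internal_hom_def by auto
    define t where "t v k = (THE g. g \<in> Hom C v h \<and> ev \<cdot> (g \<star> idm C d) = k)" for v k
    have t: "t v k \<in> Hom C v h" "ev \<cdot> (t v k \<star> idm C d) = k" if "v \<in> Obj C" "k \<in> Hom C (v \<odot> d) z" for v k
      using theI'[OF tr[OF that]] unfolding t_def by auto
    have tu: "g = g'" if g: "g \<in> Hom C v h" "g' \<in> Hom C v h" "ev \<cdot> (g \<star> idm C d) = ev \<cdot> (g' \<star> idm C d)" for g g' v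
      using tr[OF hom_obj(1)[OF g(1)] comp_hom[OF tarr_hom[OF g(2) di] hev(2)]] g by blast
    have res: "ev \<cdot> (g \<star> idm C d) \<cdot> (\<iota> i \<star> idm C d) = ev \<cdot> ((g \<cdot> \<iota> i) \<star> idm C d)" if g: "g \<in> Hom C c h" and i: "i \<in> I" for g i
      using comp_assoc[OF tarr_hom[OF ih[OF i] di] tarr_hom[OF g di] hev(2)] tarr_comp[OF ih[OF i] g di di] d by simp
    have th: "t (y i) (f i) \<in> Hom C (y i) h" if "i \<in> I" for i using t(1)[OF yo[OF that] bspec[OF f that]] .
    obtain G where G: "G \<in> Hom C c h" "\<And>i. i \<in> I \<Longrightarrow> G \<cdot> \<iota> i = t (y i) (f i)"
      using coproduct_map[where f = "\<lambda>i. t (y i) (f i)", OF ic hev(1) th] by blast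
    show "\<exists>!g. g \<in> Hom C (c \<odot> d) z \<and> (\<forall>i\<in>I. g \<cdot> (\<iota> i \<star> idm C d) = f i)"
    proof (rule ex1I[of _ "ev \<cdot> (G \<star> idm C d)"])
      have Gi: "ev \<cdot> (G \<star> idm C d) \<cdot> (\<iota> i \<star> idm C d) = f i" if i: "i \<in> I" for i
        unfolding res[OF G(1) i] G(2)[OF i] by (rule t(2)[OF yo[OF i] bspec[OF f i]])
      show "ev \<cdot> (G \<star> idm C d) \<in> Hom C (c \<odot> d) z \<and> (\<forall>i\<in>I. ev \<cdot> (G \<star> idm C d) \<cdot> (\<iota> i \<star> idm C d) = f i)"
        using Gi comp_hom[OF tarr_hom[OF G(1) di] hev(2)] by blast
      fix k assume k: "k \<in> Hom C (c \<odot> d) z \<and> (\<forall>i\<in>I. k \<cdot> (\<iota> i \<star> idm C d) = f i)"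
      note tk = t[OF co conjunct1[OF k]]
      have "t c k = G"
      proof (rule coproduct_ext[OF ic tk(1) G(1)])
        fix i assume i: "i \<in> I"
        show "t c k \<cdot> \<iota> i = G \<cdot> \<iota> i"
        proof (rule tu[OF comp_hom[OF ih[OF i] tk(1)] comp_hom[OF ih[OF i] G(1)]])
          have "ev \<cdot> ((t c k \<cdot> \<iota> i) \<star> idm C d) = f i"
            unfolding res[OF tk(1) i, symmetric] tk(2) using k i by blast
          thus "ev \<cdot> ((t c k \<cdot> \<iota> i) \<star> idm C d) = ev \<cdot> ((G \<cdot> \<iota> i) \<star> idm C d)"
            unfolding res[OF G(1) i, symmetric] Gi[OF i] .
        qed
      qed
      thus "k = ev \<cdot> (G \<star> idm C d)" using tk(2) by simp
    qed
  qed
  moreover have "(\<lambda>i. y i \<odot> d) \<in> I \<rightarrow> Obj C" using yo d by auto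
  ultimately show ?thesis using sc unfolding small_coproduct_def by blast
qed

lemma tensor_part:
  assumes ic: "is_coproduct C I y c \<iota>" and e: "part I y c \<iota> J e" and d: "d \<in> Obj C"
  shows "part I (\<lambda>i. y i \<odot> d) (c \<odot> d) (\<lambda>i. \<iota> i \<star> idm C d) J (e \<star> idm C d)"
  unfolding part_def
proof (intro conjI ballI)
  note di = idm_hom[OF d] and eh = partD(1)[OF e]
  show "e \<star> idm C d \<in> Hom C (c \<odot> d) (c \<odot> d)" by (rule tarr_hom[OF eh di])
  fix i assume i: "i \<in> I"
  have "(e \<star> idm C d) \<cdot> (\<iota> i \<star> idm C d) = (e \<cdot> \<iota> i) \<star> idm C d"
    using tarr_comp[OF coproductD(2)[OF ic i] eh di di] d by simp
  moreover have "zerom C (y i) c \<star> idm C d = zerom C (y i \<odot> d) (c \<odot> d)"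
    by (rule iszD(2)[OF isz_tarr_left[OF isz_zerom]]) (use coproduct_obj[OF ic i] coproductD(1)[OF ic] d in auto)
  ultimately show "(e \<star> idm C d) \<cdot> (\<iota> i \<star> idm C d) = (if i \<in> J then \<iota> i \<star> idm C d else zerom C (y i \<odot> d) (c \<odot> d))"
    using partD(2,3)[OF e i] by auto
qed

text \<open>Compactness provides a projector of \<open>c \<odot> d\<close>; by uniqueness it is a
  projector of \<open>c\<close> tensored with \<open>d\<close>.\<close>

lemma compact_map_tensor:
  assumes x: "compact_object U C x" and sc: "small_coproduct U I y c \<iota>" and d: "d \<in> Obj C" and f: "f \<in> Hom C x (c \<odot> d)"
  obtains J e where "finite J" "J \<subseteq> I" "part I y c \<iota> J e" "(e \<star> idm C d) \<cdot> f = f"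
proof -
  note ic = small_coproduct_is[OF sc] and sc' = tensor_coproduct[OF sc d]
  obtain J e where J: "finite J" "J \<subseteq> I" "part I (\<lambda>i. y i \<odot> d) (c \<odot> d) (\<lambda>i. \<iota> i \<star> idm C d) J e" "e \<cdot> f = f"
    using compactD(2)[OF x sc' f] by (rule fin_suppE)
  obtain e' where e': "part I y c \<iota> J e'" using part_ex[OF ic] by blast
  have "e' \<star> idm C d = e" by (rule part_unique[OF small_coproduct_is[OF sc'] tensor_part[OF ic e' d] J(3)])
  thus thesis using that[OF J(1,2) e'] J(4) by simp
qed

end

section \<open>Unit coherence and duality\<close>

context symmetric_monoidal_category begin

lemma tensor_unit_faithful:
  assumes f: "f \<in> Hom C x y" and g: "g \<in> Hom C x y" and eq: "f \<star> idm C (unit C) = g \<star> idm C (unit C)" shows "f = g"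
proof -
  have "f \<cdot> runit C x = g \<cdot> runit C x" using runit_natural[OF f] runit_natural[OF g] eq by simp
  thus ?thesis by (rule iso_cancel_right[OF runit_iso[OF hom_obj(1)[OF f]] f g])
qed

text \<open>One of Kelly's consequences of pentagon and triangle. It is verified after tensoring
  with the unit, where both axioms apply, and tensoring with the unit is faithful.\<close>

lemma runit_tensor:
  assumes x: "x \<in> Obj C" and y: "y \<in> Obj C"
  shows "runit C (x \<odot> y) = (idm C x \<star> runit C y) \<cdot> assoc C x y (unit C)"
proof -
  let ?e = "unit C" let ?a = "assoc C x y ?e" let ?i = "idm C ?e"
  have a: "?a \<in> Hom C ((x \<odot> y) \<odot> ?e) (x \<odot> (y \<odot> ?e))" using x y by (simp add: hom_iff)
  note xi = idm_hom[OF x] and yi = idm_hom[OF y] and ei = idm_hom[OF unit_closed]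
  have lh: "lunit C ?e \<in> Hom C (?e \<odot> ?e) ?e" by (simp add: hom_iff)
  have rh: "runit C y \<in> Hom C (y \<odot> ?e) y" using y by (simp add: hom_iff)
  have N1: "?a \<cdot> (idm C (x \<odot> y) \<star> lunit C ?e) = (idm C x \<star> (idm C y \<star> lunit C ?e)) \<cdot> assoc C x y (?e \<odot> ?e)"
    using assoc_natural[OF xi yi lh] x y by simp
  have T1: "(idm C (x \<odot> y) \<star> lunit C ?e) \<cdot> assoc C (x \<odot> y) ?e ?e = runit C (x \<odot> y) \<star> ?i"
    by (rule triangle) (use x y in auto)
  have T2: "(idm C y \<star> lunit C ?e) \<cdot> assoc C y ?e ?e = runit C y \<star> ?i" by (rule triangle) (use y in auto)
  have N2: "?a \<cdot> ((idm C x \<star> runit C y) \<star> ?i) = (idm C x \<star> (runit C y \<star> ?i)) \<cdot> assoc C x (y \<odot> ?e) ?e"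
    by (rule assoc_natural[OF xi rh ei])
  have P: "assoc C x y (?e \<odot> ?e) \<cdot> assoc C (x \<odot> y) ?e ?e =
      (idm C x \<star> assoc C y ?e ?e) \<cdot> assoc C x (y \<odot> ?e) ?e \<cdot> (?a \<star> ?i)" by (rule pentagon) (use x y in auto)
  have M: "(idm C x \<star> (idm C y \<star> lunit C ?e)) \<cdot> (idm C x \<star> assoc C y ?e ?e) = idm C x \<star> (runit C y \<star> ?i)"
    unfolding T2[symmetric] using x y by (subst tarr_comp_arr) auto
  have M2: "((idm C x \<star> runit C y) \<star> ?i) \<cdot> (?a \<star> ?i) = ((idm C x \<star> runit C y) \<cdot> ?a) \<star> ?i"
    using x y by (subst tarr_comp_arr) auto
  have "?a \<cdot> (runit C (x \<odot> y) \<star> ?i) = ?a \<cdot> (idm C (x \<odot> y) \<star> lunit C ?e) \<cdot> assoc C (x \<odot> y) ?e ?e"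
    unfolding T1[symmetric] using x y by simp
  also have "\<dots> = (idm C x \<star> (idm C y \<star> lunit C ?e)) \<cdot> (assoc C x y (?e \<odot> ?e) \<cdot> assoc C (x \<odot> y) ?e ?e)"
    unfolding N1 using x y by simp
  also have "\<dots> = (idm C x \<star> (idm C y \<star> lunit C ?e)) \<cdot> (idm C x \<star> assoc C y ?e ?e) \<cdot> (assoc C x (y \<odot> ?e) ?e \<cdot> (?a \<star> ?i))"
    unfolding P using x y by simp
  also have "\<dots> = (idm C x \<star> (runit C y \<star> ?i)) \<cdot> assoc C x (y \<odot> ?e) ?e \<cdot> (?a \<star> ?i)"
    unfolding M using x y by simp
  also have "\<dots> = ?a \<cdot> (((idm C x \<star> runit C y) \<star> ?i) \<cdot> (?a \<star> ?i))" unfolding N2[symmetric] using x y by simp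
  finally have "?a \<cdot> (runit C (x \<odot> y) \<star> ?i) = ?a \<cdot> (((idm C x \<star> runit C y) \<cdot> ?a) \<star> ?i)" unfolding M2 .
  hence "runit C (x \<odot> y) \<star> ?i = ((idm C x \<star> runit C y) \<cdot> ?a) \<star> ?i"
    by (rule iso_cancel_left[OF assoc_iso[OF x y unit_closed], rotated 2]) (use x y in \<open>auto simp: hom_iff\<close>)
  thus ?thesis by (rule tensor_unit_faithful[rotated 2]) (use x y in \<open>auto simp: hom_iff\<close>)
qed

text \<open>Naturality identifies \<open>runit\<close> of the unit, tensored with the unit, with
  \<open>runit\<close> of the product of two units. Comparing \<open>runit_tensor\<close> with the
  triangle axiom then gives the claim after tensoring with the unit on the left, which is
  cancelled.\<close>

lemma lunit_unit: "lunit C (unit C) = runit C (unit C)"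
proof -
  let ?e = "unit C" let ?a = "assoc C ?e ?e ?e" let ?i = "idm C ?e"
  have h: "lunit C ?e \<in> Hom C (?e \<odot> ?e) ?e" "runit C ?e \<in> Hom C (?e \<odot> ?e) ?e" by (auto simp: hom_iff)
  have "runit C ?e \<cdot> (runit C ?e \<star> ?i) = runit C ?e \<cdot> runit C (?e \<odot> ?e)" by (rule runit_natural[OF h(2)])
  hence "runit C ?e \<star> ?i = runit C (?e \<odot> ?e)"
    by (rule iso_cancel_left[OF runit_iso[OF unit_closed], rotated 2]) (auto simp: hom_iff)
  hence "(?i \<star> lunit C ?e) \<cdot> ?a = (?i \<star> runit C ?e) \<cdot> ?a"
    using runit_tensor[of ?e ?e] triangle[of ?e ?e] by simp
  hence "?i \<star> lunit C ?e = ?i \<star> runit C ?e"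
    by (rule iso_cancel_right[OF assoc_iso, rotated 5]) (auto simp: hom_iff)
  hence "lunit C ?e \<cdot> lunit C (?e \<odot> ?e) = runit C ?e \<cdot> lunit C (?e \<odot> ?e)"
    using lunit_natural[OF h(1)] lunit_natural[OF h(2)] by simp
  thus ?thesis by (rule iso_cancel_right[OF lunit_iso, rotated 3]) (auto simp: hom_iff)
qed

text \<open>The unit is its own dual, with \<open>lunit\<close> as evaluation and its inverse as
  coevaluation. Where compact and dualizable objects coincide, this makes the unit compact.\<close>

lemma dualizable_unit: "dualizable C (unit C)"
proof -
  let ?e = "unit C" let ?a = "assoc C ?e ?e ?e" let ?i = "idm C ?e" let ?l = "lunit C ?e"
  have l: "?l \<in> Hom C (?e \<odot> ?e) ?e" by (simp add: hom_iff)
  note ei = idm_hom[OF unit_closed]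
  obtain k where k: "k \<in> Hom C ?e (?e \<odot> ?e)" "?l \<cdot> k = ?i" using isoE[OF lunit_iso[OF unit_closed]] by metis
  let ?b = "inverse_arrow C ((?e \<odot> ?e) \<odot> ?e) (?e \<odot> (?e \<odot> ?e)) ?a"
  have b: "?b \<in> Hom C (?e \<odot> (?e \<odot> ?e)) ((?e \<odot> ?e) \<odot> ?e)" "?a \<cdot> ?b = idm C (?e \<odot> (?e \<odot> ?e))"
    using inverse_arrow[OF assoc_iso] by auto
  have a: "?a \<in> Hom C ((?e \<odot> ?e) \<odot> ?e) (?e \<odot> (?e \<odot> ?e))" by (simp add: hom_iff)
  have T: "(?i \<star> ?l) \<cdot> ?a = ?l \<star> ?i" using triangle[of ?e ?e] lunit_unit by simp
  have li: "?l \<star> ?i \<in> Hom C ((?e \<odot> ?e) \<odot> ?e) (?e \<odot> ?e)" "?i \<star> ?l \<in> Hom C (?e \<odot> (?e \<odot> ?e)) (?e \<odot> ?e)" by (auto simp: hom_iff)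
  have ki: "k \<star> ?i \<in> Hom C (?e \<odot> ?e) ((?e \<odot> ?e) \<odot> ?e)" "?i \<star> k \<in> Hom C (?e \<odot> ?e) (?e \<odot> (?e \<odot> ?e))"
    using k(1) by (auto simp: hom_iff)
  have lk: "(?l \<star> ?i) \<cdot> (k \<star> ?i) = idm C (?e \<odot> ?e)" "(?i \<star> ?l) \<cdot> (?i \<star> k) = idm C (?e \<odot> ?e)"
    using tarr_comp[OF k(1) l ei ei] tarr_comp[OF ei ei k(1) l] k(2) by simp_all
  have 1: "runit C ?e \<cdot> (?i \<star> ?l) \<cdot> ?a \<cdot> (k \<star> ?i) = ?l"
  proof -
    have "runit C ?e \<cdot> (?i \<star> ?l) \<cdot> ?a \<cdot> (k \<star> ?i) = runit C ?e \<cdot> ((?i \<star> ?l) \<cdot> ?a) \<cdot> (k \<star> ?i)"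
      using l k(1) by (simp add: hom_iff)
    also have "\<dots> = runit C ?e \<cdot> ((?l \<star> ?i) \<cdot> (k \<star> ?i))" unfolding T using l k(1) by (simp add: hom_iff)
    finally show ?thesis unfolding lk using lunit_unit by simp
  qed
  have "(?l \<star> ?i) \<cdot> ?b = (?i \<star> ?l) \<cdot> (?a \<cdot> ?b)" unfolding T[symmetric] by (rule comp_assoc[OF b(1) a li(2)])
  hence lb: "(?l \<star> ?i) \<cdot> ?b = ?i \<star> ?l" unfolding b(2) using li(2) by (simp add: hom_iff)
  have 2: "?l \<cdot> (?l \<star> ?i) \<cdot> ?b \<cdot> (?i \<star> k) = runit C ?e"
  proof -
    have "?l \<cdot> (?l \<star> ?i) \<cdot> ?b \<cdot> (?i \<star> k) = ?l \<cdot> ((?l \<star> ?i) \<cdot> ?b) \<cdot> (?i \<star> k)"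
      using comp_assoc[OF b(1) li(1) l] by simp
    also have "\<dots> = ?l \<cdot> ((?i \<star> ?l) \<cdot> (?i \<star> k))" unfolding lb by (rule comp_assoc[OF ki(2) li(2) l])
    finally show ?thesis unfolding lk using lunit_unit by simp
  qed
  show ?thesis unfolding dualizable_def using 1 2 l k(1) unit_closed by blast
qed

text \<open>The first triangle identity, up to isomorphism; this weak form is visibly preserved by monoidal functors.\<close>

definition half_dual :: "'o \<Rightarrow> 'o \<Rightarrow> 'a \<Rightarrow> 'a \<Rightarrow> bool" where
  "half_dual x d ev coev \<longleftrightarrow> x \<in> Obj C \<and> d \<in> Obj C \<and> ev \<in> Hom C (d \<odot> x) (unit C) \<and> coev \<in> Hom C (unit C) (x \<odot> d) \<and>
     is_iso C (unit C \<odot> x) (x \<odot> unit C) ((idm C x \<star> ev) \<cdot> (assoc C x d x \<cdot> (coev \<star> idm C x)))"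

lemma half_dualD:
  assumes "half_dual x d ev coev"
  shows "x \<in> Obj C" "d \<in> Obj C" "ev \<in> Hom C (d \<odot> x) (unit C)" "coev \<in> Hom C (unit C) (x \<odot> d)"
    "is_iso C (unit C \<odot> x) (x \<odot> unit C) ((idm C x \<star> ev) \<cdot> (assoc C x d x \<cdot> (coev \<star> idm C x)))"
  using assms unfolding half_dual_def by auto

lemma dualizableE:
  assumes "dualizable C x"
  obtains d ev coev where "half_dual x d ev coev"
    "lunit C d \<cdot> (ev \<star> idm C d) \<cdot> inverse_arrow C ((d \<odot> x) \<odot> d) (d \<odot> (x \<odot> d)) (assoc C d x d) \<cdot> (idm C d \<star> coev) = runit C d"
proof -
  obtain d ev coev where x: "x \<in> Obj C" and d: "d \<in> Obj C" "ev \<in> Hom C (d \<odot> x) (unit C)" "coev \<in> Hom C (unit C) (x \<odot> d)"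
    and 1: "runit C x \<cdot> (idm C x \<star> ev) \<cdot> assoc C x d x \<cdot> (coev \<star> idm C x) = lunit C x"
    and 2: "lunit C d \<cdot> (ev \<star> idm C d) \<cdot> inverse_arrow C ((d \<odot> x) \<odot> d) (d \<odot> (x \<odot> d)) (assoc C d x d) \<cdot> (idm C d \<star> coev) = runit C d"
    using assms unfolding dualizable_def by blast
  let ?H = "(idm C x \<star> ev) \<cdot> (assoc C x d x \<cdot> (coev \<star> idm C x))"
  have H: "?H \<in> Hom C (unit C \<odot> x) (x \<odot> unit C)" using x d by (simp add: hom_iff)
  have "runit C x \<cdot> ?H = lunit C x" unfolding 1[symmetric] using x d by (simp add: hom_iff)
  hence "is_iso C (unit C \<odot> x) (x \<odot> unit C) ?H"
    using iso_two_of_three[OF runit_iso[OF x] H] lunit_iso[OF x] by simp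
  thus thesis using that[of d ev coev] 2 x d unfolding half_dual_def by blast
qed

text \<open>This is the pentagon; as only invertibility is claimed, no unit coherence is involved.\<close>

lemma half_dual_tensor:
  assumes h: "half_dual x d ev coev" and y: "y \<in> Obj C"
    and i: "i \<in> Hom C (y \<odot> (x \<odot> d)) ((y \<odot> x) \<odot> d)" "assoc C y x d \<cdot> i = idm C (y \<odot> (x \<odot> d))"
  shows "is_iso C ((y \<odot> unit C) \<odot> x) ((y \<odot> x) \<odot> unit C)
    ((idm C (y \<odot> x) \<star> ev) \<cdot> (assoc C (y \<odot> x) d x \<cdot> ((i \<cdot> (idm C y \<star> coev)) \<star> idm C x)))"
proof -
  note H = half_dualD[OF h]
  note x = H(1) and d = H(2)
  let ?e = "unit C" and ?a = "\<lambda>x y z. assoc C x y z"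
  have A: "ev \<in> Arr C" "Dom C ev = d \<odot> x" "Cod C ev = ?e" "coev \<in> Arr C" "Dom C coev = ?e" "Cod C coev = x \<odot> d"
    "i \<in> Arr C" "Dom C i = y \<odot> (x \<odot> d)" "Cod C i = (y \<odot> x) \<odot> d" using H i(1) by (auto simp: hom_iff)
  let ?M = "(idm C (y \<odot> x) \<star> ev) \<cdot> (?a (y \<odot> x) d x \<cdot> ((i \<cdot> (idm C y \<star> coev)) \<star> idm C x))"
  let ?H = "(idm C x \<star> ev) \<cdot> (?a x d x \<cdot> (coev \<star> idm C x))"
  have N1: "?a y x ?e \<cdot> (idm C (y \<odot> x) \<star> ev) = (idm C y \<star> (idm C x \<star> ev)) \<cdot> ?a y x (d \<odot> x)"
    using assoc_natural[OF idm_hom[OF y] idm_hom[OF x] H(3)] x y by simp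
  have P: "?a y x (d \<odot> x) \<cdot> ?a (y \<odot> x) d x = (idm C y \<star> ?a x d x) \<cdot> ?a y (x \<odot> d) x \<cdot> (?a y x d \<star> idm C x)"
    by (rule pentagon[OF y x d x])
  have N2: "?a y (x \<odot> d) x \<cdot> ((idm C y \<star> coev) \<star> idm C x) = (idm C y \<star> (coev \<star> idm C x)) \<cdot> ?a y ?e x"
    by (rule assoc_natural[OF idm_hom[OF y] H(4) idm_hom[OF x]])
  have S: "(?a y x d \<star> idm C x) \<cdot> ((i \<cdot> (idm C y \<star> coev)) \<star> idm C x) = (idm C y \<star> coev) \<star> idm C x"
  proof -
    have "(?a y x d \<star> idm C x) \<cdot> ((i \<cdot> (idm C y \<star> coev)) \<star> idm C x) = (?a y x d \<cdot> (i \<cdot> (idm C y \<star> coev))) \<star> (idm C x \<cdot> idm C x)"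
      by (rule tarr_comp_arr) (use x y d A in auto)
    also have "?a y x d \<cdot> (i \<cdot> (idm C y \<star> coev)) = ?a y x d \<cdot> i \<cdot> (idm C y \<star> coev)" using x y d A by simp
    also have "\<dots> = idm C y \<star> coev" unfolding i(2) using x y d A by simp
    finally show ?thesis using x by simp
  qed
  have "?a y x ?e \<cdot> ?M = (?a y x ?e \<cdot> (idm C (y \<odot> x) \<star> ev)) \<cdot> (?a (y \<odot> x) d x \<cdot> ((i \<cdot> (idm C y \<star> coev)) \<star> idm C x))"
    using x y d A by simp
  also have "\<dots> = (idm C y \<star> (idm C x \<star> ev)) \<cdot> ((?a y x (d \<odot> x) \<cdot> ?a (y \<odot> x) d x) \<cdot> ((i \<cdot> (idm C y \<star> coev)) \<star> idm C x))"
    unfolding N1 using x y d A by simp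
  also have "\<dots> = (idm C y \<star> (idm C x \<star> ev)) \<cdot> ((idm C y \<star> ?a x d x) \<cdot> (?a y (x \<odot> d) x \<cdot>
      ((?a y x d \<star> idm C x) \<cdot> ((i \<cdot> (idm C y \<star> coev)) \<star> idm C x))))"
    unfolding P using x y d A by simp
  also have "\<dots> = (idm C y \<star> (idm C x \<star> ev)) \<cdot> ((idm C y \<star> ?a x d x) \<cdot> ((idm C y \<star> (coev \<star> idm C x)) \<cdot> ?a y ?e x))"
    unfolding S N2 ..
  also have "\<dots> = (idm C y \<star> (idm C x \<star> ev)) \<cdot> ((idm C y \<star> ?a x d x) \<cdot> (idm C y \<star> (coev \<star> idm C x))) \<cdot> ?a y ?e x"
    using x y d A by simp
  also have "(idm C y \<star> ?a x d x) \<cdot> (idm C y \<star> (coev \<star> idm C x)) = idm C y \<star> (?a x d x \<cdot> (coev \<star> idm C x))"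
    using x y d A by (subst tarr_comp_arr) auto
  also have "(idm C y \<star> (idm C x \<star> ev)) \<cdot> (idm C y \<star> (?a x d x \<cdot> (coev \<star> idm C x))) = idm C y \<star> ?H"
    using x y d A by (subst tarr_comp_arr) auto
  finally have eq: "?a y x ?e \<cdot> ?M = (idm C y \<star> ?H) \<cdot> ?a y ?e x" .
  have "is_iso C ((y \<odot> ?e) \<odot> x) (y \<odot> (x \<odot> ?e)) (?a y x ?e \<cdot> ?M)"
    unfolding eq by (rule iso_comp[OF assoc_iso[OF y unit_closed x] tarr_iso[OF iso_idm[OF y] H(5)]])
  thus ?thesis
    by (rule iso_two_of_three[OF assoc_iso[OF y x unit_closed], rotated]) (use x y d A in \<open>simp add: hom_iff\<close>)
qed

end

section \<open>Compactness of tensor products and duals\<close>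

context tt_category begin

text \<open>An arrow from \<open>y \<odot> x\<close> to \<open>c\<close> has a mate from
  \<open>y\<close> to \<open>c \<odot> d\<close>, to which compactness of \<open>y\<close> applies.
  Passing back recovers the arrow up to an invertible factor, which is enough to compare
  \<open>f\<close> with its projection.\<close>

lemma compact_tensor:
  assumes yc: "compact_object U C y" and h: "half_dual x d ev coev" shows "compact_object U C (y \<odot> x)"
proof (rule compactI)
  note H = half_dualD[OF h]
  note x = H(1) and d = H(2) and y = compactD(1)[OF yc]
  show "y \<odot> x \<in> Obj C" using x y by simp
  let ?e = "unit C"
  fix I v c \<iota> f assume sc: "small_coproduct U I v c \<iota>" and f: "f \<in> Hom C (y \<odot> x) c"
  have c: "c \<in> Obj C" using hom_obj[OF f] by blast
  have ye: "compact_object U C (y \<odot> ?e)" using compact_isoc[OF yc isoc_sym[OF isocI[OF runit_iso[OF y]]]] .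
  obtain i where i0: "i \<in> Hom C (y \<odot> (x \<odot> d)) ((y \<odot> x) \<odot> d)" "assoc C y x d \<cdot> i = idm C (y \<odot> (x \<odot> d))"
    using isoE[OF assoc_iso[OF y x d]] by metis
  let ?g = "i \<cdot> (idm C y \<star> coev)"
  have g: "?g \<in> Hom C (y \<odot> ?e) ((y \<odot> x) \<odot> d)" by (rule comp_hom[OF tarr_hom[OF idm_hom[OF y] H(4)] i0(1)])
  have fd: "f \<star> idm C d \<in> Hom C ((y \<odot> x) \<odot> d) (c \<odot> d)" by (rule tarr_hom[OF f idm_hom[OF d]])
  obtain J p where J: "finite J" "J \<subseteq> I" "part I v c \<iota> J p" "(p \<star> idm C d) \<cdot> ((f \<star> idm C d) \<cdot> ?g) = (f \<star> idm C d) \<cdot> ?g"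
    by (rule compact_map_tensor[OF ye sc d comp_hom[OF g fd]])
  note p = partD(1)[OF J(3)]
  \<comment> \<open>\<open>R\<close> undoes the passage to mates: it is natural in the target by
    \<open>nat\<close>, and on the mate \<open>?g\<close> of the identity it is an isomorphism by
    \<open>M\<close>.\<close>
  define R where "R b k = (idm C b \<star> ev) \<cdot> (assoc C b d x \<cdot> (k \<star> idm C x))" for b k
  have nat: "R b' ((q \<star> idm C d) \<cdot> k) = (q \<star> idm C ?e) \<cdot> R b k"
    if q: "q \<in> Hom C b b'" and k: "k \<in> Hom C (y \<odot> ?e) (b \<odot> d)" for q k b b'
  proof -
    have o: "b \<in> Obj C" "b' \<in> Obj C" using hom_obj[OF q] by auto
    have A: "q \<in> Arr C" "Dom C q = b" "Cod C q = b'" "k \<in> Arr C" "Dom C k = y \<odot> ?e" "Cod C k = b \<odot> d"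
      "ev \<in> Arr C" "Dom C ev = d \<odot> x" "Cod C ev = ?e" using q k H(3) by (auto simp: hom_iff)
    have s: "((q \<star> idm C d) \<cdot> k) \<star> idm C x = ((q \<star> idm C d) \<star> idm C x) \<cdot> (k \<star> idm C x)"
      using A o d x by (subst tarr_comp_arr) auto
    have n: "assoc C b' d x \<cdot> ((q \<star> idm C d) \<star> idm C x) = (q \<star> idm C (d \<odot> x)) \<cdot> assoc C b d x"
      using assoc_natural[OF q idm_hom[OF d] idm_hom[OF x]] d x by simp
    have m: "(idm C b' \<star> ev) \<cdot> (q \<star> idm C (d \<odot> x)) = (q \<star> idm C ?e) \<cdot> (idm C b \<star> ev)"
      using tarr_slide1[OF q H(3)] tarr_slide2[OF q H(3)] by simp
    have "R b' ((q \<star> idm C d) \<cdot> k) = (idm C b' \<star> ev) \<cdot> ((assoc C b' d x \<cdot> ((q \<star> idm C d) \<star> idm C x)) \<cdot> (k \<star> idm C x))"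
      unfolding R_def s using A o d x by simp
    also have "\<dots> = ((idm C b' \<star> ev) \<cdot> (q \<star> idm C (d \<odot> x))) \<cdot> (assoc C b d x \<cdot> (k \<star> idm C x))"
      unfolding n using A o d x by simp
    also have "\<dots> = (q \<star> idm C ?e) \<cdot> R b k" unfolding m R_def using A o d x by simp
    finally show ?thesis .
  qed
  note M = half_dual_tensor[OF h y i0, folded R_def]
  have fe: "f \<star> idm C ?e \<in> Hom C ((y \<odot> x) \<odot> ?e) (c \<odot> ?e)" and pe: "p \<star> idm C ?e \<in> Hom C (c \<odot> ?e) (c \<odot> ?e)"
    by (rule tarr_hom[OF f idm_hom[OF unit_closed]], rule tarr_hom[OF p idm_hom[OF unit_closed]])
  have pf: "p \<cdot> f \<in> Hom C (y \<odot> x) c" by (rule comp_hom[OF f p])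
  have "(p \<star> idm C ?e) \<cdot> (f \<star> idm C ?e) \<cdot> R (y \<odot> x) ?g = (p \<star> idm C ?e) \<cdot> R c ((f \<star> idm C d) \<cdot> ?g)"
    unfolding nat[OF f g] by (rule comp_assoc[OF iso_hom[OF M] fe pe])
  also have "\<dots> = R c ((p \<star> idm C d) \<cdot> ((f \<star> idm C d) \<cdot> ?g))" by (rule nat[OF p comp_hom[OF g fd], symmetric])
  also have "\<dots> = (f \<star> idm C ?e) \<cdot> R (y \<odot> x) ?g" unfolding J(4) by (rule nat[OF f g])
  finally have "(p \<star> idm C ?e) \<cdot> (f \<star> idm C ?e) = f \<star> idm C ?e"
    by (rule iso_cancel_right[OF M comp_hom[OF fe pe] fe])
  moreover have "(p \<star> idm C ?e) \<cdot> (f \<star> idm C ?e) = (p \<cdot> f) \<star> idm C ?e"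
    using tarr_comp[OF f p idm_hom[OF unit_closed] idm_hom[OF unit_closed]] by simp
  ultimately have "p \<cdot> f = f" using tensor_unit_faithful[OF pf f] by simp
  thus "fin_supp I v c \<iota> f" by (rule fin_suppI[OF J(1-3)])
qed

text \<open>The second triangle identity recovers an arrow from \<open>d\<close> to \<open>c\<close>
  from its mate, an arrow from the unit to \<open>x \<odot> c\<close>. Compactness of the unit gives
  finite support for the mate.\<close>

lemma compact_dual:
  assumes uc: "compact_object U C (unit C)" and h: "half_dual x d ev coev"
    and id2: "lunit C d \<cdot> (ev \<star> idm C d) \<cdot> inverse_arrow C ((d \<odot> x) \<odot> d) (d \<odot> (x \<odot> d)) (assoc C d x d) \<cdot> (idm C d \<star> coev) = runit C d"
  shows "compact_object U C d"
proof (rule compactI)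
  note H = half_dualD[OF h]
  note x = H(1) and d = H(2)
  show "d \<in> Obj C" by (rule d)
  let ?e = "unit C"
  fix I v c \<iota> f assume sc: "small_coproduct U I v c \<iota>" and f: "f \<in> Hom C d c"
  have c: "c \<in> Obj C" using hom_obj[OF f] by blast
  note xi = idm_hom[OF x] and di = idm_hom[OF d]
  let ?k = "(idm C x \<star> f) \<cdot> coev"
  have xf: "idm C x \<star> f \<in> Hom C (x \<odot> d) (x \<odot> c)" by (rule tarr_hom[OF xi f])
  have k: "?k \<in> Hom C ?e (x \<odot> c)" by (rule comp_hom[OF H(4) xf])
  \<comment> \<open>\<open>compact_map_tensor\<close> expects the coproduct as left factor, so the
    mate is braided, and braided back afterwards.\<close>
  have br: "braid C x c \<in> Hom C (x \<odot> c) (c \<odot> x)" using x c by (simp add: hom_iff)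
  obtain J p where J: "finite J" "J \<subseteq> I" "part I v c \<iota> J p" "(p \<star> idm C x) \<cdot> (braid C x c \<cdot> ?k) = braid C x c \<cdot> ?k"
    by (rule compact_map_tensor[OF uc sc x comp_hom[OF k br]])
  note p = partD(1)[OF J(3)]
  have xp: "idm C x \<star> p \<in> Hom C (x \<odot> c) (x \<odot> c)" by (rule tarr_hom[OF xi p])
  have px: "p \<star> idm C x \<in> Hom C (c \<odot> x) (c \<odot> x)" by (rule tarr_hom[OF p xi])
  have "braid C x c \<cdot> ((idm C x \<star> p) \<cdot> ?k) = (p \<star> idm C x) \<cdot> (braid C x c \<cdot> ?k)"
    using comp_assoc[OF k xp br] comp_assoc[OF k br px] braid_natural[OF xi p] by simp
  also have "\<dots> = braid C x c \<cdot> ?k" by (rule J(4))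
  finally have pk: "(idm C x \<star> p) \<cdot> ?k = ?k"
    by (rule iso_cancel_left[OF braid_iso[OF x c] comp_hom[OF k xp] k])
  define w where "w b = inverse_arrow C ((d \<odot> x) \<odot> b) (d \<odot> (x \<odot> b)) (assoc C d x b)" for b
  have w: "w b \<in> Hom C (d \<odot> (x \<odot> b)) ((d \<odot> x) \<odot> b)" "w b \<cdot> assoc C d x b = idm C ((d \<odot> x) \<odot> b)"
    "assoc C d x b \<cdot> w b = idm C (d \<odot> (x \<odot> b))" if "b \<in> Obj C" for b
    using inverse_arrow[OF assoc_iso[OF d x that]] unfolding w_def by auto
  \<comment> \<open>Evaluation turns a mate back into an arrow out of \<open>d\<close>; applied to
    \<open>coev\<close> it gives \<open>runit\<close>, by the second triangle identity.\<close>
  define R where "R b g = lunit C b \<cdot> ((ev \<star> idm C b) \<cdot> (w b \<cdot> (idm C d \<star> g)))" for b g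
  have nat: "R b' ((idm C x \<star> q) \<cdot> g) = q \<cdot> R b g" if q: "q \<in> Hom C b b'" and g: "g \<in> Hom C ?e (x \<odot> b)" for q g b b'
  proof -
    have o: "b \<in> Obj C" "b' \<in> Obj C" using hom_obj[OF q] by auto
    have A: "q \<in> Arr C" "Dom C q = b" "Cod C q = b'" "g \<in> Arr C" "Dom C g = ?e" "Cod C g = x \<odot> b"
      "ev \<in> Arr C" "Dom C ev = d \<odot> x" "Cod C ev = ?e"
      "w b \<in> Arr C" "Dom C (w b) = d \<odot> (x \<odot> b)" "Cod C (w b) = (d \<odot> x) \<odot> b"
      "w b' \<in> Arr C" "Dom C (w b') = d \<odot> (x \<odot> b')" "Cod C (w b') = (d \<odot> x) \<odot> b'"
      using q g H(3) w(1)[OF o(1)] w(1)[OF o(2)] by (auto simp: hom_iff)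
    have s: "idm C d \<star> ((idm C x \<star> q) \<cdot> g) = (idm C d \<star> (idm C x \<star> q)) \<cdot> (idm C d \<star> g)"
      using A o d x by (subst tarr_comp_arr) auto
    let ?dq = "idm C d \<star> (idm C x \<star> q)" and ?dq' = "idm C (d \<odot> x) \<star> q"
    have n0: "assoc C d x b' \<cdot> ?dq' = ?dq \<cdot> assoc C d x b"
      using assoc_natural[OF di xi q] d x by simp
    have "w b' \<cdot> ?dq = w b' \<cdot> (?dq \<cdot> assoc C d x b) \<cdot> w b"
    proof -
      have "w b' \<cdot> (?dq \<cdot> assoc C d x b) \<cdot> w b = w b' \<cdot> (?dq \<cdot> (assoc C d x b \<cdot> w b))" using A o d x by simp
      thus ?thesis unfolding w(3)[OF o(1)] using A o d x by simp
    qed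
    also have "\<dots> = w b' \<cdot> assoc C d x b' \<cdot> (?dq' \<cdot> w b)" unfolding n0[symmetric] using A o d x by simp
    also have "\<dots> = ?dq' \<cdot> w b" unfolding w(2)[OF o(2)] using A o d x by simp
    finally have n: "w b' \<cdot> ?dq = ?dq' \<cdot> w b" .
    have m: "(ev \<star> idm C b') \<cdot> ?dq' = (idm C ?e \<star> q) \<cdot> (ev \<star> idm C b)"
      using tarr_slide1[OF H(3) q] tarr_slide2[OF H(3) q] by simp
    have "R b' ((idm C x \<star> q) \<cdot> g) = lunit C b' \<cdot> ((ev \<star> idm C b') \<cdot> ((w b' \<cdot> ?dq) \<cdot> (idm C d \<star> g)))"
      unfolding R_def s using A o d x by simp
    also have "\<dots> = lunit C b' \<cdot> (((ev \<star> idm C b') \<cdot> ?dq') \<cdot> (w b \<cdot> (idm C d \<star> g)))"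
      unfolding n using A o d x by simp
    also have "\<dots> = (lunit C b' \<cdot> (idm C ?e \<star> q)) \<cdot> ((ev \<star> idm C b) \<cdot> (w b \<cdot> (idm C d \<star> g)))"
      unfolding m using A o d x by simp
    also have "\<dots> = q \<cdot> R b g" unfolding lunit_natural[OF q] R_def using A o d x by simp
    finally show ?thesis .
  qed
  have Rd: "R d coev = runit C d"
    unfolding id2[symmetric] R_def w_def[symmetric] using d x H(3,4) w(1)[OF d] by (simp add: hom_iff)
  have rh: "runit C d \<in> Hom C (d \<odot> ?e) d" using d by (simp add: hom_iff)
  have "R c ((idm C x \<star> p) \<cdot> ?k) = p \<cdot> (f \<cdot> runit C d)" unfolding nat[OF p k] nat[OF f H(4)] Rd ..
  moreover have "R c ?k = f \<cdot> runit C d" unfolding nat[OF f H(4)] Rd ..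
  ultimately have "p \<cdot> f \<cdot> runit C d = f \<cdot> runit C d" unfolding pk using comp_assoc[OF rh f p] by simp
  hence "p \<cdot> f = f" by (rule iso_cancel_right[OF runit_iso[OF d] comp_hom[OF f p] f])
  thus "fin_supp I v c \<iota> f" by (rule fin_suppI[OF J(1-3)])
qed

end

section \<open>Images of dualizable objects\<close>

context tt_functor_pair begin

lemma half_dual_image:
  assumes "A.half_dual x d ev coev" shows "\<exists>ev' coev'. B.half_dual (fobj F x) (fobj F d) ev' coev'"
proof -
  note H = A.half_dualD[OF assms]
  note x = H(1) and d = H(2)
  let ?e = "unit C" and ?i = "unit D" and ?x = "fobj F x" and ?d = "fobj F d"
  let ?X = "idm D (fobj F x)" and ?a = "assoc C x d x"
  have xd: "x \<odot>\<^bsub>C\<^esub> d \<in> Obj C" "d \<odot>\<^bsub>C\<^esub> x \<in> Obj C" "?e \<in> Obj C" using x d by auto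
  note Fx = F_obj[OF x] and Fd = F_obj[OF d]
  note mi = fmul_iso
  obtain n where n: "n \<in> Hom D (fobj F (x \<odot>\<^bsub>C\<^esub> d)) (?x \<odot>\<^bsub>D\<^esub> ?d)" "fmul F x d \<cdot>\<^bsub>D\<^esub> n = idm D (fobj F (x \<odot>\<^bsub>C\<^esub> d))"
    using B.isoE[OF mi[OF x d]] by metis
  obtain t where t: "t \<in> Hom D (fobj F ?e) ?i" "funit F \<cdot>\<^bsub>D\<^esub> t = idm D (fobj F ?e)" using B.isoE[OF funit_iso] by metis
  note eh = B.iso_hom[OF funit_iso]
  let ?co = "n \<cdot>\<^bsub>D\<^esub> (farr F coev \<cdot>\<^bsub>D\<^esub> funit F)" and ?ev = "t \<cdot>\<^bsub>D\<^esub> (farr F ev \<cdot>\<^bsub>D\<^esub> fmul F d x)"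
  have ceh: "farr F coev \<cdot>\<^bsub>D\<^esub> funit F \<in> Hom D ?i (fobj F (x \<odot>\<^bsub>C\<^esub> d))" by (rule B.comp_hom[OF eh F_hom[OF H(4)]])
  have evh: "farr F ev \<cdot>\<^bsub>D\<^esub> fmul F d x \<in> Hom D (?d \<odot>\<^bsub>D\<^esub> ?x) (fobj F ?e)"
    by (rule B.comp_hom[OF B.iso_hom[OF mi[OF d x]] F_hom[OF H(3)]])
  have co: "?co \<in> Hom D ?i (?x \<odot>\<^bsub>D\<^esub> ?d)" and ev: "?ev \<in> Hom D (?d \<odot>\<^bsub>D\<^esub> ?x) ?i"
    by (rule B.comp_hom[OF ceh n(1)], rule B.comp_hom[OF evh t(1)])
  have mco: "fmul F x d \<cdot>\<^bsub>D\<^esub> ?co = farr F coev \<cdot>\<^bsub>D\<^esub> funit F"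
    unfolding B.comp_assoc[OF ceh n(1) B.iso_hom[OF mi[OF x d]], symmetric] n(2) using ceh by (simp add: hom_iff)
  have mev: "funit F \<cdot>\<^bsub>D\<^esub> ?ev = farr F ev \<cdot>\<^bsub>D\<^esub> fmul F d x"
    unfolding B.comp_assoc[OF evh t(1) eh, symmetric] t(2) using evh by (simp add: hom_iff)
  let ?b = "assoc D ?x ?d ?x"
  let ?H = "(?X \<star>\<^bsub>D\<^esub> ?ev) \<cdot>\<^bsub>D\<^esub> (?b \<cdot>\<^bsub>D\<^esub> (?co \<star>\<^bsub>D\<^esub> ?X))"
  let ?HC = "(idm C x \<star>\<^bsub>C\<^esub> ev) \<cdot>\<^bsub>C\<^esub> (?a \<cdot>\<^bsub>C\<^esub> (coev \<star>\<^bsub>C\<^esub> idm C x))"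
  let ?m = "fmul F"
  have m_in: "?m v w \<in> Arr D" "Dom D (?m v w) = fobj F v \<odot>\<^bsub>D\<^esub> fobj F w" "Cod D (?m v w) = fobj F (v \<odot>\<^bsub>C\<^esub> w)"
    if "v \<in> Obj C" "w \<in> Obj C" for v w using B.iso_hom[OF mi[OF that]] by (auto simp: hom_iff)
  have A: "ev \<in> Arr C" "Dom C ev = d \<odot>\<^bsub>C\<^esub> x" "Cod C ev = ?e" "coev \<in> Arr C" "Dom C coev = ?e" "Cod C coev = x \<odot>\<^bsub>C\<^esub> d"
    using H by (auto simp: hom_iff)
  have B: "?co \<in> Arr D" "Dom D ?co = ?i" "Cod D ?co = ?x \<odot>\<^bsub>D\<^esub> ?d" "?ev \<in> Arr D" "Dom D ?ev = ?d \<odot>\<^bsub>D\<^esub> ?x" "Cod D ?ev = ?i"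
    "funit F \<in> Arr D" "Dom D (funit F) = ?i" "Cod D (funit F) = fobj F ?e"
    using co ev eh by (auto simp: hom_iff)
  have o: "fobj F (x \<odot>\<^bsub>C\<^esub> d) \<in> Obj D" "fobj F (d \<odot>\<^bsub>C\<^esub> x) \<in> Obj D" "fobj F ?e \<in> Obj D" using F_obj xd by auto
  let ?L = "?m x ?e \<cdot>\<^bsub>D\<^esub> (?X \<star>\<^bsub>D\<^esub> funit F)"
  have FI: "farr F (idm C x) = ?X" by (rule F_idm[OF x])
  define ev1 co1 where "ev1 = ?ev" and "co1 = ?co"
  note B1 = B[folded ev1_def co1_def]
  have 1: "(?X \<star>\<^bsub>D\<^esub> funit F) \<cdot>\<^bsub>D\<^esub> (?X \<star>\<^bsub>D\<^esub> ev1) = (?X \<star>\<^bsub>D\<^esub> farr F ev) \<cdot>\<^bsub>D\<^esub> (?X \<star>\<^bsub>D\<^esub> ?m d x)"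
  proof -
    have "(?X \<star>\<^bsub>D\<^esub> funit F) \<cdot>\<^bsub>D\<^esub> (?X \<star>\<^bsub>D\<^esub> ev1) = ?X \<star>\<^bsub>D\<^esub> (funit F \<cdot>\<^bsub>D\<^esub> ev1)"
      using B.tarr_comp_arr[of ?X ?X ev1 "funit F"] B1 Fx by simp
    also have "\<dots> = (?X \<star>\<^bsub>D\<^esub> farr F ev) \<cdot>\<^bsub>D\<^esub> (?X \<star>\<^bsub>D\<^esub> ?m d x)"
      unfolding ev1_def mev using B.tarr_comp_arr[of ?X ?X "?m d x" "farr F ev"] Fx m_in[OF d x] F_arr[OF A(1)] A by simp
    finally show ?thesis .
  qed
  have 2: "?m x ?e \<cdot>\<^bsub>D\<^esub> (?X \<star>\<^bsub>D\<^esub> farr F ev) = farr F (idm C x \<star>\<^bsub>C\<^esub> ev) \<cdot>\<^bsub>D\<^esub> ?m x (d \<odot>\<^bsub>C\<^esub> x)"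
    using fmul_natural[OF A.idm_hom[OF x] H(3)] FI by simp
  have 3: "?m x (d \<odot>\<^bsub>C\<^esub> x) \<cdot>\<^bsub>D\<^esub> (?X \<star>\<^bsub>D\<^esub> ?m d x) \<cdot>\<^bsub>D\<^esub> ?b = farr F ?a \<cdot>\<^bsub>D\<^esub> ?m (x \<odot>\<^bsub>C\<^esub> d) x \<cdot>\<^bsub>D\<^esub> (?m x d \<star>\<^bsub>D\<^esub> ?X)"
    by (rule fmul_assoc[OF x d x, symmetric])
  have 4: "(?m x d \<star>\<^bsub>D\<^esub> ?X) \<cdot>\<^bsub>D\<^esub> (co1 \<star>\<^bsub>D\<^esub> ?X) = (farr F coev \<star>\<^bsub>D\<^esub> ?X) \<cdot>\<^bsub>D\<^esub> (funit F \<star>\<^bsub>D\<^esub> ?X)"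
  proof -
    have "(?m x d \<star>\<^bsub>D\<^esub> ?X) \<cdot>\<^bsub>D\<^esub> (co1 \<star>\<^bsub>D\<^esub> ?X) = (?m x d \<cdot>\<^bsub>D\<^esub> co1) \<star>\<^bsub>D\<^esub> ?X"
      using B.tarr_comp_arr[of co1 "?m x d" ?X ?X] B1 Fx m_in[OF x d] by simp
    also have "\<dots> = (farr F coev \<star>\<^bsub>D\<^esub> ?X) \<cdot>\<^bsub>D\<^esub> (funit F \<star>\<^bsub>D\<^esub> ?X)"
      unfolding co1_def mco using B.tarr_comp_arr[of "funit F" "farr F coev" ?X ?X] Fx F_arr[OF A(4)] A B by simp
    finally show ?thesis .
  qed
  have 5: "?m (x \<odot>\<^bsub>C\<^esub> d) x \<cdot>\<^bsub>D\<^esub> (farr F coev \<star>\<^bsub>D\<^esub> ?X) = farr F (coev \<star>\<^bsub>C\<^esub> idm C x) \<cdot>\<^bsub>D\<^esub> ?m ?e x"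
    using fmul_natural[OF H(4) A.idm_hom[OF x]] FI by simp
  note S = m_in[OF x d] m_in[OF d x] m_in[OF x xd(2)] m_in[OF xd(1) x] m_in[OF x xd(3)] m_in[OF xd(3) x]
    F_arr[OF A(1)] F_arr[OF A(4)] B1 A o Fx Fd x d F_arr[of ?a] F_arr[of "idm C x \<star>\<^bsub>C\<^esub> ev"] F_arr[of "coev \<star>\<^bsub>C\<^esub> idm C x"]
  have "?L \<cdot>\<^bsub>D\<^esub> ((?X \<star>\<^bsub>D\<^esub> ev1) \<cdot>\<^bsub>D\<^esub> (?b \<cdot>\<^bsub>D\<^esub> (co1 \<star>\<^bsub>D\<^esub> ?X))) =
      ?m x ?e \<cdot>\<^bsub>D\<^esub> (((?X \<star>\<^bsub>D\<^esub> funit F) \<cdot>\<^bsub>D\<^esub> (?X \<star>\<^bsub>D\<^esub> ev1)) \<cdot>\<^bsub>D\<^esub> (?b \<cdot>\<^bsub>D\<^esub> (co1 \<star>\<^bsub>D\<^esub> ?X)))"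
    using S by simp
  also have "\<dots> = (?m x ?e \<cdot>\<^bsub>D\<^esub> (?X \<star>\<^bsub>D\<^esub> farr F ev)) \<cdot>\<^bsub>D\<^esub> ((?X \<star>\<^bsub>D\<^esub> ?m d x) \<cdot>\<^bsub>D\<^esub> (?b \<cdot>\<^bsub>D\<^esub> (co1 \<star>\<^bsub>D\<^esub> ?X)))"
    unfolding 1 using S by simp
  also have "\<dots> = farr F (idm C x \<star>\<^bsub>C\<^esub> ev) \<cdot>\<^bsub>D\<^esub> ((?m x (d \<odot>\<^bsub>C\<^esub> x) \<cdot>\<^bsub>D\<^esub> (?X \<star>\<^bsub>D\<^esub> ?m d x) \<cdot>\<^bsub>D\<^esub> ?b) \<cdot>\<^bsub>D\<^esub> (co1 \<star>\<^bsub>D\<^esub> ?X))"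
    unfolding 2 using S by simp
  also have "\<dots> = farr F (idm C x \<star>\<^bsub>C\<^esub> ev) \<cdot>\<^bsub>D\<^esub> (farr F ?a \<cdot>\<^bsub>D\<^esub> (?m (x \<odot>\<^bsub>C\<^esub> d) x \<cdot>\<^bsub>D\<^esub> ((?m x d \<star>\<^bsub>D\<^esub> ?X) \<cdot>\<^bsub>D\<^esub> (co1 \<star>\<^bsub>D\<^esub> ?X))))"
    unfolding 3 using S by simp
  also have "\<dots> = farr F (idm C x \<star>\<^bsub>C\<^esub> ev) \<cdot>\<^bsub>D\<^esub> (farr F ?a \<cdot>\<^bsub>D\<^esub> ((?m (x \<odot>\<^bsub>C\<^esub> d) x \<cdot>\<^bsub>D\<^esub> (farr F coev \<star>\<^bsub>D\<^esub> ?X)) \<cdot>\<^bsub>D\<^esub> (funit F \<star>\<^bsub>D\<^esub> ?X)))"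
    unfolding 4 using S by simp
  also have "\<dots> = (farr F (idm C x \<star>\<^bsub>C\<^esub> ev) \<cdot>\<^bsub>D\<^esub> (farr F ?a \<cdot>\<^bsub>D\<^esub> farr F (coev \<star>\<^bsub>C\<^esub> idm C x))) \<cdot>\<^bsub>D\<^esub> (?m ?e x \<cdot>\<^bsub>D\<^esub> (funit F \<star>\<^bsub>D\<^esub> ?X))"
    unfolding 5 using S by simp
  also have "farr F (idm C x \<star>\<^bsub>C\<^esub> ev) \<cdot>\<^bsub>D\<^esub> (farr F ?a \<cdot>\<^bsub>D\<^esub> farr F (coev \<star>\<^bsub>C\<^esub> idm C x)) = farr F ?HC"
  proof -
    have h1: "coev \<star>\<^bsub>C\<^esub> idm C x \<in> Hom C (?e \<odot>\<^bsub>C\<^esub> x) ((x \<odot>\<^bsub>C\<^esub> d) \<odot>\<^bsub>C\<^esub> x)" by (rule A.tarr_hom[OF H(4) A.idm_hom[OF x]])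
    have h2: "?a \<in> Hom C ((x \<odot>\<^bsub>C\<^esub> d) \<odot>\<^bsub>C\<^esub> x) (x \<odot>\<^bsub>C\<^esub> (d \<odot>\<^bsub>C\<^esub> x))" by (rule A.assoc_hom[OF x d x])
    have h3: "idm C x \<star>\<^bsub>C\<^esub> ev \<in> Hom C (x \<odot>\<^bsub>C\<^esub> (d \<odot>\<^bsub>C\<^esub> x)) (x \<odot>\<^bsub>C\<^esub> ?e)" by (rule A.tarr_hom[OF A.idm_hom[OF x] H(3)])
    show ?thesis using F_comp[OF A.comp_hom[OF h1 h2] h3] F_comp[OF h1 h2] by simp
  qed
  finally have eq: "?L \<cdot>\<^bsub>D\<^esub> ?H = farr F ?HC \<cdot>\<^bsub>D\<^esub> (?m ?e x \<cdot>\<^bsub>D\<^esub> (funit F \<star>\<^bsub>D\<^esub> ?X))" unfolding ev1_def co1_def .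
  have L: "is_iso D (?x \<odot>\<^bsub>D\<^esub> ?i) (fobj F (x \<odot>\<^bsub>C\<^esub> ?e)) ?L"
    by (rule B.iso_comp[OF B.tarr_iso[OF B.iso_idm[OF Fx] funit_iso] mi[OF x xd(3)]])
  have "is_iso D (?i \<odot>\<^bsub>D\<^esub> ?x) (fobj F (x \<odot>\<^bsub>C\<^esub> ?e)) (?L \<cdot>\<^bsub>D\<^esub> ?H)"
    unfolding eq by (rule B.iso_comp[OF B.iso_comp[OF B.tarr_iso[OF funit_iso B.iso_idm[OF Fx]] mi[OF xd(3) x]] F_iso[OF H(5)]])
  moreover have "?H \<in> Hom D (?i \<odot>\<^bsub>D\<^esub> ?x) (?x \<odot>\<^bsub>D\<^esub> ?i)"
    by (rule B.comp_hom[OF B.comp_hom[OF B.tarr_hom[OF co B.idm_hom[OF Fx]] B.assoc_hom[OF Fx Fd Fx]] B.tarr_hom[OF B.idm_hom[OF Fx] ev]])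
  ultimately have "is_iso D (?i \<odot>\<^bsub>D\<^esub> ?x) (?x \<odot>\<^bsub>D\<^esub> ?i) ?H" using B.iso_two_of_three[OF L] by blast
  thus ?thesis unfolding B.half_dual_def using Fx Fd co ev by blast
qed

end

text \<open>Both descriptions of the compact objects are exploited: zero objects, shifts and cones
  are handled through compactness, the unit through duality, and tensor products and duals by
  combining the two.\<close>

lemma rigid_subcategory_compacts:
  fixes C :: "('o, 'a, 'm) tt_data_scheme" (structure)
  assumes "rigidly_compactly_generated U C" shows "rigid_subcategory C (compacts U C)"
proof -
  have tt: "tt_category C" and eq: "compacts U C = {x. dualizable C x}"
    using assms unfolding rigidly_compactly_generated_def by auto
  interpret tt_category C by (rule tt)
  have K: "x \<in> compacts U C \<longleftrightarrow> compact_object U C x" "x \<in> compacts U C \<longleftrightarrow> dualizable C x" for x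
    using eq unfolding compacts_def by auto
  have uc: "compact_object U C (unit C)" using K dualizable_unit by blast
  show ?thesis
  proof
    show "x \<in> compacts U C \<Longrightarrow> x \<in> Obj C" for x using K(1) compactD(1) by blast
    show "zero_object C x \<Longrightarrow> x \<in> compacts U C" for x using K(1) compact_zero by blast
    show "x \<in> compacts U C \<Longrightarrow> Sho C x \<in> compacts U C" for x using K(1) compact_shift by blast
    show "\<lbrakk>tri x y z f g h; x \<in> compacts U C; y \<in> compacts U C\<rbrakk> \<Longrightarrow> z \<in> compacts U C" for x y z f g h
      unfolding K(1) by (rule compact_cone)
    show "unit C \<in> compacts U C" using K(1) uc by blast
    show "x \<odot> y \<in> compacts U C" if xy: "x \<in> compacts U C" "y \<in> compacts U C" for x y
    proof -
      have "dualizable C y" using xy(2) K(2) by blast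
      then obtain d ev coev where h: "half_dual y d ev coev" by (rule dualizableE)
      show ?thesis using compact_tensor[OF _ h] xy(1) K(1) by blast
    qed
    fix x assume "x \<in> compacts U C"
    hence "dualizable C x" using K(2) by blast
    then obtain d ev coev where h: "half_dual x d ev coev" and
      id2: "lunit C d \<cdot> (ev \<star> idm C d) \<cdot> inverse_arrow C ((d \<odot> x) \<odot> d) (d \<odot> (x \<odot> d)) (assoc C d x d) \<cdot> (idm C d \<star> coev) = runit C d"
      by (rule dualizableE)
    note H = half_dualD[OF h]
    have dK: "d \<in> compacts U C" using K(1) compact_dual[OF uc h id2] by blast
    let ?H = "(idm C x \<star> ev) \<cdot> (assoc C x d x \<cdot> (coev \<star> idm C x))"
    obtain i where i: "i \<in> Hom C (x \<odot> unit C) (unit C \<odot> x)" "i \<cdot> ?H = idm C (unit C \<odot> x)" using isoE[OF H(5)] by metis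
    \<comment> \<open>The inverse of the zigzag, composed with evaluation, retracts the coevaluation
      tensored with \<open>x\<close>.\<close>
    let ?r = "i \<cdot> ((idm C x \<star> ev) \<cdot> assoc C x d x)"
    have 1: "?r \<in> Hom C ((x \<odot> d) \<odot> x) (unit C \<odot> x)"
      by (rule comp_hom[OF comp_hom[OF assoc_hom[OF H(1,2,1)] tarr_hom[OF idm_hom[OF H(1)] H(3)]] i(1)])
    have "?r \<cdot> (coev \<star> idm C x) = i \<cdot> ?H" using i(1) H(1-4) by (simp add: hom_iff)
    hence "?r \<cdot> (coev \<star> idm C x) = idm C (unit C \<odot> x)" using i(2) by simp
    thus "\<exists>d\<in>compacts U C. \<exists>coev\<in>Hom C (unit C) (x \<odot> d). \<exists>r\<in>Hom C ((x \<odot> d) \<odot> x) (unit C \<odot> x).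
        r \<cdot> (coev \<star> idm C x) = idm C (unit C \<odot> x)" using dK H(4) 1 by blast
  qed
qed

text \<open>The functor carries the duality of \<open>x\<close> to a half duality of its image;
  \<open>compact_tensor\<close> then makes the product of the compact unit with that image
  compact.\<close>

lemma compacts_image:
  assumes C: "rigidly_compactly_generated U C" and D: "rigidly_compactly_generated U D" and F: "tt_functor C D F"
    and x: "x \<in> compacts U C"
  shows "fobj F x \<in> compacts U D"
proof -
  interpret tt_functor_pair C D F
    unfolding tt_functor_pair_def using C D F unfolding rigidly_compactly_generated_def by blast
  have "dualizable C x" using x C unfolding rigidly_compactly_generated_def by blast
  then obtain d ev coev where hd: "A.half_dual x d ev coev" by (rule A.dualizableE)
  obtain ev' coev' where h: "B.half_dual (fobj F x) (fobj F d) ev' coev'" using half_dual_image[OF hd] by blast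
  have "unit D \<in> compacts U D" using D B.dualizable_unit unfolding rigidly_compactly_generated_def by blast
  hence "compact_object U D (unit D)" unfolding compacts_def by blast
  hence "compact_object U D (unit D \<odot>\<^bsub>D\<^esub> fobj F x)" by (rule B.compact_tensor[OF _ h])
  hence "compact_object U D (fobj F x)" by (rule B.compact_isoc[OF _ B.isoc_unit[OF B.half_dualD(1)[OF h]]])
  thus ?thesis unfolding compacts_def by blast
qed

theorem theorem1p1:
  fixes U :: "'u set"
    and T :: "('o, 'a) tt_data" and S :: "('p, 'b) tt_data"
    and F :: "('o, 'a, 'p, 'b) tt_functor_data"
  defines "X \<equiv> Spc_topology (compact_part U S)"
    and "Y \<equiv> Spc_topology (compact_part U T)"
    and "\<phi> \<equiv> Spc_map (compact_part U T) F"
  assumes "universe U"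
    and "rigidly_compactly_generated U T" and "rigidly_compactly_generated U S"
    and "geometric_functor U T S F"
    and "fully_faithful T S (fobj F) (farr F)"
  shows "spectral_quotient_map X Y \<phi> \<and>
         (\<forall>P \<in> topspace Y. connectedin X {Q \<in> topspace X. \<phi> Q = P})"
proof -
  have F: "tt_functor T S F" using assms(7) unfolding geometric_functor_def by blast
  interpret A: rigid_subcategory T "compacts U T" by (rule rigid_subcategory_compacts[OF assms(5)])
  interpret B: rigid_subcategory S "compacts U S" by (rule rigid_subcategory_compacts[OF assms(6)])
  interpret tt_functor T S F by (rule F)
  interpret rigid_functor T "compacts U T" S "compacts U S" F
    by unfold_locales (use compacts_image[OF assms(5,6) F] assms(8) in auto)
  show ?thesis unfolding X_def Y_def \<phi>_def compact_part_def by (rule spectral_quotient_fibres)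
qed

end
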